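(* Let $K$ be a (nonempty) countable compact metric space. Then there exists a $\mathcal{L}_\infty$-space $X$, with $X^*$ isomorphic to $\ell_1$, and a norm-one algebra homomorphism $\Phi:\mathcal{C}al(X)\rightarrow C(K)$ that is one-to-one and onto. Even more, for every $\varepsilon>0$ the space $X$ (together with such a $\Phi$) can be chosen so that $\|\Phi\|\,\|\Phi^{-1}\|\le 1+\varepsilon$.
   Context: Banach spaces are over the real scalars. "Countable" means finite or countably infinite. $C(K)$ is the Banach algebra of continuous real-valued functions on $K$ with pointwise operations and the supremum norm. For a Banach space $X$, $\mathcal{L}(X)$ is the algebra of bounded linear operators on $X$, $\mathcal{K}(X)$ is the ideal of compact operators, and the Calkin algebra of $X$ is the quotient Banach algebra $\mathcal{C}al(X)=\mathcal{L}(X)/\mathcal{K}(X)$ with the quotient norm. Norms of $\Phi$ and $\Phi^{-1}$ are operator norms. $\mathcal{L}_\infty$-spaces: for Banach spaces $Z,W$ and $C>0$ write $Z\simeq^C W$ if there is an onto linear isomorphism $T:Z\to W$ with $\|T\|\|T^{-1}\|\le C$. A separable Banach space $X$ is a $\mathcal{L}_{\infty,C}$-space if there is a strictly increasing sequence $(Y_n)_{n\in\mathbb{N}}$ of finite dimensional subspaces of $X$ with $Y_n\simeq^C \ell_\infty(\dim Y_n)$ for every $n$ and $X=\overline{\bigcup_n Y_n}$, where $\ell_\infty(d)$ is $\mathbb{R}^d$ with the maximum norm. $X$ is a $\mathcal{L}_\infty$-space if it is a $\mathcal{L}_{\infty,C}$-space for some $C>0$. *)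

theory Defs
  imports "HOL-Analysis.Analysis" "HOL-Algebra.QuotRing" "HOL-Algebra.Module"
begin

text \<open>
  The dual or the operator algebra of a closed subspace is a set, not a type. Such spaces are
  represented by real modules (in the sense of HOL-Algebra) with a norm. As in HOL-Algebra, the
  fields \<open>mult\<close> and \<open>one\<close> are irrelevant for structures that are only normed spaces.
\<close>

record 'a normed_module = "(real, 'a) module" +
  nrm :: "'a \<Rightarrow> real"

definition of_subspace :: "'a::real_normed_vector set \<Rightarrow> 'a normed_module" where
  "of_subspace V = \<lparr>carrier = V, mult = (\<lambda>_ _. undefined), one = undefined,
     zero = 0, add = (+), smult = (*\<^sub>R), nrm = norm\<rparr>"

text \<open>Only the behaviour of \<open>T\<close> on the carrier of \<open>M\<close> matters here.\<close>

definition bounded_linear_map :: "'a normed_module \<Rightarrow> 'b normed_module \<Rightarrow> ('a \<Rightarrow> 'b) \<Rightarrow> bool" where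
  "bounded_linear_map M N T \<longleftrightarrow>
     T \<in> carrier M \<rightarrow> carrier N \<and>
     (\<forall>x\<in>carrier M. \<forall>y\<in>carrier M. T (x \<oplus>\<^bsub>M\<^esub> y) = T x \<oplus>\<^bsub>N\<^esub> T y) \<and>
     (\<forall>c. \<forall>x\<in>carrier M. T (c \<odot>\<^bsub>M\<^esub> x) = c \<odot>\<^bsub>N\<^esub> T x) \<and>
     (\<exists>B. \<forall>x\<in>carrier M. nrm N (T x) \<le> B * nrm M x)"

text \<open>
  As for \<^const>\<open>onorm\<close>, the quotient is \<open>0\<close> at \<open>x = 0\<close>, and the value is only meaningful for
  bounded linear maps, because the supremum is taken in \<^typ>\<open>real\<close>.
\<close>

definition op_norm :: "'a normed_module \<Rightarrow> 'b normed_module \<Rightarrow> ('a \<Rightarrow> 'b) \<Rightarrow> real" where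
  "op_norm M N T = (SUP x\<in>carrier M. nrm N (T x) / nrm M x)"

definition isomorphism :: "'a normed_module \<Rightarrow> 'b normed_module \<Rightarrow> ('a \<Rightarrow> 'b) \<Rightarrow> bool" where
  "isomorphism M N T \<longleftrightarrow>
     bounded_linear_map M N T \<and> bij_betw T (carrier M) (carrier N) \<and>
     bounded_linear_map N M (inv_into (carrier M) T)"

definition isomorphic :: "'a normed_module \<Rightarrow> 'b normed_module \<Rightarrow> bool" where
  "isomorphic M N \<longleftrightarrow> (\<exists>T. isomorphism M N T)"

definition isomorphic_with :: "real \<Rightarrow> 'a normed_module \<Rightarrow> 'b normed_module \<Rightarrow> bool" where
  "isomorphic_with C M N \<longleftrightarrow>
     (\<exists>T. isomorphism M N T \<and> op_norm M N T * op_norm N M (inv_into (carrier M) T) \<le> C)"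

text \<open>
  Maps are made \<^const>\<open>extensional\<close>, so that equality in the carrier is equality on \<open>carrier M\<close>.
\<close>

definition operator_space :: "'a normed_module \<Rightarrow> 'b normed_module \<Rightarrow> ('a \<Rightarrow> 'b) normed_module" where
  "operator_space M N =
     \<lparr>carrier = {T \<in> extensional (carrier M). bounded_linear_map M N T},
      mult = (\<lambda>_ _. undefined), one = undefined,
      zero = (\<lambda>x\<in>carrier M. \<zero>\<^bsub>N\<^esub>),
      add = (\<lambda>S T. \<lambda>x\<in>carrier M. S x \<oplus>\<^bsub>N\<^esub> T x),
      smult = (\<lambda>c T. \<lambda>x\<in>carrier M. c \<odot>\<^bsub>N\<^esub> T x),
      nrm = op_norm M N\<rparr>"

definition dual_space :: "'a normed_module \<Rightarrow> ('a \<Rightarrow> real) normed_module" where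
  "dual_space M = operator_space M (of_subspace UNIV)"

definition operator_algebra :: "'a normed_module \<Rightarrow> ('a \<Rightarrow> 'a) normed_module" where
  "operator_algebra M = (operator_space M M)
     \<lparr>mult := compose (carrier M), one := restrict id (carrier M)\<rparr>"

text \<open>
  The closure below is taken in the ambient type. It agrees with the closure in \<open>X\<close> when \<open>X\<close> is
  closed, in particular when \<open>X\<close> is complete.
\<close>

definition compact_operators :: "'a::real_normed_vector set \<Rightarrow> ('a \<Rightarrow> 'a) set" where
  "compact_operators X =
     {T \<in> carrier (operator_algebra (of_subspace X)). compact (closure (T ` (X \<inter> cball 0 1)))}"

text \<open>The scalar multiple of the coset of \<open>T\<close> is the coset of \<open>c \<odot> T\<close>, and likewise for the other
  operations, which come from \<^const>\<open>FactRing\<close>.\<close>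

definition calkin_algebra :: "'a::real_normed_vector set \<Rightarrow> ('a \<Rightarrow> 'a) set normed_module" where
  "calkin_algebra X =
     (let L = operator_algebra (of_subspace X); K = compact_operators X; Q = L Quot K in
      \<lparr>carrier = carrier Q, mult = mult Q, one = one Q, zero = zero Q, add = add Q,
       smult = (\<lambda>c A. \<Union>T\<in>A. K +>\<^bsub>L\<^esub> (c \<odot>\<^bsub>L\<^esub> T)),
       nrm = (\<lambda>A. INF T\<in>A. nrm L T)\<rparr>)"

definition continuous_functions :: "'k::topological_space set \<Rightarrow> ('k \<Rightarrow> real) normed_module" where
  "continuous_functions K =
     \<lparr>carrier = {f \<in> extensional K. continuous_on K f},
      mult = (\<lambda>f g. \<lambda>x\<in>K. f x * g x), one = (\<lambda>x\<in>K. 1),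
      zero = (\<lambda>x\<in>K. 0), add = (\<lambda>f g. \<lambda>x\<in>K. f x + g x),
      smult = (\<lambda>c f. \<lambda>x\<in>K. c * f x),
      nrm = (\<lambda>f. SUP x\<in>K. \<bar>f x\<bar>)\<rparr>"

text \<open>
  \<^const>\<open>ring_hom\<close> includes preservation of the unit, which holds for every multiplicative map
  onto a unital algebra.
\<close>

definition bounded_algebra_hom :: "'a normed_module \<Rightarrow> 'b normed_module \<Rightarrow> ('a \<Rightarrow> 'b) set" where
  "bounded_algebra_hom A B = {\<Phi> \<in> ring_hom A B. bounded_linear_map A B \<Phi>}"

definition ell_1 :: "(nat \<Rightarrow> real) normed_module" where
  "ell_1 =
     \<lparr>carrier = {f. summable (\<lambda>n. \<bar>f n\<bar>)}, mult = (\<lambda>_ _. undefined), one = undefined,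
      zero = (\<lambda>_. 0), add = (\<lambda>f g n. f n + g n), smult = (\<lambda>c f n. c * f n),
      nrm = (\<lambda>f. \<Sum>n. \<bar>f n\<bar>)\<rparr>"

text \<open>\<open>\<real>\<^sup>d\<close> with the maximum norm; inserting \<open>0\<close> only matters for \<open>d = 0\<close>.\<close>

definition ell_infinity :: "nat \<Rightarrow> (nat \<Rightarrow> real) normed_module" where
  "ell_infinity d =
     \<lparr>carrier = extensional {..<d}, mult = (\<lambda>_ _. undefined), one = undefined,
      zero = (\<lambda>i\<in>{..<d}. 0), add = (\<lambda>f g. \<lambda>i\<in>{..<d}. f i + g i),
      smult = (\<lambda>c f. \<lambda>i\<in>{..<d}. c * f i),
      nrm = (\<lambda>f. Max (insert 0 ((\<lambda>i. \<bar>f i\<bar>) ` {..<d})))\<rparr>"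

definition separable_banach :: "'a::real_normed_vector set \<Rightarrow> bool" where
  "separable_banach X \<longleftrightarrow> subspace X \<and> complete X \<and> separable_space (top_of_set X)"

definition L_infinity_const_space :: "real \<Rightarrow> 'a::real_normed_vector set \<Rightarrow> bool" where
  "L_infinity_const_space C X \<longleftrightarrow>
     separable_banach X \<and>
     (\<exists>Y :: nat \<Rightarrow> 'a set. strict_mono Y \<and>
        (\<forall>n. subspace (Y n) \<and> Y n \<subseteq> X \<and> (\<exists>B. finite B \<and> Y n = span B) \<and>
             isomorphic_with C (of_subspace (Y n)) (ell_infinity (dim (Y n)))) \<and>
        X = closure (\<Union>n. Y n))"

definition L_infinity_space :: "'a::real_normed_vector set \<Rightarrow> bool" where
  "L_infinity_space X \<longleftrightarrow> (\<exists>C>0. L_infinity_const_space C X)"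

end

theory Submission
  imports Defs
begin

text \<open>
  The space \<open>X\<close> is a Bourgain--Delbaen space of Argyros--Haydon type, the closed span in \<open>\<ell>\<^sub>\<infinity>\<close> of
  basis vectors \<open>d\<^sub>n\<close>. Coordinate functionals are organised in chains (a root, then nodes, each adding
  \<open>1/m\<close> times a functional of norm at most one to its predecessor); the functionals along chains of
  odd weight are determined by the past. In addition every coordinate \<open>n\<close> is attached to a point
  \<open>\<kappa> n\<close> of \<open>K\<close>, and a node sees only coordinates attached to points of the clopen cell of \<open>\<kappa> n\<close>, at
  a scale given by the rank of its predecessor. Hence the diagonal multiplication
  \<open>d\<^sub>n \<mapsto> f (\<kappa> n) d\<^sub>n\<close> by a continuous \<open>f\<close> is bounded. Conversely, were a bounded operator \<open>T\<close> not
  asymptotically scalar near some point of \<open>K\<close>, one could stack exact pairs for \<open>T\<close> along a dependent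
  sequence and contradict boundedness. So the diagonal coefficients of \<open>T\<close> converge, as the weight
  grows, to a function on \<open>K\<close>, which is continuous, and \<open>T\<close> minus the multiplication by it is small
  on far block vectors and therefore compact. The bound on the inverse comes from letting the
  multiplier act on the values of the first coordinates and choosing all weights \<open>m\<close> large.
\<close>

section \<open>Bourgain--Delbaen systems\<close>

text \<open>The scalar-plus-compact mechanism leaves room for scalars only, so the difficulty is to
  admit multipliers without weakening it. A multiplier fails to commute with the functional added at
  a node unless it is constant on what the node sees. Since the cells refine with the rank of the
  predecessor, a function that is constant on cells of scale \<open>p\<close> commutes with every
  step whose predecessor is not below \<open>p\<close>; along each chain at most one step errs, and
  the factor \<open>1 / m\<close> with \<open>m\<close> at least 32 absorbs the error. For this
  reason the estimates are stated for \<open>mlt p q g\<close> with \<open>inv_fun p g\<close>: what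
  a node sees of such a vector has the same form again. In the converse direction a chain keeps its
  point, so the stacking takes place at a single \<open>x\<close> and compares the operator with a
  scalar on small cells around \<open>x\<close> only. Compactness of \<open>K\<close> leaves
  finitely many such comparisons, and the error of localization is absorbed at each coordinate
  instead of being summed over the cells. The compact operators turn out to be the kernel of the
  limit function, so the elements of the Calkin algebra are its fibres.\<close>

definition restr :: "nat \<Rightarrow> nat \<Rightarrow> (nat \<Rightarrow> real) \<Rightarrow> nat \<Rightarrow> real" where
  "restr p q a = (\<lambda>k. if p \<le> k \<and> k < q then a k else 0)"

text \<open>The index \<open>n\<close> is also its rank. It carries a point \<open>\<kappa> n\<close>, a weight index \<open>wt n\<close>, its position
  \<open>age n\<close> in a chain (\<open>0\<close> for a root) and, unless it is a root, its predecessor \<open>prd n\<close> and the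
  coefficients \<open>bc n\<close> of the functional it adds. \<open>E t\<close> is the partition into cells at scale \<open>t\<close>.\<close>

locale bourgain_delbaen =
  fixes E :: "nat \<Rightarrow> 'k \<Rightarrow> 'k \<Rightarrow> bool"
    and \<kappa> :: "nat \<Rightarrow> 'k"
    and wt age prd :: "nat \<Rightarrow> nat"
    and bc :: "nat \<Rightarrow> nat \<Rightarrow> real"
    and m :: "nat \<Rightarrow> real"
  assumes E_refl: "E t x x"
    and E_sym: "E t x y \<Longrightarrow> E t y x"
    and E_trans: "E t x y \<Longrightarrow> E t y z \<Longrightarrow> E t x z"
    and E_mono: "s \<le> t \<Longrightarrow> E t x y \<Longrightarrow> E s x y"
    and prd_less: "age n \<noteq> 0 \<Longrightarrow> prd n < n"
    and wt_le: "wt n \<le> n"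
    and wt_prd: "age n \<noteq> 0 \<Longrightarrow> wt (prd n) = wt n"
    and \<kappa>_prd: "age n \<noteq> 0 \<Longrightarrow> \<kappa> (prd n) = \<kappa> n"
    and age_prd: "age n \<noteq> 0 \<Longrightarrow> age n = Suc (age (prd n))"
    and bc_sum: "(\<Sum>k<n. \<bar>bc n k\<bar>) \<le> 1"
    and m_ge: "32 \<le> m j"
begin

definition mlt :: "nat \<Rightarrow> nat \<Rightarrow> ('k \<Rightarrow> real) \<Rightarrow> (nat \<Rightarrow> real) \<Rightarrow> nat \<Rightarrow> real" where
  "mlt p q g a = (\<lambda>k. if p \<le> k \<and> k < q then g (\<kappa> k) * a k else 0)"

text \<open>The unit ball of the functions that are constant on cells of scale \<open>p\<close>. In
  \<open>mlt p q g\<close> the same \<open>p\<close> is also the left end of the interval, so moving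
  the left end to the right enlarges the class of admissible multipliers.\<close>

definition inv_fun :: "nat \<Rightarrow> ('k \<Rightarrow> real) \<Rightarrow> bool" where
  "inv_fun p g \<longleftrightarrow> (\<forall>x. \<bar>g x\<bar> \<le> 1) \<and> (\<forall>x y. E p x y \<longrightarrow> g x = g y)"

definition cell :: "nat \<Rightarrow> 'k \<Rightarrow> 'k \<Rightarrow> real" where
  "cell t x y = (if E t y x then 1 else 0)"

text \<open>What the functional added at \<open>n\<close> can see. Left end and scale are the same
  number, so \<open>J n\<close> is itself a multiplier with \<open>inv_fun\<close>, and its
  composition with \<open>mlt p q g\<close> stays in the class (\<open>J_mlt\<close>). Bounds for
  multipliers therefore apply again inside a node.\<close>

definition J :: "nat \<Rightarrow> (nat \<Rightarrow> real) \<Rightarrow> nat \<Rightarrow> real" where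
  "J n = mlt (Suc (prd n)) n (cell (Suc (prd n)) (\<kappa> n))"

text \<open>\<open>R a n\<close> is the \<open>n\<close>-th coordinate of \<open>\<Sum>\<^sub>k a k d\<^sub>k\<close>.\<close>

function R :: "(nat \<Rightarrow> real) \<Rightarrow> nat \<Rightarrow> real" where
  "R a n = a n + (if age n = 0 then 0
     else R a (prd n) + (\<Sum>k<n. bc n k * R (J n a) k) / m (wt n))"
  by auto
termination
  by (relation "Wellfounded.measure snd") (auto simp: prd_less)

declare R.simps [simp del]

lemma R_root: "age n = 0 \<Longrightarrow> R a n = a n"
  by (simp add: R.simps[of a n])

text \<open>One step of the evaluation analysis. Unfolded down to the root it writes a coordinate as
  the sum of the coefficients at the nodes of the chain plus \<open>1 / m\<close> times one
  functional for each gap between consecutive nodes.\<close>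

lemma R_node:
  "age n \<noteq> 0 \<Longrightarrow> R a n = a n + R a (prd n) + (\<Sum>k<n. bc n k * R (J n a) k) / m (wt n)"
  by (simp add: R.simps[of a n])

lemma m_pos: "m j > 0"
  using m_ge[of j] by linarith

lemma inv_fun_cell [simp]: "inv_fun t (cell t x)"
proof -
  have "E t y x \<longleftrightarrow> E t z x" if "E t y z" for y z
    using that E_sym E_trans by metis
  then show ?thesis by (simp add: inv_fun_def cell_def)
qed

lemma inv_fun_one [simp]: "inv_fun t (\<lambda>_. 1)"
  by (simp add: inv_fun_def)

lemma inv_fun_mono: "s \<le> t \<Longrightarrow> inv_fun s g \<Longrightarrow> inv_fun t g"
  unfolding inv_fun_def using E_mono by blast

lemma inv_fun_mult: "inv_fun t f \<Longrightarrow> inv_fun t g \<Longrightarrow> inv_fun t (\<lambda>x. f x * g x)"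
  unfolding inv_fun_def by (auto simp: abs_mult intro: mult_le_one)

lemma mlt_mlt: "mlt p q f (mlt p' q' g a) = mlt (max p p') (min q q') (\<lambda>x. f x * g x) a"
  by (auto simp: mlt_def)

lemma restr_mlt: "restr p q a = mlt p q (\<lambda>_. 1) a"
  by (auto simp: mlt_def restr_def)

lemma mlt_add: "mlt p q g (\<lambda>i. a i + a' i) = (\<lambda>i. mlt p q g a i + mlt p q g a' i)"
  by (auto simp: mlt_def algebra_simps)

lemma mlt_scale: "mlt p q g (\<lambda>i. c * a i) = (\<lambda>i. c * mlt p q g a i)"
  by (auto simp: mlt_def algebra_simps)

lemma mlt_zero [simp]: "mlt p q g (\<lambda>i. 0) = (\<lambda>i. 0)"
  by (auto simp: mlt_def)

lemma mlt_sum: "finite A \<Longrightarrow> mlt p q g (\<lambda>i. \<Sum>k\<in>A. a k i) = (\<lambda>i. \<Sum>k\<in>A. mlt p q g (a k) i)"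
  by (auto simp: mlt_def sum_distrib_left fun_eq_iff)

lemma R_cong: "(\<And>i. i \<le> n \<Longrightarrow> a i = a' i) \<Longrightarrow> R a n = R a' n"
proof (induction n arbitrary: a a' rule: less_induct)
  case (less n)
  show ?case
  proof (cases "age n = 0")
    case True
    with less.prems show ?thesis by (simp add: R_root)
  next
    case False
    have "R a (prd n) = R a' (prd n)"
      using less.prems prd_less[OF False] by (intro less.IH) auto
    moreover have "R (J n a) k = R (J n a') k" if "k < n" for k
      using less.prems that by (intro less.IH) (auto simp: J_def mlt_def)
    ultimately show ?thesis using less.prems False by (simp add: R_node)
  qed
qed

lemma R_add: "R (\<lambda>i. a i + a' i) n = R a n + R a' n"
proof (induction n arbitrary: a a' rule: less_induct)
  case (less n)
  show ?case
  proof (cases "age n = 0")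
    case False
    have "R (J n (\<lambda>i. a i + a' i)) k = R (J n a) k + R (J n a') k" if "k < n" for k
      using less.IH[OF that] by (simp add: J_def mlt_add)
    then show ?thesis using less.IH prd_less[OF False] False
      by (simp add: R_node sum.distrib algebra_simps add_divide_distrib)
  qed (simp add: R_root)
qed

lemma R_scale: "R (\<lambda>i. c * a i) n = c * R a n"
proof (induction n arbitrary: a rule: less_induct)
  case (less n)
  show ?case
  proof (cases "age n = 0")
    case False
    have "R (J n (\<lambda>i. c * a i)) k = c * R (J n a) k" if "k < n" for k
      using less.IH[OF that] by (simp add: J_def mlt_scale)
    then show ?thesis using less.IH prd_less[OF False] False
      by (simp add: R_node sum_distrib_left algebra_simps)
  qed (simp add: R_root)
qed

lemma R_zero [simp]: "R (\<lambda>i. 0) n = 0"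
  using R_scale[of 0 "\<lambda>i. 0" n] by simp

lemma R_minus: "R (\<lambda>i. - a i) n = - R a n"
  using R_scale[of "-1" a n] by simp

lemma R_diff: "R (\<lambda>i. a i - a' i) n = R a n - R a' n"
  using R_add[of a "\<lambda>i. - a' i" n] by (simp add: R_minus)

lemma R_sum: "finite A \<Longrightarrow> R (\<lambda>i. \<Sum>k\<in>A. a k i) n = (\<Sum>k\<in>A. R (a k) n)"
  by (induction A rule: finite_induct) (simp_all add: R_add)

lemma R_vanish: "(\<And>i. i \<le> n \<Longrightarrow> a i = 0) \<Longrightarrow> R a n = 0"
  using R_cong[of n a "\<lambda>i. 0"] by simp

lemma R_low: "n < p \<Longrightarrow> R (mlt p q g a) n = 0"
  by (rule R_vanish) (auto simp: mlt_def)

lemma bc_bound: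
  assumes "\<And>k. k < n \<Longrightarrow> \<bar>x k\<bar> \<le> B" "0 \<le> B"
  shows "\<bar>(\<Sum>k<n. bc n k * x k) / m j\<bar> \<le> B / m j"
proof -
  have "\<bar>\<Sum>k<n. bc n k * x k\<bar> \<le> (\<Sum>k<n. \<bar>bc n k\<bar> * B)"
    by (rule order_trans[OF sum_abs], rule sum_mono) (use assms in \<open>auto simp: abs_mult intro: mult_left_mono\<close>)
  also have "\<dots> = (\<Sum>k<n. \<bar>bc n k\<bar>) * B" by (simp add: sum_distrib_right)
  also have "\<dots> \<le> 1 * B" using assms bc_sum by (intro mult_right_mono) auto
  finally show ?thesis using m_pos[of j] by (simp add: abs_divide divide_right_mono)
qed

lemma J_mlt:
  "J n (mlt p q g a) = mlt (max (Suc (prd n)) p) (min n q) (\<lambda>x. cell (Suc (prd n)) (\<kappa> n) x * g x) a"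
  by (simp add: J_def mlt_mlt)

text \<open>The cell seen by \<open>n\<close> has scale \<open>Suc (prd n)\<close>, which refines
  scale \<open>p\<close>; so \<open>g\<close> equals \<open>g (\<kappa> n)\<close> on all of
  it.\<close>

lemma J_mlt_fine:
  assumes "p \<le> Suc (prd n)" "inv_fun p g"
  shows "J n (mlt p q g a) = (\<lambda>i. g (\<kappa> n) * J n (mlt p q (\<lambda>_. 1) a) i)"
proof -
  have "g x = g (\<kappa> n)" if "E (Suc (prd n)) x (\<kappa> n)" for x
    using assms that E_mono unfolding inv_fun_def by blast
  then show ?thesis by (auto simp: J_def mlt_def cell_def fun_eq_iff)
qed

text \<open>A multiplier constant on the cells of scale \<^term>\<open>p\<close> and the plain interval projection differ
  only in the single step of the chain of \<^term>\<open>n\<close> whose interval contains \<^term>\<open>p\<close>.\<close>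

lemma mlt_localized:
  assumes bound: "\<And>k p' g'. k < n \<Longrightarrow> p \<le> p' \<Longrightarrow> inv_fun p' g' \<Longrightarrow> \<forall>q'\<le>q. \<bar>R (mlt p' q' g' a) k\<bar> \<le> B"
    and g: "inv_fun p g" and "0 \<le> B"
  shows "\<bar>R (mlt p q g a) n - g (\<kappa> n) * R (mlt p q (\<lambda>_. 1) a) n\<bar> \<le> 2 * B / m (wt n)"
  using bound
proof (induction n rule: less_induct)
  case (less n)
  have gabs: "\<bar>g x\<bar> \<le> 1" for x using g by (simp add: inv_fun_def)
  show ?case
  proof (cases "n < p")
    case True
    then show ?thesis using \<open>0 \<le> B\<close> m_pos[of "wt n"] by (simp add: R_low)
  next
    case False
    have an: "mlt p q g a n - g (\<kappa> n) * mlt p q (\<lambda>_. 1) a n = 0"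
      by (auto simp: mlt_def)
    show ?thesis
    proof (cases "age n = 0")
      case True
      then show ?thesis using an \<open>0 \<le> B\<close> m_pos[of "wt n"] by (simp add: R_root)
    next
      case node: False
      note pn = prd_less[OF node]
      show ?thesis
      proof (cases "p \<le> Suc (prd n)")
        case True
        have "\<bar>R (mlt p q g a) (prd n) - g (\<kappa> (prd n)) * R (mlt p q (\<lambda>_. 1) a) (prd n)\<bar> \<le> 2 * B / m (wt (prd n))"
          by (rule less.IH[OF pn]) (use less.prems pn in auto)
        moreover have "R (mlt p q g a) n - g (\<kappa> n) * R (mlt p q (\<lambda>_. 1) a) n =
            R (mlt p q g a) (prd n) - g (\<kappa> n) * R (mlt p q (\<lambda>_. 1) a) (prd n)"
          using an J_mlt_fine[OF True g, of q a]
          by (simp add: R_node[OF node] R_scale algebra_simps sum_distrib_left)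
        ultimately show ?thesis using node by (simp add: wt_prd \<kappa>_prd)
      next
        \<comment> \<open>The chain crosses \<open>p\<close> here: the predecessor lies below
          \<open>p\<close> and contributes nothing. Both remaining terms carry the factor
          \<open>1 / m\<close> and are bounded separately, which is the origin of the 2 in the
          bound.\<close>
        case coarse: False
        have low: "R (mlt p q g a) (prd n) = 0" "R (mlt p q (\<lambda>_. 1) a) (prd n) = 0"
          using coarse by (auto intro: R_low)
        have 1: "\<bar>R (J n (mlt p q g a)) k\<bar> \<le> B" if "k < n" for k
          unfolding J_mlt using that g coarse
          by (intro less.prems[rule_format]) (auto intro!: inv_fun_mult inv_fun_mono[OF _ inv_fun_cell] inv_fun_mono[OF _ g])
        have 2: "\<bar>R (J n (mlt p q (\<lambda>_. 1) a)) k\<bar> \<le> B" if "k < n" for k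
          unfolding J_mlt using that coarse
          by (intro less.prems[rule_format]) (auto intro!: inv_fun_mult inv_fun_mono[OF _ inv_fun_cell])
        have b1: "\<bar>(\<Sum>k<n. bc n k * R (J n (mlt p q g a)) k) / m (wt n)\<bar> \<le> B / m (wt n)"
          using 1 \<open>0 \<le> B\<close> by (rule bc_bound)
        have b2: "\<bar>(\<Sum>k<n. bc n k * R (J n (mlt p q (\<lambda>_. 1) a)) k) / m (wt n)\<bar> \<le> B / m (wt n)"
          using 2 \<open>0 \<le> B\<close> by (rule bc_bound)
        have b3: "\<bar>g (\<kappa> n) * ((\<Sum>k<n. bc n k * R (J n (mlt p q (\<lambda>_. 1) a)) k) / m (wt n))\<bar> \<le> B / m (wt n)"
          unfolding abs_mult using mult_mono[OF gabs[of "\<kappa> n"] b2] by simp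
        have "R (mlt p q g a) n - g (\<kappa> n) * R (mlt p q (\<lambda>_. 1) a) n =
          (\<Sum>k<n. bc n k * R (J n (mlt p q g a)) k) / m (wt n)
           - g (\<kappa> n) * ((\<Sum>k<n. bc n k * R (J n (mlt p q (\<lambda>_. 1) a)) k) / m (wt n))"
          using an low by (simp add: R_node[OF node] algebra_simps)
        then show ?thesis using b1 b3 by linarith
      qed
    qed
  qed
qed

text \<open>The two bounds need each other. Cutting at \<open>q\<close> hits a single step of a
  chain and leaves a value at the predecessor plus \<open>1 / m\<close> times a multiplier bound at
  smaller indices; a multiplier differs from a difference of two initial projections by one such
  step. With \<open>m\<close> at least 32 the constants close up: \<open>1 + 8/32 <= 2\<close> and
  \<open>4 + 16/32 <= 8\<close>.\<close>

lemma bounds_aux: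
  "(\<forall>a q B. (\<forall>k<q. \<bar>R a k\<bar> \<le> B) \<longrightarrow> 0 \<le> B \<longrightarrow> \<bar>R (restr 0 q a) n\<bar> \<le> 2 * B) \<and>
   (\<forall>a p q g B. inv_fun p g \<longrightarrow> (\<forall>k<q. \<bar>R a k\<bar> \<le> B) \<longrightarrow> 0 \<le> B \<longrightarrow> \<bar>R (mlt p q g a) n\<bar> \<le> 8 * B)"
proof (induction n rule: less_induct)
  case (less n)
  have IH1: "\<bar>R (restr 0 q a) k\<bar> \<le> 2 * B" if "k < n" "\<forall>k<q. \<bar>R a k\<bar> \<le> B" "0 \<le> B" for a k q B
    using less.IH[OF that(1)] that(2,3) by blast
  have IH2: "\<bar>R (mlt p q g a) k\<bar> \<le> 8 * B" if "k < n" "inv_fun p g" "\<forall>k<q. \<bar>R a k\<bar> \<le> B" "0 \<le> B" for a k p q B g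
    using less.IH[OF that(1)] that(2-) by blast
  have one: "\<bar>R (restr 0 q a) n\<bar> \<le> 2 * B" if B: "\<forall>k<q. \<bar>R a k\<bar> \<le> B" and B0: "0 \<le> B" for a q B
  proof (cases "n < q")
    case True
    have "R (restr 0 q a) n = R a n" using True by (intro R_cong) (auto simp: restr_def)
    then show ?thesis using B True B0 by force
  next
    case False
    then have an: "restr 0 q a n = 0" by (simp add: restr_def)
    show ?thesis
    proof (cases "age n = 0")
      case True then show ?thesis using an B0 by (simp add: R_root)
    next
      case node: False
      note pn = prd_less[OF node]
      show ?thesis
      proof (cases "prd n < q")
        case True
        have "R (restr 0 q a) (prd n) = R a (prd n)"
          using True by (intro R_cong) (auto simp: restr_def)
        then have 1: "\<bar>R (restr 0 q a) (prd n)\<bar> \<le> B" using True B by simp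
        have "\<bar>R (J n (restr 0 q a)) k\<bar> \<le> 8 * B" if "k < n" for k
          unfolding restr_mlt J_mlt by (rule IH2) (use that B B0 in auto)
        then have "\<bar>(\<Sum>k<n. bc n k * R (J n (restr 0 q a)) k) / m (wt n)\<bar> \<le> 8 * B / m (wt n)"
          using B0 by (intro bc_bound) auto
        also have "\<dots> \<le> 8 * B / 32" using m_ge B0 by (intro divide_left_mono) (auto intro: mult_pos_pos m_pos)
        finally show ?thesis unfolding R_node[OF node] using 1 an B0 by linarith
      next
        case False
        then have "J n (restr 0 q a) = (\<lambda>i. 0)" by (auto simp: J_def mlt_def restr_def)
        then show ?thesis using an IH1[OF pn B B0] by (simp add: R_node[OF node])
      qed
    qed
  qed
  have two: "\<bar>R (mlt p q g a) n\<bar> \<le> 8 * B"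
    if g: "inv_fun p g" and B: "\<forall>k<q. \<bar>R a k\<bar> \<le> B" and B0: "0 \<le> B" for a p q g B
  proof (cases "p \<le> q")
    case False
    then have "mlt p q g a = (\<lambda>i. 0)" by (auto simp: mlt_def)
    then show ?thesis using B0 by simp
  next
    case True
    have "mlt p q (\<lambda>_. 1) a = (\<lambda>i. restr 0 q a i - restr 0 p a i)"
      using True by (auto simp: mlt_def restr_def)
    then have "R (mlt p q (\<lambda>_. 1) a) n = R (restr 0 q a) n - R (restr 0 p a) n"
      by (simp add: R_diff)
    moreover have "\<bar>R (restr 0 q a) n\<bar> \<le> 2 * B" "\<bar>R (restr 0 p a) n\<bar> \<le> 2 * B"
      using one[of q a B] one[of p a B] B True B0 by auto
    ultimately have "\<bar>R (mlt p q (\<lambda>_. 1) a) n\<bar> \<le> 4 * B" by linarith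
    moreover have "\<bar>g (\<kappa> n) * R (mlt p q (\<lambda>_. 1) a) n\<bar> \<le> \<bar>R (mlt p q (\<lambda>_. 1) a) n\<bar>"
      using g by (simp add: inv_fun_def abs_mult mult_left_le_one_le)
    moreover have "\<bar>R (mlt p q g a) n - g (\<kappa> n) * R (mlt p q (\<lambda>_. 1) a) n\<bar> \<le> 2 * (8 * B) / m (wt n)"
      by (rule mlt_localized) (use IH2 B B0 g in auto)
    moreover have "2 * (8 * B) / m (wt n) \<le> 2 * (8 * B) / 32"
      using m_ge B0 by (intro divide_left_mono) (auto intro: mult_pos_pos m_pos)
    ultimately show ?thesis using B0 by linarith
  qed
  from one two show ?case by blast
qed

lemma restr_bound: "(\<And>k. k < q \<Longrightarrow> \<bar>R a k\<bar> \<le> B) \<Longrightarrow> 0 \<le> B \<Longrightarrow> \<bar>R (restr 0 q a) n\<bar> \<le> 2 * B"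
  using bounds_aux[of n] by blast

lemma mlt_bound: "inv_fun p g \<Longrightarrow> (\<And>k. k < q \<Longrightarrow> \<bar>R a k\<bar> \<le> B) \<Longrightarrow> 0 \<le> B \<Longrightarrow> \<bar>R (mlt p q g a) n\<bar> \<le> 8 * B"
  using bounds_aux[of n] by blast

lemma mlt_local:
  assumes "inv_fun p g" "\<And>k. k < q \<Longrightarrow> \<bar>R a k\<bar> \<le> B" "0 \<le> B"
  shows "\<bar>R (mlt p q g a) n - g (\<kappa> n) * R (mlt p q (\<lambda>_. 1) a) n\<bar> \<le> 16 * B / m (wt n)"
  using mlt_localized[of n p q a "8 * B" g] mlt_bound assms by auto

text \<open>\<open>D\<close> recovers the basis coefficients from the coordinates: it inverts \<^const>\<open>R\<close>.\<close>

function D :: "(nat \<Rightarrow> real) \<Rightarrow> nat \<Rightarrow> real" where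
  "D x n = x n - R (\<lambda>i. if i < n then D x i else 0) n"
  by auto
termination
  by (relation "Wellfounded.measure snd") auto

declare D.simps [simp del]

lemma R_split: "R a n = a n + R (restr 0 n a) n"
proof -
  have "R (restr n (Suc n) a) n = a n"
  proof (cases "age n = 0")
    case False
    have "J n (restr n (Suc n) a) = (\<lambda>i. 0)" by (auto simp: J_def mlt_def restr_def)
    then show ?thesis using prd_less[OF False] R_vanish[of "prd n" "restr n (Suc n) a"]
      by (simp add: R_node[OF False] restr_def)
  qed (simp add: R_root restr_def)
  moreover have "R a n = R (\<lambda>i. restr 0 n a i + restr n (Suc n) a i) n"
    by (rule R_cong) (auto simp: restr_def)
  ultimately show ?thesis by (simp add: R_add)
qed

lemma D_eq: "D x n = x n - R (restr 0 n (D x)) n"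
  by (subst D.simps) (simp add: restr_def)

lemma R_D [simp]: "R (D x) = x"
  by (rule ext) (metis R_split D_eq diff_add_cancel)

lemma R_inject: "R a = R a' \<Longrightarrow> a = a'"
proof
  fix n assume eq: "R a = R a'"
  show "a n = a' n"
  proof (induction n rule: less_induct)
    case (less n)
    have "R (restr 0 n a) n = R (restr 0 n a') n"
      by (rule R_cong) (use less in \<open>auto simp: restr_def\<close>)
    then show ?case using eq R_split[of a n] R_split[of a' n] by (metis add_right_cancel)
  qed
qed

lemma D_R [simp]: "D (R a) = a"
  by (rule R_inject) simp

lemma D_add: "D (\<lambda>i. x i + y i) = (\<lambda>i. D x i + D y i)"
  by (rule R_inject) (auto simp: R_add fun_eq_iff)

lemma D_scale: "D (\<lambda>i. c * x i) = (\<lambda>i. c * D x i)"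
  by (rule R_inject) (auto simp: R_scale fun_eq_iff)

lemma D_diff: "D (\<lambda>i. x i - y i) = (\<lambda>i. D x i - D y i)"
  by (rule R_inject) (auto simp: R_diff fun_eq_iff)

lemma coord_bound:
  \<comment> \<open>The coefficient is the coordinate \<open>n\<close> of the projection of
    \<open>a\<close> to the single index \<open>n\<close>, so the multiplier constant 8
    applies.\<close>
  assumes "\<And>k. k \<le> n \<Longrightarrow> \<bar>R a k\<bar> \<le> B" "0 \<le> B"
  shows "\<bar>a n\<bar> \<le> 8 * B"
proof -
  have "R (mlt n (Suc n) (\<lambda>_. 1) a) n = a n"
    using R_split[of "mlt n (Suc n) (\<lambda>_. 1) a" n] R_vanish[of n "restr 0 n (mlt n (Suc n) (\<lambda>_. 1) a)"]
    by (auto simp: mlt_def restr_def)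
  then show ?thesis using mlt_bound[of n "\<lambda>_. 1" "Suc n" a B n] assms by auto
qed

end

section \<open>Rapidly increasing sequences\<close>

text \<open>The error that the induction of \<open>depth_estimate\<close> accumulates:
  \<open>c\<close> bounds the length of the chains of smaller weight, and one level costs the error
  of the previous level, and a few more constants, once per step of a chain. The initial value 10 is
  the constant in the hypothesis \<open>big\<close> of that lemma.\<close>

primrec depth_const :: "real \<Rightarrow> nat \<Rightarrow> real" where
  "depth_const c 0 = 10"
| "depth_const c (Suc l) = c * (depth_const c l + 5)"

lemma depth_const_ge: "1 \<le> c \<Longrightarrow> 1 \<le> depth_const c l"
proof (induction l)
  case (Suc l)
  then have "1 * 1 \<le> c * (depth_const c l + 5)" by (intro mult_mono) auto
  then show ?case by simp
qed simp

text \<open>The index set is an arbitrary finite set because the estimates are applied to the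
  subfamily of those blocks that a node meets.\<close>

definition blocks :: "nat set \<Rightarrow> (nat \<Rightarrow> nat) \<Rightarrow> (nat \<Rightarrow> nat) \<Rightarrow> (nat \<Rightarrow> nat \<Rightarrow> real) \<Rightarrow> bool" where
  "blocks A l u v \<longleftrightarrow> finite A \<and> (\<forall>k\<in>A. \<forall>i. v k i \<noteq> 0 \<longrightarrow> l k \<le> i \<and> i < u k) \<and>
     (\<forall>k\<in>A. \<forall>k'\<in>A. k < k' \<longrightarrow> u k \<le> l k')"

lemma blocks_subset: "blocks A l u v \<Longrightarrow> B \<subseteq> A \<Longrightarrow> blocks B l u v"
  unfolding blocks_def by (meson finite_subset subsetD)

lemma blocks_coord:
  assumes bl: "blocks A l u v" and C: "\<And>k. k \<in> A \<Longrightarrow> \<bar>v k i\<bar> \<le> C" and "0 \<le> C"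
  shows "\<bar>\<Sum>k\<in>A. v k i\<bar> \<le> (C::real)"
proof (cases "\<exists>k\<in>A. v k i \<noteq> 0")
  case True
  then obtain k0 where k0: "k0 \<in> A" "v k0 i \<noteq> 0" by blast
  have "v k i = 0" if "k \<in> A" "k \<noteq> k0" for k
  proof (rule ccontr)
    assume "v k i \<noteq> 0"
    then have "l k \<le> i" "i < u k" "l k0 \<le> i" "i < u k0"
      using bl k0 that unfolding blocks_def by blast+
    moreover have "u k \<le> l k0 \<or> u k0 \<le> l k"
      using bl k0 that unfolding blocks_def by (metis nat_neq_iff)
    ultimately show False by linarith
  qed
  then have "(\<Sum>k\<in>A. v k i) = (\<Sum>k\<in>A. if k = k0 then v k i else 0)"
    by (intro sum.cong) auto
  also have "\<dots> = v k0 i" using bl k0 by (simp add: blocks_def)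
  finally show ?thesis using C k0 by simp
next
  case False
  then show ?thesis using \<open>0 \<le> C\<close> by simp
qed

context bourgain_delbaen
begin

text \<open>The blocks of rapidly increasing sequences, with a bound that is stable under multipliers.\<close>

definition GV :: "real \<Rightarrow> nat \<Rightarrow> (nat \<Rightarrow> real) \<Rightarrow> bool" where
  "GV C i v \<longleftrightarrow> (\<forall>p q g n. inv_fun p g \<longrightarrow> \<bar>R (mlt p q g v) n\<bar> \<le> C \<and>
      (wt n < i \<longrightarrow> \<bar>R (mlt p q g v) n\<bar> \<le> C / m (wt n)))"

text \<open>\<open>j k\<close> is the weight below which \<open>v k\<close> is small. The condition
  \<open>u k \<le> j k'\<close> makes all earlier blocks invisible to a node of weight at least
  \<open>j k'\<close>, by \<open>R_below_weight\<close>; so at each node only one block can lack the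
  factor \<open>1 / m\<close>.\<close>

definition RIS :: "real \<Rightarrow> nat set \<Rightarrow> (nat \<Rightarrow> nat) \<Rightarrow> (nat \<Rightarrow> nat) \<Rightarrow> (nat \<Rightarrow> nat) \<Rightarrow> (nat \<Rightarrow> nat \<Rightarrow> real) \<Rightarrow> bool" where
  "RIS C A l u j v \<longleftrightarrow> blocks A l u v \<and> (\<forall>k\<in>A. GV C (j k) (v k)) \<and>
     (\<forall>k\<in>A. \<forall>k'\<in>A. k < k' \<longrightarrow> u k \<le> j k')"

lemma GV_bound: "GV C i v \<Longrightarrow> inv_fun p g \<Longrightarrow> \<bar>R (mlt p q g v) n\<bar> \<le> C"
  unfolding GV_def by blast

lemma GV_weight: "GV C i v \<Longrightarrow> inv_fun p g \<Longrightarrow> wt n < i \<Longrightarrow> \<bar>R (mlt p q g v) n\<bar> \<le> C / m (wt n)"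
  unfolding GV_def by blast

lemma R_mlt_full: "R (mlt 0 (Suc n) (\<lambda>_. 1) a) n = R a n"
  by (rule R_cong) (auto simp: mlt_def)

lemma R_mlt_point: "R (mlt n (Suc n) (\<lambda>_. 1) a) n = a n"
  using R_split[of "mlt n (Suc n) (\<lambda>_. 1) a" n]
    R_vanish[of n "restr 0 n (mlt n (Suc n) (\<lambda>_. 1) a)"]
  by (auto simp: mlt_def restr_def)

lemma GV_norm: "GV C i v \<Longrightarrow> \<bar>R v n\<bar> \<le> C"
  using GV_bound[of C i v 0 "\<lambda>_. 1" "Suc n" n] by (simp add: R_mlt_full)

lemma GV_coord: "GV C i v \<Longrightarrow> \<bar>v n\<bar> \<le> C"
  using GV_bound[of C i v n "\<lambda>_. 1" "Suc n" n] by (simp add: R_mlt_point)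

lemma R_mlt_sum:
  "finite A \<Longrightarrow> R (mlt p q g (\<lambda>i. \<Sum>k\<in>A. v k i)) n = (\<Sum>k\<in>A. R (mlt p q g (v k)) n)"
  by (simp add: mlt_sum R_sum)

text \<open>All nodes of the chain of \<open>n\<close> have the weight of \<open>n\<close>, and a
  weight never exceeds the rank. So the whole chain, gaps included, lives at indices from
  \<open>wt n\<close> on.\<close>

lemma R_below_weight: "(\<And>i. wt n \<le> i \<Longrightarrow> a i = 0) \<Longrightarrow> R a n = 0"
proof (induction n rule: less_induct)
  case (less n)
  have an: "a n = 0" using less.prems wt_le by simp
  show ?case
  proof (cases "age n = 0")
    case True then show ?thesis using an by (simp add: R_root)
  next
    case False
    note pn = prd_less[OF False]
    have "wt n \<le> prd n" using wt_le[of "prd n"] wt_prd[OF False] by simp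
    then have "J n a = (\<lambda>i. 0)" using less.prems by (auto simp: J_def mlt_def)
    moreover have "R a (prd n) = 0" using less pn wt_prd[OF False] by simp
    ultimately show ?thesis using an by (simp add: R_node[OF False])
  qed
qed

text \<open>Blocks with \<open>wt n < j k\<close> contribute at most \<open>C / m (wt n)\<close>
  each. Among the others all but the last are supported below \<open>wt n\<close> and vanish at
  \<open>n\<close>; the last one costs \<open>C\<close>.\<close>

lemma high_weight_estimate:
  assumes RIS: "RIS C A l u j v" and g: "inv_fun p g" and C: "0 \<le> C"
  shows "\<bar>R (mlt p q g (\<lambda>i. \<Sum>k\<in>A. v k i)) n\<bar> \<le> C * (1 + card A / m (wt n))"
proof -
  have fin: "finite A" using RIS by (simp add: RIS_def blocks_def)
  define B where "B = {k\<in>A. j k \<le> wt n}"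
  have 1: "\<bar>R (mlt p q g (v k)) n\<bar> \<le> C / m (wt n) + (if k = Max B then C else 0)" if "k \<in> A" for k
  proof (cases "k \<in> B")
    case False
    then show ?thesis using RIS that g C GV_weight[of C "j k" "v k" p g n q] by (auto simp: RIS_def B_def)
  next
    case True
    show ?thesis
    proof (cases "k = Max B")
      case True
      have "0 \<le> C / m (wt n)" using C m_pos[of "wt n"] by simp
      moreover have "\<bar>R (mlt p q g (v k)) n\<bar> \<le> C"
        using RIS that g GV_bound[of C "j k" "v k" p g q n] by (auto simp: RIS_def)
      ultimately show ?thesis using True by simp
    next
      case False
      have "finite B" using fin by (simp add: B_def)
      then have "k < Max B" using False True by (simp add: order_less_le)
      have "Max B \<in> B" using Max_in[of B] \<open>finite B\<close> True by blast
      then have "j (Max B) \<le> wt n" "u k \<le> j (Max B)"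
        using RIS that \<open>k < Max B\<close> by (auto simp: RIS_def B_def)
      then have "u k \<le> wt n" by linarith
      moreover have "\<forall>i. v k i \<noteq> 0 \<longrightarrow> i < u k" using RIS that unfolding RIS_def blocks_def by blast
      ultimately have "R (mlt p q g (v k)) n = 0"
        by (intro R_below_weight) (force simp: mlt_def)
      then show ?thesis using C m_pos[of "wt n"] by simp
    qed
  qed
  have "\<bar>R (mlt p q g (\<lambda>i. \<Sum>k\<in>A. v k i)) n\<bar> \<le> (\<Sum>k\<in>A. \<bar>R (mlt p q g (v k)) n\<bar>)"
    using fin by (simp add: R_mlt_sum sum_abs)
  also have "\<dots> \<le> (\<Sum>k\<in>A. C / m (wt n) + (if k = Max B then C else 0))"
    using 1 by (intro sum_mono)
  also have "\<dots> \<le> card A * (C / m (wt n)) + C"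
    using fin C by (simp add: sum.distrib)
  finally show ?thesis by (simp add: algebra_simps)
qed

text \<open>Every gap of the chain meets a subfamily of the blocks, to which \<open>bound\<close>
  applies with the factor \<open>1 / m\<close>. Consecutive gaps share at most one block, so the
  cardinalities add up to at most the number of blocks plus the number of steps. The coefficients at
  the nodes themselves cost \<open>C\<close> each.\<close>

lemma chain_estimate:
  fixes C \<theta> d :: real
  assumes bl: "blocks A l u v" and C: "\<And>k i. k \<in> A \<Longrightarrow> \<bar>v k i\<bar> \<le> C" "0 \<le> C"
    and bound: "\<And>B p q g i. B \<subseteq> A \<Longrightarrow> inv_fun p g \<Longrightarrow>
        \<bar>R (mlt p q g (\<lambda>i. \<Sum>k\<in>B. v k i)) i\<bar> \<le> \<theta> * card B + d"
    and pos: "0 \<le> \<theta>" "0 \<le> d" and g: "inv_fun p g"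
  shows "\<bar>R (mlt p q g (\<lambda>i. \<Sum>k\<in>A. v k i)) n\<bar> \<le>
     (\<theta> * (card {k\<in>A. l k \<le> n} + age n) + age n * d) / m (wt n) + (age n + 1) * C"
proof (induction n rule: less_induct)
  case (less n)
  define S where "S B = (\<lambda>i. \<Sum>k\<in>B. v k i)" for B
  have fin: "finite A" using bl by (simp add: blocks_def)
  have "\<bar>S A n\<bar> \<le> C" unfolding S_def by (rule blocks_coord[OF bl C])
  moreover have "\<bar>mlt p q g (S A) n\<bar> \<le> \<bar>S A n\<bar>"
    using g by (auto simp: mlt_def abs_mult inv_fun_def mult_left_le_one_le)
  ultimately have an: "\<bar>mlt p q g (S A) n\<bar> \<le> C" by linarith
  show ?case
  proof (cases "age n = 0")
    case True
    have "0 \<le> \<theta> * card {k\<in>A. l k \<le> n} / m (wt n)" using pos m_pos[of "wt n"] by simp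
    then show ?thesis using an True by (simp add: R_root S_def)
  next
    case False
    note pn = prd_less[OF False]
    have wp: "wt (prd n) = wt n" using wt_prd[OF False] .
    define B where "B = {k\<in>A. l k \<le> n \<and> prd n < u k}"
    have "B \<subseteq> A" by (auto simp: B_def)
    have "J n (mlt p q g (S A)) = J n (mlt p q g (S B))"
    proof
      fix i
      have "S A i = S B i" if "prd n < i" "i < n"
        unfolding S_def using fin bl that
        by (intro sum.mono_neutral_right) (auto simp: B_def blocks_def, (meson less_imp_le order_trans dual_order.strict_trans)+)
      then show "J n (mlt p q g (S A)) i = J n (mlt p q g (S B)) i"
        by (simp add: J_def mlt_def)
    qed
    then have JB: "\<bar>R (J n (mlt p q g (S A))) k\<bar> \<le> \<theta> * card B + d" for k
      unfolding S_def J_mlt using bound[OF \<open>B \<subseteq> A\<close>] g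
      by (simp add: S_def J_mlt inv_fun_mult inv_fun_mono[OF _ inv_fun_cell] inv_fun_mono[OF _ g])
    then have b: "\<bar>(\<Sum>k<n. bc n k * R (J n (mlt p q g (S A))) k) / m (wt n)\<bar> \<le> (\<theta> * card B + d) / m (wt n)"
      using pos by (intro bc_bound) auto
    \<comment> \<open>Only the last block that begins up to \<open>prd n\<close> can reach beyond
      it.\<close>
    have "card {k\<in>A. l k \<le> prd n} + card B \<le> card {k\<in>A. l k \<le> n} + 1"
    proof -
      define L where "L = {k\<in>A. l k \<le> prd n}"
      have f: "finite L" "finite B" using fin by (auto simp: L_def B_def)
      have "L \<inter> B \<subseteq> {Max (L \<inter> B)}"
      proof
        fix k assume k: "k \<in> L \<inter> B"
        let ?M = "Max (L \<inter> B)"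
        have M: "?M \<in> L \<inter> B" using Max_in[of "L \<inter> B"] f k by blast
        have "k \<le> ?M" using f k by simp
        show "k \<in> {?M}"
        proof (rule ccontr)
          assume "k \<notin> {?M}"
          then have "k < ?M" using \<open>k \<le> ?M\<close> by simp
          moreover have "k \<in> A" "?M \<in> A" using M k by (auto simp: L_def)
          ultimately have "u k \<le> l ?M" using bl unfolding blocks_def by blast
          then show False using M k by (auto simp: L_def B_def)
        qed
      qed
      then have "card (L \<inter> B) \<le> 1" using card_mono[of "{Max (L \<inter> B)}"] by simp
      moreover have "card (L \<union> B) \<le> card {k\<in>A. l k \<le> n}"
        using pn fin by (intro card_mono) (auto simp: L_def B_def)
      ultimately show ?thesis using card_Un_Int[OF f] unfolding L_def by linarith
    qed
    then have c: "real (card {k\<in>A. l k \<le> prd n}) + card B \<le> card {k\<in>A. l k \<le> n} + 1"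
      by linarith
    let ?M = "m (wt n)"
    have IH: "\<bar>R (mlt p q g (S A)) (prd n)\<bar> \<le>
        (\<theta> * (card {k\<in>A. l k \<le> prd n} + age (prd n)) + age (prd n) * d) / ?M + (age (prd n) + 1) * C"
      using less[OF pn] wp by (simp add: S_def)
    have ag: "real (age n) = age (prd n) + 1" using age_prd[OF False] by simp
    have "\<theta> * (card {k\<in>A. l k \<le> prd n} + age (prd n)) + age (prd n) * d + (\<theta> * card B + d)
        = \<theta> * (real (card {k\<in>A. l k \<le> prd n}) + card B + age (prd n)) + age n * d"
      by (simp add: algebra_simps ag)
    also have "\<dots> \<le> \<theta> * (card {k\<in>A. l k \<le> n} + age n) + age n * d"
      using c pos ag by (intro add_right_mono mult_left_mono) auto
    finally have "(\<theta> * (card {k\<in>A. l k \<le> prd n} + age (prd n)) + age (prd n) * d) / ?M + (\<theta> * card B + d) / ?M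
        \<le> (\<theta> * (card {k\<in>A. l k \<le> n} + age n) + age n * d) / ?M"
      using m_pos[of "wt n"] by (simp add: add_divide_distrib[symmetric] divide_right_mono)
    moreover have "(age (prd n) + 1) * C + C = (age n + 1) * C" by (simp add: ag algebra_simps)
    ultimately have "\<bar>R (mlt p q g (S A)) n\<bar> \<le>
       (\<theta> * (card {k\<in>A. l k \<le> n} + age n) + age n * d) / ?M + (age n + 1) * C"
      unfolding R_node[OF False] using IH b an by linarith
    then show ?thesis by (simp add: S_def)
  qed
qed

end

text \<open>\<open>nn j\<close> bounds the length of chains of weight \<open>j\<close>. By
  \<open>nn_dom\<close>, a depth \<open>l\<close> is available with \<open>2 ^ l\<close> at least
  the square of \<open>m j\<close>, while \<open>nn j\<close> is so large that after averaging over
  \<open>nn j\<close> blocks the accumulated constants are negligible. The depth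
  \<open>Suc l\<close> occurs because the estimate at smaller weights uses one more level. By
  \<open>m_grow\<close>, the square of a chain length is dominated by all later weights, so even a
  sum over a whole chain of such small terms is small.\<close>

locale saturated = bourgain_delbaen +
  fixes nn :: "nat \<Rightarrow> nat"
  assumes age_le: "age n \<le> nn (wt n)"
    and nn_dom: "\<exists>(c::real) l. 1 \<le> c \<and> (\<forall>i<j. nn i \<le> c) \<and> (m j)\<^sup>2 \<le> 2 ^ l \<and>
                 (m j)\<^sup>2 * depth_const c (Suc l) \<le> nn j \<and> (m j)\<^sup>2 * depth_const c l \<le> nn j"
    and m_grow: "i < j \<Longrightarrow> (real (nn i))\<^sup>2 \<le> m j"
begin

lemma nn_ge: "(m j)\<^sup>2 \<le> nn j"
proof -
  obtain c l where cl: "1 \<le> c" "(m j)\<^sup>2 * depth_const c l \<le> nn j" using nn_dom[of j] by blast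
  have "(m j)\<^sup>2 * 1 \<le> (m j)\<^sup>2 * depth_const c l" using depth_const_ge[OF cl(1)] by (intro mult_left_mono) auto
  then show ?thesis using cl by simp
qed

lemma m_ge_1: "1 \<le> m j" using m_ge[of j] by linarith

lemma m_le_nn: "m j \<le> nn j"
proof -
  have "m j * 1 \<le> m j * m j" using m_ge_1[of j] by (intro mult_left_mono) auto
  then show ?thesis using nn_ge[of j] by (simp add: power2_eq_square)
qed

lemma nn_pos: "0 < nn j" using m_le_nn[of j] m_pos[of j] by (metis of_nat_0_less_iff order_less_le_trans)

lemma m_sq: "i < j \<Longrightarrow> (m i)\<^sup>2 \<le> m j"
proof -
  assume "i < j"
  have "(m i)\<^sup>2 \<le> (real (nn i))\<^sup>2" using m_le_nn m_pos[of i] by (intro power_mono) auto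
  then show ?thesis using m_grow[OF \<open>i < j\<close>] by linarith
qed

lemma m_mono: "i \<le> j \<Longrightarrow> m i \<le> m j"
proof (cases "i = j")
  case False
  assume "i \<le> j"
  then have "(m i)\<^sup>2 \<le> m j" using False m_sq by simp
  moreover have "m i * 1 \<le> m i * m i" using m_ge_1[of i] by (intro mult_left_mono) auto
  ultimately show ?thesis by (simp add: power2_eq_square)
qed simp

lemma m_unbounded: "real j \<le> m j"
proof (induction j)
  case 0 then show ?case using m_pos[of 0] by simp
next
  case (Suc j)
  have "m j * 2 \<le> m j * m j" using m_ge[of j] by (intro mult_left_mono) auto
  then have "m j + 1 \<le> (m j)\<^sup>2" using m_ge_1[of j] unfolding power2_eq_square by linarith
  then show ?case using m_sq[of j "Suc j"] Suc by simp
qed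

text \<open>A chain of weight below \<open>j\<close> has at most \<open>c\<close> steps. Hence
  \<open>chain_estimate\<close> gives the main term the factor \<open>1 / m (wt n)\<close> and only
  replaces the additive constant by the next one.\<close>

lemma depth_step:
  fixes C c \<mu> :: real
  assumes bl: "blocks A l u v" and C: "\<And>k i. k \<in> A \<Longrightarrow> \<bar>v k i\<bar> \<le> C" "0 \<le> C"
    and c: "1 \<le> c" "\<And>i. i < j \<Longrightarrow> nn i \<le> c" and \<mu>: "1 \<le> \<mu>"
    and bound: "\<And>B p q g i. B \<subseteq> A \<Longrightarrow> inv_fun p g \<Longrightarrow>
        \<bar>R (mlt p q g (\<lambda>i. \<Sum>k\<in>B. v k i)) i\<bar> \<le> C * (card B / \<mu> + card B / 2 ^ d + depth_const c d)"
    and g: "inv_fun p g" and B: "B \<subseteq> A" and n: "wt n < j"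
  shows "\<bar>R (mlt p q g (\<lambda>i. \<Sum>k\<in>B. v k i)) n\<bar> \<le>
      C * (card B * (1 / \<mu> + 1 / 2 ^ d) / m (wt n) + depth_const c (Suc d))"
proof -
  let ?M = "m (wt n)" and ?\<theta> = "1 / \<mu> + 1 / 2 ^ d" and ?d = "depth_const c d"
  define a where "a = real (age n)"
  have M: "32 \<le> ?M" by (rule m_ge)
  have dpos: "1 \<le> ?d" using depth_const_ge[OF c(1)] .
  have \<theta>: "0 \<le> ?\<theta>" "?\<theta> \<le> 2" using \<mu>
    by (auto intro!: add_nonneg_nonneg add_mono[of "1/\<mu>" 1 "1/2^d" 1, simplified] simp: divide_le_eq_1)
  have "a \<le> c" using age_le[of n] c(2)[OF n] by (simp add: a_def)
  have a0: "0 \<le> a" by (simp add: a_def)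
  have fB: "finite B" using B bl by (meson blocks_def finite_subset)
  have "\<bar>R (mlt p q g (\<lambda>i. \<Sum>k\<in>B. v k i)) n\<bar> \<le>
     (C * ?\<theta> * (card {k\<in>B. l k \<le> n} + age n) + age n * (C * ?d)) / ?M + (age n + 1) * C"
  proof (rule chain_estimate[OF blocks_subset[OF bl B]])
    fix B' p q g i assume "B' \<subseteq> B" and "inv_fun p g"
    then have "\<bar>R (mlt p q g (\<lambda>i. \<Sum>k\<in>B'. v k i)) i\<bar> \<le> C * (card B' / \<mu> + card B' / 2 ^ d + ?d)"
      using B by (intro bound) auto
    then show "\<bar>R (mlt p q g (\<lambda>i. \<Sum>k\<in>B'. v k i)) i\<bar> \<le> C * ?\<theta> * card B' + C * ?d"
      by (simp add: algebra_simps)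
  qed (use C B \<theta> dpos g in auto)
  also have "\<dots> = C * (?\<theta> * card {k\<in>B. l k \<le> n} / ?M + (?\<theta> * a / ?M + a * ?d / ?M + a + 1))"
    using M by (simp add: field_simps a_def)
  also have "\<dots> \<le> C * (card B * ?\<theta> / ?M + c * (?d + 5))"
  proof (intro mult_left_mono add_mono C(2))
    have "real (card {k\<in>B. l k \<le> n}) \<le> card B" using fB by (simp add: card_mono)
    then have "?\<theta> * card {k\<in>B. l k \<le> n} \<le> ?\<theta> * card B" using \<theta> by (intro mult_left_mono) auto
    then show "?\<theta> * card {k\<in>B. l k \<le> n} / ?M \<le> card B * ?\<theta> / ?M"
      using M by (simp add: divide_right_mono mult.commute)
    have "?\<theta> * a / ?M \<le> 2 * a" using \<theta> M a0 mult_mono[of ?\<theta> 2 a a]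
      by (simp add: divide_le_eq) (smt (verit) mult_le_cancel_left1 mult_nonneg_nonneg)
    moreover have "a * ?d / ?M \<le> a * ?d"
      using M a0 dpos by (simp add: divide_le_eq mult_le_cancel_left1) (smt (verit) mult_le_cancel_left1 mult_nonneg_nonneg)
    moreover have "a * ?d \<le> c * ?d" using \<open>a \<le> c\<close> dpos by (intro mult_right_mono) auto
    ultimately show "?\<theta> * a / ?M + a * ?d / ?M + a + 1 \<le> c * (?d + 5)"
      using \<open>a \<le> c\<close> c(1) by (simp add: algebra_simps)
  qed
  finally show ?thesis by simp
qed

text \<open>Unfolding a node of weight below \<open>j\<close> at least halves the main term, and a
  node of weight at least \<open>j\<close> ends the recursion through \<open>big\<close>. After
  \<open>d\<close> levels what has not met a large weight is down to \<open>card B / 2 ^ d\<close>.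
  The parameter \<open>\<mu>\<close> is \<open>m j\<close> for ordinary averages and its square for
  dependent sequences.\<close>

lemma depth_estimate:
  fixes C c \<mu> :: real
  assumes bl: "blocks A l u v"
    and C: "\<And>k p q g i. k \<in> A \<Longrightarrow> inv_fun p g \<Longrightarrow> \<bar>R (mlt p q g (v k)) i\<bar> \<le> C" "0 \<le> C"
    and c: "1 \<le> c" "\<And>i. i < j \<Longrightarrow> nn i \<le> c" and \<mu>: "1 \<le> \<mu>"
    and big: "\<And>B p q g i. B \<subseteq> A \<Longrightarrow> inv_fun p g \<Longrightarrow> j \<le> wt i \<Longrightarrow>
        \<bar>R (mlt p q g (\<lambda>i. \<Sum>k\<in>B. v k i)) i\<bar> \<le> C * (10 + card B / \<mu>)"
    and g: "inv_fun p g" and B: "B \<subseteq> A"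
  shows "\<bar>R (mlt p q g (\<lambda>i. \<Sum>k\<in>B. v k i)) n\<bar> \<le>
     C * (card B / \<mu> + card B / 2 ^ d + depth_const c d)"
  using g B
proof (induction d arbitrary: B p q g n)
  case 0
  have "finite B" using 0 bl by (meson blocks_def finite_subset)
  then have "\<bar>R (mlt p q g (\<lambda>i. \<Sum>k\<in>B. v k i)) n\<bar> \<le> (\<Sum>k\<in>B. \<bar>R (mlt p q g (v k)) n\<bar>)"
    by (simp add: R_mlt_sum sum_abs)
  also have "\<dots> \<le> C * card B"
  proof -
    have "(\<Sum>k\<in>B. \<bar>R (mlt p q g (v k)) n\<bar>) \<le> of_nat (card B) * C"
      by (rule sum_bounded_above) (use C(1) 0 in blast)
    then show ?thesis by (simp add: mult.commute)
  qed
  also have "\<dots> \<le> C * (card B / \<mu> + card B / 2 ^ 0 + depth_const c 0)"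
    using C \<mu> by (intro mult_left_mono) auto
  finally show ?case .
next
  case (Suc d)
  have vC: "\<bar>v k i\<bar> \<le> C" if "k \<in> A" for k i
    using C(1)[OF that, of i "\<lambda>_. 1" "Suc i" i] by (simp add: R_mlt_point)
  show ?case
  proof (cases "wt n < j")
    case False
    have "10 \<le> depth_const c d'" for d'
    proof (induction d')
      case (Suc d')
      have "1 * 15 \<le> c * (depth_const c d' + 5)" using c(1) Suc by (intro mult_mono) auto
      then show ?case by simp
    qed simp
    then have "C * (10 + card B / \<mu>) \<le> C * (card B / \<mu> + card B / 2 ^ Suc d + depth_const c (Suc d))"
      using C(2) by (intro mult_left_mono) (auto intro: add_increasing simp del: depth_const.simps)
    then show ?thesis using big[OF Suc.prems(2,1), of n q] False by linarith
  next
    case True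
    have "\<bar>R (mlt p q g (\<lambda>i. \<Sum>k\<in>B. v k i)) n\<bar> \<le>
        C * (card B * (1 / \<mu> + 1 / 2 ^ d) / m (wt n) + depth_const c (Suc d))"
      by (rule depth_step[OF bl vC C(2) c \<mu> Suc.IH Suc.prems True])
    also have "\<dots> \<le> C * (card B * (1 / \<mu> + 1 / 2 ^ d) / 2 + depth_const c (Suc d))"
      using C(2) \<mu> m_ge[of "wt n"]
      by (intro mult_left_mono add_right_mono divide_left_mono) auto
    also have "\<dots> \<le> C * (card B / \<mu> + card B / 2 ^ Suc d + depth_const c (Suc d))"
      using C(2) \<mu> by (intro mult_left_mono) (auto simp: field_simps)
    finally show ?thesis .
  qed
qed

text \<open>The vectors of exact pairs of weight \<^term>\<open>j\<close>; they arise as averages of rapidly increasing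
  sequences of length \<^term>\<open>nn j\<close>.\<close>

definition EXV :: "real \<Rightarrow> nat \<Rightarrow> (nat \<Rightarrow> real) \<Rightarrow> bool" where
  "EXV C j z \<longleftrightarrow> GV C j z \<and> (\<forall>p q g n. inv_fun p g \<longrightarrow> j < wt n \<longrightarrow> \<bar>R (mlt p q g z) n\<bar> \<le> C / m j) \<and>
     (\<forall>i. \<bar>z i\<bar> \<le> C / m j)"

text \<open>The three terms of \<open>depth_estimate\<close>, multiplied by
  \<open>m j / nn j\<close>, are at most 1 each; this is the constant 3. Below weight
  \<open>j\<close> a further \<open>depth_step\<close> keeps the factor \<open>1 / m (wt n)\<close>;
  above weight \<open>j\<close> the square of \<open>m j\<close> is dominated by
  \<open>m (wt n)\<close>. At weight \<open>j\<close> itself nothing better than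
  \<open>3 * C\<close> is claimed.\<close>

lemma average_EXV:
  assumes RIS: "RIS C {..<nn j} l u w v" and C: "0 \<le> C"
  shows "EXV (3 * C) j (\<lambda>i. m j / nn j * (\<Sum>k<nn j. v k i))"
proof -
  let ?A = "{..<nn j}" and ?N = "real (nn j)" and ?m = "m j"
  define S where "S = (\<lambda>i. \<Sum>k<nn j. v k i)"
  define z where "z = (\<lambda>i. ?m / ?N * S i)"
  obtain c :: real and d where cd: "1 \<le> c" "\<forall>i<j. nn i \<le> c" "?m\<^sup>2 \<le> 2 ^ d"
      "?m\<^sup>2 * depth_const c (Suc d) \<le> ?N" "?m\<^sup>2 * depth_const c d \<le> ?N"
    using nn_dom[of j] by blast
  have m: "0 < ?m" "1 \<le> ?m" and N: "0 < ?N" using m_pos m_ge_1 nn_pos by auto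
  have bl: "blocks ?A l u v" and GV: "\<And>k. k \<in> ?A \<Longrightarrow> GV C (w k) (v k)" using RIS by (auto simp: RIS_def)
  have sub: "RIS C B l u w v" if "B \<subseteq> ?A" for B
    using RIS that blocks_subset[OF _ that] unfolding RIS_def by blast
  have big: "\<bar>R (mlt p q g (\<lambda>i. \<Sum>k\<in>B. v k i)) i\<bar> \<le> C * (10 + card B / ?m)"
    if "B \<subseteq> ?A" "inv_fun p g" "j \<le> wt i" for B p q g i
  proof -
    have "\<bar>R (mlt p q g (\<lambda>i. \<Sum>k\<in>B. v k i)) i\<bar> \<le> C * (1 + card B / m (wt i))"
      by (rule high_weight_estimate[OF sub[OF that(1)] that(2) C])
    also have "\<dots> \<le> C * (10 + card B / ?m)"
      using C m_mono[OF that(3)] m by (intro mult_left_mono add_mono divide_left_mono) (auto intro: mult_pos_pos m_pos)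
    finally show ?thesis .
  qed
  have est: "\<bar>R (mlt p q g (\<lambda>i. \<Sum>k\<in>B. v k i)) n\<bar> \<le> C * (card B / ?m + card B / 2 ^ d + depth_const c d)"
    if "inv_fun p g" "B \<subseteq> ?A" for p q g B n
    by (rule depth_estimate[where j = j, OF bl _ C cd(1) _ m(2) big that]) (use GV GV_bound cd(2) in blast)+
  have mm: "?m \<le> 2 ^ d" using cd(3) m(2) unfolding power2_eq_square using mult_left_mono[of 1 ?m ?m] by linarith
  then have d2: "1 / 2 ^ d \<le> 1 / ?m" using m by (intro divide_left_mono) auto
  have Rz: "R (mlt p q g z) n = ?m / ?N * R (mlt p q g S) n" for p q g n
    unfolding z_def mlt_scale R_scale ..
  have Rzle: "\<bar>R (mlt p q g z) n\<bar> \<le> ?m / ?N * X" if "\<bar>R (mlt p q g S) n\<bar> \<le> X" for p q g n X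
    using mult_left_mono[OF that, of "?m / ?N"] m N by (simp add: Rz abs_mult)
  have D1: "?m / ?N * depth_const c d \<le> 1 / ?m" "?m / ?N * depth_const c (Suc d) \<le> 1 / ?m"
    using cd(4,5) m N by (simp_all add: field_simps power2_eq_square)
  have sup: "\<bar>R (mlt p q g z) n\<bar> \<le> 3 * C" if "inv_fun p g" for p q g n
  proof -
    have "\<bar>R (mlt p q g z) n\<bar> \<le> ?m / ?N * (C * (?N / ?m + ?N / 2 ^ d + depth_const c d))"
      using est[OF that, of ?A q n] by (intro Rzle) (simp add: S_def)
    also have "\<dots> = C * (1 + ?m * (1 / 2 ^ d) + ?m / ?N * depth_const c d)" using m N by (simp add: field_simps)
    also have "\<dots> \<le> C * (1 + ?m * (1 / ?m) + 1 / ?m)" using C m d2 D1 by (intro mult_left_mono add_mono) auto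
    also have "\<dots> \<le> C * 3" using C m by (intro mult_left_mono) auto
    finally show ?thesis by simp
  qed
  have low: "\<bar>R (mlt p q g z) n\<bar> \<le> 3 * C / m (wt n)" if "inv_fun p g" "wt n < j" for p q g n
  proof -
    have "\<bar>R (mlt p q g S) n\<bar> \<le> C * (card ?A * (1 / ?m + 1 / 2 ^ d) / m (wt n) + depth_const c (Suc d))"
      unfolding S_def
      by (rule depth_step[OF bl _ C cd(1) _ m(2) est that(1) subset_refl that(2)]) (use GV GV_coord cd(2) in blast)+
    then have "\<bar>R (mlt p q g z) n\<bar> \<le> ?m / ?N * (C * (?N * (1 / ?m + 1 / 2 ^ d) / m (wt n) + depth_const c (Suc d)))"
      by (intro Rzle) simp
    also have "\<dots> = C * (?m * (1 / ?m + 1 / 2 ^ d) / m (wt n) + ?m / ?N * depth_const c (Suc d))"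
      using m N by (simp add: field_simps)
    also have "\<dots> \<le> C * (?m * (1 / ?m + 1 / ?m) / m (wt n) + 1 / m (wt n))"
    proof (intro mult_left_mono add_mono divide_right_mono C)
      have "1 / ?m \<le> 1 / m (wt n)" using m_mono[of "wt n" j] that m_pos by (intro divide_left_mono) auto
      then show "?m / ?N * depth_const c (Suc d) \<le> 1 / m (wt n)" using D1 by linarith
    qed (use d2 m m_pos[of "wt n"] in auto)
    also have "\<dots> = 3 * C / m (wt n)" using m by (simp add: field_simps)
    finally show ?thesis .
  qed
  have mN: "?m / ?N \<le> 1 / ?m" using nn_ge[of j] m N by (simp add: field_simps power2_eq_square)
  have high: "\<bar>R (mlt p q g z) n\<bar> \<le> 3 * C / ?m" if "inv_fun p g" "j < wt n" for p q g n
  proof -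
    have "\<bar>R (mlt p q g S) n\<bar> \<le> C * (1 + ?N / m (wt n))"
      using high_weight_estimate[OF RIS that(1) C, of q n] by (simp add: S_def)
    then have "\<bar>R (mlt p q g z) n\<bar> \<le> ?m / ?N * (C * (1 + ?N / m (wt n)))"
      by (rule Rzle)
    also have "\<dots> = C * (?m / ?N + ?m / m (wt n))" using N by (simp add: field_simps)
    also have "\<dots> \<le> C * (1 / ?m + 1 / ?m)"
    proof (intro mult_left_mono add_mono C mN)
      show "?m / m (wt n) \<le> 1 / ?m" using m_sq[OF that(2)] m m_pos[of "wt n"]
        by (simp add: field_simps power2_eq_square)
    qed
    also have "\<dots> \<le> 3 * C / ?m" using C m by (simp add: field_simps)
    finally show ?thesis .
  qed
  have coord: "\<bar>z i\<bar> \<le> 3 * C / ?m" for i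
  proof -
    have "\<bar>S i\<bar> \<le> C" unfolding S_def using blocks_coord[OF bl _ C] GV GV_coord by blast
    then have "\<bar>z i\<bar> \<le> ?m / ?N * C"
      using mult_left_mono[of "\<bar>S i\<bar>" C "?m / ?N"] m N by (simp add: z_def abs_mult)
    also have "\<dots> \<le> 1 / ?m * C" using mN C by (intro mult_right_mono)
    also have "\<dots> \<le> 3 * C / ?m" using C m by (simp add: field_simps)
    finally show ?thesis .
  qed
  show ?thesis
    using sup low high coord unfolding EXV_def GV_def z_def S_def by auto
qed

end

section \<open>Dependent sequences\<close>

text \<open>Along a chain of odd weight, the functional added after \<open>\<xi>\<close> is the coordinate of an index whose
  weight \<open>2 * \<xi> + 2\<close> encodes \<open>\<xi>\<close>. So two such chains agree until they split, and afterwards all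
  weights differ.\<close>

locale argyros_haydon = saturated +
  fixes K :: "'a set"
  assumes K_cover: "\<exists>F. finite F \<and> F \<subseteq> K \<and> (\<forall>y\<in>K. \<exists>x\<in>F. E (\<pi> x) y x)"
    and \<kappa>_in: "\<kappa> n \<in> K"
    and odd_bc: "age n \<noteq> 0 \<Longrightarrow> odd (wt n) \<Longrightarrow>
        \<exists>\<eta><n. wt \<eta> = 2 * prd n + 2 \<and> bc n = (\<lambda>k. if k = \<eta> then 1 else 0)"
    and ex_root: "x \<in> K \<Longrightarrow> \<exists>n\<ge>q. age n = 0 \<and> wt n = j \<and> \<kappa> n = x"
    and ex_even: "even (wt \<xi>) \<Longrightarrow> age \<xi> < nn (wt \<xi>) \<Longrightarrow> (\<Sum>k<q. \<bar>\<beta> k\<bar>) \<le> 1 \<Longrightarrow> 0 < \<tau> \<Longrightarrow>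
        \<exists>n\<ge>q. age n \<noteq> 0 \<and> prd n = \<xi> \<and> (\<Sum>k<n. \<bar>bc n k - (if k < q then \<beta> k else 0)\<bar>) \<le> \<tau>"
    and ex_odd: "odd (wt \<xi>) \<Longrightarrow> age \<xi> < nn (wt \<xi>) \<Longrightarrow> wt \<eta> = 2 * \<xi> + 2 \<Longrightarrow>
        \<exists>n\<ge>q. age n \<noteq> 0 \<and> prd n = \<xi> \<and> bc n = (\<lambda>k. if k = \<eta> then 1 else 0)"
begin

lemma inv_fun_J: "inv_fun p g \<Longrightarrow> inv_fun (max (Suc (prd n)) p) (\<lambda>x. cell (Suc (prd n)) (\<kappa> n) x * g x)"
  by (intro inv_fun_mult) (auto intro: inv_fun_mono[OF _ inv_fun_cell] inv_fun_mono[of p])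

text \<open>The chain through the \<open>\<xi> i\<close> hardly sees the sum, since each
  \<open>\<eta> i\<close> nearly annihilates \<open>z i\<close>. Another chain of weight
  \<open>j\<close> may follow it for a while; the step at which it leaves costs \<open>C\<close>,
  and afterwards the weights of its functionals differ from those of all the \<open>z i\<close>, so
  that the interaction is small from either side. All coordinates of weight \<open>j\<close> are
  thus bounded by a multiple of \<open>C\<close> without a term proportional to
  \<open>N\<close>.\<close>

lemma dependent_estimate:
  assumes j: "odd j" and N: "N = nn j" and C: "0 \<le> C"
    and wt0: "wt (\<xi> 0) = j"
    and step: "\<And>i. i < N \<Longrightarrow> age (\<xi> (Suc i)) \<noteq> 0 \<and> prd (\<xi> (Suc i)) = \<xi> i \<and>
        bc (\<xi> (Suc i)) = (\<lambda>k. if k = \<eta> i then 1 else 0) \<and> \<eta> i < \<xi> (Suc i)"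
    and z: "\<And>i. i < N \<Longrightarrow> EXV C (2 * \<xi> i + 2) (z i) \<and>
        (\<forall>k. z i k \<noteq> 0 \<longrightarrow> \<xi> i < k \<and> k < \<xi> (Suc i)) \<and> \<bar>R (J (\<xi> (Suc i)) (z i)) (\<eta> i)\<bar> \<le> C / N"
  shows "\<bar>R (\<lambda>k. \<Sum>i<N. z i k) n\<bar> \<le> 3 * C * N / (m j)\<^sup>2"
proof -
  define w where "w i = 2 * \<xi> i + 2" for i
  define S where "S A = (\<lambda>k. \<Sum>i\<in>A. z i k)" for A
  have N1: "1 \<le> real N" using nn_pos[of j] by (simp add: N Suc_leI)
  have m1: "1 \<le> m j" by (rule m_ge_1)
  have \<xi>_less: "\<xi> i < \<xi> (Suc i)" if "i < N" for i
    using step[OF that] prd_less by metis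
  have \<xi>_mono: "\<xi> i \<le> \<xi> i'" if "i \<le> i'" "i' \<le> N" for i i'
    using that
  proof (induction i' rule: dec_induct)
    case (step k)
    then show ?case using \<xi>_less[of k] by simp
  qed simp
  have \<xi>_inj: "i = i'" if "\<xi> i = \<xi> i'" "i \<le> N" "i' \<le> N" for i i'
  proof (rule ccontr)
    assume "i \<noteq> i'"
    then consider "Suc i \<le> i'" | "Suc i' \<le> i" by linarith
    then show False
      by cases (use \<xi>_less[of i] \<xi>_less[of i'] \<xi>_mono[of "Suc i" i'] \<xi>_mono[of "Suc i'" i] that in auto)
  qed
  have wt\<xi>: "wt (\<xi> i) = j" if "i \<le> N" for i
    using that
  proof (induction i)
    case (Suc i)
    then show ?case using wt_prd[of "\<xi> (Suc i)"] step[of i] by simp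
  qed (simp add: wt0)
  have wj: "j < 2 * \<xi> i + 2" if "i \<le> N" for i using wt_le[of "\<xi> i"] wt\<xi>[OF that] by simp
  have big_m: "(real N)\<^sup>2 \<le> m h" if "j < h" for h using m_grow[OF that] by (simp add: N)
  have small: "C / m h \<le> C / N / N" if "j < h" for h
    using divide_left_mono[OF big_m[OF that] C] N1 m_pos[of h] by (simp add: power2_eq_square)
  have NN: "C / N / N \<le> C / N" "C / N \<le> C" using C N1 by (auto simp: divide_le_eq mult_le_cancel_left1 field_simps mult_left_mono)
  have bl: "blocks {..<N} (\<lambda>i. Suc (\<xi> i)) (\<lambda>i. \<xi> (Suc i)) z"
    unfolding blocks_def
  proof (intro conjI ballI allI impI)
    fix k k' assume "k \<in> {..<N}" "k' \<in> {..<N}" "k < k'"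
    then show "\<xi> (Suc k) \<le> Suc (\<xi> k')" using \<xi>_mono[of "Suc k" k'] by simp
  qed (use z in \<open>auto simp: Suc_le_eq\<close>)
  have EXz: "EXV C (w i) (z i)" and GVz: "GV C (w i) (z i)" if "i < N" for i
    using z[OF that] by (auto simp: w_def EXV_def)
  have RIS: "RIS C {..<N} (\<lambda>i. Suc (\<xi> i)) (\<lambda>i. \<xi> (Suc i)) w z"
    unfolding RIS_def
  proof (intro conjI ballI impI bl)
    fix k k' assume k: "k \<in> {..<N}" "k' \<in> {..<N}" "k < k'"
    then have "\<xi> (Suc k) \<le> \<xi> k'" using \<xi>_mono[of "Suc k" k'] by simp
    then show "\<xi> (Suc k) \<le> w k'" by (simp add: w_def)
  qed (use GVz in auto)
  have coord: "\<bar>mlt p q g (S A) k\<bar> \<le> C / N" if A: "A \<subseteq> {..<N}" and g: "inv_fun p g" for A p q g k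
  proof -
    have "\<bar>S A k\<bar> \<le> C / N" unfolding S_def
    proof (rule blocks_coord[OF blocks_subset[OF bl A]])
      fix i assume "i \<in> A"
      then have i: "i < N" using A by auto
      then have "\<bar>z i k\<bar> \<le> C / m (w i)" using EXz by (auto simp: EXV_def)
      also have "\<dots> \<le> C / N" using small[of "w i"] wj[of i] NN i by (auto simp: w_def)
      finally show "\<bar>z i k\<bar> \<le> C / N" .
    qed (use C N1 in auto)
    moreover have "\<bar>mlt p q g (S A) k\<bar> \<le> \<bar>S A k\<bar>"
      using g by (auto simp: mlt_def abs_mult inv_fun_def mult_left_le_one_le)
    ultimately show ?thesis by linarith
  qed
  have zvan: "z i (\<xi> r) = 0" if "i < N" "r \<le> N" for i r
  proof (rule ccontr)
    assume "z i (\<xi> r) \<noteq> 0"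
    then have "\<xi> i < \<xi> r" "\<xi> r < \<xi> (Suc i)" using z[OF that(1)] by auto
    then show False using \<xi>_mono[of r i] \<xi>_mono[of "Suc i" r] that by linarith
  qed
  have Jbound: "\<bar>R (J k (mlt p q g (z i))) k'\<bar> \<le> C" if "inv_fun p g" "i < N" for p q g i k k'
    unfolding J_mlt by (rule GV_bound[OF GVz[OF that(2)] inv_fun_J[OF that(1)]])
  have initial: "\<bar>R (mlt p q g (S A)) (\<xi> r)\<bar> \<le> 3 * C" if A: "A \<subseteq> {..<N}" and g: "inv_fun p g" and r: "r \<le> N" for A p q g r
  proof -
    \<comment> \<open>The end points \<open>p\<close> and \<open>q\<close> of the interval may
      destroy the near annihilation, but each of them falls into the gap of at most one
      \<open>i\<close>, where the trivial bound \<open>C\<close> is paid.\<close>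
    define cut where "cut i p = (if \<xi> i < p \<and> p \<le> \<xi> (Suc i) then C else 0)" for i p
    have piece: "\<bar>R (J (\<xi> (Suc i)) (mlt p q g (z i))) (\<eta> i)\<bar> \<le> C / N + cut i p + cut i q" if i: "i < N" for i
    proof -
      have nonneg: "0 \<le> C / N" "0 \<le> cut i p" "0 \<le> cut i q" using C N1 by (auto simp: cut_def)
      note st = step[OF i]
      \<comment> \<open>For \<open>p = Suc (\<xi> i)\<close> nothing is cut off, since the gap
        begins there; this value is left to the other cases.\<close>
      consider (cutp) "\<xi> i < p \<and> p \<le> \<xi> (Suc i)" "Suc (\<xi> i) \<noteq> p" | (cutq) "\<xi> i < q" "q \<le> \<xi> (Suc i)"
        | (out) "\<xi> (Suc i) < p \<or> q \<le> \<xi> i" | (inn) "p \<le> Suc (\<xi> i)" "\<xi> (Suc i) < q" by linarith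
      then show ?thesis
      proof cases
        case cutp
        then have "cut i p = C" by (simp add: cut_def)
        then show ?thesis using Jbound[OF g i, of "\<xi> (Suc i)" q "\<eta> i"] nonneg by linarith
      next
        case cutq
        then have "cut i q = C" by (simp add: cut_def)
        then show ?thesis using Jbound[OF g i, of "\<xi> (Suc i)" q "\<eta> i"] nonneg by linarith
      next
        case out
        then have "J (\<xi> (Suc i)) (mlt p q g (z i)) = (\<lambda>_. 0)"
          using st by (auto simp: J_def mlt_def)
        then show ?thesis using nonneg by simp
      next
        case inn
        have "J (\<xi> (Suc i)) (mlt p q (\<lambda>_. 1) (z i)) = J (\<xi> (Suc i)) (z i)"
          using st inn by (auto simp: J_def mlt_def)
        then have "J (\<xi> (Suc i)) (mlt p q g (z i)) = (\<lambda>k. g (\<kappa> (\<xi> (Suc i))) * J (\<xi> (Suc i)) (z i) k)"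
          using J_mlt_fine[of p "\<xi> (Suc i)" g q "z i"] st inn g by simp
        then have "\<bar>R (J (\<xi> (Suc i)) (mlt p q g (z i))) (\<eta> i)\<bar> \<le> \<bar>R (J (\<xi> (Suc i)) (z i)) (\<eta> i)\<bar>"
          using g by (simp add: R_scale abs_mult inv_fun_def mult_left_le_one_le)
        then show ?thesis using z[OF i] nonneg by linarith
      qed
    qed
    have cut_sum: "(\<Sum>i<r. cut i p) \<le> (if p \<le> \<xi> r then C else 0)" if "r \<le> N" for r p
      using that
    proof (induction r)
      case (Suc r)
      then show ?case using C \<xi>_less[of r] by (auto simp: cut_def split: if_splits)
    qed (use C in simp)
    have "\<bar>R (mlt p q g (S A)) (\<xi> r)\<bar> \<le> (\<Sum>i<r. C / N + cut i p + cut i q)"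
      using r
    proof (induction r)
      case 0
      have "(mlt p q g (S A)) (\<xi> 0) = 0" using A zvan[of _ 0] by (auto simp: mlt_def S_def intro!: sum.neutral)
      moreover have "R (mlt p q g (S A)) (\<xi> 0) = 0" 
      proof (rule R_vanish)
        fix k assume k: "k \<le> \<xi> 0"
        have "z i k = 0" if "i \<in> A" for i
        proof (rule ccontr)
          assume "z i k \<noteq> 0"
          then have "\<xi> i < k" "i < N" using z[of i] A that by auto
          then show False using k \<xi>_mono[of 0 i] by simp
        qed
        then show "mlt p q g (S A) k = 0" by (simp add: mlt_def S_def)
      qed
      ultimately show ?case by simp
    next
      case (Suc r)
      then have r: "r < N" by simp
      note st = step[OF r]
      then have node: "age (\<xi> (Suc r)) \<noteq> 0" by simp
      define t where "t = R (J (\<xi> (Suc r)) (mlt p q g (S A))) (\<eta> r)"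
      have tb: "\<bar>t\<bar> \<le> C / N + cut r p + cut r q"
      proof (cases "r \<in> A")
        case True
        have "S A k = z r k" if "\<xi> r < k" "k < \<xi> (Suc r)" for k
        proof -
          have "z i k = 0" if "i \<in> A" "i \<noteq> r" for i
          proof (rule ccontr)
            assume nz: "z i k \<noteq> 0"
            have "i < N" using A that by auto
            then have "\<xi> i < k" "k < \<xi> (Suc i)" using z nz by auto
            then show False using \<open>\<xi> r < k\<close> \<open>k < \<xi> (Suc r)\<close> \<xi>_mono[of "Suc i" r] \<xi>_mono[of "Suc r" i] that r \<open>i < N\<close> by linarith
          qed
          then have "S A k = (\<Sum>i\<in>A. if i = r then z i k else 0)" unfolding S_def by (intro sum.cong) auto
          also have "\<dots> = z r k" using True A by (simp add: finite_subset)
          finally show ?thesis .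
        qed
        then have "J (\<xi> (Suc r)) (mlt p q g (S A)) = J (\<xi> (Suc r)) (mlt p q g (z r))"
          using st by (auto simp: J_def mlt_def)
        then show ?thesis using piece[OF r] by (simp add: t_def)
      next
        case False
        have "S A k = 0" if "\<xi> r < k" "k < \<xi> (Suc r)" for k
          unfolding S_def
        proof (rule sum.neutral, rule ballI, rule ccontr)
          fix i assume i: "i \<in> A" "z i k \<noteq> 0"
          have "i < N" "i \<noteq> r" using A i False by auto
          then have "\<xi> i < k" "k < \<xi> (Suc i)" using z i by auto
          then show False using that \<xi>_mono[of "Suc i" r] \<xi>_mono[of "Suc r" i] r \<open>i < N\<close> \<open>i \<noteq> r\<close> by linarith
        qed
        then have "J (\<xi> (Suc r)) (mlt p q g (S A)) = (\<lambda>_. 0)"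
          using st by (auto simp: J_def mlt_def)
        then show ?thesis using C N1 by (simp add: t_def cut_def)
      qed
      have "(mlt p q g (S A)) (\<xi> (Suc r)) = 0"
        using A zvan[of _ "Suc r"] r by (auto simp: mlt_def S_def intro!: sum.neutral)
      moreover have "(\<Sum>k<\<xi> (Suc r). bc (\<xi> (Suc r)) k * R (J (\<xi> (Suc r)) (mlt p q g (S A))) k) = t"
        using st by (simp add: t_def if_distrib[of "\<lambda>x. x * _"] cong: if_cong)
      ultimately have "R (mlt p q g (S A)) (\<xi> (Suc r)) = R (mlt p q g (S A)) (\<xi> r) + t / m j"
        using st wt\<xi>[of "Suc r"] r by (simp add: R_node[OF node])
      moreover have "\<bar>t / m j\<bar> \<le> \<bar>t\<bar>" using m1 by (simp add: abs_divide divide_le_eq mult_le_cancel_left1)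
      ultimately show ?case using Suc tb by (simp, linarith)
    qed
    also have "\<dots> = r * (C / N) + (\<Sum>i<r. cut i p) + (\<Sum>i<r. cut i q)" by (simp add: sum.distrib)
    also have "\<dots> \<le> C + C + C"
    proof (intro add_mono)
      have "real r * (C / N) \<le> N * (C / N)" using r C by (intro mult_right_mono) auto
      then show "r * (C / N) \<le> C" using N1 by simp
    qed (use cut_sum[OF r, of p] cut_sum[OF r, of q] C in \<open>auto split: if_splits\<close>)
    finally show ?thesis by simp
  qed
  \<comment> \<open>On leaving the chain: at most \<open>3 * C\<close> at the predecessor,
    \<open>C\<close> for the functional and two terms \<open>C / N\<close>, hence
    \<open>6 * C\<close>. Each later step adds \<open>C / N\<close> for its coefficient and
    \<open>C / N\<close> for its functional.\<close>
  have same: "\<bar>R (mlt p q g (S A)) n\<bar> \<le> (if \<exists>r\<le>N. n = \<xi> r then 3 * C else 6 * C + age n * (2 * C / N))"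
    if A: "A \<subseteq> {..<N}" and g: "inv_fun p g" and n: "wt n = j" for A p q g n
    using n
  proof (induction n rule: less_induct)
    case (less n)
    show ?case
    proof (cases "\<exists>r\<le>N. n = \<xi> r")
      case True then show ?thesis using initial[OF A g] by auto
    next
      case notin: False
      have bnd: "\<bar>R (mlt p q g (S A)) n\<bar> \<le> 6 * C + age n * (2 * C / N)"
      proof (cases "age n = 0")
        case True
        then show ?thesis using coord[OF A g, of q n] NN(2) C by (simp add: R_root)
      next
        case node: False
        note pn = prd_less[OF node]
        obtain h where h: "h < n" "wt h = 2 * prd n + 2" "bc n = (\<lambda>k. if k = h then 1 else 0)"
          using odd_bc[OF node] j less.prems by auto
        define t where "t = R (J n (mlt p q g (S A))) h"
        have eq: "(\<Sum>k<n. bc n k * R (J n (mlt p q g (S A))) k) = t"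
          using h by (simp add: t_def if_distrib[of "\<lambda>x. x * _"] cong: if_cong)
        have jh: "j < wt h" using h(2) wt_le[of "prd n"] wt_prd[OF node] less.prems by simp
        have fA: "finite A" using A finite_subset by blast
        \<comment> \<open>The weight of \<open>h\<close> determines \<open>prd n\<close>, so it
          equals \<open>w i\<close> only if \<open>prd n = \<xi> i\<close>. For a smaller weight
          \<open>z i\<close> is small by \<open>GV\<close>, for a larger one by
          \<open>EXV\<close>.\<close>
        have ti: "\<bar>R (J n (mlt p q g (z i))) h\<bar> \<le> C / N / N + (if prd n = \<xi> i then C else 0)" if "i \<in> A" for i
        proof -
          have i: "i < N" using that A by auto
          have inv: "inv_fun (max (Suc (prd n)) p) (\<lambda>x. cell (Suc (prd n)) (\<kappa> n) x * g x)"
            by (rule inv_fun_J[OF g])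
          consider "prd n = \<xi> i" | "wt h < w i" | "w i < wt h" using h(2) by (fastforce simp: w_def)
          then show ?thesis
          proof cases
            case 1 then show ?thesis using Jbound[OF g i, of n q h] C N1 by (simp add: add_increasing)
          next
            case 2
            then have "\<bar>R (J n (mlt p q g (z i))) h\<bar> \<le> C / m (wt h)"
              unfolding J_mlt by (rule GV_weight[OF GVz[OF i] inv])
            then show ?thesis using small[OF jh] C by (auto split: if_splits)
          next
            case 3
            then have "\<bar>R (J n (mlt p q g (z i))) h\<bar> \<le> C / m (w i)"
              unfolding J_mlt using EXz[OF i] inv by (auto simp: EXV_def)
            then show ?thesis using small[of "w i"] wj[of i] i C by (auto simp: w_def split: if_splits)
          qed
        qed
        have "t = (\<Sum>i\<in>A. R (J n (mlt p q g (z i))) h)"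
          unfolding t_def S_def using fA by (simp add: mlt_sum J_def R_sum)
        then have "\<bar>t\<bar> \<le> (\<Sum>i\<in>A. \<bar>R (J n (mlt p q g (z i))) h\<bar>)" by (simp add: sum_abs)
        also have "\<dots> \<le> (\<Sum>i\<in>A. C / N / N + (if prd n = \<xi> i then C else 0))" by (rule sum_mono[OF ti])
        also have "\<dots> = card A * (C / N / N) + (\<Sum>i\<in>A. if prd n = \<xi> i then C else 0)" by (simp add: sum.distrib)
        also have "\<dots> \<le> C / N + (if \<exists>r\<le>N. prd n = \<xi> r then C else 0)"
        proof (intro add_mono)
          have "real (card A) \<le> N" using card_mono[OF _ A] by simp
          then have "card A * (C / N / N) \<le> N * (C / N / N)" using C by (intro mult_right_mono) auto
          then show "card A * (C / N / N) \<le> C / N" using N1 by simp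
          show "(\<Sum>i\<in>A. if prd n = \<xi> i then C else 0) \<le> (if \<exists>r\<le>N. prd n = \<xi> r then C else 0)"
          proof (cases "\<exists>i\<in>A. prd n = \<xi> i")
            case True
            then obtain r where r: "r \<in> A" "prd n = \<xi> r" by blast
            have "r < N" using subsetD[OF A r(1)] by simp
            have "(\<Sum>i\<in>A. if prd n = \<xi> i then C else 0) = (\<Sum>i\<in>A. if i = r then C else 0)"
            proof (rule sum.cong[OF refl])
              fix i assume "i \<in> A"
              then have "i < N" using subsetD[OF A] by blast
              then have "prd n = \<xi> i \<longleftrightarrow> i = r" using \<xi>_inj[of i r] r(2) \<open>r < N\<close>
                by (metis less_imp_le_nat)
              then show "(if prd n = \<xi> i then C else 0) = (if i = r then C else 0)" by simp
            qed
            also have "\<dots> = C" using r fA by simp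
            finally show ?thesis using r \<open>r < N\<close> by (auto intro: less_imp_le)
          next
            case False
            then have "(\<Sum>i\<in>A. if prd n = \<xi> i then C else 0) = 0" by (intro sum.neutral) auto
            then show ?thesis using C by simp
          qed
        qed
        finally have tb: "\<bar>t\<bar> \<le> C / N + (if \<exists>r\<le>N. prd n = \<xi> r then C else 0)" .
        have "\<bar>t / m j\<bar> \<le> \<bar>t\<bar>" using m1 by (simp add: abs_divide divide_le_eq mult_le_cancel_left1)
        moreover have "R (mlt p q g (S A)) n = mlt p q g (S A) n + R (mlt p q g (S A)) (prd n) + t / m j"
          using eq less.prems by (simp add: R_node[OF node])
        ultimately have tot: "\<bar>R (mlt p q g (S A)) n\<bar> \<le> C / N + \<bar>R (mlt p q g (S A)) (prd n)\<bar> + \<bar>t\<bar>"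
          using coord[OF A g, of q n] by linarith
        note IH = less.IH[OF pn]
        have ag: "real (age n) = age (prd n) + 1" using age_prd[OF node] by simp
        have pos: "0 \<le> 2 * C / N" using C N1 by simp
        show ?thesis
        proof (cases "\<exists>r\<le>N. prd n = \<xi> r")
          case True
          then have "\<bar>R (mlt p q g (S A)) n\<bar> \<le> 6 * C"
          proof -
            have "\<bar>t\<bar> \<le> C / N + C" using tb True by (simp only: if_True)
            moreover have "\<bar>R (mlt p q g (S A)) (prd n)\<bar> \<le> 3 * C"
              using IH wt_prd[OF node] less.prems True by (simp only: if_True)
            ultimately show ?thesis using tot NN(2) by linarith
          qed
          moreover have "0 \<le> age n * (2 * C / N)" using pos by (intro mult_nonneg_nonneg) auto
          ultimately show ?thesis by linarith
        next
          case False
          have "6 * C + age n * (2 * C / N) = 6 * C + age (prd n) * (2 * C / N) + C / N + C / N"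
            by (simp add: ag ring_distribs add_divide_distrib)
          moreover have "\<bar>t\<bar> \<le> C / N" using tb False by (simp only: if_False)
          moreover have "\<bar>R (mlt p q g (S A)) (prd n)\<bar> \<le> 6 * C + age (prd n) * (2 * C / N)"
            using IH wt_prd[OF node] less.prems False by (simp only: if_False)
          ultimately show ?thesis using tot by linarith
        qed
      qed
      then show ?thesis by (simp only: if_not_P[OF notin])
    qed
  qed
  \<comment> \<open>As the age is at most \<open>N\<close>, the later steps add up to
    \<open>2 * C\<close>; the total \<open>8 * C\<close> is rounded up to the initial value of
    \<open>depth_const\<close>.\<close>
  have same10: "\<bar>R (mlt p q g (S A)) n\<bar> \<le> 10 * C"
    if A: "A \<subseteq> {..<N}" and g: "inv_fun p g" and n: "wt n = j" for A p q g n
  proof -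
    have "real (age n) \<le> N" using age_le[of n] n N by simp
    then have "age n * (2 * C / N) \<le> N * (2 * C / N)" using C N1 by (intro mult_right_mono) auto
    then have "age n * (2 * C / N) \<le> 2 * C" using N1 by simp
    moreover have "\<bar>R (mlt p q g (S A)) n\<bar> \<le> max (3 * C) (6 * C + age n * (2 * C / N))"
    proof (cases "\<exists>r\<le>N. n = \<xi> r")
      case True
      from same[OF that, of q, unfolded if_P[OF True]] show ?thesis by linarith
    next
      case False
      from same[OF that, of q, unfolded if_not_P[OF False]] show ?thesis by linarith
    qed
    ultimately show ?thesis using C by linarith
  qed
  obtain c :: real and d where cd: "1 \<le> c" "\<forall>i<j. nn i \<le> c" "(m j)\<^sup>2 \<le> 2 ^ d"
      "(m j)\<^sup>2 * depth_const c d \<le> nn j"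
    using nn_dom[of j] by blast
  have \<mu>: "1 \<le> (m j)\<^sup>2" using m1 by (simp add: one_le_power)
  \<comment> \<open>Here \<open>\<mu>\<close> can be the square of \<open>m j\<close>: nodes of
    weight \<open>j\<close> satisfy a bound without cardinality, and for larger weights
    \<open>m\<close> is at least that square. This gain of a factor \<open>m j\<close> over an
    ordinary average is the point of the lemma.\<close>
  have "\<bar>R (mlt 0 (Suc n) (\<lambda>_. 1) (\<lambda>k. \<Sum>i\<in>{..<N}. z i k)) n\<bar>
      \<le> C * (card {..<N} / (m j)\<^sup>2 + card {..<N} / 2 ^ d + depth_const c d)"
  proof (rule depth_estimate[where j = j, OF bl _ C cd(1) _ \<mu>])
    fix B p q g i assume B: "B \<subseteq> {..<N}" "inv_fun p g" "j \<le> wt i"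
    show "\<bar>R (mlt p q g (\<lambda>i. \<Sum>k\<in>B. z k i)) i\<bar> \<le> C * (10 + card B / (m j)\<^sup>2)"
    proof (cases "wt i = j")
      case True
      have "0 \<le> C * (card B / (m j)\<^sup>2)" using C by (intro mult_nonneg_nonneg) auto
      then show ?thesis using same10[OF B(1,2) True, of q] unfolding S_def distrib_left by linarith
    next
      case False
      then have jw: "j < wt i" using B by simp
      have "RIS C B (\<lambda>i. Suc (\<xi> i)) (\<lambda>i. \<xi> (Suc i)) w z"
        using RIS B(1) blocks_subset[OF _ B(1)] unfolding RIS_def by blast
      from high_weight_estimate[OF this B(2) C]
      have "\<bar>R (mlt p q g (\<lambda>i. \<Sum>k\<in>B. z k i)) i\<bar> \<le> C * (1 + card B / m (wt i))" .
      also have "\<dots> \<le> C * (10 + card B / (m j)\<^sup>2)"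
        using C m_sq[OF jw] \<mu> by (intro mult_left_mono add_mono divide_left_mono) (auto intro!: mult_pos_pos m_pos)
      finally show ?thesis .
    qed
  qed (use GVz GV_bound cd(2) in \<open>auto, blast\<close>)
  then have "\<bar>R (\<lambda>k. \<Sum>i<N. z i k) n\<bar> \<le> C * (N / (m j)\<^sup>2 + N / 2 ^ d + depth_const c d)"
    by (simp add: R_mlt_full)
  also have "\<dots> \<le> C * (N / (m j)\<^sup>2 + N / (m j)\<^sup>2 + N / (m j)\<^sup>2)"
  proof (intro mult_left_mono add_mono C)
    show "N / 2 ^ d \<le> N / (m j)\<^sup>2" using cd(3) \<mu> m_pos[of j] by (intro divide_left_mono) auto
    show "depth_const c d \<le> N / (m j)\<^sup>2" using cd(4) \<mu> N m_pos[of j] by (simp add: field_simps)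
  qed auto
  finally show ?thesis by (simp add: field_simps)
qed

end

section \<open>Bounded operators on finitely supported vectors\<close>

lemma finite_dependent_choice:
  assumes "P 0 x" "\<And>r x. r < N \<Longrightarrow> P r x \<Longrightarrow> \<exists>y. P (Suc r) y \<and> Q r x y"
  shows "\<exists>f. (\<forall>r\<le>N. P r (f r)) \<and> (\<forall>r<N. Q r (f r) (f (Suc r)))"
proof -
  have "\<exists>f. \<forall>r. (r \<le> N \<longrightarrow> P r (f r)) \<and> (r < N \<longrightarrow> Q r (f r) (f (Suc r)))"
  proof (rule dependent_nat_choice)
    show "\<exists>x. 0 \<le> N \<longrightarrow> P 0 x" using assms(1) by blast
    fix y n assume "n \<le> N \<longrightarrow> P n y"
    then show "\<exists>z. (Suc n \<le> N \<longrightarrow> P (Suc n) z) \<and> (n < N \<longrightarrow> Q n y z)"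
      using assms(2)[of n y] by (cases "n < N") auto
  qed
  then show ?thesis by blast
qed

definition supp :: "nat \<Rightarrow> nat \<Rightarrow> (nat \<Rightarrow> real) \<Rightarrow> bool" where
  "supp p q a \<longleftrightarrow> (\<forall>k. a k \<noteq> 0 \<longrightarrow> p \<le> k \<and> k < q)"

definition fs :: "(nat \<Rightarrow> real) \<Rightarrow> bool" where
  "fs a \<longleftrightarrow> (\<exists>q. supp 0 q a)"

lemma supp_mono: "supp p q a \<Longrightarrow> p' \<le> p \<Longrightarrow> q \<le> q' \<Longrightarrow> supp p' q' a"
  unfolding supp_def by (meson order_less_le_trans order_trans)

lemma supp_fs: "supp p q a \<Longrightarrow> fs a"
  unfolding fs_def using supp_mono by blast

lemma supp_add: "supp p q a \<Longrightarrow> supp p q a' \<Longrightarrow> supp p q (\<lambda>k. a k + a' k)"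
  unfolding supp_def by (metis add_0)

lemma supp_scale: "supp p q a \<Longrightarrow> supp p q (\<lambda>k. c * a k)"
  unfolding supp_def by auto

lemma supp_sum: "(\<And>r. r \<in> A \<Longrightarrow> supp p q (v r)) \<Longrightarrow> supp p q (\<lambda>k. \<Sum>r\<in>A. v r k)"
  unfolding supp_def by (metis sum.neutral)

lemma fs_add: "fs a \<Longrightarrow> fs a' \<Longrightarrow> fs (\<lambda>k. a k + a' k)"
  unfolding fs_def by (metis max.cobounded1 max.cobounded2 order_refl supp_add supp_mono)

lemma fs_scale: "fs a \<Longrightarrow> fs (\<lambda>k. c * a k)"
  unfolding fs_def using supp_scale by blast

lemma fs_zero: "fs (\<lambda>k. 0)"
  by (auto simp: fs_def supp_def)

lemma fs_diff: "fs a \<Longrightarrow> fs a' \<Longrightarrow> fs (\<lambda>k. a k - a' k)"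
  using fs_add[of a "\<lambda>k. (-1) * a' k"] fs_scale[of a' "-1"] by simp

lemma fs_sum: "(\<And>r. r \<in> A \<Longrightarrow> fs (v r)) \<Longrightarrow> fs (\<lambda>k. \<Sum>r\<in>A. v r k)"
  by (induction A rule: infinite_finite_induct) (auto simp: fs_zero intro: fs_add)

context bourgain_delbaen
begin

text \<open>The argument is a sequence of basis coefficients, measured by its coordinates
  \<open>R a\<close>; the value is a sequence of coordinates. So no completion is involved, and a
  functional becomes an operator by letting its value be a constant sequence.\<close>

definition bdd_op :: "real \<Rightarrow> ((nat \<Rightarrow> real) \<Rightarrow> nat \<Rightarrow> real) \<Rightarrow> bool" where
  "bdd_op L U \<longleftrightarrow> 0 \<le> L \<and> (\<forall>a a'. fs a \<longrightarrow> fs a' \<longrightarrow> U (\<lambda>k. a k + a' k) = (\<lambda>k. U a k + U a' k)) \<and>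
     (\<forall>a c. fs a \<longrightarrow> U (\<lambda>k. c * a k) = (\<lambda>k. c * U a k)) \<and>
     (\<forall>a B. fs a \<longrightarrow> (\<forall>n. \<bar>R a n\<bar> \<le> B) \<longrightarrow> (\<forall>n. \<bar>U a n\<bar> \<le> L * B))"

lemma bdd_op_sum:
  assumes "bdd_op L U" "finite A" "\<And>r. r \<in> A \<Longrightarrow> fs (v r)"
  shows "U (\<lambda>k. \<Sum>r\<in>A. v r k) = (\<lambda>k. \<Sum>r\<in>A. U (v r) k)"
  using assms(2,3)
proof (induction A rule: finite_induct)
  case empty
  have "U (\<lambda>k. 0 * 0) = (\<lambda>k. 0 * U (\<lambda>k. 0) k)" using assms(1) fs_zero unfolding bdd_op_def by blast
  then show ?case by simp
next
  case (insert r A)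
  have "U (\<lambda>k. v r k + (\<Sum>r\<in>A. v r k)) = (\<lambda>k. U (v r) k + U (\<lambda>k. \<Sum>r\<in>A. v r k) k)"
    using assms(1) insert.prems fs_sum[of A v] unfolding bdd_op_def by blast
  then show ?case using insert by simp
qed

text \<open>The blocks lie strictly inside the gaps, so the nodes contribute no coefficients and
  each gap meets one block. The multiplier drops out: every gap sees only a cell around
  \<open>x\<close> of scale beyond \<open>p\<close>, where \<open>g\<close> equals
  \<open>g x = 1\<close>.\<close>

lemma chain_eval:
  assumes root: "age (\<zeta> 0) = 0" "\<kappa> (\<zeta> 0) = x" "wt (\<zeta> 0) = w"
    and step: "\<And>r. r < N \<Longrightarrow> age (\<zeta> (Suc r)) \<noteq> 0 \<and> prd (\<zeta> (Suc r)) = \<zeta> r"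
    and v: "\<And>r. r < N \<Longrightarrow> supp (Suc (\<zeta> r)) (\<zeta> (Suc r)) (v r)"
    and g: "inv_fun p g" "g x = 1" and p: "p \<le> \<zeta> 0" and q: "\<zeta> N \<le> q" and s: "s \<le> N"
  shows "R (mlt p q g (\<lambda>k. \<Sum>r<N. v r k)) (\<zeta> s) =
     (\<Sum>r<s. \<Sum>k<\<zeta> (Suc r). bc (\<zeta> (Suc r)) k * R (J (\<zeta> (Suc r)) (v r)) k) / m w"
proof -
  let ?S = "\<lambda>k. \<Sum>r<N. v r k"
  have less: "\<zeta> r < \<zeta> (Suc r)" if "r < N" for r
    using step[OF that] prd_less by metis
  have mono: "\<zeta> r \<le> \<zeta> s" if "r \<le> s" "s \<le> N" for r s
    using that
  proof (induction s rule: dec_induct)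
    case (step k)
    then show ?case using less[of k] by simp
  qed simp
  have w\<kappa>: "wt (\<zeta> r) = w \<and> \<kappa> (\<zeta> r) = x" if "r \<le> N" for r
    using that
  proof (induction r)
    case (Suc r)
    then show ?case using wt_prd[of "\<zeta> (Suc r)"] \<kappa>_prd[of "\<zeta> (Suc r)"] step[of r] by simp
  qed (simp add: root)
  have v0: "v i k = 0" if "i < N" "r < N" "i \<noteq> r" "\<zeta> r < k" "k < \<zeta> (Suc r)" for i r k
  proof (rule ccontr)
    assume "v i k \<noteq> 0"
    then have "\<zeta> i < k" "k < \<zeta> (Suc i)" using v[OF that(1)] by (auto simp: supp_def Suc_le_eq)
    then show False using that mono[of "Suc i" r] mono[of "Suc r" i] by linarith
  qed
  have v\<zeta>: "v i (\<zeta> r) = 0" if "i < N" "r \<le> N" for i r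
  proof (rule ccontr)
    assume "v i (\<zeta> r) \<noteq> 0"
    then have "\<zeta> i < \<zeta> r" "\<zeta> r < \<zeta> (Suc i)" using v[OF that(1)] by (auto simp: supp_def Suc_le_eq)
    then show False using that mono[of "Suc i" r] mono[of r i] by linarith
  qed
  show ?thesis
    using s
  proof (induction s)
    case 0
    have "mlt p q g ?S (\<zeta> 0) = 0" using v\<zeta>[of _ 0] by (simp add: mlt_def)
    then show ?case by (simp add: R_root[OF root(1)])
  next
    case (Suc s)
    then have sN: "s < N" by simp
    let ?z = "\<zeta> (Suc s)"
    have node: "age ?z \<noteq> 0" and prd: "prd ?z = \<zeta> s" using step[OF sN] by auto
    have "J ?z (mlt p q g ?S) = J ?z (v s)"
    proof
      fix k
      show "J ?z (mlt p q g ?S) k = J ?z (v s) k"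
      proof (cases "\<zeta> s < k \<and> k < ?z \<and> E (Suc (\<zeta> s)) (\<kappa> k) x")
        case True
        have "(\<Sum>r<N. v r k) = (\<Sum>r<N. if r = s then v r k else 0)"
          using v0[OF _ sN] True by (intro sum.cong) auto
        then have "?S k = v s k" using sN by simp
        moreover have "p \<le> k" "k < q" using True p q mono[of 0 s] mono[of "Suc s" N] sN by auto
        moreover have "E p (\<kappa> k) x" using True E_mono[of p "Suc (\<zeta> s)"] p mono[of 0 s] sN by auto
        then have "g (\<kappa> k) = 1" using g by (auto simp: inv_fun_def)
        ultimately show ?thesis by (simp add: J_def mlt_def)
      next
        case False
        then show ?thesis using w\<kappa>[of "Suc s"] sN prd by (auto simp: J_def mlt_def cell_def)
      qed
    qed
    moreover have "mlt p q g ?S ?z = 0" using v\<zeta>[of _ "Suc s"] sN by (simp add: mlt_def)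
    ultimately show ?case using Suc w\<kappa>[of "Suc s"] prd
      by (simp add: R_node[OF node] add_divide_distrib)
  qed
qed

end

section \<open>Exact pairs, and the contradiction obtained by stacking them\<close>

context argyros_haydon
begin

text \<open>Hypothesis \<open>H\<close> provides, arbitrarily far out, a block and a functional that
  nearly annihilates the block but not its image. Building the functionals into a chain of even
  weight at \<open>x\<close> and averaging the blocks gives a vector \<open>z\<close> and a node
  \<open>\<eta>\<close> in the same relation; the weight of \<open>\<eta>\<close> cancels the factor
  of the average.\<close>

lemma exact_pair:
  assumes U: "bdd_op L U" and x: "x \<in> K" and C: "0 \<le> C" and w: "even w" and \<epsilon>: "0 < \<epsilon>"
    and H: "\<And>p i \<epsilon>. 0 < \<epsilon> \<Longrightarrow> \<exists>v y \<beta> q. supp p q v \<and> supp p q y \<and> GV C i v \<and>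
       (\<forall>n. \<bar>R y n - U v n\<bar> \<le> \<epsilon>) \<and> (\<Sum>k<q. \<bar>\<beta> k\<bar>) \<le> 1 \<and>
       \<bar>\<Sum>k<q. \<beta> k * R (mlt p q (cell p x) v) k\<bar> \<le> \<epsilon> \<and>
       \<delta> \<le> (\<Sum>k<q. \<beta> k * R (mlt p q (cell p x) y) k)"
  shows "\<exists>z y \<eta>. supp p \<eta> z \<and> supp p \<eta> y \<and> EXV (3 * C) w z \<and> (\<forall>n. \<bar>R y n - U z n\<bar> \<le> \<epsilon>) \<and> wt \<eta> = w \<and>
     \<kappa> \<eta> = x \<and> \<bar>R (mlt p \<eta> (cell p x) z) \<eta>\<bar> \<le> \<epsilon> \<and> \<delta> - \<epsilon> \<le> R (mlt p \<eta> (cell p x) y) \<eta>"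
proof -
  \<comment> \<open>Averaging multiplies the errors of approximation by \<open>m w\<close>, while
    each functional is off by up to \<open>2 * e\<close>; the bound 1 on \<open>e\<close> only
    serves the estimate \<open>L * C + 1\<close> for the images.\<close>
  define e where "e = min 1 (\<epsilon> / (2 * m w))"
  have mw: "1 \<le> m w" by (rule m_ge_1)
  have "\<epsilon> / (2 * m w) \<le> \<epsilon> / (2 * 1)" using \<epsilon> mw by (intro divide_left_mono) auto
  then have e: "0 < e" "e \<le> 1" "2 * e \<le> \<epsilon>" "m w * e \<le> \<epsilon>" "e \<le> \<epsilon>"
    using \<epsilon> mw by (auto simp: e_def min_def field_simps)
  have L: "0 \<le> L" using U by (simp add: bdd_op_def)
  define G where "G = 8 * (L * C + 1)"
  have G: "0 \<le> G" using L C by (simp add: G_def)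
  obtain \<zeta>0 where \<zeta>0: "p \<le> \<zeta>0" "age \<zeta>0 = 0" "wt \<zeta>0 = w" "\<kappa> \<zeta>0 = x" using ex_root[OF x] by blast
  define P where "P r s \<longleftrightarrow> (case s of (\<zeta>, v, y) \<Rightarrow> age \<zeta> = r \<and> wt \<zeta> = w \<and> \<kappa> \<zeta> = x \<and> p \<le> \<zeta>)"
    for r :: nat and s :: "nat \<times> (nat \<Rightarrow> real) \<times> (nat \<Rightarrow> real)"
  define Q where "Q r s s' \<longleftrightarrow> (case s of (\<zeta>, _, _) \<Rightarrow> case s' of (\<zeta>', v, y) \<Rightarrow>
      prd \<zeta>' = \<zeta> \<and> supp (Suc \<zeta>) \<zeta>' v \<and> supp (Suc \<zeta>) \<zeta>' y \<and> GV C \<zeta> v \<and> (\<forall>n. \<bar>R y n - U v n\<bar> \<le> e) \<and>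
      \<bar>\<Sum>k<\<zeta>'. bc \<zeta>' k * R (J \<zeta>' v) k\<bar> \<le> 2 * e \<and> \<delta> - e \<le> (\<Sum>k<\<zeta>'. bc \<zeta>' k * R (J \<zeta>' y) k))"
    for r :: nat and s s' :: "nat \<times> (nat \<Rightarrow> real) \<times> (nat \<Rightarrow> real)"
  have "\<exists>f. (\<forall>r\<le>nn w. P r (f r)) \<and> (\<forall>r<nn w. Q r (f r) (f (Suc r)))"
  proof (rule finite_dependent_choice)
    show "P 0 (\<zeta>0, \<lambda>_. 0, \<lambda>_. 0)" using \<zeta>0 by (simp add: P_def)
    fix r s assume r: "r < nn w" and s: "P r s"
    obtain \<zeta> v0 y0 where s_eq: "s = (\<zeta>, v0, y0)" by (cases s)
    have \<zeta>: "age \<zeta> = r" "wt \<zeta> = w" "\<kappa> \<zeta> = x" "p \<le> \<zeta>" using s by (auto simp: P_def s_eq)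
    \<comment> \<open>The block that follows \<open>\<zeta>\<close> is requested with
      \<open>\<zeta>\<close> as its weight parameter; this is the growth condition of a rapidly
      increasing sequence.\<close>
    obtain v y \<beta> q where H': "supp (Suc \<zeta>) q v" "supp (Suc \<zeta>) q y" "GV C \<zeta> v" "\<forall>n. \<bar>R y n - U v n\<bar> \<le> e"
      "(\<Sum>k<q. \<bar>\<beta> k\<bar>) \<le> 1" "\<bar>\<Sum>k<q. \<beta> k * R (mlt (Suc \<zeta>) q (cell (Suc \<zeta>) x) v) k\<bar> \<le> e"
      "\<delta> \<le> (\<Sum>k<q. \<beta> k * R (mlt (Suc \<zeta>) q (cell (Suc \<zeta>) x) y) k)"
      using H[OF e(1)] by blast
    \<comment> \<open>Replacing \<open>\<beta>\<close> by admissible coefficients changes the values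
      on block and image by at most \<open>\<tau> * C\<close> and \<open>\<tau> * G\<close>, both at
      most \<open>e\<close>.\<close>
    define \<tau> where "\<tau> = e / (C + G + 1)"
    have \<tau>: "0 < \<tau>" "\<tau> * C \<le> e" "\<tau> * G \<le> e" using e C G by (auto simp: \<tau>_def field_simps)
    obtain \<zeta>' where \<zeta>': "q \<le> \<zeta>'" "age \<zeta>' \<noteq> 0" "prd \<zeta>' = \<zeta>"
       "(\<Sum>k<\<zeta>'. \<bar>bc \<zeta>' k - (if k < q then \<beta> k else 0)\<bar>) \<le> \<tau>"
      using ex_even[where \<xi> = \<zeta> and q = q and \<beta> = \<beta> and \<tau> = \<tau>] \<zeta> w r H'(5) \<tau> by auto
    have \<kappa>': "\<kappa> \<zeta>' = x" "wt \<zeta>' = w" "age \<zeta>' = Suc r"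
      using \<zeta>' \<zeta> \<kappa>_prd[OF \<zeta>'(2)] wt_prd[OF \<zeta>'(2)] age_prd[OF \<zeta>'(2)] by auto
    have \<zeta>\<zeta>': "\<zeta> < \<zeta>'" using prd_less[OF \<zeta>'(2)] \<zeta>' by simp
    have Jeq: "J \<zeta>' a = mlt (Suc \<zeta>) q (cell (Suc \<zeta>) x) a" if "supp (Suc \<zeta>) q a" for a
      using that \<zeta>' \<kappa>' by (auto simp: J_def mlt_def supp_def fun_eq_iff)
    have close: "\<bar>(\<Sum>k<\<zeta>'. bc \<zeta>' k * R (J \<zeta>' a) k) - (\<Sum>k<q. \<beta> k * R (mlt (Suc \<zeta>) q (cell (Suc \<zeta>) x) a) k)\<bar> \<le> \<tau> * D"
      if a: "supp (Suc \<zeta>) q a" and D: "\<And>k. \<bar>R (J \<zeta>' a) k\<bar> \<le> D" for a D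
    proof -
      have "(\<Sum>k<q. \<beta> k * R (mlt (Suc \<zeta>) q (cell (Suc \<zeta>) x) a) k) = (\<Sum>k<\<zeta>'. (if k < q then \<beta> k else 0) * R (J \<zeta>' a) k)"
        using \<zeta>' by (intro sum.mono_neutral_cong_left) (auto simp: Jeq[OF a])
      then have eq: "(\<Sum>k<\<zeta>'. bc \<zeta>' k * R (J \<zeta>' a) k) - (\<Sum>k<q. \<beta> k * R (mlt (Suc \<zeta>) q (cell (Suc \<zeta>) x) a) k)
         = (\<Sum>k<\<zeta>'. (bc \<zeta>' k - (if k < q then \<beta> k else 0)) * R (J \<zeta>' a) k)"
        by (simp add: sum_subtractf[symmetric] left_diff_distrib)
      have "\<bar>\<Sum>k<\<zeta>'. (bc \<zeta>' k - (if k < q then \<beta> k else 0)) * R (J \<zeta>' a) k\<bar> \<le> (\<Sum>k<\<zeta>'. \<bar>bc \<zeta>' k - (if k < q then \<beta> k else 0)\<bar> * D)"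
        by (rule order_trans[OF sum_abs]) (auto intro!: sum_mono mult_left_mono D simp: abs_mult)
      also have "\<dots> = (\<Sum>k<\<zeta>'. \<bar>bc \<zeta>' k - (if k < q then \<beta> k else 0)\<bar>) * D" by (simp add: sum_distrib_right)
      also have "\<dots> \<le> \<tau> * D" using \<zeta>'(4) D[of 0] by (intro mult_right_mono) auto
      finally show ?thesis unfolding eq .
    qed
    have vb: "\<bar>R (J \<zeta>' v) k\<bar> \<le> C" for k
      unfolding Jeq[OF H'(1)] using GV_bound[OF H'(3) inv_fun_cell] by blast
    have "\<bar>R y n\<bar> \<le> L * C + 1" for n
    proof -
      have "\<forall>n. \<bar>R v n\<bar> \<le> C" using GV_norm[OF H'(3)] by blast
      then have "\<bar>U v n\<bar> \<le> L * C" using U supp_fs[OF H'(1)] unfolding bdd_op_def by blast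
      then show ?thesis using H'(4) e(2) by (smt (verit))
    qed
    then have yb: "\<bar>R (J \<zeta>' y) k\<bar> \<le> G" for k
      unfolding Jeq[OF H'(2)] G_def using L C by (intro mlt_bound inv_fun_cell) auto
    have "\<bar>\<Sum>k<\<zeta>'. bc \<zeta>' k * R (J \<zeta>' v) k\<bar> \<le> 2 * e" "\<delta> - e \<le> (\<Sum>k<\<zeta>'. bc \<zeta>' k * R (J \<zeta>' y) k)"
      using close[OF H'(1) vb] close[OF H'(2) yb] H'(6,7) \<tau> by linarith+
    then have "P (Suc r) (\<zeta>', v, y) \<and> Q r s (\<zeta>', v, y)"
      using \<kappa>' \<zeta> \<zeta>' H' \<zeta>\<zeta>' by (auto simp: P_def Q_def s_eq intro: supp_mono)
    then show "\<exists>s'. P (Suc r) s' \<and> Q r s s'" by blast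
  qed
  then obtain f where f: "\<forall>r\<le>nn w. P r (f r)" "\<forall>r<nn w. Q r (f r) (f (Suc r))" by blast
  define \<zeta> v y where "\<zeta> r = fst (f r)" and "v r = fst (snd (f (Suc r)))" and "y r = snd (snd (f (Suc r)))" for r
  let ?N = "nn w"
  have P: "age (\<zeta> r) = r" "wt (\<zeta> r) = w" "\<kappa> (\<zeta> r) = x" "p \<le> \<zeta> r" if "r \<le> ?N" for r
    using f(1)[rule_format, OF that] by (simp_all add: P_def \<zeta>_def case_prod_beta)
  have Q: "prd (\<zeta> (Suc r)) = \<zeta> r" "supp (Suc (\<zeta> r)) (\<zeta> (Suc r)) (v r)" "supp (Suc (\<zeta> r)) (\<zeta> (Suc r)) (y r)"
      "GV C (\<zeta> r) (v r)" "\<forall>n. \<bar>R (y r) n - U (v r) n\<bar> \<le> e"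
      "\<bar>\<Sum>k<\<zeta> (Suc r). bc (\<zeta> (Suc r)) k * R (J (\<zeta> (Suc r)) (v r)) k\<bar> \<le> 2 * e"
      "\<delta> - e \<le> (\<Sum>k<\<zeta> (Suc r). bc (\<zeta> (Suc r)) k * R (J (\<zeta> (Suc r)) (y r)) k)" if "r < ?N" for r
    using f(2)[rule_format, OF that] by (simp_all add: Q_def \<zeta>_def v_def y_def case_prod_beta)
  have age: "age (\<zeta> (Suc r)) \<noteq> 0" if "r < ?N" for r using P(1)[of "Suc r"] that by simp
  have less: "\<zeta> r < \<zeta> (Suc r)" if "r < ?N" for r
    using prd_less[OF age[OF that]] Q(1)[OF that] by simp
  have mono: "\<zeta> r \<le> \<zeta> s" if "r \<le> s" "s \<le> ?N" for r s
    using that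
  proof (induction s rule: dec_induct)
    case (step k)
    then show ?case using less[of k] by simp
  qed simp
  have N: "0 < real ?N" using nn_pos by simp
  define z where "z = (\<lambda>k. m w / ?N * (\<Sum>r<?N. v r k))"
  define Y where "Y = (\<lambda>k. m w / ?N * (\<Sum>r<?N. y r k))"
  have RIS: "RIS C {..<?N} (\<lambda>r. Suc (\<zeta> r)) (\<lambda>r. \<zeta> (Suc r)) \<zeta> v"
    unfolding RIS_def blocks_def
  proof (intro conjI ballI impI allI)
    fix k k' assume k: "k \<in> {..<?N}" "k' \<in> {..<?N}" "k < k'"
    show "\<zeta> (Suc k) \<le> \<zeta> k'" using mono[of "Suc k" k'] k by simp
    then show "\<zeta> (Suc k) \<le> Suc (\<zeta> k')" by simp
  qed (use Q in \<open>auto simp: supp_def\<close>)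
  have eval: "R (mlt p (\<zeta> ?N) (cell p x) (\<lambda>k. \<Sum>r<?N. u r k)) (\<zeta> ?N) =
     (\<Sum>r<?N. \<Sum>k<\<zeta> (Suc r). bc (\<zeta> (Suc r)) k * R (J (\<zeta> (Suc r)) (u r)) k) / m w"
    if "\<And>r. r < ?N \<Longrightarrow> supp (Suc (\<zeta> r)) (\<zeta> (Suc r)) (u r)" for u
  proof (rule chain_eval)
    show "cell p x x = 1" by (simp add: cell_def E_refl)
  qed (use P[of 0] Q age that in auto)
  have supps: "supp p (\<zeta> ?N) (\<lambda>k. m w / ?N * (\<Sum>r<?N. u r k))"
    if "\<And>r. r < ?N \<Longrightarrow> supp (Suc (\<zeta> r)) (\<zeta> (Suc r)) (u r)" for u
  proof (intro supp_scale supp_sum)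
    fix r assume "r \<in> {..<?N}"
    then show "supp p (\<zeta> ?N) (u r)"
      using that[of r] P(4)[of r] mono[of "Suc r" ?N] by (auto intro: supp_mono)
  qed
  have evz: "R (mlt p (\<zeta> ?N) (cell p x) (\<lambda>k. m w / ?N * (\<Sum>r<?N. u r k))) (\<zeta> ?N) =
      (\<Sum>r<?N. \<Sum>k<\<zeta> (Suc r). bc (\<zeta> (Suc r)) k * R (J (\<zeta> (Suc r)) (u r)) k) / ?N"
    if "\<And>r. r < ?N \<Longrightarrow> supp (Suc (\<zeta> r)) (\<zeta> (Suc r)) (u r)" for u
  proof -
    have "R (mlt p (\<zeta> ?N) (cell p x) (\<lambda>k. \<Sum>r<?N. u r k)) (\<zeta> ?N) =
     (\<Sum>r<?N. \<Sum>k<\<zeta> (Suc r). bc (\<zeta> (Suc r)) k * R (J (\<zeta> (Suc r)) (u r)) k) / m w"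
      using that by (rule eval)
    then show ?thesis unfolding mlt_scale R_scale using mw by simp
  qed
  have evz_z: "R (mlt p (\<zeta> ?N) (cell p x) z) (\<zeta> ?N) =
      (\<Sum>r<?N. \<Sum>k<\<zeta> (Suc r). bc (\<zeta> (Suc r)) k * R (J (\<zeta> (Suc r)) (v r)) k) / ?N"
    unfolding z_def using Q(2) by (rule evz)
  have evz_Y: "R (mlt p (\<zeta> ?N) (cell p x) Y) (\<zeta> ?N) =
      (\<Sum>r<?N. \<Sum>k<\<zeta> (Suc r). bc (\<zeta> (Suc r)) k * R (J (\<zeta> (Suc r)) (y r)) k) / ?N"
    unfolding Y_def using Q(3) by (rule evz)
  have "EXV (3 * C) w z" unfolding z_def by (rule average_EXV[OF RIS C])
  moreover have "\<bar>R Y n - U z n\<bar> \<le> \<epsilon>" for n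
  proof -
    have fsv: "fs (v r)" if "r < ?N" for r using Q(2)[OF that] supp_fs by blast
    have "U z = (\<lambda>k. m w / ?N * U (\<lambda>k. \<Sum>r<?N. v r k) k)"
      unfolding z_def using U fs_sum[of "{..<?N}" v] fsv unfolding bdd_op_def by blast
    also have "U (\<lambda>k. \<Sum>r<?N. v r k) = (\<lambda>k. \<Sum>r<?N. U (v r) k)"
      by (rule bdd_op_sum[OF U]) (use fsv in auto)
    finally have "R Y n - U z n = m w / ?N * (\<Sum>r<?N. R (y r) n - U (v r) n)"
      unfolding Y_def R_scale by (simp add: R_sum sum_subtractf right_diff_distrib)
    moreover have "\<bar>\<Sum>r<?N. R (y r) n - U (v r) n\<bar> \<le> ?N * e"
      using sum_bounded_above[of "{..<?N}" "\<lambda>r. \<bar>R (y r) n - U (v r) n\<bar>" e] Q(5)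
      by (intro order_trans[OF sum_abs]) auto
    ultimately have "\<bar>R Y n - U z n\<bar> \<le> m w / ?N * (?N * e)"
      using mult_left_mono[of "\<bar>\<Sum>r<?N. R (y r) n - U (v r) n\<bar>" "?N * e" "m w / ?N"] mw by (simp add: abs_mult)
    then show ?thesis using e N by simp
  qed
  moreover have "\<bar>R (mlt p (\<zeta> ?N) (cell p x) z) (\<zeta> ?N)\<bar> \<le> \<epsilon>"
  proof -
    have "\<bar>\<Sum>r<?N. \<Sum>k<\<zeta> (Suc r). bc (\<zeta> (Suc r)) k * R (J (\<zeta> (Suc r)) (v r)) k\<bar> \<le> ?N * (2 * e)"
      using sum_bounded_above[of "{..<?N}" "\<lambda>r. \<bar>\<Sum>k<\<zeta> (Suc r). bc (\<zeta> (Suc r)) k * R (J (\<zeta> (Suc r)) (v r)) k\<bar>" "2 * e"] Q(6)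
      by (intro order_trans[OF sum_abs]) auto
    then have "\<bar>R (mlt p (\<zeta> ?N) (cell p x) z) (\<zeta> ?N)\<bar> \<le> 2 * e"
      unfolding evz_z using N by (simp add: abs_divide divide_le_eq mult.commute)
    then show ?thesis using e by linarith
  qed
  moreover have "\<delta> - \<epsilon> \<le> R (mlt p (\<zeta> ?N) (cell p x) Y) (\<zeta> ?N)"
  proof -
    have "?N * (\<delta> - e) \<le> (\<Sum>r<?N. \<Sum>k<\<zeta> (Suc r). bc (\<zeta> (Suc r)) k * R (J (\<zeta> (Suc r)) (y r)) k)"
      using sum_bounded_below[of "{..<?N}" "\<delta> - e" "\<lambda>r. \<Sum>k<\<zeta> (Suc r). bc (\<zeta> (Suc r)) k * R (J (\<zeta> (Suc r)) (y r)) k"] Q(7)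
      by auto
    then have "\<delta> - e \<le> R (mlt p (\<zeta> ?N) (cell p x) Y) (\<zeta> ?N)"
      unfolding evz_Y using N by (simp add: le_divide_eq mult.commute)
    then show ?thesis using e by linarith
  qed
  moreover have "supp p (\<zeta> ?N) z" "supp p (\<zeta> ?N) Y"
    unfolding z_def Y_def by (rule supps, rule Q(2), simp, rule supps, rule Q(3), simp)
  ultimately show ?thesis using P[of ?N] by blast
qed

text \<open>Exact pairs are stacked along a chain of odd weight \<open>j\<close>. The sum of the
  vectors has norm of order \<open>nn j\<close> over the square of \<open>m j\<close>, whereas the
  end of the chain takes a value of order \<open>nn j * \<delta> / m j\<close> on its image. For
  \<open>m j\<close> large this contradicts boundedness.\<close>

lemma no_separation:
  assumes U: "bdd_op L U" and x: "x \<in> K" and C: "0 \<le> C" and \<delta>: "0 < \<delta>"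
    and H: "\<And>p i \<epsilon>. 0 < \<epsilon> \<Longrightarrow> \<exists>v y \<beta> q. supp p q v \<and> supp p q y \<and> GV C i v \<and>
       (\<forall>n. \<bar>R y n - U v n\<bar> \<le> \<epsilon>) \<and> (\<Sum>k<q. \<bar>\<beta> k\<bar>) \<le> 1 \<and>
       \<bar>\<Sum>k<q. \<beta> k * R (mlt p q (cell p x) v) k\<bar> \<le> \<epsilon> \<and>
       \<delta> \<le> (\<Sum>k<q. \<beta> k * R (mlt p q (cell p x) y) k)"
  shows False
proof -
  have L: "0 \<le> L" using U by (simp add: bdd_op_def)
  \<comment> \<open>The summand 1 keeps \<open>C'\<close> positive, as is necessary for a positive
    \<open>\<epsilon>\<close> below \<open>C' / nn j\<close>.\<close>
  define C' where "C' = 3 * (C + 1)"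
  have C': "0 < C'" "3 * C \<le> C'" using C by (auto simp: C'_def)
  obtain j where j: "odd j" "8 * L * C' / \<delta> < m j"
  proof -
    obtain i :: nat where i: "8 * L * C' / \<delta> < i" using reals_Archimedean2 by blast
    have "real i \<le> m (2 * i + 1)" using m_unbounded[of "2 * i + 1"] by simp
    then show thesis using that[of "2 * i + 1"] i by simp
  qed
  let ?N = "nn j"
  have N: "1 \<le> real ?N" using nn_pos[of j] by simp
  have mj: "1 \<le> m j" by (rule m_ge_1)
  \<comment> \<open>The three bounds serve, in this order, the near annihilation required by
    \<open>dependent_estimate\<close>, a separation of at least \<open>\<delta> / 2\<close>, and the
    total error \<open>nn j * \<epsilon>\<close>, which must stay below a fraction of
    \<open>nn j * \<delta> / m j\<close>.\<close>
  define \<epsilon> where "\<epsilon> = min (C' / ?N) (min (\<delta> / 2) (\<delta> / (8 * m j)))"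
  have \<epsilon>: "0 < \<epsilon>" "\<epsilon> \<le> C' / ?N" "\<epsilon> \<le> \<delta> / 2" "\<epsilon> \<le> \<delta> / (8 * m j)" unfolding \<epsilon>_def using C' \<delta> N mj by (simp_all only: min_less_iff_conj min.cobounded1 min.coboundedI2 min.coboundedI1 order_refl) auto
  obtain \<xi>0 where \<xi>0: "age \<xi>0 = 0" "wt \<xi>0 = j" "\<kappa> \<xi>0 = x" using ex_root[OF x] by blast
  define P where "P r s \<longleftrightarrow> (case s of (\<xi>, z, y, \<eta>) \<Rightarrow> age \<xi> = r \<and> wt \<xi> = j \<and> \<kappa> \<xi> = x)"
    for r :: nat and s :: "nat \<times> (nat \<Rightarrow> real) \<times> (nat \<Rightarrow> real) \<times> nat"
  define Q where "Q r s s' \<longleftrightarrow> (case s of (\<xi>, _, _, _) \<Rightarrow> case s' of (\<xi>', z, y, \<eta>) \<Rightarrow>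
      prd \<xi>' = \<xi> \<and> bc \<xi>' = (\<lambda>k. if k = \<eta> then 1 else 0) \<and> \<eta> < \<xi>' \<and>
      supp (Suc \<xi>) \<xi>' z \<and> supp (Suc \<xi>) \<xi>' y \<and> EXV C' (2 * \<xi> + 2) z \<and> (\<forall>n. \<bar>R y n - U z n\<bar> \<le> \<epsilon>) \<and>
      \<bar>R (J \<xi>' z) \<eta>\<bar> \<le> C' / ?N \<and> \<delta> / 2 \<le> R (J \<xi>' y) \<eta>)"
    for r :: nat and s s' :: "nat \<times> (nat \<Rightarrow> real) \<times> (nat \<Rightarrow> real) \<times> nat"
  have "\<exists>f. (\<forall>r\<le>?N. P r (f r)) \<and> (\<forall>r<?N. Q r (f r) (f (Suc r)))"
  proof (rule finite_dependent_choice)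
    show "P 0 (\<xi>0, \<lambda>_. 0, \<lambda>_. 0, 0)" using \<xi>0 by (simp add: P_def)
    fix r s assume r: "r < ?N" and s: "P r s"
    obtain \<xi> z0 y0 \<eta>0 where s_eq: "s = (\<xi>, z0, y0, \<eta>0)" by (cases s)
    have \<xi>: "age \<xi> = r" "wt \<xi> = j" "\<kappa> \<xi> = x" using s by (auto simp: P_def s_eq)
    \<comment> \<open>The weight \<open>2 * \<xi> + 2\<close> is even, so the pair exists, and it is
      the one that an odd chain accepts after \<open>\<xi>\<close>.\<close>
    obtain z y \<eta> where H': "supp (Suc \<xi>) \<eta> z" "supp (Suc \<xi>) \<eta> y" "EXV (3 * C) (2 * \<xi> + 2) z"
       "\<forall>n. \<bar>R y n - U z n\<bar> \<le> \<epsilon>" "wt \<eta> = 2 * \<xi> + 2" "\<kappa> \<eta> = x"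
       "\<bar>R (mlt (Suc \<xi>) \<eta> (cell (Suc \<xi>) x) z) \<eta>\<bar> \<le> \<epsilon>" "\<delta> - \<epsilon> \<le> R (mlt (Suc \<xi>) \<eta> (cell (Suc \<xi>) x) y) \<eta>"
      using exact_pair[OF U x C _ \<epsilon>(1) H, of "2 * \<xi> + 2" "Suc \<xi>"] by auto
    obtain \<xi>' where \<xi>': "Suc \<eta> \<le> \<xi>'" "age \<xi>' \<noteq> 0" "prd \<xi>' = \<xi>" "bc \<xi>' = (\<lambda>k. if k = \<eta> then 1 else 0)"
      using ex_odd[where \<xi> = \<xi> and \<eta> = \<eta> and q = "Suc \<eta>"] \<xi> j r H'(5) by auto
    have \<kappa>': "\<kappa> \<xi>' = x" "wt \<xi>' = j" "age \<xi>' = Suc r"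
      using \<xi>' \<xi> \<kappa>_prd[OF \<xi>'(2)] wt_prd[OF \<xi>'(2)] age_prd[OF \<xi>'(2)] by auto
    have Jeq: "J \<xi>' a = mlt (Suc \<xi>) \<eta> (cell (Suc \<xi>) x) a" if "supp (Suc \<xi>) \<eta> a" for a
      using that \<xi>' \<kappa>' by (auto simp: J_def mlt_def supp_def fun_eq_iff)
    have "EXV C' (2 * \<xi> + 2) z"
    proof -
      have d: "3 * C / m i \<le> C' / m i" for i using C'(2) m_pos[of i] by (simp add: divide_right_mono)
      show ?thesis using H'(3) C'(2) order_trans[OF _ d] unfolding EXV_def GV_def by (meson order_trans)
    qed
    moreover have "supp (Suc \<xi>) \<xi>' z" "supp (Suc \<xi>) \<xi>' y" using H'(1,2) \<xi>'(1) by (auto intro: supp_mono)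
    ultimately have "P (Suc r) (\<xi>', z, y, \<eta>) \<and> Q r s (\<xi>', z, y, \<eta>)"
      using \<kappa>' \<xi>' H' \<epsilon> Jeq[OF H'(1)] Jeq[OF H'(2)] by (auto simp: P_def Q_def s_eq)
    then show "\<exists>s'. P (Suc r) s' \<and> Q r s s'" by blast
  qed
  then obtain f where f: "\<forall>r\<le>?N. P r (f r)" "\<forall>r<?N. Q r (f r) (f (Suc r))" by blast
  define \<xi> z y \<eta> where "\<xi> r = fst (f r)" and "z r = fst (snd (f (Suc r)))"
    and "y r = fst (snd (snd (f (Suc r))))" and "\<eta> r = snd (snd (snd (f (Suc r))))" for r
  have P: "age (\<xi> r) = r" "wt (\<xi> r) = j" "\<kappa> (\<xi> r) = x" if "r \<le> ?N" for r
    using f(1)[rule_format, OF that] by (simp_all add: P_def \<xi>_def case_prod_beta)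
  have Q: "prd (\<xi> (Suc r)) = \<xi> r" "bc (\<xi> (Suc r)) = (\<lambda>k. if k = \<eta> r then 1 else 0)" "\<eta> r < \<xi> (Suc r)"
      "supp (Suc (\<xi> r)) (\<xi> (Suc r)) (z r)" "supp (Suc (\<xi> r)) (\<xi> (Suc r)) (y r)"
      "EXV C' (2 * \<xi> r + 2) (z r)" "\<forall>n. \<bar>R (y r) n - U (z r) n\<bar> \<le> \<epsilon>"
      "\<bar>R (J (\<xi> (Suc r)) (z r)) (\<eta> r)\<bar> \<le> C' / ?N" "\<delta> / 2 \<le> R (J (\<xi> (Suc r)) (y r)) (\<eta> r)" if "r < ?N" for r
    using f(2)[rule_format, OF that] by (simp_all add: Q_def \<xi>_def z_def y_def \<eta>_def case_prod_beta)
  have age: "age (\<xi> (Suc r)) \<noteq> 0" if "r < ?N" for r using P(1)[of "Suc r"] that by simp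
  define S where "S = (\<lambda>k. \<Sum>r<?N. z r k)"
  define Y where "Y = (\<lambda>k. \<Sum>r<?N. y r k)"
  have "\<bar>R S n\<bar> \<le> 3 * C' * ?N / (m j)\<^sup>2" for n
    unfolding S_def
  proof (rule dependent_estimate[OF j(1) refl, where \<xi> = \<xi> and \<eta> = \<eta>])
    show "0 \<le> C'" using C' by simp
    show "wt (\<xi> 0) = j" using P by simp
  next
    fix i assume i: "i < ?N"
    show "age (\<xi> (Suc i)) \<noteq> 0 \<and> prd (\<xi> (Suc i)) = \<xi> i \<and> bc (\<xi> (Suc i)) = (\<lambda>k. if k = \<eta> i then 1 else 0) \<and> \<eta> i < \<xi> (Suc i)"
      using age[OF i] Q[OF i] by simp
    show "EXV C' (2 * \<xi> i + 2) (z i) \<and> (\<forall>k. z i k \<noteq> 0 \<longrightarrow> \<xi> i < k \<and> k < \<xi> (Suc i)) \<and> \<bar>R (J (\<xi> (Suc i)) (z i)) (\<eta> i)\<bar> \<le> C' / ?N"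
      using Q[OF i] by (auto simp: supp_def Suc_le_eq)
  qed
  moreover have fsz: "fs (z r)" if "r < ?N" for r using Q(4)[OF that] supp_fs by blast
  moreover have "fs S" unfolding S_def by (rule fs_sum) (use fsz in auto)
  ultimately have US: "\<bar>U S n\<bar> \<le> L * (3 * C' * ?N / (m j)\<^sup>2)" for n
    using U unfolding bdd_op_def by blast
  have "U S = (\<lambda>k. \<Sum>r<?N. U (z r) k)" unfolding S_def by (rule bdd_op_sum[OF U]) (use fsz in auto)
  then have "R Y n - U S n = (\<Sum>r<?N. R (y r) n - U (z r) n)" for n
    by (simp add: Y_def R_sum sum_subtractf)
  moreover have "\<bar>\<Sum>r<?N. R (y r) n - U (z r) n\<bar> \<le> ?N * \<epsilon>" for n
    using sum_bounded_above[of "{..<?N}" "\<lambda>r. \<bar>R (y r) n - U (z r) n\<bar>" \<epsilon>] Q(7)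
    by (intro order_trans[OF sum_abs]) auto
  ultimately have close: "\<bar>R Y n - U S n\<bar> \<le> ?N * \<epsilon>" for n by simp
  have "R (mlt 0 (Suc (\<xi> ?N)) (\<lambda>_. 1) Y) (\<xi> ?N) =
     (\<Sum>r<?N. \<Sum>k<\<xi> (Suc r). bc (\<xi> (Suc r)) k * R (J (\<xi> (Suc r)) (y r)) k) / m j"
    unfolding Y_def by (rule chain_eval) (use P[of 0] Q age in auto)
  also have "\<dots> = (\<Sum>r<?N. R (J (\<xi> (Suc r)) (y r)) (\<eta> r)) / m j"
    using Q(2,3) by (intro arg_cong[of _ _ "\<lambda>x. x / m j"] sum.cong refl)
      (simp add: if_distrib[of "\<lambda>x. x * _"] cong: if_cong)
  finally have RY: "R Y (\<xi> ?N) = (\<Sum>r<?N. R (J (\<xi> (Suc r)) (y r)) (\<eta> r)) / m j" by (simp add: R_mlt_full)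
  have "?N * (\<delta> / 2) \<le> (\<Sum>r<?N. R (J (\<xi> (Suc r)) (y r)) (\<eta> r))"
    using sum_bounded_below[of "{..<?N}" "\<delta> / 2" "\<lambda>r. R (J (\<xi> (Suc r)) (y r)) (\<eta> r)"] Q(9) by auto
  then have "?N * (\<delta> / 2) / m j \<le> R Y (\<xi> ?N)" unfolding RY using m_pos[of j] by (intro divide_right_mono) auto
  moreover have "?N * \<epsilon> \<le> ?N * (\<delta> / (8 * m j))" using \<epsilon> N by (intro mult_left_mono) auto
  ultimately have "?N * (\<delta> / 2) / m j \<le> L * (3 * C' * ?N / (m j)\<^sup>2) + ?N * (\<delta> / (8 * m j))"
    using US[of "\<xi> ?N"] close[of "\<xi> ?N"] by linarith
  then have "?N / m j * (3 * \<delta> / 8) \<le> ?N / m j * (3 * L * C' / m j)"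
    using mj by (simp add: field_simps power2_eq_square)
  moreover have "0 < ?N / m j" using N mj by simp
  ultimately have "3 * \<delta> / 8 \<le> 3 * L * C' / m j" by (rule mult_left_le_imp_le)
  then have "m j \<le> 8 * L * C' / \<delta>" using \<delta> mj L C' by (simp add: field_simps)
  then show False using j by simp
qed

end

section \<open>Extension from finitely many coordinates, and smallness at prescribed weights\<close>

context bourgain_delbaen
begin

lemma GV_scale: "GV C i v \<Longrightarrow> \<bar>c\<bar> \<le> 1 \<Longrightarrow> GV C i (\<lambda>k. c * v k)"
  unfolding GV_def mlt_scale R_scale abs_mult
  by (meson abs_ge_zero mult_left_le_one_le order_trans)

lemma GV_mono: "GV C i v \<Longrightarrow> C \<le> C' \<Longrightarrow> i' \<le> i \<Longrightarrow> GV C' i' v"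
  unfolding GV_def by (meson divide_right_mono less_imp_le m_pos order_less_le_trans order_trans)

lemma GV_add: "GV C i v \<Longrightarrow> GV C' i v' \<Longrightarrow> GV (C + C') i (\<lambda>k. v k + v' k)"
  unfolding GV_def mlt_add R_add add_divide_distrib
  by (meson abs_triangle_ineq add_mono order_trans)

text \<open>The Bourgain-Delbaen extension operator: the vector supported below \<open>q\<close>
  whose first \<open>q\<close> coordinates are those of \<open>u\<close>. Its norm is at most 2 by
  \<open>ext_bound\<close>, and \<open>ext_R\<close> shows that it inverts the restriction to the
  first \<open>q\<close> coordinates.\<close>

definition ext :: "nat \<Rightarrow> (nat \<Rightarrow> real) \<Rightarrow> nat \<Rightarrow> real" where
  "ext q u = restr 0 q (D u)"

lemma R_restr_low: "n < q \<Longrightarrow> R (restr 0 q a) n = R a n"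
  by (rule R_cong) (simp add: restr_def)

lemma R_ext [simp]: "k < q \<Longrightarrow> R (ext q u) k = u k"
  by (simp add: ext_def R_restr_low)

lemma ext_bound: "(\<And>k. k < q \<Longrightarrow> \<bar>u k\<bar> \<le> B) \<Longrightarrow> 0 \<le> B \<Longrightarrow> \<bar>R (ext q u) n\<bar> \<le> 2 * B"
  unfolding ext_def by (rule restr_bound) auto

lemma D_vanish: "(\<And>k. k \<le> n \<Longrightarrow> u k = 0) \<Longrightarrow> D u n = 0"
proof (induction n rule: less_induct)
  case (less n)
  have "R (restr 0 n (D u)) n = 0"
    by (rule R_vanish) (use less in \<open>auto simp: restr_def\<close>)
  then show ?case using less.prems D_eq[of u n] by simp
qed

lemma ext_supp: "(\<And>k. k < p \<Longrightarrow> u k = 0) \<Longrightarrow> supp p q (ext q u)"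
  unfolding supp_def ext_def restr_def using D_vanish[of _ u] by (auto, meson le_less_trans linorder_not_less)

lemma restr_supp: "supp 0 q a \<Longrightarrow> restr 0 q a = a"
  by (fastforce simp: restr_def supp_def)

lemma ext_R: "supp 0 q a \<Longrightarrow> ext q (R a) = a"
  by (simp add: ext_def restr_supp)

lemma ext_add: "ext q (\<lambda>k. u k + u' k) = (\<lambda>k. ext q u k + ext q u' k)"
  by (auto simp: ext_def D_add restr_def)

lemma ext_scale: "ext q (\<lambda>k. c * u k) = (\<lambda>k. c * ext q u k)"
  by (auto simp: ext_def D_scale restr_def)

lemma ext_supp0: "supp 0 q (ext q u)"
  by (rule ext_supp) simp

lemma ext_cong: "(\<And>k. k < q \<Longrightarrow> u k = u' k) \<Longrightarrow> ext q u = ext q u'"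
proof -
  assume eq: "\<And>k. k < q \<Longrightarrow> u k = u' k"
  have "D u k = D u' k" if "k < q" for k
    using D_vanish[of k "\<lambda>i. u i - u' i"] eq that by (simp add: D_diff)
  then show ?thesis by (auto simp: ext_def restr_def)
qed

lemma ext_sum: "finite A \<Longrightarrow> ext q (\<lambda>k. \<Sum>r\<in>A. u r k) = (\<lambda>k. \<Sum>r\<in>A. ext q (u r) k)"
proof (induction A rule: finite_induct)
  case empty
  have "ext q (\<lambda>k. 0 * 0) = (\<lambda>k. 0 * ext q (\<lambda>_. 0) k)" by (rule ext_scale)
  then show ?case by simp
qed (simp add: ext_add)

text \<open>Vectors supported below \<open>q\<close> correspond to arbitrary values of the first
  \<open>q\<close> coordinates. A functional is therefore a combination of these coordinates, and
  testing it on the extension of the signs of the coefficients gives the sum of their absolute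
  values.\<close>

lemma functional_repr:
  assumes add: "\<And>a a'. g (\<lambda>k. a k + a' k) = g a + (g a' :: real)"
    and scale: "\<And>c a. g (\<lambda>k. c * a k) = c * g a"
    and bound: "\<And>a. supp 0 q a \<Longrightarrow> (\<And>k. k < q \<Longrightarrow> \<bar>R a k\<bar> \<le> 1) \<Longrightarrow> g a \<le> G"
  shows "\<exists>\<beta>. (\<Sum>k<q. \<bar>\<beta> k\<bar>) \<le> G \<and> (\<forall>a. supp 0 q a \<longrightarrow> g a = (\<Sum>k<q. \<beta> k * R a k))"
proof -
  define \<beta> where "\<beta> k = g (ext q (\<lambda>i. if i = k then 1 else 0))" for k
  have g_sum: "g (\<lambda>k. \<Sum>r\<in>A. u r k) = (\<Sum>r\<in>A. g (u r))" if "finite A" for A and u :: "nat \<Rightarrow> nat \<Rightarrow> real"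
    using that
  proof (induction A rule: finite_induct)
    case empty
    then show ?case using scale[of 0 "\<lambda>_. 0"] by simp
  qed (simp add: add)
  have rep: "g a = (\<Sum>k<q. \<beta> k * R a k)" if "supp 0 q a" for a
  proof -
    have "a = ext q (R a)" using ext_R[OF that] by simp
    also have "\<dots> = ext q (\<lambda>i. \<Sum>k<q. R a k * (if i = k then 1 else 0))"
      by (rule ext_cong) (simp add: if_distrib[of "\<lambda>x. _ * x"] cong: if_cong)
    also have "\<dots> = (\<lambda>i. \<Sum>k<q. R a k * ext q (\<lambda>i. if i = k then 1 else 0) i)"
      by (simp add: ext_sum ext_scale)
    finally have "g a = g (\<lambda>i. \<Sum>k<q. R a k * ext q (\<lambda>i. if i = k then 1 else 0) i)" by simp
    also have "\<dots> = (\<Sum>k<q. R a k * \<beta> k)"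
      by (subst g_sum) (simp_all add: scale \<beta>_def)
    finally show ?thesis by (simp add: mult.commute)
  qed
  have "(\<Sum>k<q. \<bar>\<beta> k\<bar>) = (\<Sum>k<q. \<beta> k * R (ext q (\<lambda>k. sgn (\<beta> k))) k)"
    by (simp add: abs_sgn)
  also have "\<dots> = g (ext q (\<lambda>k. sgn (\<beta> k)))" by (simp add: rep ext_supp0)
  also have "\<dots> \<le> G" by (rule bound[OF ext_supp0]) (simp add: abs_sgn_eq)
  finally show ?thesis using rep by blast
qed

text \<open>Past \<open>q\<close> a chain of weight \<open>w\<close> takes its value from its last
  node below \<open>q\<close>, apart from the one step that crosses \<open>q\<close>. That step has
  the factor \<open>1 / m w\<close>, and beyond it the gaps see nothing.\<close>

lemma restr_weight:
  assumes B: "\<And>k. \<bar>R a k\<bar> \<le> B" and G: "\<And>k. k < q \<Longrightarrow> wt k = w \<Longrightarrow> \<bar>R a k\<bar> \<le> G" "0 \<le> G" and n: "wt n = w"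
  shows "\<bar>R (restr 0 q a) n\<bar> \<le> G + 8 * B / m w"
  using n
proof (induction n rule: less_induct)
  case (less n)
  have B0: "0 \<le> B" using B[of 0] by linarith
  have pos: "0 \<le> 8 * B / m w" using B0 m_pos[of w] by simp
  show ?case
  proof (cases "n < q")
    case True
    then show ?thesis using G(1)[of n] less.prems pos by (simp add: R_restr_low)
  next
    case nq: False
    have an: "restr 0 q a n = 0" using nq by (simp add: restr_def)
    show ?thesis
    proof (cases "age n = 0")
      case True then show ?thesis using an pos G by (simp add: R_root)
    next
      case node: False
      note pn = prd_less[OF node]
      have wp: "wt (prd n) = w" using wt_prd[OF node] less.prems by simp
      show ?thesis
      proof (cases "prd n < q")
        case True
        have "\<bar>(\<Sum>k<n. bc n k * R (J n (restr 0 q a)) k) / m (wt n)\<bar> \<le> 8 * B / m (wt n)"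
          unfolding restr_mlt J_mlt
          by (intro bc_bound mlt_bound) (use B B0 in auto)
        then show ?thesis using G(1)[OF True wp] an
          unfolding R_node[OF node] R_restr_low[OF True] less.prems by linarith
      next
        case False
        then have "J n (restr 0 q a) = (\<lambda>_. 0)" by (auto simp: J_def mlt_def restr_def)
        then show ?thesis using less.IH[OF pn wp] an by (simp add: R_node[OF node])
      qed
    qed
  qed
qed

text \<open>If the coordinates of one weight vanish up to the end of the support, they stay of order
  \<open>1 / m\<close> afterwards. Each of the two ends of the interval costs \<open>8 + 8\<close>,
  and the localization by \<open>g\<close> another 16; hence 48.\<close>

lemma local_weight:
  assumes a: "supp 0 q a" and B: "\<And>k. \<bar>R a k\<bar> \<le> B" and van: "\<And>k. k < q \<Longrightarrow> wt k = wt n \<Longrightarrow> R a k = 0"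
    and g: "inv_fun p g"
  shows "\<bar>R (mlt p q' g a) n\<bar> \<le> 48 * B / m (wt n)"
proof (cases "p \<le> q'")
  case True
  have B0: "0 \<le> B" using B[of 0] by linarith
  let ?b = "8 * B / m (wt n)"
  have b: "0 \<le> ?b" using B0 m_pos[of "wt n"] by simp
  have 1: "\<bar>R a k\<bar> \<le> ?b" if "wt k = wt n" for k
    using restr_weight[of a B q "wt n" 0 k] B van that by (simp add: restr_supp[OF a])
  have 2: "\<bar>R (restr 0 r a) n\<bar> \<le> ?b + ?b" for r
    using restr_weight[of a B r "wt n" ?b n] B 1 b by simp
  have "mlt p q' (\<lambda>_. 1) a = (\<lambda>i. restr 0 q' a i - restr 0 p a i)"
    using True by (auto simp: mlt_def restr_def)
  then have "\<bar>R (mlt p q' (\<lambda>_. 1) a) n\<bar> \<le> 4 * ?b"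
    using 2[of q'] 2[of p] by (simp add: R_diff)
  moreover have "\<bar>g (\<kappa> n) * R (mlt p q' (\<lambda>_. 1) a) n\<bar> \<le> \<bar>R (mlt p q' (\<lambda>_. 1) a) n\<bar>"
    using g by (simp add: inv_fun_def abs_mult mult_left_le_one_le)
  moreover have "\<bar>R (mlt p q' g a) n - g (\<kappa> n) * R (mlt p q' (\<lambda>_. 1) a) n\<bar> \<le> 16 * B / m (wt n)"
    by (rule mlt_local[OF g]) (use B B0 in auto)
  moreover have "4 * ?b + 16 * B / m (wt n) = 48 * B / m (wt n)" by (simp add: field_simps)
  ultimately show ?thesis by linarith
next
  case False
  then have "mlt p q' g a = (\<lambda>i. 0)" by (auto simp: mlt_def)
  then show ?thesis using B[of 0] m_pos[of "wt n"] by simp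
qed

definition unit :: "nat \<Rightarrow> nat \<Rightarrow> real" where
  "unit n k = (if k = n then 1 else 0)"

lemma unit_supp: "supp n (Suc n) (unit n)"
  by (simp add: supp_def unit_def)

lemma unit_bound: "\<bar>R (unit n) k\<bar> \<le> 2"
proof -
  have "\<bar>R (unit n) k\<bar> \<le> 1" if "k < Suc n" for k
  proof (cases "k = n")
    case True
    have "mlt n (Suc n) (\<lambda>_. 1) (unit n) = unit n" by (auto simp: mlt_def unit_def)
    then show ?thesis using R_mlt_point[of n "unit n"] True by (simp add: unit_def)
  next
    case False
    then show ?thesis using that R_vanish[of k "unit n"] by (simp add: unit_def)
  qed
  moreover have "restr 0 (Suc n) (unit n) = unit n" by (auto simp: restr_def unit_def)
  ultimately show ?thesis using restr_bound[of "Suc n" "unit n" 1 k] by simp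
qed

lemma R_unit_self: "R (unit n) n = 1"
proof -
  have "mlt n (Suc n) (\<lambda>_. 1) (unit n) = unit n" by (auto simp: mlt_def unit_def)
  then show ?thesis using R_mlt_point[of n "unit n"] by (simp add: unit_def)
qed

text \<open>Among the coordinates up to \<open>n\<close> only that at \<open>n\<close> is not zero,
  and its weight is \<open>wt n\<close>. So at all smaller weights \<open>local_weight\<close>
  applies, with the norm bound 2 for basis vectors; 100 rounds up \<open>48 * 2\<close>.\<close>

lemma unit_GV: "GV 100 (wt n) (unit n)"
  unfolding GV_def
proof (intro allI impI conjI)
  fix p q g k assume g: "inv_fun p g"
  show "\<bar>R (mlt p q g (unit n)) k\<bar> \<le> 100"
    using mlt_bound[OF g, of q "unit n" 2 k] unit_bound by fastforce
  assume w: "wt k < wt n"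
  have "\<bar>R (mlt p q g (unit n)) k\<bar> \<le> 48 * 2 / m (wt k)"
  proof (rule local_weight[OF _ unit_bound _ g])
    show "supp 0 (Suc n) (unit n)" using unit_supp supp_mono by blast
    fix i assume "i < Suc n" "wt i = wt k"
    then have "i < n" using w by (cases "i = n") auto
    then show "R (unit n) i = 0" by (intro R_vanish) (auto simp: unit_def)
  qed
  also have "\<dots> \<le> 100 / m (wt k)" using m_pos[of "wt k"] by (simp add: divide_right_mono)
  finally show "\<bar>R (mlt p q g (unit n)) k\<bar> \<le> 100 / m (wt k)" .
qed

end

section \<open>Behaviour of operators on far blocks\<close>

context saturated
begin

text \<open>Otherwise blocks could be chosen one after the other, with signs, so that
  \<open>U\<close> exceeds \<open>\<epsilon>\<close> at the fixed coordinate \<open>n\<close> on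
  each. Their average times \<open>m j\<close> has norm at most \<open>3 * C\<close>, but its image
  has a value above \<open>m j * \<epsilon>\<close>, which is impossible for large
  \<open>j\<close>.\<close>

lemma RIS_small:
  assumes U: "bdd_op L U" and C: "0 \<le> C" and \<epsilon>: "0 < \<epsilon>"
  shows "\<exists>p i. \<forall>v q. supp p q v \<longrightarrow> GV C i v \<longrightarrow> \<bar>U v n\<bar> \<le> \<epsilon>"
proof (rule ccontr)
  assume "\<not> ?thesis"
  then have neg: "\<exists>v q. supp p q v \<and> GV C i v \<and> \<epsilon> < \<bar>U v n\<bar>" for p i by (meson not_le)
  have L: "0 \<le> L" using U by (simp add: bdd_op_def)
  obtain j where j: "3 * L * C / \<epsilon> < m j"
    using reals_Archimedean2[of "3 * L * C / \<epsilon>"] m_unbounded order_less_le_trans by blast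
  let ?N = "nn j"
  have N: "0 < real ?N" using nn_pos by simp
  define Q where "Q r s s' \<longleftrightarrow> fst s \<le> fst s' \<and> supp (fst s) (fst s') (snd s') \<and> GV C (fst s) (snd s') \<and> \<epsilon> < U (snd s') n"
    for r :: nat and s s' :: "nat \<times> (nat \<Rightarrow> real)"
  have "\<exists>f. (\<forall>r\<le>?N. True) \<and> (\<forall>r<?N. Q r (f r) (f (Suc r)))"
  proof (rule finite_dependent_choice)
    fix r and s :: "nat \<times> (nat \<Rightarrow> real)"
    obtain v q where v: "supp (fst s) q v" "GV C (fst s) v" "\<epsilon> < \<bar>U v n\<bar>" using neg by blast
    define v' where "v' = (\<lambda>k. sgn (U v n) * v k)"
    have "U v' = (\<lambda>k. sgn (U v n) * U v k)"
      unfolding v'_def using U supp_fs[OF v(1)] unfolding bdd_op_def by blast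
    then have "\<epsilon> < U v' n" using v(3) by (simp add: abs_sgn mult.commute)
    moreover have "GV C (fst s) v'" unfolding v'_def using v(2) by (rule GV_scale) (simp add: abs_sgn_eq)
    moreover have "supp (fst s) (max (fst s) q) v'"
      unfolding v'_def by (intro supp_scale supp_mono[OF v(1)]) auto
    ultimately have "Q r s (max (fst s) q, v')" by (simp add: Q_def)
    then show "\<exists>y. True \<and> Q r s y" by blast
  qed auto
  then obtain f where f: "\<And>r. r < ?N \<Longrightarrow> Q r (f r) (f (Suc r))" by blast
  define l v where "l r = fst (f r)" and "v r = snd (f (Suc r))" for r
  have Q: "l r \<le> l (Suc r)" "supp (l r) (l (Suc r)) (v r)" "GV C (l r) (v r)" "\<epsilon> < U (v r) n" if "r < ?N" for r
    using f[OF that] by (auto simp: Q_def l_def v_def)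
  have mono: "l r \<le> l s" if "r \<le> s" "s \<le> ?N" for r s
    using that
  proof (induction s rule: dec_induct)
    case (step k)
    then show ?case using Q(1)[of k] by simp
  qed simp
  have RIS: "RIS C {..<?N} l (\<lambda>r. l (Suc r)) l v"
    unfolding RIS_def blocks_def
  proof (intro conjI ballI impI allI)
    fix k k' assume k: "k \<in> {..<?N}" "k' \<in> {..<?N}" "k < k'"
    show "l (Suc k) \<le> l k'" using mono[of "Suc k" k'] k by simp
    then show "l (Suc k) \<le> l k'" .
  qed (use Q in \<open>auto simp: supp_def\<close>)
  define z where "z = (\<lambda>i. m j / ?N * (\<Sum>k<?N. v k i))"
  have "GV (3 * C) j z" using average_EXV[OF RIS C] by (simp add: z_def EXV_def)
  then have zb: "\<bar>R z k\<bar> \<le> 3 * C" for k by (rule GV_norm)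
  have fsv: "fs (v r)" if "r < ?N" for r using Q(2)[OF that] supp_fs by blast
  have "fs z" unfolding z_def by (intro fs_scale fs_sum) (use fsv in auto)
  then have "\<bar>U z n\<bar> \<le> L * (3 * C)" using U zb unfolding bdd_op_def by blast
  moreover have "U z = (\<lambda>k. m j / ?N * U (\<lambda>k. \<Sum>r<?N. v r k) k)"
    unfolding z_def using U fs_sum[of "{..<?N}" v] fsv unfolding bdd_op_def by blast
  moreover have "U (\<lambda>k. \<Sum>r<?N. v r k) = (\<lambda>k. \<Sum>r<?N. U (v r) k)"
    by (rule bdd_op_sum[OF U]) (use fsv in auto)
  moreover have "?N * \<epsilon> \<le> (\<Sum>r<?N. U (v r) n)"
    using sum_bounded_below[of "{..<?N}" \<epsilon> "\<lambda>r. U (v r) n"] Q(4) by (auto intro: less_imp_le)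
  then have "m j / ?N * (?N * \<epsilon>) \<le> m j / ?N * (\<Sum>r<?N. U (v r) n)"
    using m_pos[of j] by (intro mult_left_mono) auto
  ultimately have "m j / ?N * (?N * \<epsilon>) \<le> L * (3 * C)"
    by (metis abs_ge_self order_trans)
  then have "m j * \<epsilon> \<le> L * (3 * C)" using N by simp
  then show False using j \<epsilon> by (simp add: field_simps)
qed

text \<open>Every bounded block is the sum of two blocks to which \<open>small\<close> applies: the
  part with coordinates of weight at least \<open>i1\<close>, which is small at all lower weights,
  and the rest, which is small at weight \<open>i1\<close> and beyond.\<close>

lemma block_small:
  assumes add: "\<And>a a'. fs a \<Longrightarrow> fs a' \<Longrightarrow> W (\<lambda>k. a k + a' k) = (\<lambda>k. W a k + (W a' k :: real))"
    and small: "\<And>C \<epsilon>. 0 \<le> C \<Longrightarrow> 0 < \<epsilon> \<Longrightarrow> \<exists>p i. \<forall>v q. supp p q v \<longrightarrow> GV C i v \<longrightarrow> (\<forall>n. \<bar>W v n\<bar> \<le> \<epsilon>)"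
    and \<epsilon>: "0 < \<epsilon>"
  shows "\<exists>p. \<forall>v q. supp p q v \<longrightarrow> (\<forall>n. \<bar>R v n\<bar> \<le> 1) \<longrightarrow> (\<forall>n. \<bar>W v n\<bar> \<le> \<epsilon>)"
proof -
  obtain p1 i1 where 1: "\<And>v q. supp p1 q v \<Longrightarrow> GV 100 i1 v \<Longrightarrow> \<forall>n. \<bar>W v n\<bar> \<le> \<epsilon> / 2"
    using small[of 100 "\<epsilon> / 2"] \<epsilon> by auto
  \<comment> \<open>At weights below \<open>i1\<close> the second part need not be small, but there
    a constant as large as \<open>100 * m i1\<close> makes the requirement void. Hence
    \<open>small\<close> is used twice, the second time with a constant that depends on the
    first.\<close>
  define C where "C = 100 * m i1"
  have mi: "1 \<le> m i1" by (rule m_ge_1)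
  obtain p2 i2 where 2: "\<And>v q. supp p2 q v \<Longrightarrow> GV C i2 v \<Longrightarrow> \<forall>n. \<bar>W v n\<bar> \<le> \<epsilon> / 2"
    using small[of C "\<epsilon> / 2"] \<epsilon> mi by (auto simp: C_def)
  have "\<forall>n. \<bar>W v n\<bar> \<le> \<epsilon>" if v: "supp (max p1 p2) q v" and b: "\<forall>n. \<bar>R v n\<bar> \<le> 1" for v q
  proof
    fix n
    let ?p = "max p1 p2"
    define h where "h = ext q (\<lambda>k. if i1 \<le> wt k then R v k else 0)"
    define l where "l = ext q (\<lambda>k. if i1 \<le> wt k then 0 else R v k)"
    have Rv: "R v k = 0" if "k < ?p" for k
      using v that by (intro R_vanish) (auto simp: supp_def)
    have sh: "supp ?p q h" and sl: "supp ?p q l" unfolding h_def l_def by (rule ext_supp, use Rv in simp)+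
    have "v = ext q (R v)" using ext_R[of q v] supp_mono[OF v] by simp
    also have "\<dots> = ext q (\<lambda>k. (if i1 \<le> wt k then R v k else 0) + (if i1 \<le> wt k then 0 else R v k))"
      by (rule ext_cong) simp
    finally have vhl: "v = (\<lambda>k. h k + l k)" by (simp add: ext_add h_def l_def)
    have hb: "\<bar>R h k\<bar> \<le> 2" and lb: "\<bar>R l k\<bar> \<le> 2" for k
      using ext_bound[of q "\<lambda>k. if i1 \<le> wt k then R v k else 0" 1 k]
        ext_bound[of q "\<lambda>k. if i1 \<le> wt k then 0 else R v k" 1 k] b by (auto simp: h_def l_def)
    have h0: "supp 0 q h" and l0: "supp 0 q l" using sh sl by (auto intro: supp_mono)
    have "GV 100 i1 h"
      unfolding GV_def
    proof (intro allI impI conjI)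
      fix p q' g k assume g: "inv_fun p g"
      show "\<bar>R (mlt p q' g h) k\<bar> \<le> 100" using mlt_bound[OF g, of q' h 2 k] hb by fastforce
      assume w: "wt k < i1"
      have "\<bar>R (mlt p q' g h) k\<bar> \<le> 48 * 2 / m (wt k)"
        by (rule local_weight[OF h0 hb _ g]) (use w in \<open>simp add: h_def\<close>)
      also have "\<dots> \<le> 100 / m (wt k)" using m_pos[of "wt k"] by (simp add: divide_right_mono)
      finally show "\<bar>R (mlt p q' g h) k\<bar> \<le> 100 / m (wt k)" .
    qed
    then have Wh: "\<bar>W h n\<bar> \<le> \<epsilon> / 2" using 1[OF supp_mono[OF sh]] by auto
    have "GV C i2 l"
      unfolding GV_def
    proof (intro allI impI conjI)
      fix p q' g k assume g: "inv_fun p g"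
      have b16: "\<bar>R (mlt p q' g l) k\<bar> \<le> 16" using mlt_bound[OF g, of q' l 2 k] lb by fastforce
      then show "\<bar>R (mlt p q' g l) k\<bar> \<le> C" using mi by (simp add: C_def)
      have mk: "0 < m (wt k)" by (rule m_pos)
      show "\<bar>R (mlt p q' g l) k\<bar> \<le> C / m (wt k)"
      proof (cases "i1 \<le> wt k")
        case True
        have "\<bar>R (mlt p q' g l) k\<bar> \<le> 48 * 2 / m (wt k)"
          by (rule local_weight[OF l0 lb _ g]) (use True in \<open>simp add: l_def\<close>)
        also have "\<dots> \<le> C / m (wt k)" using mk mi by (intro divide_right_mono) (auto simp: C_def)
        finally show ?thesis .
      next
        case False
        then have "m (wt k) \<le> m i1" by (intro m_mono) simp
        then have "16 * m (wt k) \<le> C" using mi by (simp add: C_def)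
        then have "16 \<le> C / m (wt k)" using mk by (simp add: le_divide_eq)
        then show ?thesis using b16 by linarith
      qed
    qed
    then have Wl: "\<bar>W l n\<bar> \<le> \<epsilon> / 2" using 2[OF supp_mono[OF sl]] by auto
    have "W v n = W h n + W l n"
      using add[OF supp_fs[OF h0] supp_fs[OF l0]] vhl by (metis (no_types))
    then show "\<bar>W v n\<bar> \<le> \<epsilon>" using Wh Wl by linarith
  qed
  then show ?thesis by blast
qed

text \<open>The values of \<open>U\<close> lie in the closed span of the basis, expressed without
  the completion.\<close>

definition op_into :: "((nat \<Rightarrow> real) \<Rightarrow> nat \<Rightarrow> real) \<Rightarrow> bool" where
  "op_into U \<longleftrightarrow> (\<forall>a \<epsilon>. fs a \<longrightarrow> 0 < \<epsilon> \<longrightarrow> (\<exists>y. fs y \<and> (\<forall>n. \<bar>R y n - U a n\<bar> \<le> \<epsilon>)))"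

definition diag_coeff :: "((nat \<Rightarrow> real) \<Rightarrow> nat \<Rightarrow> real) \<Rightarrow> nat \<Rightarrow> real" where
  "diag_coeff U n = D (U (unit n)) n"

text \<open>On far blocks the finitely many coordinates of \<open>U v\<close> below
  \<open>p0\<close> are small by \<open>RIS_small\<close>. So an approximant keeps its quality when
  its projection to \<open>{..<p0}\<close>, whose norm is at most twice these values, is
  subtracted.\<close>

lemma approx_far:
  assumes U: "bdd_op L U" and into: "op_into U" and C: "0 \<le> C" and \<epsilon>: "0 < \<epsilon>"
  shows "\<exists>p i. \<forall>v q. supp p q v \<longrightarrow> GV C i v \<longrightarrow> (\<exists>y q'. supp p0 q' y \<and> (\<forall>n. \<bar>R y n - U v n\<bar> \<le> \<epsilon>))"
proof -
  have "\<forall>n. \<exists>p i. \<forall>v q. supp p q v \<longrightarrow> GV C i v \<longrightarrow> \<bar>U v n\<bar> \<le> \<epsilon> / 8"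
    using RIS_small[OF U C, of "\<epsilon> / 8"] \<epsilon> by simp
  then obtain p i where pi: "\<And>n v q. supp (p n) q v \<Longrightarrow> GV C (i n) v \<Longrightarrow> \<bar>U v n\<bar> \<le> \<epsilon> / 8" by metis
  define P I where "P = Max (p ` {..p0})" and "I = Max (i ` {..p0})"
  have "\<exists>y q'. supp p0 q' y \<and> (\<forall>n. \<bar>R y n - U v n\<bar> \<le> \<epsilon>)" if v: "supp P q v" "GV C I v" for v q
  proof -
    have Uv: "\<bar>U v n\<bar> \<le> \<epsilon> / 8" if "n < p0" for n
    proof (rule pi)
      show "supp (p n) q v" using v(1) that by (rule_tac supp_mono) (auto simp: P_def)
      show "GV C (i n) v" using v(2) that by (rule_tac GV_mono) (auto simp: I_def)
    qed
    obtain y0 where y0: "fs y0" "\<forall>n. \<bar>R y0 n - U v n\<bar> \<le> \<epsilon> / 8"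
      using into supp_fs[OF v(1)] \<epsilon> unfolding op_into_def by (meson divide_pos_pos zero_less_numeral)
    have "\<bar>R y0 n\<bar> \<le> \<epsilon> / 4" if "n < p0" for n
      using y0(2)[rule_format, of n] Uv[OF that] \<epsilon> by linarith
    then have rb: "\<bar>R (restr 0 p0 y0) n\<bar> \<le> \<epsilon> / 2" for n
      using restr_bound[of p0 y0 "\<epsilon> / 4" n] \<epsilon> by simp
    define y where "y = (\<lambda>k. y0 k - restr 0 p0 y0 k)"
    obtain q' where "supp 0 q' y0" using y0(1) by (auto simp: fs_def)
    then have "supp p0 q' y" by (auto simp: supp_def y_def restr_def split: if_splits)
    moreover have "\<bar>R y n - U v n\<bar> \<le> \<epsilon>" for n
      using rb[of n] y0(2)[rule_format, of n] \<epsilon> unfolding y_def R_diff by linarith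
    ultimately show ?thesis by blast
  qed
  then show ?thesis by blast
qed

end

section \<open>Operators are asymptotically scalar near each point of \<open>K\<close>\<close>

context argyros_haydon
begin

text \<open>If \<open>y\<close>, close to \<open>U v\<close>, were far from a multiple of
  \<open>v\<close> near \<open>x\<close>, separation would follow. A functional vanishing at the
  block is produced without Hahn-Banach: a far basis vector is added to \<open>v\<close>, and its
  coefficient serves to correct the functional. This is why the scalar is the diagonal coefficient
  at a far node with point \<open>x\<close>.\<close>

lemma local_scalar:
  assumes U: "bdd_op L U" and into: "op_into U" and x: "x \<in> K" and C: "0 \<le> C" and \<epsilon>: "0 < \<epsilon>"
  shows "\<exists>p i e. 0 < e \<and> (\<forall>v y q. supp p q v \<longrightarrow> supp p q y \<longrightarrow> GV C i v \<longrightarrow> (\<forall>n. \<bar>R y n - U v n\<bar> \<le> e) \<longrightarrow>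
     (\<exists>M. \<forall>n. \<kappa> n = x \<longrightarrow> M \<le> wt n \<longrightarrow>
        (\<forall>k. \<bar>R (mlt p q (cell p x) (\<lambda>k. y k - diag_coeff U n * v k)) k\<bar> \<le> \<epsilon>)))"
proof (rule ccontr)
  assume "\<not> ?thesis"
  then have neg: "\<exists>v y q. supp p q v \<and> supp p q y \<and> GV C i v \<and> (\<forall>n. \<bar>R y n - U v n\<bar> \<le> e) \<and>
     (\<forall>M. \<exists>n. \<kappa> n = x \<and> M \<le> wt n \<and>
        (\<exists>k. \<epsilon> < \<bar>R (mlt p q (cell p x) (\<lambda>k. y k - diag_coeff U n * v k)) k\<bar>))" if "0 < e" for p i e
    using that by (simp only: not_ex not_all not_imp not_le de_Morgan_conj) blast
  define G where "G = 8 + 8 * C"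
  have G: "0 < G" using C by (simp add: G_def)
  show False
  proof (rule no_separation[OF U x, of "C + 100" "\<epsilon> / (2 * G)"])
    show "0 \<le> C + 100" using C by simp
    show "0 < \<epsilon> / (2 * G)" using \<epsilon> G by simp
    fix p i and \<epsilon>' :: real assume \<epsilon>': "0 < \<epsilon>'"
    obtain v y q where vy: "supp p q v" "supp p q y" "GV C i v" "\<forall>n. \<bar>R y n - U v n\<bar> \<le> \<epsilon>' / 2"
     "\<forall>M. \<exists>n. \<kappa> n = x \<and> M \<le> wt n \<and>
        (\<exists>k. \<epsilon> < \<bar>R (mlt p q (cell p x) (\<lambda>k. y k - diag_coeff U n * v k)) k\<bar>)"
      using neg[of "\<epsilon>' / 2" p i] \<epsilon>' by auto
    \<comment> \<open>A coefficient is bounded by 8 times the norm, and the correcting factor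
      \<open>c\<close> by \<open>C\<close>; so the diagonal coefficient is known up to an error that
      costs at most half of \<open>\<epsilon>\<close>.\<close>
    define e where "e = min (\<epsilon>' / 2) (\<epsilon> / (16 * (C + 1)))"
    have e: "0 < e" "e \<le> \<epsilon>' / 2" "e \<le> \<epsilon> / (16 * (C + 1))" unfolding e_def using \<epsilon> \<epsilon>' C by (simp_all only: min_less_iff_conj min.cobounded1 min.cobounded2) auto
    have "C * (8 * e) \<le> (C + 1) * (8 * (\<epsilon> / (16 * (C + 1))))" using C e by (intro mult_mono) auto
    also have "\<dots> = \<epsilon> / 2" using C by (simp add: field_simps)
    finally have Ce: "C * (8 * e) \<le> \<epsilon> / 2" .
    obtain p1 i1 where p1: "\<And>v q'. supp p1 q' v \<Longrightarrow> GV 100 i1 v \<Longrightarrow>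
        \<exists>y q'. supp q q' y \<and> (\<forall>n. \<bar>R y n - U v n\<bar> \<le> e)"
      using approx_far[OF U into _ e(1), of 100 q] by (meson zero_le_numeral)
    obtain n k where n: "\<kappa> n = x" "max (max p q) (max p1 (max i i1)) \<le> wt n"
       "\<epsilon> < \<bar>R (mlt p q (cell p x) (\<lambda>k. y k - diag_coeff U n * v k)) k\<bar>"
      using vy(5) by blast
    have nge: "p \<le> n" "q \<le> n" "p1 \<le> n" using n(2) wt_le[of n] by auto
    have GVu: "GV 100 i1 (unit n)" "GV 100 i (unit n)" using unit_GV[of n] n(2) by (auto intro: GV_mono)
    obtain y' q' where y': "supp q q' y'" "\<forall>k. \<bar>R y' k - U (unit n) k\<bar> \<le> e"
      using p1[OF supp_mono[OF unit_supp] GVu(1)] nge by blast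
    define V where "V = (\<lambda>k. v k + unit n k)"
    define Y where "Y = (\<lambda>k. y k + y' k)"
    define Q where "Q = max (max q q') (Suc n)"
    have Qn: "n < Q" "q \<le> Q" "q' \<le> Q" by (auto simp: Q_def)
    have pq: "supp p Q y'"
      unfolding supp_def
    proof (intro allI impI conjI)
      fix k assume k: "y' k \<noteq> 0"
      then have "q \<le> k" "k < q'" using y'(1) by (auto simp: supp_def)
      then show "k < Q" using Qn by simp
      show "p \<le> k"
      proof (cases "p \<le> q")
        case True then show ?thesis using \<open>q \<le> k\<close> by simp
      next
        case False
        then have "v = (\<lambda>_. 0)" "y = (\<lambda>_. 0)" using vy(1,2) by (auto simp: supp_def fun_eq_iff)
        then have "mlt p q (cell p x) (\<lambda>k. y k - diag_coeff U n * v k) = (\<lambda>_. 0)" by (auto simp: mlt_def)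
        then show ?thesis using n(3) \<epsilon> by simp
      qed
    qed
    have sV: "supp p Q V" unfolding V_def
      by (intro supp_add supp_mono[OF vy(1)] supp_mono[OF unit_supp]) (use nge Qn in auto)
    have sY: "supp p Q Y" unfolding Y_def
      by (intro supp_add supp_mono[OF vy(2)] pq) (use Qn in auto)
    have GVV: "GV (C + 100) i V" unfolding V_def by (rule GV_add[OF vy(3) GVu(2)])
    have "U V = (\<lambda>k. U v k + U (unit n) k)"
      unfolding V_def using U supp_fs[OF vy(1)] supp_fs[OF unit_supp] unfolding bdd_op_def by blast
    then have close: "\<forall>k. \<bar>R Y k - U V k\<bar> \<le> \<epsilon>'"
      using vy(4) y'(2) e(2) unfolding Y_def R_add by (smt (verit) field_sum_of_halves)
    define \<sigma> where "\<sigma> = sgn (R (mlt p q (cell p x) (\<lambda>k. y k - diag_coeff U n * v k)) k)"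
    define c where "c = \<sigma> * R (mlt p q (cell p x) v) k"
    have \<sigma>: "\<bar>\<sigma>\<bar> \<le> 1" by (simp add: \<sigma>_def abs_sgn_eq)
    have "\<bar>R (mlt p q (cell p x) v) k\<bar> \<le> C" using GV_bound[OF vy(3) inv_fun_cell] .
    then have c: "\<bar>c\<bar> \<le> C" unfolding c_def abs_mult using \<sigma> C by (meson abs_ge_zero mult_left_le_one_le order_trans)
    \<comment> \<open>\<open>c\<close> is the value of the first term at \<open>v\<close>, and
      \<open>V\<close> has coefficient 1 at \<open>n\<close>, so \<open>g\<close> annihilates
      \<open>V\<close>. At \<open>Y\<close> it returns the large coordinate of
      \<open>y - diag_coeff U n * v\<close>, up to the error in the diagonal coefficient. Its norm
      is at most \<open>G\<close>, by which it is divided below.\<close>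
    define g where "g a = \<sigma> * R (mlt p q (cell p x) a) k - c * a n" for a
    have "\<exists>\<beta>. (\<Sum>k<Q. \<bar>\<beta> k\<bar>) \<le> G \<and> (\<forall>a. supp 0 Q a \<longrightarrow> g a = (\<Sum>k<Q. \<beta> k * R a k))"
    proof (rule functional_repr)
      fix a :: "nat \<Rightarrow> real" assume a: "supp 0 Q a" "\<And>k. k < Q \<Longrightarrow> \<bar>R a k\<bar> \<le> 1"
      have "\<bar>R (mlt p q (cell p x) a) k\<bar> \<le> 8 * 1" by (rule mlt_bound) (use a Qn in auto)
      then have "\<bar>\<sigma> * R (mlt p q (cell p x) a) k\<bar> \<le> 8"
        unfolding abs_mult using \<sigma> by (smt (verit) abs_ge_zero mult_left_le_one_le)
      moreover have "\<bar>a n\<bar> \<le> 8 * 1" by (rule coord_bound) (use a Qn in auto)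
      then have "\<bar>c * a n\<bar> \<le> C * 8" unfolding abs_mult using c C by (intro mult_mono) auto
      ultimately show "g a \<le> G" unfolding g_def G_def by linarith
    qed (auto simp: g_def mlt_add mlt_scale R_add R_scale algebra_simps)
    then obtain \<beta> where \<beta>: "(\<Sum>k<Q. \<bar>\<beta> k\<bar>) \<le> G" "\<And>a. supp 0 Q a \<Longrightarrow> g a = (\<Sum>k<Q. \<beta> k * R a k)" by blast
    have supm: "supp 0 Q (mlt p Q (cell p x) a)" for a by (auto simp: supp_def mlt_def)
    have cn: "cell p x (\<kappa> n) = 1" using n(1) by (simp add: cell_def E_refl)
    have v_n: "v n = 0" "y n = 0" using vy(1,2) nge by (auto simp: supp_def)
    have y'_low: "y' k = 0" if "k < q" for k using y'(1) that by (auto simp: supp_def)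
    have "mlt p q (cell p x) (mlt p Q (cell p x) V) = mlt p q (cell p x) v"
      using Qn nge by (auto simp: mlt_def V_def unit_def cell_def fun_eq_iff)
    moreover have "mlt p Q (cell p x) V n = 1"
      using cn Qn nge v_n by (simp add: mlt_def V_def unit_def)
    ultimately have gV: "g (mlt p Q (cell p x) V) = 0" by (simp add: g_def c_def)
    have "mlt p q (cell p x) (mlt p Q (cell p x) Y) = mlt p q (cell p x) y"
      using Qn y'_low by (auto simp: mlt_def Y_def cell_def fun_eq_iff)
    moreover have "mlt p Q (cell p x) Y n = y' n"
      using cn Qn nge v_n by (simp add: mlt_def Y_def)
    ultimately have gY: "g (mlt p Q (cell p x) Y) = \<sigma> * R (mlt p q (cell p x) y) k - c * y' n"
      by (simp add: g_def)
    have "mlt p q (cell p x) (\<lambda>k. y k - diag_coeff U n * v k) =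
        (\<lambda>k. mlt p q (cell p x) y k - diag_coeff U n * mlt p q (cell p x) v k)"
      by (auto simp: mlt_def algebra_simps)
    then have "\<sigma> * R (mlt p q (cell p x) (\<lambda>k. y k - diag_coeff U n * v k)) k =
        \<sigma> * R (mlt p q (cell p x) y) k - diag_coeff U n * c"
      by (simp only: R_diff R_scale c_def right_diff_distrib mult.left_commute)
    moreover have "\<sigma> * R (mlt p q (cell p x) (\<lambda>k. y k - diag_coeff U n * v k)) k =
        \<bar>R (mlt p q (cell p x) (\<lambda>k. y k - diag_coeff U n * v k)) k\<bar>"
      by (simp add: \<sigma>_def abs_sgn mult.commute)
    ultimately have gY': "g (mlt p Q (cell p x) Y) =
        \<bar>R (mlt p q (cell p x) (\<lambda>k. y k - diag_coeff U n * v k)) k\<bar> + c * (diag_coeff U n - y' n)"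
      using gY by (simp add: algebra_simps)
    have "\<bar>D (\<lambda>k. U (unit n) k - R y' k) n\<bar> \<le> 8 * e"
      by (rule coord_bound) (use y'(2) e in \<open>auto simp: abs_minus_commute\<close>)
    then have "\<bar>diag_coeff U n - y' n\<bar> \<le> 8 * e" by (simp add: D_diff diag_coeff_def)
    then have "\<bar>c * (diag_coeff U n - y' n)\<bar> \<le> C * (8 * e)"
      unfolding abs_mult using c C by (intro mult_mono) auto
    then have gYb: "\<epsilon> / 2 \<le> g (mlt p Q (cell p x) Y)" using gY' n(3) Ce by linarith
    define \<beta>' where "\<beta>' k = \<beta> k / G" for k
    have sum\<beta>': "(\<Sum>k<Q. \<beta>' k * R a k) = (\<Sum>k<Q. \<beta> k * R a k) / G" for a
      by (simp add: \<beta>'_def sum_divide_distrib)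
    have "(\<Sum>k<Q. \<bar>\<beta>' k\<bar>) \<le> 1"
      using \<beta>(1) G by (simp add: \<beta>'_def abs_divide sum_divide_distrib[symmetric] divide_le_eq)
    moreover have "\<bar>\<Sum>k<Q. \<beta>' k * R (mlt p Q (cell p x) V) k\<bar> \<le> \<epsilon>'"
      using \<beta>(2)[OF supm, of V] gV \<epsilon>' by (simp add: sum\<beta>')
    moreover have "\<epsilon> / (2 * G) \<le> (\<Sum>k<Q. \<beta>' k * R (mlt p Q (cell p x) Y) k)"
      unfolding sum\<beta>' \<beta>(2)[OF supm, of Y, symmetric] using gYb G by (simp add: field_simps)
    ultimately show "\<exists>v y \<beta> q. supp p q v \<and> supp p q y \<and> GV (C + 100) i v \<and>
       (\<forall>n. \<bar>R y n - U v n\<bar> \<le> \<epsilon>') \<and> (\<Sum>k<q. \<bar>\<beta> k\<bar>) \<le> 1 \<and>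
       \<bar>\<Sum>k<q. \<beta> k * R (mlt p q (cell p x) v) k\<bar> \<le> \<epsilon>' \<and>
       \<epsilon> / (2 * G) \<le> (\<Sum>k<q. \<beta> k * R (mlt p q (cell p x) y) k)"
      using sV sY GVV close by blast
  qed
qed

text \<open>\<open>local_scalar\<close> is applied to the basis vector at \<open>n\<close>, and
  coefficient \<open>n\<close> of the difference is read off. The point of \<open>n\<close> only has
  to lie in the cell of \<open>x\<close>; this is the source of the continuity of the limit.\<close>

lemma diag_coeff_local:
  assumes U: "bdd_op L U" and into: "op_into U" and x: "x \<in> K" and \<epsilon>: "0 < \<epsilon>"
  shows "\<exists>p i. \<forall>n. E p (\<kappa> n) x \<longrightarrow> i \<le> wt n \<longrightarrow>
     (\<exists>M. \<forall>n'. \<kappa> n' = x \<longrightarrow> M \<le> wt n' \<longrightarrow> \<bar>diag_coeff U n - diag_coeff U n'\<bar> \<le> \<epsilon>)"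
proof -
  obtain p i e where e: "0 < e" and p: "\<And>v y q. supp p q v \<Longrightarrow> supp p q y \<Longrightarrow> GV 100 i v \<Longrightarrow> (\<forall>n. \<bar>R y n - U v n\<bar> \<le> e) \<Longrightarrow>
     \<exists>M. \<forall>n. \<kappa> n = x \<longrightarrow> M \<le> wt n \<longrightarrow>
        (\<forall>k. \<bar>R (mlt p q (cell p x) (\<lambda>k. y k - diag_coeff U n * v k)) k\<bar> \<le> \<epsilon> / 16)"
    using local_scalar[OF U into x, of 100 "\<epsilon> / 16"] \<epsilon> by auto
  define e' where "e' = min e (\<epsilon> / 16)"
  have e': "0 < e'" "e' \<le> e" "e' \<le> \<epsilon> / 16" using e \<epsilon> by (auto simp: e'_def)
  obtain p1 i1 where p1: "\<And>v q'. supp p1 q' v \<Longrightarrow> GV 100 i1 v \<Longrightarrow>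
        \<exists>y q'. supp p q' y \<and> (\<forall>n. \<bar>R y n - U v n\<bar> \<le> e')"
    using approx_far[OF U into _ e'(1), of 100 p] by (meson zero_le_numeral)
  have "\<exists>M. \<forall>n'. \<kappa> n' = x \<longrightarrow> M \<le> wt n' \<longrightarrow> \<bar>diag_coeff U n - diag_coeff U n'\<bar> \<le> \<epsilon>"
    if n: "E p (\<kappa> n) x" "max (max p p1) (max i i1) \<le> wt n" for n
  proof -
    have nge: "p \<le> n" "p1 \<le> n" using n(2) wt_le[of n] by auto
    have GVu: "GV 100 i1 (unit n)" "GV 100 i (unit n)" using unit_GV[of n] n(2) by (auto intro: GV_mono)
    obtain y q' where y: "supp p q' y" "\<forall>k. \<bar>R y k - U (unit n) k\<bar> \<le> e'"
      using p1[OF supp_mono[OF unit_supp] GVu(1)] nge by blast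
    define Q where "Q = max q' (Suc n)"
    have s: "supp p Q (unit n)" "supp p Q y"
      using nge by (auto intro!: supp_mono[OF unit_supp] supp_mono[OF y(1)] simp: Q_def)
    obtain M where M: "\<And>n' k. \<kappa> n' = x \<Longrightarrow> M \<le> wt n' \<Longrightarrow>
        \<bar>R (mlt p Q (cell p x) (\<lambda>k. y k - diag_coeff U n' * unit n k)) k\<bar> \<le> \<epsilon> / 16"
      using p[OF s GVu(2)] y(2) e'(2) order_trans by blast
    have "\<bar>diag_coeff U n - diag_coeff U n'\<bar> \<le> \<epsilon>" if n': "\<kappa> n' = x" "M \<le> wt n'" for n'
    proof -
      have "\<bar>mlt p Q (cell p x) (\<lambda>k. y k - diag_coeff U n' * unit n k) n\<bar> \<le> 8 * (\<epsilon> / 16)"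
        by (rule coord_bound) (use M[OF n'] \<epsilon> in auto)
      then have "\<bar>y n - diag_coeff U n'\<bar> \<le> \<epsilon> / 2"
        using n(1) nge by (simp add: mlt_def cell_def unit_def Q_def less_max_iff_disj)
      moreover have "\<bar>D (\<lambda>k. U (unit n) k - R y k) n\<bar> \<le> 8 * e'"
        by (rule coord_bound) (use y(2) e' in \<open>auto simp: abs_minus_commute\<close>)
      then have "\<bar>diag_coeff U n - y n\<bar> \<le> \<epsilon> / 2" using e'(3) by (simp add: D_diff diag_coeff_def)
      ultimately show ?thesis by linarith
    qed
    then show ?thesis by blast
  qed
  then show ?thesis by blast
qed

lemma diag_coeff_limit:
  assumes U: "bdd_op L U" and into: "op_into U"
  shows "\<exists>f. \<forall>x\<in>K. \<forall>\<epsilon>>0. \<exists>p i. \<forall>n. E p (\<kappa> n) x \<longrightarrow> i \<le> wt n \<longrightarrow> \<bar>diag_coeff U n - f x\<bar> \<le> \<epsilon>"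
proof -
  have "\<exists>c. \<forall>\<epsilon>>0. \<exists>p i. \<forall>n. E p (\<kappa> n) x \<longrightarrow> i \<le> wt n \<longrightarrow> \<bar>diag_coeff U n - c\<bar> \<le> \<epsilon>" if x: "x \<in> K" for x
  proof -
    have "\<forall>j. \<exists>n. wt n = j \<and> \<kappa> n = x" using ex_root[OF x] by blast
    then obtain \<rho> where \<rho>: "\<And>j. wt (\<rho> j) = j \<and> \<kappa> (\<rho> j) = x" by metis
    have "Cauchy (\<lambda>j. diag_coeff U (\<rho> j))"
    proof (rule metric_CauchyI)
      fix \<epsilon> :: real assume \<epsilon>: "0 < \<epsilon>"
      then obtain p i where p: "\<And>n. E p (\<kappa> n) x \<Longrightarrow> i \<le> wt n \<Longrightarrow>
          \<exists>M. \<forall>n'. \<kappa> n' = x \<longrightarrow> M \<le> wt n' \<longrightarrow> \<bar>diag_coeff U n - diag_coeff U n'\<bar> \<le> \<epsilon> / 3"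
        using diag_coeff_local[OF U into x, of "\<epsilon> / 3"] by auto
      have "dist (diag_coeff U (\<rho> j)) (diag_coeff U (\<rho> k)) < \<epsilon>" if jk: "i \<le> j" "i \<le> k" for j k
      proof -
        obtain M1 where M1: "\<forall>n'. \<kappa> n' = x \<longrightarrow> M1 \<le> wt n' \<longrightarrow> \<bar>diag_coeff U (\<rho> j) - diag_coeff U n'\<bar> \<le> \<epsilon> / 3"
          using p[of "\<rho> j"] \<rho> jk E_refl by auto
        obtain M2 where M2: "\<forall>n'. \<kappa> n' = x \<longrightarrow> M2 \<le> wt n' \<longrightarrow> \<bar>diag_coeff U (\<rho> k) - diag_coeff U n'\<bar> \<le> \<epsilon> / 3"
          using p[of "\<rho> k"] \<rho> jk E_refl by auto
        \<comment> \<open>The bound from which comparison holds depends on the node, so two nodes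
          are compared through a third one of larger weight.\<close>
        have "\<bar>diag_coeff U (\<rho> j) - diag_coeff U (\<rho> (max M1 M2))\<bar> \<le> \<epsilon> / 3"
             "\<bar>diag_coeff U (\<rho> k) - diag_coeff U (\<rho> (max M1 M2))\<bar> \<le> \<epsilon> / 3"
          using M1 M2 \<rho> by auto
        then show ?thesis unfolding dist_real_def using \<epsilon> by linarith
      qed
      then show "\<exists>M. \<forall>j\<ge>M. \<forall>k\<ge>M. dist (diag_coeff U (\<rho> j)) (diag_coeff U (\<rho> k)) < \<epsilon>" by blast
    qed
    then obtain c where c: "(\<lambda>j. diag_coeff U (\<rho> j)) \<longlonglongrightarrow> c"
      using Cauchy_convergent_iff convergent_def by metis
    have "\<exists>p i. \<forall>n. E p (\<kappa> n) x \<longrightarrow> i \<le> wt n \<longrightarrow> \<bar>diag_coeff U n - c\<bar> \<le> \<epsilon>" if \<epsilon>: "0 < \<epsilon>" for \<epsilon>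
    proof -
      obtain p i where p: "\<And>n. E p (\<kappa> n) x \<Longrightarrow> i \<le> wt n \<Longrightarrow>
          \<exists>M. \<forall>n'. \<kappa> n' = x \<longrightarrow> M \<le> wt n' \<longrightarrow> \<bar>diag_coeff U n - diag_coeff U n'\<bar> \<le> \<epsilon> / 2"
        using diag_coeff_local[OF U into x, of "\<epsilon> / 2"] \<epsilon> by auto
      obtain j0 where j0: "\<And>j. j0 \<le> j \<Longrightarrow> \<bar>diag_coeff U (\<rho> j) - c\<bar> < \<epsilon> / 2"
        using c[unfolded LIMSEQ_iff, rule_format, of "\<epsilon> / 2"] \<epsilon> by auto
      have "\<bar>diag_coeff U n - c\<bar> \<le> \<epsilon>" if n: "E p (\<kappa> n) x" "i \<le> wt n" for n
      proof -
        obtain M where "\<And>n'. \<kappa> n' = x \<Longrightarrow> M \<le> wt n' \<Longrightarrow> \<bar>diag_coeff U n - diag_coeff U n'\<bar> \<le> \<epsilon> / 2"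
          using p[OF n] by blast
        then have "\<bar>diag_coeff U n - diag_coeff U (\<rho> (max M j0))\<bar> \<le> \<epsilon> / 2" using \<rho> by simp
        then show ?thesis using j0[of "max M j0"] by linarith
      qed
      then show ?thesis by blast
    qed
    then show ?thesis by blast
  qed
  then show ?thesis by (rule_tac bchoice) blast
qed

end

section \<open>Diagonal operators\<close>

context bourgain_delbaen
begin

lemma mlt_normalize:
  assumes "\<forall>x. \<bar>g x\<bar> \<le> c" "\<forall>x y. E p x y \<longrightarrow> g x = g y"
  shows "\<exists>h. inv_fun p h \<and> (\<forall>x. g x = c * h x)"
proof (cases "c = 0")
  case True
  then show ?thesis using assms by (intro exI[of _ "\<lambda>_. 1"]) auto
next
  case False
  have "0 \<le> c" using assms(1) abs_ge_zero order_trans by blast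
  then have "0 < c" using False by simp
  then show ?thesis using assms by (intro exI[of _ "\<lambda>x. g x / c"]) (auto simp: inv_fun_def abs_divide)
qed

lemma mlt_bound_scaled:
  assumes g: "\<forall>x. \<bar>g x\<bar> \<le> c" "\<forall>x y. E p x y \<longrightarrow> g x = g y"
    and B: "\<And>k. k < q \<Longrightarrow> \<bar>R a k\<bar> \<le> B" "0 \<le> B"
  shows "\<bar>R (mlt p q g a) n\<bar> \<le> 8 * B * c"
proof -
  obtain h where h: "inv_fun p h" "\<forall>x. g x = c * h x" using mlt_normalize[OF g] by blast
  have c: "0 \<le> c" using g(1) abs_ge_zero order_trans by blast
  have "mlt p q g a = (\<lambda>i. c * mlt p q h a i)" using h(2) by (auto simp: mlt_def)
  moreover have "\<bar>R (mlt p q h a) n\<bar> \<le> 8 * B" using h(1) B by (rule mlt_bound)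
  then have "c * \<bar>R (mlt p q h a) n\<bar> \<le> c * (8 * B)" using c by (rule mult_left_mono)
  ultimately show ?thesis using c by (simp add: R_scale abs_mult algebra_simps)
qed

lemma mlt_local_scaled:
  assumes g: "\<forall>x. \<bar>g x\<bar> \<le> c" "\<forall>x y. E p x y \<longrightarrow> g x = g y"
    and B: "\<And>k. k < q \<Longrightarrow> \<bar>R a k\<bar> \<le> B" "0 \<le> B"
  shows "\<bar>R (mlt p q g a) n - g (\<kappa> n) * R (mlt p q (\<lambda>_. 1) a) n\<bar> \<le> 16 * B * c / m (wt n)"
proof -
  obtain h where h: "inv_fun p h" "\<forall>x. g x = c * h x" using mlt_normalize[OF g] by blast
  have c: "0 \<le> c" using g(1) abs_ge_zero order_trans by blast
  have "mlt p q g a = (\<lambda>i. c * mlt p q h a i)" using h(2) by (auto simp: mlt_def)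
  then have "R (mlt p q g a) n - g (\<kappa> n) * R (mlt p q (\<lambda>_. 1) a) n
     = c * (R (mlt p q h a) n - h (\<kappa> n) * R (mlt p q (\<lambda>_. 1) a) n)"
    using h(2) by (simp add: R_scale algebra_simps)
  moreover have "\<bar>R (mlt p q h a) n - h (\<kappa> n) * R (mlt p q (\<lambda>_. 1) a) n\<bar> \<le> 16 * B / m (wt n)"
    using h(1) B by (rule mlt_local)
  then have "c * \<bar>R (mlt p q h a) n - h (\<kappa> n) * R (mlt p q (\<lambda>_. 1) a) n\<bar> \<le> c * (16 * B / m (wt n))"
    using c by (rule mult_left_mono)
  moreover have "c * (16 * B / m (wt n)) = 16 * B * c / m (wt n)" by simp
  ultimately show ?thesis using c by (simp only: abs_mult abs_of_nonneg)
qed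

end

context argyros_haydon
begin

text \<open>\<^term>\<open>G j\<close> is a locally constant approximation of \<^term>\<open>f\<close> at scale \<^term>\<open>t j\<close>, and the
  diagonal multiplier \<^term>\<open>\<mu>\<close> switches from one approximation to the next as the rank grows.\<close>

definition symb where
  "symb c \<epsilon> t G f \<mu> \<longleftrightarrow> 0 < \<epsilon> \<and> (\<forall>j x. \<bar>G j x\<bar> \<le> c) \<and>
     (\<forall>j x y. E (t j) x y \<longrightarrow> G j x = G j y) \<and> (\<forall>j. \<forall>x\<in>K. \<bar>G j x - f x\<bar> \<le> \<epsilon> / 2 ^ j) \<and>
     (\<forall>j p q g a B n. t j \<le> p \<longrightarrow> inv_fun p g \<longrightarrow> (\<forall>k<q. \<bar>R a k\<bar> \<le> B) \<longrightarrow> 0 \<le> B \<longrightarrow>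
        \<bar>R (mlt p q g (\<lambda>k. (\<mu> k - G j (\<kappa> k)) * a k)) n\<bar> \<le> 8 * B * \<epsilon> / 2 ^ j)"

definition E_continuous :: "('a \<Rightarrow> real) \<Rightarrow> bool" where
  "E_continuous f \<longleftrightarrow> (\<forall>\<epsilon>>0. \<exists>p. \<forall>x\<in>K. \<forall>y\<in>K. E p x y \<longrightarrow> \<bar>f x - f y\<bar> \<le> \<epsilon>)"

lemma geometric_tail: "(\<Sum>j=Suc l..l + d. \<epsilon> / 2 ^ j) \<le> (\<epsilon>::real) / 2 ^ l" if "0 \<le> \<epsilon>"
proof -
  have "(\<Sum>j=Suc l..l + d. \<epsilon> / 2 ^ j) = \<epsilon> / 2 ^ l - \<epsilon> / 2 ^ (l + d)"
  proof (induction d)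
    case (Suc d)
    have "{Suc l..l + Suc d} = insert (l + Suc d) {Suc l..l + d}" by auto
    then have "(\<Sum>j=Suc l..l + Suc d. \<epsilon> / 2 ^ j) = \<epsilon> / 2 ^ (l + Suc d) + (\<Sum>j=Suc l..l + d. \<epsilon> / 2 ^ j)" by simp
    then show ?case using Suc by simp
  qed simp
  then show ?thesis using that by simp
qed

text \<open>\<open>f\<close> is telescoped into locally constant increments \<open>dl j\<close> of
  size \<open>\<epsilon> / 2 ^ j\<close>. The increment \<open>j\<close> is switched on only at the
  coefficients from \<open>t j\<close> on, where it is constant on the relevant cells; so each
  contributes at most 8 times its size and the tails sum geometrically.\<close>

lemma symb_exists:
  assumes f: "E_continuous f" "\<forall>x\<in>K. \<bar>f x\<bar> \<le> c" and c: "0 \<le> c" and \<epsilon>: "0 < \<epsilon>"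
  shows "\<exists>t G \<mu>. symb c \<epsilon> t G f \<mu>"
proof -
  have "\<exists>p. j \<le> p \<and> (\<forall>x\<in>K. \<forall>y\<in>K. E p x y \<longrightarrow> \<bar>f x - f y\<bar> \<le> \<epsilon> / 2 ^ Suc j)" for j
  proof -
    obtain p where "\<forall>x\<in>K. \<forall>y\<in>K. E p x y \<longrightarrow> \<bar>f x - f y\<bar> \<le> \<epsilon> / 2 ^ Suc j"
      using f(1) \<epsilon> unfolding E_continuous_def by (meson divide_pos_pos zero_less_numeral zero_less_power)
    then show ?thesis using E_mono[of p "max j p"] by (intro exI[of _ "max j p"]) auto
  qed
  then obtain s where s: "\<And>j. j \<le> s j" "\<And>j x y. x \<in> K \<Longrightarrow> y \<in> K \<Longrightarrow> E (s j) x y \<Longrightarrow> \<bar>f x - f y\<bar> \<le> \<epsilon> / 2 ^ Suc j"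
    by metis
  define t where "t j = Max (s ` {..j})" for j
  have t_mono: "t i \<le> t j" if "i \<le> j" for i j
    unfolding t_def using that by (intro Max_mono) auto
  have st: "s j \<le> t j" for j by (simp add: t_def)
  have tj: "j \<le> t j" for j using s(1)[of j] st[of j] by linarith
  have tf: "\<bar>f x - f y\<bar> \<le> \<epsilon> / 2 ^ Suc j" if "x \<in> K" "y \<in> K" "E (t j) x y" for j x y
    using s(2)[OF that(1,2)] E_mono[OF st that(3)] by blast
  \<comment> \<open>The cells partition the whole type, but \<open>f\<close> is controlled on
    \<open>K\<close> only. A cell that misses \<open>K\<close> gets the value 0, and the increment
    is 0 there too.\<close>
  define near where "near j x \<longleftrightarrow> (\<exists>z\<in>K. E (t j) x z)" for j x
  define rep where "rep j x = (SOME z. z \<in> K \<and> E (t j) x z)" for j x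
  have rep: "rep j x \<in> K" "E (t j) x (rep j x)" if "near j x" for j x
    using someI_ex[of "\<lambda>z. z \<in> K \<and> E (t j) x z"] that by (auto simp: rep_def near_def)
  have rep_eq: "near j x = near j y" "rep j x = rep j y" if "E (t j) x y" for j x y
  proof -
    have "E (t j) x z \<longleftrightarrow> E (t j) y z" for z using that E_sym E_trans by blast
    then show "near j x = near j y" "rep j x = rep j y" by (simp_all add: near_def rep_def)
  qed
  have near_mono: "near i x" if "i \<le> j" "near j x" for i j x
    using that(2) E_mono[OF t_mono[OF that(1)]] unfolding near_def by blast
  have nearK: "near j x" if "x \<in> K" for j x using that E_refl by (auto simp: near_def)
  define G where "G j x = (if near j x then f (rep j x) else 0)" for j x
  define dl where "dl j x = (if near j x then G j x - (if j = 0 then 0 else G (j - 1) x) else 0)" for j x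
  \<comment> \<open>The summation up to \<open>k\<close> loses nothing, because
    \<open>j \<le> t j\<close>.\<close>
  define \<mu> where "\<mu> k = (\<Sum>j\<le>k. if t j \<le> k then dl j (\<kappa> k) else 0)" for k
  have G_inv: "G j x = G j y" if "E (t j) x y" for j x y
    using rep_eq[OF that] by (simp add: G_def)
  have dl_inv: "dl j x = dl j y" if "E (t j) x y" for j x y
  proof -
    have "E (t (j - 1)) x y" using that by (rule E_mono[OF t_mono[OF diff_le_self]])
    then show ?thesis using rep_eq(1)[OF that] G_inv[OF that] G_inv[of "j - 1" x y] by (simp add: dl_def)
  qed
  have dl_small: "\<bar>dl j x\<bar> \<le> \<epsilon> / 2 ^ j" if "0 < j" for j x
  proof (cases "near j x")
    case True
    then have n: "near j x" "near (j - 1) x" using near_mono[of "j - 1" j x] by auto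
    have "E (t (j - 1)) (rep j x) x"
      using E_mono[OF t_mono rep(2)[OF n(1)]] E_sym diff_le_self by blast
    then have "E (t (j - 1)) (rep j x) (rep (j - 1) x)" using rep(2)[OF n(2)] E_trans by blast
    then have "\<bar>f (rep j x) - f (rep (j - 1) x)\<bar> \<le> \<epsilon> / 2 ^ Suc (j - 1)"
      by (rule tf[OF rep(1)[OF n(1)] rep(1)[OF n(2)]])
    then show ?thesis using that n by (simp add: dl_def G_def)
  next
    case False then show ?thesis using \<epsilon> by (simp add: dl_def)
  qed
  have tele: "(\<Sum>j\<le>l. dl j x) = G l x" if "x \<in> K" for l x
    using nearK[OF that] by (induction l) (auto simp: dl_def)
  have \<mu>_tail: "\<mu> k - G l (\<kappa> k) = (\<Sum>j=Suc l..l + q. if t j \<le> k then dl j (\<kappa> k) else 0)"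
    if k: "t l \<le> k" "k < q" for l k q
  proof -
    have Jk: "l \<le> k" using tj[of l] k by linarith
    have "\<mu> k = (\<Sum>j\<le>l + q. if t j \<le> k then dl j (\<kappa> k) else 0)"
      unfolding \<mu>_def using k tj by (intro sum.mono_neutral_left) (auto, meson order_trans)
    also have "{..l + q} = {..l} \<union> {Suc l..l + q}" by auto
    also have "(\<Sum>j\<in>{..l} \<union> {Suc l..l + q}. if t j \<le> k then dl j (\<kappa> k) else 0) =
        (\<Sum>j\<le>l. if t j \<le> k then dl j (\<kappa> k) else 0) + (\<Sum>j=Suc l..l + q. if t j \<le> k then dl j (\<kappa> k) else 0)"
      by (rule sum.union_disjoint) auto
    also have "(\<Sum>j\<le>l. if t j \<le> k then dl j (\<kappa> k) else 0) = (\<Sum>j\<le>l. dl j (\<kappa> k))"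
      using t_mono[of _ l] k by (intro sum.cong) (auto, meson order_trans)
    finally show ?thesis using tele[OF \<kappa>_in] by simp
  qed
  have "symb c \<epsilon> t G f \<mu>"
    unfolding symb_def
  proof (intro conjI allI impI ballI \<epsilon>)
    show "\<bar>G j x\<bar> \<le> c" for j x using f(2) c rep by (simp add: G_def)
    show "G j x = G j y" if "E (t j) x y" for j x y using G_inv[OF that] .
    show "\<bar>G j x - f x\<bar> \<le> \<epsilon> / 2 ^ j" if x: "x \<in> K" for j x
    proof -
      have "\<bar>f (rep j x) - f x\<bar> \<le> \<epsilon> / 2 ^ Suc j"
        using tf rep[OF nearK[OF x]] x E_sym by blast
      also have "\<dots> \<le> \<epsilon> / 2 ^ j" using \<epsilon> by (simp add: field_simps)
      finally show ?thesis using nearK[OF x] by (simp add: G_def)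
    qed
    fix l p q g a B n
    assume p: "t l \<le> p" and g: "inv_fun p g" and B: "\<forall>k<q. \<bar>R a k\<bar> \<le> B" "(0::real) \<le> B"
    have "mlt p q g (\<lambda>k. (\<mu> k - G l (\<kappa> k)) * a k) =
        (\<lambda>k. \<Sum>j=Suc l..l + q. mlt (max p (t j)) q (\<lambda>x. g x * dl j x) a k)"
    proof
      fix k
      show "mlt p q g (\<lambda>k. (\<mu> k - G l (\<kappa> k)) * a k) k =
        (\<Sum>j=Suc l..l + q. mlt (max p (t j)) q (\<lambda>x. g x * dl j x) a k)"
      proof (cases "p \<le> k \<and> k < q")
        case True
        then have "\<mu> k - G l (\<kappa> k) = (\<Sum>j=Suc l..l + q. if t j \<le> k then dl j (\<kappa> k) else 0)"
          using p by (intro \<mu>_tail) auto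
        then show ?thesis using True
          by (auto simp: mlt_def sum_distrib_left sum_distrib_right intro!: sum.cong)
      next
        case False
        then show ?thesis by (auto simp: mlt_def intro!: sum.neutral)
      qed
    qed
    then have "\<bar>R (mlt p q g (\<lambda>k. (\<mu> k - G l (\<kappa> k)) * a k)) n\<bar> \<le>
        (\<Sum>j=Suc l..l + q. \<bar>R (mlt (max p (t j)) q (\<lambda>x. g x * dl j x) a) n\<bar>)"
      by (simp add: R_sum sum_abs)
    also have "\<dots> \<le> (\<Sum>j=Suc l..l + q. 8 * B * (\<epsilon> / 2 ^ j))"
    proof (rule sum_mono)
      fix j assume j: "j \<in> {Suc l..l + q}"
      show "\<bar>R (mlt (max p (t j)) q (\<lambda>x. g x * dl j x) a) n\<bar> \<le> 8 * B * (\<epsilon> / 2 ^ j)"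
      proof (rule mlt_bound_scaled)
        show "\<forall>x. \<bar>g x * dl j x\<bar> \<le> \<epsilon> / 2 ^ j"
          unfolding abs_mult using dl_small[of j] g j
          by (auto simp: inv_fun_def intro: order_trans[OF mult_left_le_one_le])
        show "\<forall>x y. E (max p (t j)) x y \<longrightarrow> g x * dl j x = g y * dl j y"
          using dl_inv g E_mono[of p "max p (t j)"] E_mono[of "t j" "max p (t j)"]
          unfolding inv_fun_def by (metis max.cobounded1 max.cobounded2)
      qed (use B in auto)
    qed
    also have "\<dots> = 8 * B * (\<Sum>j=Suc l..l + q. \<epsilon> / 2 ^ j)" by (simp add: sum_distrib_left)
    also have "\<dots> \<le> 8 * B * (\<epsilon> / 2 ^ l)"
      using geometric_tail[of \<epsilon> l q] \<epsilon> B by (intro mult_left_mono) auto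
    finally show "\<bar>R (mlt p q g (\<lambda>k. (\<mu> k - G l (\<kappa> k)) * a k)) n\<bar> \<le> 8 * B * \<epsilon> / 2 ^ l" by simp
  qed
  then show ?thesis by blast
qed

lemma symb_tail:
  assumes "symb c \<epsilon> t G f \<mu>" "t j \<le> p" "inv_fun p g" "\<And>k. k < q \<Longrightarrow> \<bar>R a k\<bar> \<le> B" "0 \<le> B"
  shows "\<bar>R (mlt p q g (\<lambda>k. (\<mu> k - G j (\<kappa> k)) * a k)) n\<bar> \<le> 8 * B * \<epsilon> / 2 ^ j"
  using assms unfolding symb_def by blast

lemma symb_approx: "symb c \<epsilon> t G f \<mu> \<Longrightarrow> x \<in> K \<Longrightarrow> \<bar>G j x - f x\<bar> \<le> \<epsilon> / 2 ^ j"
  unfolding symb_def by blast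

lemma symb_limit:
  assumes S: "symb c \<epsilon> t G f \<mu>" and \<delta>: "0 < \<delta>"
  shows "\<exists>N. \<forall>n\<ge>N. \<bar>\<mu> n - f (\<kappa> n)\<bar> \<le> \<delta>"
proof -
  have \<epsilon>: "0 < \<epsilon>" using S by (simp add: symb_def)
  obtain j where j: "17 * \<epsilon> / \<delta> < 2 ^ j" using real_arch_pow[of 2 "17 * \<epsilon> / \<delta>"] by auto
  have "17 * \<epsilon> < 2 ^ j * \<delta>" using j \<delta> by (simp add: field_simps)
  then have j': "17 * \<epsilon> / 2 ^ j \<le> \<delta>" by (simp add: field_simps)
  have "\<bar>\<mu> n - f (\<kappa> n)\<bar> \<le> \<delta>" if n: "t j \<le> n" for n
  proof -
    have "\<bar>R (mlt n (Suc n) (\<lambda>_. 1) (\<lambda>k. (\<mu> k - G j (\<kappa> k)) * unit n k)) n\<bar> \<le> 8 * 2 * \<epsilon> / 2 ^ j"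
      by (rule symb_tail[OF S n]) (use unit_bound in auto)
    then have "\<bar>\<mu> n - G j (\<kappa> n)\<bar> \<le> 16 * \<epsilon> / 2 ^ j" by (simp add: R_mlt_point unit_def)
    moreover have "\<bar>G j (\<kappa> n) - f (\<kappa> n)\<bar> \<le> \<epsilon> / 2 ^ j" using symb_approx[OF S \<kappa>_in] .
    ultimately have "\<bar>\<mu> n - f (\<kappa> n)\<bar> \<le> 16 * \<epsilon> / 2 ^ j + \<epsilon> / 2 ^ j" by linarith
    also have "\<dots> = 17 * \<epsilon> / 2 ^ j" by (simp add: add_divide_distrib[symmetric])
    finally show ?thesis using j' by linarith
  qed
  then show ?thesis by blast
qed

lemma symb_bdd:
  assumes S: "symb c \<epsilon> t G f \<mu>"
  shows "\<exists>L. bdd_op L (\<lambda>a. R (\<lambda>k. \<mu> k * a k))"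
proof -
  have \<epsilon>: "0 < \<epsilon>" and G: "\<forall>x. \<bar>G 0 x\<bar> \<le> c" "\<forall>x y. E (t 0) x y \<longrightarrow> G 0 x = G 0 y" using S by (auto simp: symb_def)
  have c: "0 \<le> c" using G(1) abs_ge_zero order_trans by blast
  define L where "L = (\<Sum>k<t 0. 16 * \<bar>\<mu> k\<bar>) + 8 * \<epsilon> + 8 * c"
  have L: "0 \<le> L" using \<epsilon> c by (simp add: L_def sum_nonneg)
  have "\<bar>R (\<lambda>k. \<mu> k * a k) n\<bar> \<le> L * B" if a: "fs a" and B: "\<forall>n. \<bar>R a n\<bar> \<le> B" for a B n
  proof -
    have B0: "0 \<le> B" using B abs_ge_zero order_trans by blast
    obtain q where q: "supp 0 q a" using a by (auto simp: fs_def)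
    define p where "p = t 0"
    have "(\<lambda>k. \<mu> k * a k) = (\<lambda>k. (\<Sum>i<p. \<mu> i * a i * unit i k) + (mlt p q (\<lambda>_. 1) (\<lambda>k. (\<mu> k - G 0 (\<kappa> k)) * a k) k + mlt p q (G 0) a k))"
    proof
      fix k
      have "(\<Sum>i<p. \<mu> i * a i * unit i k) = (if k < p then \<mu> k * a k else 0)"
        by (simp add: unit_def if_distrib[of "\<lambda>x. _ * x"] cong: if_cong)
      then show "\<mu> k * a k = (\<Sum>i<p. \<mu> i * a i * unit i k) + (mlt p q (\<lambda>_. 1) (\<lambda>k. (\<mu> k - G 0 (\<kappa> k)) * a k) k + mlt p q (G 0) a k)"
        using q by (auto simp: mlt_def supp_def algebra_simps)
    qed
    then have eq: "R (\<lambda>k. \<mu> k * a k) n = (\<Sum>i<p. \<mu> i * a i * R (unit i) n) +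
       (R (mlt p q (\<lambda>_. 1) (\<lambda>k. (\<mu> k - G 0 (\<kappa> k)) * a k)) n + R (mlt p q (G 0) a) n)"
      by (simp only: R_add R_sum finite_lessThan R_scale)
    have "\<bar>\<Sum>i<p. \<mu> i * a i * R (unit i) n\<bar> \<le> (\<Sum>i<p. 16 * \<bar>\<mu> i\<bar> * B)"
    proof (rule order_trans[OF sum_abs], rule sum_mono)
      fix i
      have "\<bar>a i\<bar> \<le> 8 * B" by (rule coord_bound) (use B B0 in auto)
      then have "\<bar>\<mu> i * a i\<bar> * \<bar>R (unit i) n\<bar> \<le> \<bar>\<mu> i\<bar> * (8 * B) * 2"
        unfolding abs_mult using unit_bound by (intro mult_mono) (auto simp: B0)
      then show "\<bar>\<mu> i * a i * R (unit i) n\<bar> \<le> 16 * \<bar>\<mu> i\<bar> * B" by (simp add: abs_mult algebra_simps)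
    qed
    moreover have "\<bar>R (mlt p q (\<lambda>_. 1) (\<lambda>k. (\<mu> k - G 0 (\<kappa> k)) * a k)) n\<bar> \<le> 8 * B * \<epsilon> / 2 ^ 0"
      by (rule symb_tail[OF S]) (use B B0 in \<open>auto simp: p_def\<close>)
    moreover have "\<bar>R (mlt p q (G 0) a) n\<bar> \<le> 8 * B * c"
      by (rule mlt_bound_scaled) (use B B0 G in \<open>auto simp: p_def\<close>)
    ultimately have "\<bar>R (\<lambda>k. \<mu> k * a k) n\<bar> \<le> (\<Sum>i<p. 16 * \<bar>\<mu> i\<bar> * B) + (8 * B * \<epsilon> / 2 ^ 0 + 8 * B * c)"
      unfolding eq by linarith
    also have "\<dots> = L * B" unfolding L_def p_def distrib_right sum_distrib_right by simp
    finally show ?thesis .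
  qed
  then have "bdd_op L (\<lambda>a. R (\<lambda>k. \<mu> k * a k))"
    unfolding bdd_op_def using L by (auto simp: R_add[symmetric] R_scale[symmetric] algebra_simps)
  then show ?thesis by blast
qed

text \<open>On the cell around \<open>x\<close> the approximation \<open>G j\<close> is constant and
  close to \<open>f x\<close>; what remains is the tail of \<open>\<mu>\<close> beyond
  \<open>G j\<close>.\<close>

lemma symb_cell:
  assumes S: "symb c \<epsilon> t G f \<mu>" and x: "x \<in> K" and \<delta>: "0 < \<delta>"
  shows "\<exists>p. \<forall>p'\<ge>p. \<forall>q a B n. (\<forall>k<q. \<bar>R a k\<bar> \<le> B) \<longrightarrow> 0 \<le> B \<longrightarrow>
     \<bar>R (mlt p' q (cell p' x) (\<lambda>k. (\<mu> k - f x) * a k)) n\<bar> \<le> \<delta> * B"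
proof -
  have \<epsilon>: "0 < \<epsilon>" using S by (simp add: symb_def)
  obtain j where j: "16 * \<epsilon> / \<delta> < 2 ^ j" using real_arch_pow[of 2 "16 * \<epsilon> / \<delta>"] by auto
  have "16 * \<epsilon> < 2 ^ j * \<delta>" using j \<delta> by (simp add: field_simps)
  then have j': "16 * \<epsilon> / 2 ^ j \<le> \<delta>" by (simp add: field_simps)
  have "\<bar>R (mlt p' q (cell p' x) (\<lambda>k. (\<mu> k - f x) * a k)) n\<bar> \<le> \<delta> * B"
    if p': "t j \<le> p'" and B: "\<forall>k<q. \<bar>R a k\<bar> \<le> B" "0 \<le> B" for p' q a B n
  proof -
    have "G j (\<kappa> k) = G j x" if "E p' (\<kappa> k) x" for k
      using E_mono[OF p' that] S unfolding symb_def by blast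
    then have "mlt p' q (cell p' x) (\<lambda>k. (\<mu> k - f x) * a k) =
      (\<lambda>k. mlt p' q (cell p' x) (\<lambda>k. (\<mu> k - G j (\<kappa> k)) * a k) k + (G j x - f x) * mlt p' q (cell p' x) a k)"
      by (auto simp: mlt_def cell_def algebra_simps fun_eq_iff)
    then have "R (mlt p' q (cell p' x) (\<lambda>k. (\<mu> k - f x) * a k)) n =
      R (mlt p' q (cell p' x) (\<lambda>k. (\<mu> k - G j (\<kappa> k)) * a k)) n + (G j x - f x) * R (mlt p' q (cell p' x) a) n"
      by (simp only: R_add R_scale)
    moreover have "\<bar>R (mlt p' q (cell p' x) (\<lambda>k. (\<mu> k - G j (\<kappa> k)) * a k)) n\<bar> \<le> 8 * B * \<epsilon> / 2 ^ j"
      by (rule symb_tail[OF S p']) (use B in auto)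
    moreover have "\<bar>G j x - f x\<bar> \<le> \<epsilon> / 2 ^ j" using symb_approx[OF S x] .
    then have "\<bar>(G j x - f x) * R (mlt p' q (cell p' x) a) n\<bar> \<le> \<epsilon> / 2 ^ j * (8 * B)"
      unfolding abs_mult by (intro mult_mono mlt_bound) (use B \<epsilon> in auto)
    ultimately have "\<bar>R (mlt p' q (cell p' x) (\<lambda>k. (\<mu> k - f x) * a k)) n\<bar> \<le> 8 * B * \<epsilon> / 2 ^ j + \<epsilon> / 2 ^ j * (8 * B)"
      by linarith
    also have "\<dots> = 16 * \<epsilon> / 2 ^ j * B" by (simp add: field_simps)
    also have "\<dots> \<le> \<delta> * B" using j' B by (intro mult_right_mono) auto
    finally show ?thesis .
  qed
  then show ?thesis by blast
qed

text \<open>Adding up the cells would cost a factor that depends on their number. Instead each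
  coordinate \<open>n\<close> is compared with the cell of \<open>\<kappa> n\<close> alone: the
  error is at most \<open>16 / 32\<close> of the norm, and since the norm is known to be finite it
  can be absorbed.\<close>

lemma norm_from_cells:
  assumes a: "\<And>n. \<bar>R a n\<bar> \<le> B" and p: "supp p q a" and \<epsilon>: "0 \<le> \<epsilon>"
    and F: "\<forall>y\<in>K. \<exists>x\<in>F. E (\<pi> x) y x" "\<And>x. x \<in> F \<Longrightarrow> \<pi> x \<le> p"
    and cells: "\<And>x n. x \<in> F \<Longrightarrow> \<bar>R (mlt p q (cell (\<pi> x) x) a) n\<bar> \<le> \<epsilon>"
  shows "\<bar>R a n\<bar> \<le> 2 * \<epsilon>"
proof -
  define S where "S = (SUP n. \<bar>R a n\<bar>)"
  have bdd: "bdd_above (range (\<lambda>n. \<bar>R a n\<bar>))" using a by (auto intro!: bdd_aboveI2)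
  have le: "\<bar>R a n\<bar> \<le> S" for n unfolding S_def using bdd by (auto intro: cSUP_upper)
  have S0: "0 \<le> S" using le[of 0] by linarith
  have "\<bar>R a n\<bar> \<le> \<epsilon> + S / 2" for n
  proof -
    obtain x where x: "x \<in> F" "E (\<pi> x) (\<kappa> n) x" using F \<kappa>_in by blast
    have "inv_fun p (cell (\<pi> x) x)" using F(2)[OF x(1)] by (rule inv_fun_mono[OF _ inv_fun_cell])
    then have "\<bar>R (mlt p q (cell (\<pi> x) x) a) n - cell (\<pi> x) x (\<kappa> n) * R (mlt p q (\<lambda>_. 1) a) n\<bar> \<le> 16 * S / m (wt n)"
      by (rule mlt_local) (use le S0 in auto)
    also have "\<dots> \<le> 16 * S / 32" using m_ge[of "wt n"] S0 by (intro divide_left_mono) (auto intro: m_pos)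
    finally have "\<bar>R (mlt p q (cell (\<pi> x) x) a) n - cell (\<pi> x) x (\<kappa> n) * R (mlt p q (\<lambda>_. 1) a) n\<bar> \<le> S / 2" by simp
    moreover have "mlt p q (\<lambda>_. 1) a = a" using p by (fastforce simp: mlt_def supp_def)
    ultimately show ?thesis using cells[OF x(1), of n] x(2) unfolding cell_def
      by (simp only: if_True mult_1)
  qed
  then have "S \<le> \<epsilon> + S / 2" unfolding S_def by (intro cSUP_least) auto
  then show ?thesis using le[of n] by linarith
qed

text \<open>Near each point the operator and the multiplier are both close to the same scalar
  \<open>f x\<close>. A finite subfamily of the cells where this holds covers \<open>K\<close>, and
  \<open>norm_from_cells\<close> turns the local comparisons into one of norms.\<close>

lemma RIS_perturbation:
  assumes U: "bdd_op L U" and into: "op_into U"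
    and f: "\<forall>x\<in>K. \<forall>\<epsilon>>0. \<exists>p i. \<forall>n. E p (\<kappa> n) x \<longrightarrow> i \<le> wt n \<longrightarrow> \<bar>diag_coeff U n - f x\<bar> \<le> \<epsilon>"
    and S: "symb c e t G f \<mu>" and C: "0 \<le> C" and \<epsilon>: "0 < \<epsilon>"
  shows "\<exists>p i. \<forall>v q. supp p q v \<longrightarrow> GV C i v \<longrightarrow> (\<forall>n. \<bar>U v n - R (\<lambda>k. \<mu> k * v k) n\<bar> \<le> \<epsilon>)"
proof -
  \<comment> \<open>Each cell gives at most \<open>16 * \<delta> + \<delta>\<close>, rounded up to
    \<open>20 * \<delta>\<close>, and \<open>norm_from_cells\<close> doubles it; this uses half of
    \<open>\<epsilon>\<close>. The other half is the distance from \<open>y\<close> to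
    \<open>U v\<close>.\<close>
  define \<delta> where "\<delta> = \<epsilon> / 80"
  have \<delta>: "0 < \<delta>" using \<epsilon> by (simp add: \<delta>_def)
  define loc where "loc x p i d \<longleftrightarrow> 0 < d \<and> (\<forall>v y q. supp p q v \<longrightarrow> supp p q y \<longrightarrow> GV C i v \<longrightarrow>
     (\<forall>n. \<bar>R y n - U v n\<bar> \<le> d) \<longrightarrow>
     (\<forall>k. \<bar>R (mlt p q (cell p x) (\<lambda>k. y k - f x * v k)) k\<bar> \<le> 2 * \<delta>))" for x p i and d :: real
  have "\<exists>p i d. loc x p i d" if x: "x \<in> K" for x
  proof -
    obtain p i d where d: "0 < d" and p: "\<And>v y q. supp p q v \<Longrightarrow> supp p q y \<Longrightarrow> GV C i v \<Longrightarrow> (\<forall>n. \<bar>R y n - U v n\<bar> \<le> d) \<Longrightarrow>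
       \<exists>M. \<forall>n. \<kappa> n = x \<longrightarrow> M \<le> wt n \<longrightarrow>
        (\<forall>k. \<bar>R (mlt p q (cell p x) (\<lambda>k. y k - diag_coeff U n * v k)) k\<bar> \<le> \<delta>)"
      using local_scalar[OF U into x C \<delta>] by blast
    have "\<bar>R (mlt p q (cell p x) (\<lambda>k. y k - f x * v k)) k\<bar> \<le> 2 * \<delta>"
      if v: "supp p q v" "supp p q y" "GV C i v" "\<forall>n. \<bar>R y n - U v n\<bar> \<le> d" for v y q k
    proof -
      obtain M where M: "\<And>n k. \<kappa> n = x \<Longrightarrow> M \<le> wt n \<Longrightarrow>
         \<bar>R (mlt p q (cell p x) (\<lambda>k. y k - diag_coeff U n * v k)) k\<bar> \<le> \<delta>"
        using p[OF v] by blast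
      obtain p' i' where f': "\<And>n. E p' (\<kappa> n) x \<Longrightarrow> i' \<le> wt n \<Longrightarrow> \<bar>diag_coeff U n - f x\<bar> \<le> \<delta> / (C + 1)"
        using f x \<delta> C by (metis add_nonneg_pos divide_pos_pos zero_less_one)
      obtain n where n: "\<kappa> n = x" "wt n = max M i'" using ex_root[OF x] by blast
      have dn: "\<bar>diag_coeff U n - f x\<bar> \<le> \<delta> / (C + 1)" using f'[of n] n E_refl by simp
      have "mlt p q (cell p x) (\<lambda>k. y k - f x * v k) = (\<lambda>k. mlt p q (cell p x) (\<lambda>k. y k - diag_coeff U n * v k) k
          + (diag_coeff U n - f x) * mlt p q (cell p x) v k)"
        by (auto simp: mlt_def algebra_simps)
      then have "R (mlt p q (cell p x) (\<lambda>k. y k - f x * v k)) k =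
         R (mlt p q (cell p x) (\<lambda>k. y k - diag_coeff U n * v k)) k + (diag_coeff U n - f x) * R (mlt p q (cell p x) v) k"
        by (simp only: R_add R_scale)
      moreover have "\<bar>R (mlt p q (cell p x) (\<lambda>k. y k - diag_coeff U n * v k)) k\<bar> \<le> \<delta>"
        using M n by simp
      moreover have "\<bar>R (mlt p q (cell p x) v) k\<bar> \<le> C + 1" using GV_bound[OF v(3) inv_fun_cell[of p x], of q k] by simp
      then have "\<bar>(diag_coeff U n - f x) * R (mlt p q (cell p x) v) k\<bar> \<le> \<delta> / (C + 1) * (C + 1)"
        unfolding abs_mult using dn C \<delta> by (intro mult_mono) auto
      then have "\<bar>(diag_coeff U n - f x) * R (mlt p q (cell p x) v) k\<bar> \<le> \<delta>" using C by simp
      ultimately show ?thesis by linarith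
    qed
    then have "loc x p i d" using d unfolding loc_def by blast
    then show ?thesis by blast
  qed
  then obtain sp si sd where sl: "\<And>x. x \<in> K \<Longrightarrow> loc x (sp x) (si x) (sd x)" by metis
  have s: "0 < sd x" "\<And>v y q k. supp (sp x) q v \<Longrightarrow> supp (sp x) q y \<Longrightarrow> GV C (si x) v \<Longrightarrow>
     (\<forall>n. \<bar>R y n - U v n\<bar> \<le> sd x) \<Longrightarrow>
     \<bar>R (mlt (sp x) q (cell (sp x) x) (\<lambda>k. y k - f x * v k)) k\<bar> \<le> 2 * \<delta>" if "x \<in> K" for x
    using sl[OF that] unfolding loc_def by blast+
  define loc' where "loc' x p \<longleftrightarrow> (\<forall>p'\<ge>p. \<forall>q a B n. (\<forall>k<q. \<bar>R a k\<bar> \<le> B) \<longrightarrow> 0 \<le> B \<longrightarrow>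
     \<bar>R (mlt p' q (cell p' x) (\<lambda>k. (\<mu> k - f x) * a k)) n\<bar> \<le> \<delta> / (C + 1) * B)" for x p
  have "\<exists>p. loc' x p" if "x \<in> K" for x
    using symb_cell[OF S that, of "\<delta> / (C + 1)"] \<delta> C unfolding loc'_def by simp
  then obtain r where r': "\<And>x. x \<in> K \<Longrightarrow> loc' x (r x)" by metis
  have r: "\<bar>R (mlt p' q (cell p' x) (\<lambda>k. (\<mu> k - f x) * a k)) n\<bar> \<le> \<delta> / (C + 1) * B"
    if "x \<in> K" "r x \<le> p'" "\<forall>k<q. \<bar>R a k\<bar> \<le> B" "0 \<le> B" for x p' q a B n
    using r'[OF that(1)] that(2-) unfolding loc'_def by blast
  define \<pi> where "\<pi> x = max (sp x) (r x)" for x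
  obtain F where F: "finite F" "F \<subseteq> K" "\<forall>y\<in>K. \<exists>x\<in>F. E (\<pi> x) y x" using K_cover[of \<pi>] by auto
  have F0: "F \<noteq> {}" using F(3) \<kappa>_in by blast
  define P I d where "P = Max (\<pi> ` F)" and "I = Max ((\<lambda>x. si x) ` F)" and
    "d = min (\<epsilon> / 2) (Min ((\<lambda>x. sd x) ` F))"
  have P: "\<pi> x \<le> P" and I: "si x \<le> I" and dx: "d \<le> sd x" if "x \<in> F" for x
    using that F(1) by (auto simp: P_def I_def d_def intro: min.coboundedI2)
  have d: "0 < d" "d \<le> \<epsilon> / 2" using s(1) F F0 \<epsilon> by (auto simp: d_def)
  obtain p1 i1 where p1: "\<And>v q. supp p1 q v \<Longrightarrow> GV C i1 v \<Longrightarrow> \<exists>y q'. supp P q' y \<and> (\<forall>n. \<bar>R y n - U v n\<bar> \<le> d)"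
    using approx_far[OF U into C d(1), of P] by meson
  obtain L\<mu> where L\<mu>: "bdd_op L\<mu> (\<lambda>a. R (\<lambda>k. \<mu> k * a k))" using symb_bdd[OF S] by blast
  have "\<bar>U v n - R (\<lambda>k. \<mu> k * v k) n\<bar> \<le> \<epsilon>" if v: "supp (max P p1) q v" "GV C (max I i1) v" for v q n
  proof -
    obtain y q' where y: "supp P q' y" "\<forall>n. \<bar>R y n - U v n\<bar> \<le> d"
      using p1[of q v] v by (meson GV_mono max.cobounded2 order_refl supp_mono)
    define Q where "Q = max q q'"
    have vQ: "supp P Q v" and yQ: "supp P Q y"
      using supp_mono[OF v(1), of P Q] supp_mono[OF y(1), of P Q] by (auto simp: Q_def)
    define a where "a = (\<lambda>k. y k - \<mu> k * v k)"
    have aQ: "supp P Q a" using vQ yQ unfolding a_def supp_def by (metis diff_0_right mult_zero_right)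
    have vC: "\<forall>n. \<bar>R v n\<bar> \<le> C" using GV_norm[OF v(2)] by blast
    have ULb: "\<bar>U v n\<bar> \<le> L * C" "\<bar>R (\<lambda>k. \<mu> k * v k) n\<bar> \<le> L\<mu> * C" for n
      using U L\<mu> vC supp_fs[OF vQ] unfolding bdd_op_def by blast+
    have ab: "\<bar>R a n\<bar> \<le> L * C + d + L\<mu> * C" for n
      using y(2)[rule_format, of n] ULb[of n] unfolding a_def R_diff by linarith
    have cells: "\<bar>R (mlt P Q (cell (\<pi> x) x) a) n\<bar> \<le> 20 * \<delta>" if x: "x \<in> F" for x n
    proof -
      have xK: "x \<in> K" using x F by blast
      let ?p = "sp x"
      have pp: "?p \<le> \<pi> x" "r x \<le> \<pi> x" by (auto simp: \<pi>_def)
      have pP: "?p \<le> P" using pp P[OF x] by simp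
      have "GV C (si x) v" using v(2) I[OF x] by (auto intro: GV_mono)
      moreover have "\<forall>n. \<bar>R y n - U v n\<bar> \<le> sd x" using y(2) dx[OF x] order_trans by blast
      ultimately have b1: "\<bar>R (mlt ?p Q (cell ?p x) (\<lambda>k. y k - f x * v k)) k\<bar> \<le> 2 * \<delta>" for k
        using s(2)[OF xK] supp_mono[OF vQ pP] supp_mono[OF yQ pP] by blast
      have "mlt P Q (cell (\<pi> x) x) (\<lambda>k. y k - f x * v k) =
          mlt P Q (cell (\<pi> x) x) (mlt ?p Q (cell ?p x) (\<lambda>k. y k - f x * v k))"
        using pP E_mono[OF pp(1)] by (auto simp: mlt_def cell_def fun_eq_iff)
      moreover have "inv_fun P (cell (\<pi> x) x)" using P[OF x] by (rule inv_fun_mono[OF _ inv_fun_cell])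
      ultimately have b2: "\<bar>R (mlt P Q (cell (\<pi> x) x) (\<lambda>k. y k - f x * v k)) n\<bar> \<le> 8 * (2 * \<delta>)"
        using mlt_bound[of P "cell (\<pi> x) x" Q "mlt ?p Q (cell ?p x) (\<lambda>k. y k - f x * v k)" "2 * \<delta>" n] b1 \<delta> by simp
      have "mlt P Q (cell (\<pi> x) x) (\<lambda>k. (\<mu> k - f x) * v k) = mlt (\<pi> x) Q (cell (\<pi> x) x) (\<lambda>k. (\<mu> k - f x) * v k)"
        using vQ P[OF x] by (auto simp: mlt_def supp_def fun_eq_iff)
      moreover have "\<bar>R (mlt (\<pi> x) Q (cell (\<pi> x) x) (\<lambda>k. (\<mu> k - f x) * v k)) n\<bar> \<le> \<delta> / (C + 1) * C"
        by (rule r[OF xK pp(2)]) (use vC C in auto)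
      moreover have "\<delta> / (C + 1) * C \<le> \<delta>" using C \<delta> by (simp add: field_simps)
      ultimately have b3: "\<bar>R (mlt P Q (cell (\<pi> x) x) (\<lambda>k. (\<mu> k - f x) * v k)) n\<bar> \<le> \<delta>" by simp
      have "mlt P Q (cell (\<pi> x) x) a = (\<lambda>k. mlt P Q (cell (\<pi> x) x) (\<lambda>k. y k - f x * v k) k
          - mlt P Q (cell (\<pi> x) x) (\<lambda>k. (\<mu> k - f x) * v k) k)"
        by (auto simp: mlt_def a_def algebra_simps)
      then show ?thesis using b2 b3 \<delta> by (simp add: R_diff)
    qed
    have "\<bar>R a n\<bar> \<le> 2 * (20 * \<delta>)"
      by (rule norm_from_cells[OF ab aQ _ F(3) P cells]) (use \<delta> in auto)
    then have "\<bar>R y n - R (\<lambda>k. \<mu> k * v k) n\<bar> \<le> \<epsilon> / 2" by (simp add: a_def R_diff \<delta>_def)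
    then show ?thesis using y(2)[rule_format, of n] d(2) by linarith
  qed
  then show ?thesis by blast
qed

theorem diagonal_plus_small:
  assumes U: "bdd_op L U" and into: "op_into U"
    and f: "\<forall>x\<in>K. \<forall>\<epsilon>>0. \<exists>p i. \<forall>n. E p (\<kappa> n) x \<longrightarrow> i \<le> wt n \<longrightarrow> \<bar>diag_coeff U n - f x\<bar> \<le> \<epsilon>"
    and S: "symb c e t G f \<mu>" and \<epsilon>: "0 < \<epsilon>"
  shows "\<exists>p. \<forall>v q. supp p q v \<longrightarrow> (\<forall>n. \<bar>R v n\<bar> \<le> 1) \<longrightarrow> (\<forall>n. \<bar>U v n - R (\<lambda>k. \<mu> k * v k) n\<bar> \<le> \<epsilon>)"
proof (rule block_small[OF _ _ \<epsilon>, where W = "\<lambda>v n. U v n - R (\<lambda>k. \<mu> k * v k) n"])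
  fix a a' assume "fs a" "fs a'"
  then have "U (\<lambda>k. a k + a' k) = (\<lambda>k. U a k + U a' k)" using U by (simp add: bdd_op_def)
  then show "(\<lambda>n. U (\<lambda>k. a k + a' k) n - R (\<lambda>k. \<mu> k * (a k + a' k)) n) =
      (\<lambda>k. (U a k - R (\<lambda>k. \<mu> k * a k) k) + (U a' k - R (\<lambda>k. \<mu> k * a' k) k))"
    by (simp add: R_add distrib_left fun_eq_iff)
qed (rule RIS_perturbation[OF U into f S])

text \<open>A finite subcover makes continuity at each point uniform. Cells are equivalence classes,
  so two points in a common fine cell share the cell of the same centre.\<close>

lemma E_continuousI:
  assumes f: "\<And>x \<epsilon>. x \<in> K \<Longrightarrow> 0 < \<epsilon> \<Longrightarrow> \<exists>p. \<forall>y\<in>K. E p y x \<longrightarrow> \<bar>f y - f x\<bar> \<le> \<epsilon>"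
  shows "E_continuous f"
  unfolding E_continuous_def
proof (intro allI impI)
  fix \<epsilon> :: real assume \<epsilon>: "0 < \<epsilon>"
  define loc where "loc x p \<longleftrightarrow> (\<forall>y\<in>K. E p y x \<longrightarrow> \<bar>f y - f x\<bar> \<le> \<epsilon> / 2)" for x p
  have "\<exists>p. loc x p" if "x \<in> K" for x
    using f[OF that, of "\<epsilon> / 2"] \<epsilon> unfolding loc_def by simp
  then obtain \<pi> where \<pi>': "\<And>x. x \<in> K \<Longrightarrow> loc x (\<pi> x)" by metis
  then have \<pi>: "\<And>x y. x \<in> K \<Longrightarrow> y \<in> K \<Longrightarrow> E (\<pi> x) y x \<Longrightarrow> \<bar>f y - f x\<bar> \<le> \<epsilon> / 2"
    unfolding loc_def by blast
  obtain F where F: "finite F" "F \<subseteq> K" "\<forall>y\<in>K. \<exists>x\<in>F. E (\<pi> x) y x" using K_cover[of \<pi>] by auto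
  have "\<bar>f x - f y\<bar> \<le> \<epsilon>" if xy: "x \<in> K" "y \<in> K" "E (Max (\<pi> ` F)) x y" for x y
  proof -
    obtain z where z: "z \<in> F" "E (\<pi> z) x z" using F xy by blast
    have "\<pi> z \<le> Max (\<pi> ` F)" using F(1) z(1) by simp
    then have "E (\<pi> z) x y" using xy(3) by (rule E_mono)
    then have "E (\<pi> z) y z" using z E_sym E_trans by blast
    then have "\<bar>f y - f z\<bar> \<le> \<epsilon> / 2" "\<bar>f x - f z\<bar> \<le> \<epsilon> / 2" using \<pi> z F xy by auto
    then show ?thesis by linarith
  qed
  then show "\<exists>p. \<forall>x\<in>K. \<forall>y\<in>K. E p x y \<longrightarrow> \<bar>f x - f y\<bar> \<le> \<epsilon>" by blast
qed

lemma diag_symbol_continuous: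
  assumes f: "\<forall>x\<in>K. \<forall>\<epsilon>>0. \<exists>p i. \<forall>n. E p (\<kappa> n) x \<longrightarrow> i \<le> wt n \<longrightarrow> \<bar>diag_coeff U n - f x\<bar> \<le> \<epsilon>"
  shows "E_continuous f"
proof (rule E_continuousI)
  fix x and \<epsilon> :: real assume x: "x \<in> K" and \<epsilon>: "0 < \<epsilon>"
  obtain p i where p: "\<And>n. E p (\<kappa> n) x \<Longrightarrow> i \<le> wt n \<Longrightarrow> \<bar>diag_coeff U n - f x\<bar> \<le> \<epsilon> / 2"
    using f x \<epsilon> by (metis divide_pos_pos zero_less_numeral)
  have "\<bar>f y - f x\<bar> \<le> \<epsilon>" if y: "y \<in> K" "E p y x" for y
  proof -
    obtain p' i' where p': "\<And>n. E p' (\<kappa> n) y \<Longrightarrow> i' \<le> wt n \<Longrightarrow> \<bar>diag_coeff U n - f y\<bar> \<le> \<epsilon> / 2"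
      using f y(1) \<epsilon> by (metis divide_pos_pos zero_less_numeral)
    obtain n where n: "\<kappa> n = y" "wt n = max i i'" using ex_root[OF y(1)] by blast
    have "\<bar>diag_coeff U n - f x\<bar> \<le> \<epsilon> / 2" "\<bar>diag_coeff U n - f y\<bar> \<le> \<epsilon> / 2"
      using p[of n] p'[of n] n y(2) E_refl[of p' y] by simp_all
    then show ?thesis by linarith
  qed
  then show "\<exists>p. \<forall>y\<in>K. E p y x \<longrightarrow> \<bar>f y - f x\<bar> \<le> \<epsilon>" by blast
qed

text \<open>On the first \<^term>\<open>p\<close> coordinates the multiplication by \<^term>\<open>f\<close> acts on the values and not
  on the basis coefficients. This is what brings the norm of the operator down to \<^term>\<open>c\<close>, up to a
  multiple of the largest weight.\<close>

lemma multiplication_norm: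
  assumes S: "symb c \<epsilon> t G f \<mu>" and f: "\<forall>x\<in>K. \<bar>f x\<bar> \<le> c" and M: "\<And>j. M \<le> m j" "0 < M"
    and a: "supp 0 q a" and B: "\<And>n. \<bar>R a n\<bar> \<le> B" and p: "t 0 \<le> p"
  shows "\<bar>R (ext p (\<lambda>k. f (\<kappa> k) * R a k)) n + R (\<lambda>k. if p \<le> k then \<mu> k * a k else 0) n\<bar>
     \<le> (c + 32 * c / M + 16 * \<epsilon>) * B"
proof -
  have \<epsilon>: "0 < \<epsilon>" and G: "\<forall>x. \<bar>G 0 x\<bar> \<le> c" "\<forall>x y. E (t 0) x y \<longrightarrow> G 0 x = G 0 y" using S by (auto simp: symb_def)
  have Gp: "\<forall>x y. E p x y \<longrightarrow> G 0 x = G 0 y" using G(2) E_mono[OF p] by blast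
  have c: "0 \<le> c" using G(1) abs_ge_zero order_trans by blast
  have B0: "0 \<le> B" using B abs_ge_zero order_trans by blast
  define u where "u = (\<lambda>k. f (\<kappa> k) * R a k)"
  have ub: "\<bar>u k\<bar> \<le> c * B" for k
    unfolding u_def abs_mult using f \<kappa>_in B c by (intro mult_mono) auto
  \<comment> \<open>Along a chain \<open>\<kappa>\<close> is constant, so the values
    \<open>f (\<kappa> k) * R a k\<close> below \<open>p\<close> are carried on unchanged with the
    right factor. The step that crosses \<open>p\<close> is the only exception and contributes 8
    twice.\<close>
  have low: "\<bar>R (ext p u) n - f (\<kappa> n) * R (restr 0 p a) n\<bar> \<le> 16 * c * B / m (wt n)" for n
  proof (induction n rule: less_induct)
    case (less n)
    have pos: "0 \<le> 16 * c * B / m (wt n)" using c B0 m_pos[of "wt n"] by simp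
    show ?case
    proof (cases "n < p")
      case True
      then show ?thesis using pos by (simp add: R_restr_low u_def)
    next
      case np: False
      have an: "ext p u n = 0" "restr 0 p a n = 0" using np by (auto simp: ext_def restr_def)
      show ?thesis
      proof (cases "age n = 0")
        case True then show ?thesis using an pos by (simp add: R_root)
      next
        case node: False
        note pn = prd_less[OF node]
        show ?thesis
        proof (cases "prd n < p")
          case True
          have 1: "R (ext p u) (prd n) = f (\<kappa> n) * R (restr 0 p a) (prd n)"
            using True \<kappa>_prd[OF node] by (simp add: R_restr_low u_def)
          have "\<bar>R (J n (ext p u)) k\<bar> \<le> 8 * (c * B)" for k
            unfolding ext_def restr_mlt J_mlt
            by (rule mlt_bound) (use ub c B0 in auto)
          then have b1: "\<bar>(\<Sum>k<n. bc n k * R (J n (ext p u)) k) / m (wt n)\<bar> \<le> 8 * (c * B) / m (wt n)"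
            using c B0 by (intro bc_bound) auto
          have "\<bar>R (J n (restr 0 p a)) k\<bar> \<le> 8 * B" for k
            unfolding restr_mlt J_mlt by (rule mlt_bound) (use B B0 in auto)
          then have "\<bar>(\<Sum>k<n. bc n k * R (J n (restr 0 p a)) k) / m (wt n)\<bar> \<le> 8 * B / m (wt n)"
            using B0 by (intro bc_bound) auto
          then have b2: "\<bar>f (\<kappa> n) * ((\<Sum>k<n. bc n k * R (J n (restr 0 p a)) k) / m (wt n))\<bar> \<le> c * (8 * B / m (wt n))"
            unfolding abs_mult[of "f (\<kappa> n)"] using f \<kappa>_in c by (intro mult_mono) auto
          have "R (ext p u) n - f (\<kappa> n) * R (restr 0 p a) n = (\<Sum>k<n. bc n k * R (J n (ext p u)) k) / m (wt n)
              - f (\<kappa> n) * ((\<Sum>k<n. bc n k * R (J n (restr 0 p a)) k) / m (wt n))"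
            using 1 an by (simp add: R_node[OF node] distrib_left)
          moreover have "8 * (c * B) / m (wt n) + c * (8 * B / m (wt n)) = 16 * c * B / m (wt n)"
            by (simp add: field_simps)
          ultimately show ?thesis using b1 b2 by linarith
        next
          case False
          then have "J n (ext p u) = (\<lambda>_. 0)" "J n (restr 0 p a) = (\<lambda>_. 0)"
            by (auto simp: J_def mlt_def restr_def ext_def)
          then show ?thesis using less.IH[OF pn] an wt_prd[OF node] \<kappa>_prd[OF node] by (simp add: R_node[OF node])
        qed
      qed
    qed
  qed
  let ?h = "mlt p q (\<lambda>_. 1) (\<lambda>k. (\<mu> k - G 0 (\<kappa> k)) * a k)"
  have "(\<lambda>k. if p \<le> k then \<mu> k * a k else 0) = (\<lambda>k. ?h k + mlt p q (G 0) a k)"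
    using a by (auto simp: mlt_def supp_def algebra_simps fun_eq_iff)
  then have hi: "R (\<lambda>k. if p \<le> k then \<mu> k * a k else 0) n = R ?h n + R (mlt p q (G 0) a) n"
    by (simp only: R_add)
  have h1: "\<bar>R ?h n\<bar> \<le> 8 * B * \<epsilon> / 2 ^ 0" by (rule symb_tail[OF S p]) (use B B0 in auto)
  have h2: "\<bar>R (mlt p q (G 0) a) n - G 0 (\<kappa> n) * R (mlt p q (\<lambda>_. 1) a) n\<bar> \<le> 16 * B * c / m (wt n)"
    by (rule mlt_local_scaled[OF G(1) Gp]) (use B B0 in auto)
  have g0: "\<bar>G 0 (\<kappa> n) - f (\<kappa> n)\<bar> \<le> \<epsilon>" using symb_approx[OF S \<kappa>_in, of 0 n] by simp
  have "\<bar>R (mlt p q (\<lambda>_. 1) a) n\<bar> \<le> 8 * B" by (rule mlt_bound) (use B B0 in auto)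
  then have "\<bar>(G 0 (\<kappa> n) - f (\<kappa> n)) * R (mlt p q (\<lambda>_. 1) a) n\<bar> \<le> \<epsilon> * (8 * B)"
    unfolding abs_mult using g0 \<epsilon> by (intro mult_mono) auto
  then have h3: "\<bar>G 0 (\<kappa> n) * R (mlt p q (\<lambda>_. 1) a) n - f (\<kappa> n) * R (mlt p q (\<lambda>_. 1) a) n\<bar> \<le> \<epsilon> * (8 * B)"
    by (simp add: left_diff_distrib)
  have "a = (\<lambda>k. restr 0 p a k + mlt p q (\<lambda>_. 1) a k)"
    using a by (auto simp: mlt_def restr_def supp_def fun_eq_iff)
  then have "R a n = R (restr 0 p a) n + R (mlt p q (\<lambda>_. 1) a) n" by (metis R_add)
  then have sum: "f (\<kappa> n) * R a n = f (\<kappa> n) * R (restr 0 p a) n + f (\<kappa> n) * R (mlt p q (\<lambda>_. 1) a) n"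
    by (simp add: distrib_left)
  have mM: "x / m (wt n) \<le> x / M" if "0 \<le> x" for x
    using M m_pos that by (intro divide_left_mono) auto
  have "16 * c * B / m (wt n) \<le> 16 * c * B / M" "16 * B * c / m (wt n) \<le> 16 * B * c / M"
    using c B0 by (auto intro!: mM)
  moreover have "\<bar>f (\<kappa> n) * R a n\<bar> \<le> c * B" using ub[of n] by (simp add: u_def)
  \<comment> \<open>The main terms on both sides of \<open>p\<close> recombine to
    \<open>f (\<kappa> n) * R a n\<close>, without a constant in front of \<open>c\<close>. Of the
    errors, the crossing step and the localization give 16 each, and the two comparisons of
    \<open>\<mu>\<close> with \<open>f\<close> give 8 each.\<close>
  ultimately have "\<bar>R (ext p u) n + R (\<lambda>k. if p \<le> k then \<mu> k * a k else 0) n\<bar>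
      \<le> c * B + (16 * c * B / M + 16 * B * c / M + 8 * B * \<epsilon> / 2 ^ 0 + \<epsilon> * (8 * B))"
    unfolding hi using sum low[of n] h1 h2 h3 by linarith
  also have "\<dots> = (c + 32 * c / M + 16 * \<epsilon>) * B"
    using M(2) by (simp add: field_simps)
  finally show ?thesis by (simp only: u_def)
qed

end

section \<open>Existence of the system\<close>

definition list_coeff :: "rat list \<Rightarrow> nat \<Rightarrow> real" where
  "list_coeff l k = (if k < length l then of_rat (l ! k) else 0)"

text \<open>The second component of the pairing is ignored, so that every code recurs at arbitrarily
  large indices.\<close>

definition code_at :: "nat \<Rightarrow> bool \<times> nat \<times> nat \<times> rat list" where
  "code_at n = from_nat (fst (prod_decode n))"

lemma code_at_ex: "\<exists>n\<ge>q. code_at n = c"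
  by (intro exI[of _ "prod_encode (to_nat c, q)"]) (simp add: code_at_def le_prod_encode_2)

text \<open>The triple consists of the weight, the index of the point and the age. A code that does not
  describe an admissible node gives a root of weight \<open>0\<close>.\<close>

function node_data :: "(nat \<Rightarrow> nat) \<Rightarrow> nat \<Rightarrow> nat \<times> nat \<times> nat" where
  "node_data N n = (case code_at n of (b, i, j, l) \<Rightarrow>
     if b then (if i \<le> n then (i, j, 0) else (0, 0, 0))
     else if i < n then
       (if snd (snd (node_data N i)) < N (fst (node_data N i)) \<and> (\<Sum>k<n. \<bar>list_coeff l k\<bar>) \<le> 1 \<and>
           (odd (fst (node_data N i)) \<longrightarrow> (\<exists>h\<in>{..<n}. fst (node_data N h) = 2 * i + 2 \<and>
              list_coeff l = (\<lambda>k. if k = h then 1 else 0)))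
        then (fst (node_data N i), fst (snd (node_data N i)), Suc (snd (snd (node_data N i))))
        else (0, 0, 0))
     else (0, 0, 0))"
  by auto
termination
  by (relation "Wellfounded.measure snd") auto

declare node_data.simps [simp del]

text \<open>Rounding towards 0 keeps the sum of the absolute values of the coefficients at most
  1.\<close>

lemma rat_approx: "0 < \<delta> \<Longrightarrow> \<exists>r::rat. \<bar>of_rat r\<bar> \<le> \<bar>x\<bar> \<and> \<bar>of_rat r - x\<bar> \<le> (\<delta>::real)"
proof -
  assume \<delta>: "0 < \<delta>"
  consider "x = 0" | "0 < x" | "x < 0" by linarith
  then show ?thesis
  proof cases
    case 1
    then show ?thesis using \<delta> by (intro exI[of _ 0]) simp
  next
    case 2
    then obtain r where "max 0 (x - \<delta>) < of_rat r" "of_rat r < x"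
      using of_rat_dense[of "max 0 (x - \<delta>)" x] \<delta> by auto
    then show ?thesis by (intro exI[of _ r] conjI) linarith+
  next
    case 3
    then obtain r where "x < of_rat r" "of_rat r < min 0 (x + \<delta>)"
      using of_rat_dense[of x "min 0 (x + \<delta>)"] \<delta> by auto
    then show ?thesis by (intro exI[of _ r] conjI) linarith+
  qed
qed

text \<open>With \<open>m = 2 ^ e\<close> and depth \<open>2 * e\<close> the condition on
  \<open>2 ^ l\<close> holds with equality; the two depth constants are the ones demanded by
  \<open>nn_dom\<close>.\<close>

definition next_length :: "nat \<Rightarrow> real \<Rightarrow> nat" where
  "next_length e c = nat \<lceil>(2 ^ e)\<^sup>2 * (depth_const c (2 * e) + depth_const c (Suc (2 * e)))\<rceil>"

text \<open>The pairs are \<open>(e j, N j)\<close> with \<open>m j = 2 ^ e j\<close>. Doubling the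
  last length in the exponent makes the next weight exceed the square of that length; and since the
  lengths increase, the last one can serve as the bound \<open>c\<close> for all previous
  ones.\<close>

primrec parameters :: "nat \<Rightarrow> nat \<Rightarrow> nat \<times> nat" where
  "parameters e0 0 = (e0, next_length e0 1)"
| "parameters e0 (Suc j) = (2 * snd (parameters e0 j),
     next_length (2 * snd (parameters e0 j)) (snd (parameters e0 j)))"

lemma next_length_ge:
  assumes "1 \<le> c"
  shows "(2 ^ e)\<^sup>2 * depth_const c (2 * e) \<le> next_length e c"
    "(2 ^ e)\<^sup>2 * depth_const c (Suc (2 * e)) \<le> next_length e c"
    "c \<le> next_length e c" "e \<le> next_length e c"
proof -
  let ?a = "depth_const c (2 * e)" and ?b = "depth_const c (Suc (2 * e))"
  have a: "1 \<le> ?a" "1 \<le> ?b" using depth_const_ge[OF assms] by blast+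
  have "c * 1 \<le> c * (?a + 5)" using assms a by (intro mult_left_mono) auto
  then have b: "c \<le> ?b" by simp
  have le: "(2 ^ e)\<^sup>2 * (?a + ?b) \<le> next_length e c"
    unfolding next_length_def by (rule real_nat_ceiling_ge)
  have p: "1 \<le> (2 ^ e :: real)\<^sup>2" by (simp add: one_le_power)
  show 1: "(2 ^ e)\<^sup>2 * ?a \<le> next_length e c" and 2: "(2 ^ e)\<^sup>2 * ?b \<le> next_length e c"
    using le a p by (smt (verit) mult_left_mono zero_le_power2)+
  have "1 * c \<le> (2 ^ e)\<^sup>2 * ?b" using p b assms by (intro mult_mono) auto
  then show "c \<le> next_length e c" using 2 by linarith
  have "real e \<le> 2 ^ e" by (metis less_exp less_imp_le of_nat_le_iff of_nat_numeral of_nat_power)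
  also have "\<dots> \<le> (2 ^ e)\<^sup>2" by (simp add: power2_eq_square)
  also have "\<dots> \<le> (2 ^ e)\<^sup>2 * ?a" using a p by (simp add: mult_le_cancel_left1)
  finally have "real e \<le> next_length e c" using 1 by linarith
  then show "e \<le> next_length e c" by linarith
qed

lemma parameters_exist:
  "\<exists>m :: nat \<Rightarrow> real. \<exists>N :: nat \<Rightarrow> nat. (\<forall>j. max 32 M \<le> m j) \<and>
     (\<forall>j. \<exists>(c::real) l. 1 \<le> c \<and> (\<forall>i<j. N i \<le> c) \<and> (m j)\<^sup>2 \<le> 2 ^ l \<and>
        (m j)\<^sup>2 * depth_const c (Suc l) \<le> N j \<and> (m j)\<^sup>2 * depth_const c l \<le> N j) \<and>
     (\<forall>i j. i < j \<longrightarrow> (real (N i))\<^sup>2 \<le> m j)"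
proof -
  obtain e0 where e0: "max 32 M < 2 ^ e0" using real_arch_pow[of 2 "max 32 M"] by auto
  define e where "e j = fst (parameters e0 j)" for j
  define N where "N j = snd (parameters e0 j)" for j
  define m where "m j = (2::real) ^ e j" for j
  have e_Suc: "e (Suc j) = 2 * N j" and N_Suc: "N (Suc j) = next_length (e (Suc j)) (N j)" for j
    by (simp_all add: e_def N_def)
  have N0: "N 0 = next_length (e 0) 1" by (simp add: e_def N_def)
  have N1: "1 \<le> real (N j)" for j
  proof (induction j)
    case 0 then show ?case using next_length_ge(3)[of 1 "e 0"] by (simp add: N0)
  next
    case (Suc j) then show ?case using next_length_ge(3)[OF Suc, of "e (Suc j)"] by (simp add: N_Suc)
  qed
  have N_step: "N j \<le> N (Suc j)" for j
    using next_length_ge(3)[OF N1, of j "e (Suc j)"] by (simp add: N_Suc)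
  have N_mono: "N i \<le> N j" if "i \<le> j" for i j
    using lift_Suc_mono_le[of N, OF N_step that] .
  have eN: "e j \<le> N j" for j
    using next_length_ge(4)[OF N1] next_length_ge(4)[of 1 "e 0"] by (cases j) (auto simp: N0 N_Suc)
  have e_step: "e j \<le> e (Suc j)" for j using eN[of j] by (simp add: e_Suc)
  have "e 0 \<le> e j" for j using lift_Suc_mono_le[of e, OF e_step] by simp
  then have "max 32 M \<le> m j" for j
    using e0 power_increasing[of e0 "e j" "2::real"] unfolding m_def e_def by (metis fst_conv less_imp_le one_le_numeral order_trans parameters.simps(1))
  moreover have "\<exists>(c::real) l. 1 \<le> c \<and> (\<forall>i<j. N i \<le> c) \<and> (m j)\<^sup>2 \<le> 2 ^ l \<and>
        (m j)\<^sup>2 * depth_const c (Suc l) \<le> N j \<and> (m j)\<^sup>2 * depth_const c l \<le> N j" for j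
  proof (cases j)
    case 0
    then show ?thesis using next_length_ge[of 1 "e 0"]
      by (intro exI[of _ 1] exI[of _ "2 * e 0"]) (auto simp: m_def N0 power_mult[symmetric] mult.commute)
  next
    case (Suc i)
    have "real (N i') \<le> N i" if "i' < j" for i' using N_mono[of i' i] that Suc by simp
    then show ?thesis using next_length_ge[OF N1[of i], of "e j"] N1[of i] Suc
      by (intro exI[of _ "real (N i)"] exI[of _ "2 * e j"])
        (auto simp: m_def N_Suc power_mult[symmetric] mult.commute)
  qed
  moreover have "(real (N i))\<^sup>2 \<le> m j" if ij: "i < j" for i j
  proof -
    obtain j' where j': "j = Suc j'" using ij by (cases j) auto
    have "N i \<le> N j'" using N_mono[of i j'] ij j' by simp
    moreover have "N j' \<le> 2 ^ N j'" by (simp add: less_imp_le)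
    ultimately have "real (N i) \<le> 2 ^ N j'"
      by (metis of_nat_le_iff of_nat_numeral of_nat_power order_trans)
    then have "(real (N i))\<^sup>2 \<le> (2 ^ N j')\<^sup>2" by (intro power_mono) auto
    also have "\<dots> = m j" by (simp add: m_def j' e_Suc power_mult[symmetric] mult.commute)
    finally show ?thesis .
  qed
  ultimately show ?thesis by blast
qed

text \<open>Since \<^term>\<open>K\<close> is countable, the radii of its spheres can be avoided, so that \<^term>\<open>K\<close> has a
  countable base of balls whose traces on \<^term>\<open>K\<close> are clopen.\<close>

lemma clopen_partitions:
  fixes K :: "'k::metric_space set"
  assumes "countable K" "K \<noteq> {}"
  shows "\<exists>E :: nat \<Rightarrow> 'k \<Rightarrow> 'k \<Rightarrow> bool. (\<forall>t x. E t x x) \<and> (\<forall>t x y. E t x y \<longrightarrow> E t y x) \<and>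
     (\<forall>t x y z. E t x y \<longrightarrow> E t y z \<longrightarrow> E t x z) \<and> (\<forall>s t x y. s \<le> t \<longrightarrow> E t x y \<longrightarrow> E s x y) \<and>
     (\<forall>x\<in>K. \<forall>p. \<exists>d>0. \<forall>y. dist y x < d \<longrightarrow> E p y x) \<and>
     (\<forall>x\<in>K. \<forall>d>0. \<exists>p. \<forall>y. E p y x \<longrightarrow> dist y x < d)"
proof -
  define c where "c = from_nat_into K"
  have c: "range c = K" unfolding c_def by (rule range_from_nat_into[OF assms(2,1)])
  have "\<exists>r. 0 < r \<and> r < 1 / (real l + 1) \<and> (\<forall>y\<in>K. dist y (c i) \<noteq> r)" for i l :: nat
  proof -
    have "uncountable {0<..<1 / (real l + 1)}" by (rule uncountable_open_interval[THEN iffD2]) simp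
    moreover have "countable ((\<lambda>y. dist y (c i)) ` K)" using assms by simp
    ultimately have "\<not> {0<..<1 / (real l + 1)} \<subseteq> (\<lambda>y. dist y (c i)) ` K"
      by (meson countable_subset)
    then show ?thesis by (auto simp: image_iff)
  qed
  note ex = this
  define r where "r i l = (SOME r. 0 < r \<and> r < 1 / (real l + 1) \<and> (\<forall>y\<in>K. dist y (c i) \<noteq> r))" for i l
  have r: "0 < r i l" "r i l < 1 / (real l + 1)" "\<And>y. y \<in> K \<Longrightarrow> dist y (c i) \<noteq> r i l" for i l
    using someI_ex[OF ex[of l i]] by (simp_all add: r_def)
  define U where "U u = (case prod_decode u of (i, l) \<Rightarrow> {y. dist y (c i) < r i l})" for u
  define E where "E t x y \<longleftrightarrow> (\<forall>u<t. x \<in> U u \<longleftrightarrow> y \<in> U u)" for t :: nat and x y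
  have nbhd: "\<exists>d>0. \<forall>y. dist y x < d \<longrightarrow> E p y x" if x: "x \<in> K" for x p
  proof -
    have "\<exists>d>0. \<forall>y. dist y x < d \<longrightarrow> (y \<in> U u \<longleftrightarrow> x \<in> U u)" for u
    proof -
      obtain i l where il: "prod_decode u = (i, l)" by (cases "prod_decode u")
      define d where "d = \<bar>dist x (c i) - r i l\<bar>"
      have "0 < d" using r(3)[OF x, of i l] by (simp add: d_def)
      moreover have "y \<in> U u \<longleftrightarrow> x \<in> U u" if "dist y x < d" for y
      proof -
        have "dist y (c i) \<le> dist y x + dist x (c i)" "dist x (c i) \<le> dist y x + dist y (c i)"
          using dist_triangle[of y "c i" x] dist_triangle[of x "c i" y] by (simp_all add: dist_commute)
        then have "dist y (c i) < r i l \<longleftrightarrow> dist x (c i) < r i l"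
          using that unfolding d_def by linarith
        then show ?thesis by (simp add: U_def il)
      qed
      ultimately show ?thesis by blast
    qed
    then obtain d where d: "\<And>u. 0 < d u" "\<And>u y. dist y x < d u \<Longrightarrow> y \<in> U u \<longleftrightarrow> x \<in> U u" by metis
    show ?thesis
    proof (cases "p = 0")
      case True
      then show ?thesis by (intro exI[of _ 1]) (simp add: E_def)
    next
      case False
      then have fin: "finite (d ` {..<p})" "d ` {..<p} \<noteq> {}" by auto
      have "0 < Min (d ` {..<p})" using fin d(1) by simp
      moreover have "E p y x" if "dist y x < Min (d ` {..<p})" for y
        using that fin d(2) by (auto simp: E_def)
      ultimately show ?thesis by blast
    qed
  qed
  have sep: "\<exists>p. \<forall>y. E p y x \<longrightarrow> dist y x < d" if x: "x \<in> K" and d: "0 < d" for x d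
  proof -
    obtain i where i: "c i = x" using c x by blast
    obtain l :: nat where l: "1 / (real l + 1) < d" using reals_Archimedean[OF d] by (auto simp: inverse_eq_divide add.commute)
    have "dist y x < d" if "E (Suc (prod_encode (i, l))) y x" for y
    proof -
      have "y \<in> U (prod_encode (i, l)) \<longleftrightarrow> x \<in> U (prod_encode (i, l))" using that by (simp add: E_def)
      then show ?thesis using r(1,2)[of i l] l i by (auto simp: U_def)
    qed
    then show ?thesis by blast
  qed
  show ?thesis
    by (rule exI[of _ E]) (use nbhd sep in \<open>auto simp: E_def\<close>)
qed

lemma argyros_haydon_exists:
  fixes K :: "'k::metric_space set"
  assumes K: "compact K" "countable K" "K \<noteq> {}"
  shows "\<exists>E \<kappa> wt age prd bc m nn. argyros_haydon E \<kappa> wt age prd bc m nn K \<and> (\<forall>j. M \<le> m j) \<and>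
     (\<forall>x\<in>K. \<forall>p. \<exists>d>0. \<forall>y. dist y x < d \<longrightarrow> E p y x) \<and>
     (\<forall>x\<in>K. \<forall>d>0. \<exists>p. \<forall>y. E p y x \<longrightarrow> dist y x < d)"
proof -
  obtain E :: "nat \<Rightarrow> 'k \<Rightarrow> 'k \<Rightarrow> bool" where E: "\<forall>t x. E t x x" "\<forall>t x y. E t x y \<longrightarrow> E t y x"
     "\<forall>t x y z. E t x y \<longrightarrow> E t y z \<longrightarrow> E t x z" "\<forall>s t x y. s \<le> t \<longrightarrow> E t x y \<longrightarrow> E s x y"
    and E_nbhd: "\<forall>x\<in>K. \<forall>p. \<exists>d>0. \<forall>y. dist y x < d \<longrightarrow> E p y x"
    and E_sep: "\<forall>x\<in>K. \<forall>d>0. \<exists>p. \<forall>y. E p y x \<longrightarrow> dist y x < d"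
    using clopen_partitions[OF K(2,3)] by (elim exE conjE) (rule that)
  obtain m :: "nat \<Rightarrow> real" and N :: "nat \<Rightarrow> nat" where mM: "\<And>j. max 32 M \<le> m j" and
     dom: "\<And>j. \<exists>(c::real) l. 1 \<le> c \<and> (\<forall>i<j. N i \<le> c) \<and> (m j)\<^sup>2 \<le> 2 ^ l \<and>
        (m j)\<^sup>2 * depth_const c (Suc l) \<le> N j \<and> (m j)\<^sup>2 * depth_const c l \<le> N j" and
     grow: "\<And>i j. i < j \<Longrightarrow> (real (N i))\<^sup>2 \<le> m j"
    using parameters_exist[of M] by blast
  define wt where "wt n = fst (node_data N n)" for n
  define ix where "ix n = fst (snd (node_data N n))" for n
  define age where "age n = snd (snd (node_data N n))" for n
  define \<kappa> where "\<kappa> n = from_nat_into K (ix n)" for n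
  define prd where "prd n = fst (snd (code_at n))" for n
  define ls where "ls n = snd (snd (snd (code_at n)))" for n
  define bc where "bc n = (if age n = 0 then (\<lambda>_. 0) else list_coeff (ls n))" for n
  define ok where "ok n \<longleftrightarrow> \<not> fst (code_at n) \<and> prd n < n \<and> age (prd n) < N (wt (prd n)) \<and>
      (\<Sum>k<n. \<bar>list_coeff (ls n) k\<bar>) \<le> 1 \<and>
      (odd (wt (prd n)) \<longrightarrow> (\<exists>h\<in>{..<n}. wt h = 2 * prd n + 2 \<and> list_coeff (ls n) = (\<lambda>k. if k = h then 1 else 0)))" for n
  have data: "node_data N n = (if ok n then (wt (prd n), ix (prd n), Suc (age (prd n)))
      else if fst (code_at n) \<and> prd n \<le> n then (prd n, fst (snd (snd (code_at n))), 0) else (0, 0, 0))" for n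
  proof -
    obtain b i j l where c: "code_at n = (b, i, j, l)" by (cases "code_at n")
    show ?thesis
      by (subst node_data.simps) (simp add: c ok_def wt_def ix_def age_def prd_def ls_def; blast)
  qed
  have node: "ok n" if "age n \<noteq> 0" for n
    using that data[of n] by (auto simp: age_def split: if_splits)
  have node_eq: "wt n = wt (prd n)" "ix n = ix (prd n)" "age n = Suc (age (prd n))" if "ok n" for n
    using that data[of n] by (auto simp: wt_def[of n] ix_def[of n] age_def[of n])
  have okD: "prd n < n" "age (prd n) < N (wt (prd n))" "(\<Sum>k<n. \<bar>list_coeff (ls n) k\<bar>) \<le> 1" if "ok n" for n
    using that by (auto simp: ok_def)
  have wt_le: "wt n \<le> n" for n
  proof (induction n rule: less_induct)
    case (less n)
    show ?case
    proof (cases "ok n")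
      case True
      then show ?thesis using less[OF okD(1)[OF True]] node_eq(1)[OF True] okD(1)[OF True] by simp
    next
      case False
      then show ?thesis using data[of n] by (auto simp: wt_def)
    qed
  qed
  have age_le: "age n \<le> N (wt n)" for n
    using node_eq okD(2) node[of n] by (cases "age n = 0") (auto simp: Suc_le_eq)
  have K_cover: "\<exists>F. finite F \<and> F \<subseteq> K \<and> (\<forall>y\<in>K. \<exists>x\<in>F. E (\<pi> x) y x)" for \<pi>
  proof -
    have "\<forall>x\<in>K. \<exists>d. 0 < d \<and> (\<forall>y. dist y x < d \<longrightarrow> E (\<pi> x) y x)" using E_nbhd by blast
    from bchoice[OF this] obtain d where d: "\<And>x. x \<in> K \<Longrightarrow> 0 < d x"
        "\<And>x y. x \<in> K \<Longrightarrow> dist y x < d x \<Longrightarrow> E (\<pi> x) y x"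
      by blast
    obtain F where F: "F \<subseteq> K" "finite F" "K \<subseteq> (\<Union>x\<in>F. ball x (d x))"
    proof (rule compactE_image[OF K(1), of K "\<lambda>x. ball x (d x)"])
      show "K \<subseteq> (\<Union>x\<in>K. ball x (d x))" using d(1) by auto
    qed auto
    have "\<exists>x\<in>F. E (\<pi> x) y x" if "y \<in> K" for y
      using F that d(2) by (force simp: dist_commute)
    then show ?thesis using F by blast
  qed
  have bcl: "bc n = list_coeff (ls n)" if "ok n" for n using node_eq(3)[OF that] by (simp add: bc_def)
  have "argyros_haydon E \<kappa> wt age prd bc m N K"
  proof unfold_locales
    fix n assume "age n \<noteq> 0"
    then have o: "ok n" by (rule node)
    show "prd n < n" "wt (prd n) = wt n" "\<kappa> (prd n) = \<kappa> n" "age n = Suc (age (prd n))"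
      using okD[OF o] node_eq[OF o] by (auto simp: \<kappa>_def)
    assume "odd (wt n)"
    then have "odd (wt (prd n))" using node_eq(1)[OF o] by simp
    then show "\<exists>\<eta><n. wt \<eta> = 2 * prd n + 2 \<and> bc n = (\<lambda>k. if k = \<eta> then 1 else 0)"
      using o bcl[OF o] by (auto simp: ok_def)
  next
    fix n show "(\<Sum>k<n. \<bar>bc n k\<bar>) \<le> 1"
      using node[of n] okD(3)[of n] by (auto simp: bc_def)
    show "32 \<le> m n" for n using mM[of n] by simp
    show "\<kappa> n \<in> K" unfolding \<kappa>_def using K(3) by (rule from_nat_into)
  next
    fix x q j assume x: "x \<in> K"
    obtain n where n: "max q j \<le> n" "code_at n = (True, j, to_nat_on K x, [])" using code_at_ex by blast
    have "\<not> ok n" using n by (simp add: ok_def)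
    then have "node_data N n = (j, to_nat_on K x, 0)" using data[of n] n by (simp add: prd_def)
    then show "\<exists>n\<ge>q. age n = 0 \<and> wt n = j \<and> \<kappa> n = x"
      using n x K(2) by (intro exI[of _ n]) (simp add: age_def wt_def \<kappa>_def ix_def)
  next
    fix \<xi> q and \<beta> :: "nat \<Rightarrow> real" and \<tau> :: real
    assume a: "even (wt \<xi>)" "age \<xi> < N (wt \<xi>)" "(\<Sum>k<q. \<bar>\<beta> k\<bar>) \<le> 1" "0 < \<tau>"
    \<comment> \<open>The total error of \<open>q\<close> roundings stays below
      \<open>\<tau>\<close>; the summand 1 covers \<open>q = 0\<close>.\<close>
    have "\<forall>k. \<exists>r::rat. \<bar>of_rat r\<bar> \<le> \<bar>\<beta> k\<bar> \<and> \<bar>of_rat r - \<beta> k\<bar> \<le> \<tau> / (real q + 1)"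
      using a by (intro allI rat_approx) simp
    then obtain r :: "nat \<Rightarrow> rat" where r: "\<And>k. \<bar>of_rat (r k)\<bar> \<le> \<bar>\<beta> k\<bar>" "\<And>k. \<bar>of_rat (r k) - \<beta> k\<bar> \<le> \<tau> / (real q + 1)"
      by metis
    define l where "l = map r [0..<q]"
    have l: "list_coeff l k = (if k < q then of_rat (r k) else 0)" for k
      by (simp add: list_coeff_def l_def)
    obtain n where n: "max q (Suc \<xi>) \<le> n" "code_at n = (False, \<xi>, 0, l)" using code_at_ex by blast
    have pl: "prd n = \<xi>" "ls n = l" using n by (auto simp: prd_def ls_def)
    have sub: "{..<q} \<subseteq> {..<n}" using n by auto
    have "(\<Sum>k<n. \<bar>list_coeff l k\<bar>) = (\<Sum>k<q. \<bar>of_rat (r k)\<bar>)"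
      using sub by (intro sum.mono_neutral_cong_right) (auto simp: l)
    also have "\<dots> \<le> (\<Sum>k<q. \<bar>\<beta> k\<bar>)" by (intro sum_mono r)
    finally have o: "ok n" using a n pl by (simp add: ok_def)
    have "(\<Sum>k<n. \<bar>bc n k - (if k < q then \<beta> k else 0)\<bar>) = (\<Sum>k<q. \<bar>of_rat (r k) - \<beta> k\<bar>)"
      using sub by (intro sum.mono_neutral_cong_right) (auto simp: l bcl[OF o] pl)
    also have "\<dots> \<le> (\<Sum>k<q. \<tau> / (real q + 1))" by (intro sum_mono r)
    also have "\<dots> \<le> \<tau>" using a(4) by (simp add: field_simps)
    finally show "\<exists>n\<ge>q. age n \<noteq> 0 \<and> prd n = \<xi> \<and> (\<Sum>k<n. \<bar>bc n k - (if k < q then \<beta> k else 0)\<bar>) \<le> \<tau>"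
      using n pl node_eq(3)[OF o] by (intro exI[of _ n]) simp
  next
    fix \<xi> \<eta> q assume a: "odd (wt \<xi>)" "age \<xi> < N (wt \<xi>)" "wt \<eta> = 2 * \<xi> + 2"
    define l where "l = map (\<lambda>k. if k = \<eta> then 1 else 0 :: rat) [0..<Suc \<eta>]"
    have l: "list_coeff l = (\<lambda>k. if k = \<eta> then 1 else 0)"
      by (auto simp: list_coeff_def l_def fun_eq_iff simp del: upt_Suc)
    obtain n where n: "max q (max (Suc \<eta>) (Suc \<xi>)) \<le> n" "code_at n = (False, \<xi>, 0, l)" using code_at_ex by blast
    have pl: "prd n = \<xi>" "ls n = l" using n by (auto simp: prd_def ls_def)
    have lt: "\<eta> < n" "\<xi> < n" "q \<le> n" using n(1) by linarith+
    have "(\<Sum>k<n. \<bar>list_coeff l k\<bar>) = 1" using lt by (simp add: l if_distrib[of abs] cong: if_cong)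
    then have o: "ok n" using a n lt pl l by (auto simp: ok_def)
    then show "\<exists>n\<ge>q. age n \<noteq> 0 \<and> prd n = \<xi> \<and> bc n = (\<lambda>k. if k = \<eta> then 1 else 0)"
      using lt pl node_eq(3)[OF o] l bcl[OF o] by (intro exI[of _ n]) simp
  qed (use E(1) in blast, use E(2) in blast, use E(3) in blast, use E(4) in blast, rule wt_le, rule age_le, rule dom, rule grow, assumption, rule K_cover)
  moreover have "M \<le> m j" for j using mM[of j] by simp
  ultimately show ?thesis using E_nbhd E_sep by blast
qed

section \<open>Operators on the completion\<close>

lemma op_norm_bound:
  assumes "\<exists>B. \<forall>x\<in>carrier M. nrm N (T x) \<le> B * nrm M x" "\<And>x. x \<in> carrier M \<Longrightarrow> 0 \<le> nrm M x" "x \<in> carrier M"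
  shows "nrm N (T x) \<le> op_norm M N T * nrm M x"
proof -
  obtain B where B: "\<And>x. x \<in> carrier M \<Longrightarrow> nrm N (T x) \<le> B * nrm M x" using assms(1) by blast
  show ?thesis
  proof (cases "nrm M x = 0")
    case True
    then show ?thesis using B[OF assms(3)] by simp
  next
    case False
    then have pos: "0 < nrm M x" using assms(2,3) by (simp add: order_less_le)
    have "nrm N (T y) / nrm M y \<le> \<bar>B\<bar>" if "y \<in> carrier M" for y
    proof (cases "nrm M y = 0")
      case False
      then have "0 < nrm M y" using assms(2) that by (simp add: order_less_le)
      then show ?thesis using B[OF that] by (simp add: divide_le_eq) (meson abs_ge_self mult_right_mono less_imp_le order_trans)
    qed simp
    then have "nrm N (T x) / nrm M x \<le> op_norm M N T"
      unfolding op_norm_def using assms(3) by (intro cSUP_upper bdd_aboveI2) auto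
    then show ?thesis using pos by (simp add: divide_le_eq)
  qed
qed

lemma op_norm_least:
  assumes "\<And>x. x \<in> carrier M \<Longrightarrow> nrm N (T x) \<le> C * nrm M x" "\<And>x. x \<in> carrier M \<Longrightarrow> 0 \<le> nrm M x"
    "carrier M \<noteq> {}" "0 \<le> C"
  shows "op_norm M N T \<le> C"
  unfolding op_norm_def
proof (rule cSUP_least[OF assms(3)])
  fix x assume x: "x \<in> carrier M"
  show "nrm N (T x) / nrm M x \<le> C"
  proof (cases "nrm M x = 0")
    case False
    then have "0 < nrm M x" using assms(2) x by (simp add: order_less_le)
    then show ?thesis using assms(1)[OF x] by (simp add: divide_le_eq)
  qed (use assms in simp)
qed

lemma subspace_map_iff:
  "bounded_linear_map (of_subspace V) (of_subspace W) T \<longleftrightarrow> (\<forall>x\<in>V. T x \<in> W) \<and>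
     (\<forall>x\<in>V. \<forall>y\<in>V. T (x + y) = T x + T y) \<and> (\<forall>c. \<forall>x\<in>V. T (c *\<^sub>R x) = c *\<^sub>R T x) \<and>
     (\<exists>B. \<forall>x\<in>V. norm (T x) \<le> B * norm x)"
  by (auto simp: bounded_linear_map_def of_subspace_def Pi_iff)

lemma subspace_map_diff:
  assumes "bounded_linear_map (of_subspace V) (of_subspace W) T" "subspace V" "x \<in> V" "y \<in> V"
  shows "T (x - y) = T x - T y"
proof -
  have "(-1) *\<^sub>R y \<in> V" using assms by (intro subspace_scale)
  then have "T (x + (-1) *\<^sub>R y) = T x + (-1) *\<^sub>R T y"
    using assms unfolding subspace_map_iff by metis
  then show ?thesis by simp
qed

lemma compact_scaled_combinations:
  fixes w :: "nat \<Rightarrow> 'a::real_normed_vector"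
  shows "compact {\<Sum>k<n. c k *\<^sub>R w k | c. \<forall>k<n. \<bar>c k\<bar> \<le> 1}"
proof (induction n)
  case 0
  then show ?case by simp
next
  case (Suc n)
  have "compact ((\<lambda>t. t *\<^sub>R w n) ` {-1..1})"
    by (intro compact_continuous_image continuous_intros) auto
  then have "compact {x + y | x y. x \<in> {\<Sum>k<n. c k *\<^sub>R w k | c. \<forall>k<n. \<bar>c k\<bar> \<le> 1} \<and> y \<in> (\<lambda>t. t *\<^sub>R w n) ` {-1..1}}"
    using Suc by (rule compact_sums[rotated])
  also have "{x + y | x y. x \<in> {\<Sum>k<n. c k *\<^sub>R w k | c. \<forall>k<n. \<bar>c k\<bar> \<le> 1} \<and> y \<in> (\<lambda>t. t *\<^sub>R w n) ` {-1..1}}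
     = {\<Sum>k<Suc n. c k *\<^sub>R w k | c. \<forall>k<Suc n. \<bar>c k\<bar> \<le> 1}" (is "?L = ?R")
  proof (intro subset_antisym subsetI)
    fix z assume "z \<in> ?L"
    then obtain c t where c: "\<forall>k<n. \<bar>c k\<bar> \<le> 1" "-1 \<le> t" "t \<le> 1" "z = (\<Sum>k<n. c k *\<^sub>R w k) + t *\<^sub>R w n"
      by force
    then have "z = (\<Sum>k<Suc n. (if k = n then t else c k) *\<^sub>R w k)" by simp
    then show "z \<in> ?R" using c by (intro CollectI exI[of _ "\<lambda>k. if k = n then t else c k"]) auto
  next
    fix z assume "z \<in> ?R"
    then obtain c where c: "\<forall>k<Suc n. \<bar>c k\<bar> \<le> 1" "z = (\<Sum>k<n. c k *\<^sub>R w k) + c n *\<^sub>R w n" by auto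
    have "(\<Sum>k<n. c k *\<^sub>R w k) \<in> {\<Sum>k<n. c k *\<^sub>R w k | c. \<forall>k<n. \<bar>c k\<bar> \<le> 1}" using c(1) by auto
    moreover have "c n \<in> {-1..1}" using c(1) by (auto simp: abs_le_iff)
    ultimately show "z \<in> ?L" using c(2) by blast
  qed
  finally show ?case .
qed

lemma Cauchy_bcontfun_convergent:
  fixes f :: "nat \<Rightarrow> 'a::topological_space \<Rightarrow>\<^sub>C 'b::complete_space"
  assumes "Cauchy f"
  shows "convergent f"
proof -
  obtain g where "uniform_limit UNIV f g sequentially"
    using uniformly_convergent_eq_cauchy[of "\<lambda>_. True" f] assms
    unfolding Cauchy_def uniform_limit_sequentially_iff by (metis dist_fun_lt_imp_dist_val_lt)
  from uniform_limit_bcontfunE[OF this sequentially_bot] show ?thesis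
    unfolding convergent_def by metis
qed

lemma closed_bcontfun_complete:
  fixes S :: "('a::topological_space \<Rightarrow>\<^sub>C 'b::complete_space) set"
  assumes "closed S"
  shows "complete S"
  unfolding complete_def
proof (intro allI impI)
  fix f assume f: "(\<forall>n. f n \<in> S) \<and> Cauchy f"
  then obtain l where "f \<longlonglongrightarrow> l" using Cauchy_bcontfun_convergent unfolding convergent_def by blast
  then show "\<exists>l\<in>S. f \<longlonglongrightarrow> l" using closed_sequentially[OF assms] f by blast
qed

lemma subspace_closure:
  fixes S :: "'a::real_normed_vector set"
  assumes "subspace S"
  shows "subspace (closure S)"
  unfolding subspace_def
proof (intro conjI ballI allI)
  show "0 \<in> closure S" using subspace_0[OF assms] closure_subset by blast
  fix x y assume "x \<in> closure S" "y \<in> closure S"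
  then obtain f g where "\<forall>n. f n \<in> S" "f \<longlonglongrightarrow> x" "\<forall>n. g n \<in> S" "g \<longlonglongrightarrow> y"
    unfolding closure_sequential by blast
  then have "\<forall>n. f n + g n \<in> S" "(\<lambda>n. f n + g n) \<longlonglongrightarrow> x + y"
    using subspace_add[OF assms] tendsto_add by blast+
  then show "x + y \<in> closure S" unfolding closure_sequential by (intro exI conjI)
next
  fix c x assume "x \<in> closure S"
  then obtain f where "\<forall>n. f n \<in> S" "f \<longlonglongrightarrow> x" unfolding closure_sequential by blast
  then have "\<forall>n. c *\<^sub>R f n \<in> S" "(\<lambda>n. c *\<^sub>R f n) \<longlonglongrightarrow> c *\<^sub>R x"
    using subspace_scale[OF assms] tendsto_scaleR[OF tendsto_const] by blast+
  then show "c *\<^sub>R x \<in> closure S" unfolding closure_sequential by (intro exI conjI)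
qed

text \<open>A finite net of the approximating compact set is a net of the closure as well, and a
  complete totally bounded set is compact.\<close>

lemma compact_closure_if_approximable:
  fixes S :: "'a::metric_space set"
  assumes complete: "complete (closure S)"
    and approx: "\<And>e. 0 < e \<Longrightarrow> \<exists>C. compact C \<and> (\<forall>x\<in>S. \<exists>y\<in>C. dist x y \<le> e)"
  shows "compact (closure S)"
proof -
  have "\<exists>k. finite k \<and> closure S \<subseteq> (\<Union>x\<in>k. ball x e)" if e: "0 < e" for e
  proof -
    obtain C where C: "compact C" "\<And>x. x \<in> S \<Longrightarrow> \<exists>y\<in>C. dist x y \<le> e / 4"
      using approx[of "e / 4"] e by auto
    obtain k where k: "finite k" "C \<subseteq> (\<Union>x\<in>k. ball x (e / 4))"
      using C(1) e unfolding compact_eq_totally_bounded by (meson divide_pos_pos zero_less_numeral)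
    have "closure S \<subseteq> (\<Union>x\<in>k. ball x e)"
    proof
      fix z assume "z \<in> closure S"
      then obtain x where x: "x \<in> S" "dist x z < e / 4"
        using e unfolding closure_approachable by (meson divide_pos_pos zero_less_numeral)
      obtain y where y: "y \<in> C" "dist x y \<le> e / 4" using C(2)[OF x(1)] by blast
      obtain w where w: "w \<in> k" "dist w y < e / 4" using k y by auto
      have "dist w z \<le> dist w y + dist x y + dist x z"
        by (metis add.commute add_mono_thms_linordered_semiring(3) dist_commute dist_triangle dist_triangle2 order_trans)
      then have "dist w z < e" using w y x e by linarith
      then show "z \<in> (\<Union>x\<in>k. ball x e)" using w by auto
    qed
    then show ?thesis using k by blast
  qed
  then show ?thesis unfolding compact_eq_totally_bounded using complete by blast
qed

section \<open>The space, its basis, and the extension of operators from finitely supported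
  vectors\<close>

context bourgain_delbaen
begin

text \<open>Bounded continuous functions on the discrete space of natural numbers form
  \<open>\<ell>\<^sub>\<infinity>\<close>. For coefficients \<open>a\<close> with finite support
  \<open>R a\<close> is bounded, and only then is the value used.\<close>

definition vec :: "(nat \<Rightarrow> real) \<Rightarrow> nat \<Rightarrow>\<^sub>C real" where
  "vec a = Bcontfun (R a)"

definition spc :: "(nat \<Rightarrow>\<^sub>C real) set" where
  "spc = closure (vec ` {a. fs a})"

lemma fs_bounded: "fs a \<Longrightarrow> \<exists>B. \<forall>n. \<bar>R a n\<bar> \<le> B"
proof -
  assume "fs a"
  then obtain q where q: "supp 0 q a" by (auto simp: fs_def)
  have "\<bar>R (ext q (R a)) n\<bar> \<le> 2 * (\<Sum>k<q. \<bar>R a k\<bar>)" for n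
    by (rule ext_bound) (auto intro: member_le_sum sum_nonneg)
  then show ?thesis by (auto simp: ext_R[OF q])
qed

lemma apply_vec [simp]: "fs a \<Longrightarrow> apply_bcontfun (vec a) = R a"
proof -
  assume "fs a"
  then have "R a \<in> bcontfun"
    using fs_bounded[of a] by (auto simp: bcontfun_def bounded_iff)
  then show ?thesis unfolding vec_def by (rule Bcontfun_inverse)
qed

lemma vec_norm_le: "fs a \<Longrightarrow> (\<And>n. \<bar>R a n\<bar> \<le> B) \<Longrightarrow> norm (vec a) \<le> B"
  by (rule norm_bound) simp

lemma coord_le: "\<bar>apply_bcontfun x n\<bar> \<le> norm x"
  using norm_bounded[of x n] by simp

lemma vec_coord_le: "fs a \<Longrightarrow> \<bar>R a n\<bar> \<le> norm (vec a)"
  using coord_le[of "vec a" n] by simp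

lemma vec_add: "fs a \<Longrightarrow> fs a' \<Longrightarrow> vec (\<lambda>k. a k + a' k) = vec a + vec a'"
  by (rule bcontfun_eqI) (simp add: fs_add R_add plus_bcontfun.rep_eq)

lemma vec_scale: "fs a \<Longrightarrow> vec (\<lambda>k. c * a k) = c *\<^sub>R vec a"
  by (rule bcontfun_eqI) (simp add: fs_scale R_scale scaleR_bcontfun.rep_eq)

lemma vec_diff: "fs a \<Longrightarrow> fs a' \<Longrightarrow> vec (\<lambda>k. a k - a' k) = vec a - vec a'"
  by (rule bcontfun_eqI) (simp add: fs_diff R_diff minus_bcontfun.rep_eq)

lemma vec_sum: "finite A \<Longrightarrow> (\<And>r. r \<in> A \<Longrightarrow> fs (v r)) \<Longrightarrow> vec (\<lambda>k. \<Sum>r\<in>A. v r k) = (\<Sum>r\<in>A. vec (v r))"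
proof (induction A rule: finite_induct)
  case empty
  show ?case by (rule bcontfun_eqI) (simp add: fs_zero zero_bcontfun.rep_eq)
qed (simp add: vec_add fs_sum)

lemma vec_in_spc: "fs a \<Longrightarrow> vec a \<in> spc"
  unfolding spc_def using closure_subset by fastforce

lemma subspace_spc: "subspace spc"
  unfolding spc_def
proof (rule subspace_closure)
  show "subspace (vec ` {a. fs a})"
    unfolding subspace_def
  proof (intro conjI ballI allI)
    have "0 = vec (\<lambda>k. 0)" by (rule bcontfun_eqI) (simp add: fs_zero zero_bcontfun.rep_eq)
    then show "0 \<in> vec ` {a. fs a}" using fs_zero by blast
  qed (auto simp flip: vec_add vec_scale intro: fs_add fs_scale)
qed

lemma closed_spc: "closed spc"
  by (simp add: spc_def)

lemma complete_spc: "complete spc"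
  using closed_spc by (rule closed_bcontfun_complete)

lemma spc_approx: "x \<in> spc \<Longrightarrow> 0 < \<epsilon> \<Longrightarrow> \<exists>a. fs a \<and> norm (x - vec a) < \<epsilon>"
  unfolding spc_def closure_approachable by (force simp: dist_norm norm_minus_commute)

lemma fs_restr: "fs (restr 0 q a)"
  by (rule supp_fs[of 0 q]) (auto simp: supp_def restr_def)

lemma fs_unit: "fs (unit n)"
  by (rule supp_fs[OF unit_supp])

lemma fs_ext: "fs (ext q u)"
  by (rule supp_fs[OF ext_supp0])

abbreviation coeff :: "(nat \<Rightarrow>\<^sub>C real) \<Rightarrow> nat \<Rightarrow> real" where
  "coeff x \<equiv> D (apply_bcontfun x)"

lemma coeff_le: "\<bar>coeff x n\<bar> \<le> 8 * norm x"
  by (rule coord_bound) (simp_all add: coord_le)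

lemma coeff_diff: "coeff (x - y) n = coeff x n - coeff y n"
  by (simp add: minus_bcontfun.rep_eq D_diff)

lemma coeff_scale: "coeff (c *\<^sub>R x) n = c * coeff x n"
  by (simp add: scaleR_bcontfun.rep_eq D_scale)

lemma coeff_vec: "fs a \<Longrightarrow> coeff (vec a) = a"
  by simp

lemma restr_norm: "norm (vec (restr 0 q (coeff x))) \<le> 2 * norm x"
  by (rule vec_norm_le[OF fs_restr], rule restr_bound) (simp_all add: coord_le)

text \<open>The vectors \<open>vec (unit n)\<close> form a Schauder basis: the partial sum
  projections have norm at most 2 and are eventually exact on a dense subspace.\<close>

lemma restr_tendsto:
  assumes "x \<in> spc"
  shows "(\<lambda>q. vec (restr 0 q (coeff x))) \<longlonglongrightarrow> x"
proof (rule LIMSEQ_I)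
  fix e :: real assume e: "0 < e"
  obtain a where a: "fs a" "norm (x - vec a) < e / 4" using spc_approx[OF assms, of "e / 4"] e by auto
  obtain q0 where q0: "supp 0 q0 a" using a by (auto simp: fs_def)
  have "norm (vec (restr 0 q (coeff x)) - x) < e" if "q0 \<le> q" for q
  proof -
    have a0: "a k = 0" if "q \<le> k" for k using q0 that \<open>q0 \<le> q\<close> by (auto simp: supp_def)
    have cd: "coeff (x - vec a) k = coeff x k - a k" for k
      using coeff_diff[of x "vec a" k] by (simp only: coeff_vec[OF a(1)])
    have "restr 0 q (coeff x) = (\<lambda>k. a k + restr 0 q (coeff (x - vec a)) k)"
    proof
      fix k show "restr 0 q (coeff x) k = a k + restr 0 q (coeff (x - vec a)) k"
        unfolding restr_def cd using a0[of k] by simp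
    qed
    then have "vec (restr 0 q (coeff x)) = vec a + vec (restr 0 q (coeff (x - vec a)))"
      using a by (simp add: vec_add fs_restr)
    then have "norm (vec (restr 0 q (coeff x)) - x) \<le> norm (vec (restr 0 q (coeff (x - vec a)))) + norm (x - vec a)"
      using norm_triangle_ineq4[of "vec (restr 0 q (coeff (x - vec a)))" "x - vec a"] by (simp add: algebra_simps)
    then show "norm (vec (restr 0 q (coeff x)) - x) < e"
      using restr_norm[of q "x - vec a"] a(2) norm_ge_zero[of "x - vec a"] by linarith
  qed
  then show "\<exists>q0. \<forall>q\<ge>q0. norm (vec (restr 0 q (coeff x)) - x) < e" by blast
qed

lemma coeff_tendsto_0:
  assumes "x \<in> spc"
  shows "coeff x \<longlonglongrightarrow> 0"
proof (rule LIMSEQ_I)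
  fix e :: real assume e: "0 < e"
  obtain a where a: "fs a" "norm (x - vec a) < e / 16" using spc_approx[OF assms, of "e / 16"] e by auto
  obtain q where q: "supp 0 q a" using a by (auto simp: fs_def)
  have "norm (coeff x n - 0) < e" if "q \<le> n" for n
  proof -
    have "a n = 0" using q that by (auto simp: supp_def)
    then have "coeff x n = coeff (x - vec a) n" using a(1) by (simp only: coeff_diff coeff_vec)
    then have "\<bar>coeff x n\<bar> \<le> 8 * norm (x - vec a)" using coeff_le[of "x - vec a" n] by simp
    then show ?thesis using a(2) e by simp
  qed
  then show "\<exists>q. \<forall>n\<ge>q. norm (coeff x n - 0) < e" by blast
qed

definition rep :: "((nat \<Rightarrow>\<^sub>C real) \<Rightarrow> nat \<Rightarrow>\<^sub>C real) \<Rightarrow> (nat \<Rightarrow> real) \<Rightarrow> nat \<Rightarrow> real" where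
  "rep T a = apply_bcontfun (T (vec a))"

abbreviation "bop T \<equiv> bounded_linear_map (of_subspace spc) (of_subspace spc) T"

lemma bopD:
  assumes "bop T"
  shows "x \<in> spc \<Longrightarrow> T x \<in> spc" "x \<in> spc \<Longrightarrow> y \<in> spc \<Longrightarrow> T (x + y) = T x + T y"
    "x \<in> spc \<Longrightarrow> T (c *\<^sub>R x) = c *\<^sub>R T x" "x \<in> spc \<Longrightarrow> y \<in> spc \<Longrightarrow> T (x - y) = T x - T y"
    "\<exists>B>0. \<forall>x\<in>spc. norm (T x) \<le> B * norm x"
proof -
  have T: "\<forall>x\<in>spc. T x \<in> spc" "\<forall>x\<in>spc. \<forall>y\<in>spc. T (x + y) = T x + T y" "\<forall>c. \<forall>x\<in>spc. T (c *\<^sub>R x) = c *\<^sub>R T x"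
    "\<exists>B. \<forall>x\<in>spc. norm (T x) \<le> B * norm x" using assms by (auto simp: subspace_map_iff)
  show "x \<in> spc \<Longrightarrow> T x \<in> spc" "x \<in> spc \<Longrightarrow> y \<in> spc \<Longrightarrow> T (x + y) = T x + T y"
    "x \<in> spc \<Longrightarrow> T (c *\<^sub>R x) = c *\<^sub>R T x" using T by auto
  show "x \<in> spc \<Longrightarrow> y \<in> spc \<Longrightarrow> T (x - y) = T x - T y"
    by (rule subspace_map_diff[OF assms subspace_spc])
  obtain B where "\<forall>x\<in>spc. norm (T x) \<le> B * norm x" using T(4) by blast
  then have "\<forall>x\<in>spc. norm (T x) \<le> (\<bar>B\<bar> + 1) * norm x"
    by (meson abs_ge_self add_increasing2 mult_right_mono norm_ge_zero order_trans zero_le_one)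
  then show "\<exists>B>0. \<forall>x\<in>spc. norm (T x) \<le> B * norm x" by (intro exI[of _ "\<bar>B\<bar> + 1"]) simp
qed

lemma rep_bdd_op: "bop T \<Longrightarrow> \<exists>L. bdd_op L (rep T)"
proof -
  assume T: "bop T"
  obtain L where L: "0 < L" "\<forall>x\<in>spc. norm (T x) \<le> L * norm x" using bopD(5)[OF T] by blast
  have "\<bar>rep T a n\<bar> \<le> L * B" if "fs a" "\<forall>n. \<bar>R a n\<bar> \<le> B" for a B n
  proof -
    have "\<bar>rep T a n\<bar> \<le> norm (T (vec a))" unfolding rep_def by (rule coord_le)
    also have "\<dots> \<le> L * norm (vec a)" using L vec_in_spc[OF that(1)] by blast
    also have "\<dots> \<le> L * B" using L vec_norm_le[OF that(1)] that(2) by (intro mult_left_mono) auto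
    finally show ?thesis .
  qed
  then have "bdd_op L (rep T)" using L(1) vec_in_spc bopD(2,3)[OF T]
    unfolding bdd_op_def
    by (auto simp: rep_def vec_add vec_scale plus_bcontfun.rep_eq scaleR_bcontfun.rep_eq fun_eq_iff)
  then show ?thesis by blast
qed

text \<open>The extension is the limit along the partial sums of the basis expansion; these depend
  linearly on the vector, so linearity passes to the limit.\<close>

lemma extension:
  assumes V: "\<And>a. fs a \<Longrightarrow> V a \<in> spc" "\<And>a a'. fs a \<Longrightarrow> fs a' \<Longrightarrow> V (\<lambda>k. a k + a' k) = V a + V a'"
     "\<And>a c. fs a \<Longrightarrow> V (\<lambda>k. c * a k) = c *\<^sub>R V a" "\<And>a. fs a \<Longrightarrow> norm (V a) \<le> C * norm (vec a)"
    and C: "0 \<le> C"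
  shows "\<exists>T. T \<in> extensional spc \<and> bop T \<and> (\<forall>a. fs a \<longrightarrow> T (vec a) = V a) \<and> (\<forall>x\<in>spc. norm (T x) \<le> C * norm x)"
proof -
  define P where "P q x = restr 0 q (coeff x)" for q x
  have fsP: "fs (P q x)" for q x unfolding P_def by (rule fs_restr)
  have P: "(\<lambda>q. vec (P q x)) \<longlonglongrightarrow> x" if "x \<in> spc" for x
    using restr_tendsto[OF that] by (simp add: P_def)
  have Vdiff: "V (\<lambda>k. a k - a' k) = V a - V a'" if "fs a" "fs a'" for a a'
    using V(2)[OF that(1) fs_scale[OF that(2), of "-1"]] V(3)[OF that(2), of "-1"] by simp
  have "convergent (\<lambda>q. V (P q x))" if x: "x \<in> spc" for x
  proof -
    have cau: "Cauchy (\<lambda>q. vec (P q x))" using P[OF x] by (rule LIMSEQ_imp_Cauchy)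
    have "Cauchy (\<lambda>q. V (P q x))"
    proof (rule metric_CauchyI)
      fix e :: real assume e: "0 < e"
      then obtain M where M: "\<forall>i\<ge>M. \<forall>j\<ge>M. dist (vec (P i x)) (vec (P j x)) < e / (C + 1)"
        using metric_CauchyD[OF cau, of "e / (C + 1)"] C by auto
      have "dist (V (P i x)) (V (P j x)) < e" if "M \<le> i" "M \<le> j" for i j
      proof -
        have "dist (V (P i x)) (V (P j x)) = norm (V (\<lambda>k. P i x k - P j x k))"
          by (simp add: dist_norm Vdiff fsP)
        also have "\<dots> \<le> C * norm (vec (P i x) - vec (P j x))"
          using V(4)[OF fs_diff[OF fsP fsP], of i x j x] by (simp add: vec_diff fsP)
        also have "\<dots> \<le> C * (e / (C + 1))"
          using M that C by (intro mult_left_mono) (auto simp: dist_norm intro: less_imp_le)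
        also have "\<dots> < e" using e C by (simp add: field_simps)
        finally show ?thesis .
      qed
      then show "\<exists>M. \<forall>i\<ge>M. \<forall>j\<ge>M. dist (V (P i x)) (V (P j x)) < e" by blast
    qed
    then show ?thesis by (rule Cauchy_bcontfun_convergent)
  qed
  then obtain T0 where T0: "\<And>x. x \<in> spc \<Longrightarrow> (\<lambda>q. V (P q x)) \<longlonglongrightarrow> T0 x" unfolding convergent_def by metis
  define T where "T = restrict T0 spc"
  have T: "(\<lambda>q. V (P q x)) \<longlonglongrightarrow> T x" if "x \<in> spc" for x using T0[OF that] that by (simp add: T_def)
  have add: "T (x + y) = T x + T y" if "x \<in> spc" "y \<in> spc" for x y
  proof (rule LIMSEQ_unique)
    show "(\<lambda>q. V (P q (x + y))) \<longlonglongrightarrow> T (x + y)" using T subspace_add[OF subspace_spc that] by blast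
    have "P q (x + y) = (\<lambda>k. P q x k + P q y k)" for q
      by (auto simp: P_def restr_def coeff_add plus_bcontfun.rep_eq D_add)
    then show "(\<lambda>q. V (P q (x + y))) \<longlonglongrightarrow> T x + T y"
      using tendsto_add[OF T[OF that(1)] T[OF that(2)]] by (simp add: V(2) fsP)
  qed
  have scale: "T (c *\<^sub>R x) = c *\<^sub>R T x" if "x \<in> spc" for x c
  proof (rule LIMSEQ_unique)
    show "(\<lambda>q. V (P q (c *\<^sub>R x))) \<longlonglongrightarrow> T (c *\<^sub>R x)" using T subspace_scale[OF subspace_spc that] by blast
    have "P q (c *\<^sub>R x) = (\<lambda>k. c * P q x k)" for q
      by (auto simp: P_def restr_def scaleR_bcontfun.rep_eq D_scale)
    then show "(\<lambda>q. V (P q (c *\<^sub>R x))) \<longlonglongrightarrow> c *\<^sub>R T x"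
      using tendsto_scaleR[OF tendsto_const T[OF that], of c] by (simp add: V(3) fsP)
  qed
  have mem: "T x \<in> spc" if "x \<in> spc" for x
    using closed_sequentially[OF closed_spc _ T[OF that]] V(1)[OF fsP] by blast
  have bd: "norm (T x) \<le> C * norm x" if "x \<in> spc" for x
  proof (rule LIMSEQ_le)
    show "(\<lambda>q. norm (V (P q x))) \<longlonglongrightarrow> norm (T x)" using T[OF that] by (rule tendsto_norm)
    show "(\<lambda>q. C * norm (vec (P q x))) \<longlonglongrightarrow> C * norm x" by (intro tendsto_mult tendsto_const tendsto_norm P[OF that])
    show "\<exists>N. \<forall>n\<ge>N. norm (V (P n x)) \<le> C * norm (vec (P n x))" using V(4)[OF fsP] by blast
  qed
  have "T (vec a) = V a" if a: "fs a" for a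
  proof (rule LIMSEQ_unique[OF T[OF vec_in_spc[OF a]]])
    obtain q0 where q0: "supp 0 q0 a" using a by (auto simp: fs_def)
    have "P q (vec a) = a" if "q0 \<le> q" for q
      using restr_supp[OF supp_mono[OF q0, of 0 q]] that a by (simp add: P_def)
    then show "(\<lambda>q. V (P q (vec a))) \<longlonglongrightarrow> V a"
      by (intro tendsto_eventually) (auto simp: eventually_sequentially intro!: exI[of _ q0])
  qed
  moreover have "bop T" unfolding subspace_map_iff using add scale mem bd by blast
  moreover have "T \<in> extensional spc" by (simp add: T_def)
  ultimately show ?thesis using bd by blast
qed

end

section \<open>The symbol of a bounded operator\<close>

context argyros_haydon
begin

lemma rep_op_into: "bop T \<Longrightarrow> op_into (rep T)"
  unfolding op_into_def
proof (intro allI impI)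
  fix a and \<epsilon> :: real assume T: "bop T" and a: "fs a" and \<epsilon>: "0 < \<epsilon>"
  have "T (vec a) \<in> spc" using bopD(1)[OF T vec_in_spc[OF a]] .
  then obtain y where y: "fs y" "norm (T (vec a) - vec y) < \<epsilon>" using spc_approx \<epsilon> by blast
  have "\<bar>R y n - rep T a n\<bar> \<le> \<epsilon>" for n
    using coord_le[of "T (vec a) - vec y" n] y by (simp add: rep_def minus_bcontfun.rep_eq)
  then show "\<exists>y. fs y \<and> (\<forall>n. \<bar>R y n - rep T a n\<bar> \<le> \<epsilon>)" using y by blast
qed

text \<open>A node at \<open>x\<close> for every weight. Since a weight is at most the rank, the
  anchors of a point tend to infinity.\<close>

definition anchor :: "'a \<Rightarrow> nat \<Rightarrow> nat" where
  "anchor x j = (SOME n. wt n = j \<and> \<kappa> n = x)"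

lemma anchor: "x \<in> K \<Longrightarrow> wt (anchor x j) = j \<and> \<kappa> (anchor x j) = x"
  unfolding anchor_def by (rule someI_ex) (use ex_root in blast)

lemma anchor_ge: "x \<in> K \<Longrightarrow> j \<le> anchor x j"
  using anchor[of x j] wt_le[of "anchor x j"] by simp

lemma anchor_filterlim: "x \<in> K \<Longrightarrow> filterlim (anchor x) at_top sequentially"
  by (rule filterlim_at_top_mono[OF filterlim_ident]) (simp add: anchor_ge)

text \<open>The function on \<open>K\<close> that becomes the image of the operator in
  \<open>C(K)\<close>. It is restricted to \<open>K\<close> because the carrier of
  \<open>continuous_functions K\<close> consists of extensional functions.\<close>

definition symbol :: "((nat \<Rightarrow>\<^sub>C real) \<Rightarrow> nat \<Rightarrow>\<^sub>C real) \<Rightarrow> 'a \<Rightarrow> real" where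
  "symbol T = (\<lambda>x\<in>K. lim (\<lambda>j. diag_coeff (rep T) (anchor x j)))"

lemma symbol_limit:
  assumes T: "bop T"
  shows "\<forall>x\<in>K. \<forall>\<epsilon>>0. \<exists>p i. \<forall>n. E p (\<kappa> n) x \<longrightarrow> i \<le> wt n \<longrightarrow> \<bar>diag_coeff (rep T) n - symbol T x\<bar> \<le> \<epsilon>"
    and "x \<in> K \<Longrightarrow> (\<lambda>j. diag_coeff (rep T) (anchor x j)) \<longlonglongrightarrow> symbol T x"
proof -
  obtain L where "bdd_op L (rep T)" using rep_bdd_op[OF T] by blast
  from diag_coeff_limit[OF this rep_op_into[OF T]] obtain f where
    f: "\<forall>x\<in>K. \<forall>\<epsilon>>0. \<exists>p i. \<forall>n. E p (\<kappa> n) x \<longrightarrow> i \<le> wt n \<longrightarrow> \<bar>diag_coeff (rep T) n - f x\<bar> \<le> \<epsilon>" by blast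
  have lim: "(\<lambda>j. diag_coeff (rep T) (anchor x j)) \<longlonglongrightarrow> f x" if x: "x \<in> K" for x
  proof (rule LIMSEQ_I)
    fix e :: real assume e: "0 < e"
    then have "0 < e / 2" by simp
    with f x obtain p i where p: "\<forall>n. E p (\<kappa> n) x \<longrightarrow> i \<le> wt n \<longrightarrow> \<bar>diag_coeff (rep T) n - f x\<bar> \<le> e / 2" by blast
    have "\<bar>diag_coeff (rep T) (anchor x j) - f x\<bar> < e" if "i \<le> j" for j
    proof -
      have "\<bar>diag_coeff (rep T) (anchor x j) - f x\<bar> \<le> e / 2"
        using p[rule_format, of "anchor x j"] anchor[OF x, of j] that E_refl[of p x] by simp
      then show ?thesis using e by linarith
    qed
    then show "\<exists>i. \<forall>j\<ge>i. norm (diag_coeff (rep T) (anchor x j) - f x) < e" by auto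
  qed
  then have eq: "symbol T x = f x" if "x \<in> K" for x
    using that by (simp add: symbol_def limI)
  show "\<forall>x\<in>K. \<forall>\<epsilon>>0. \<exists>p i. \<forall>n. E p (\<kappa> n) x \<longrightarrow> i \<le> wt n \<longrightarrow> \<bar>diag_coeff (rep T) n - symbol T x\<bar> \<le> \<epsilon>"
    using f eq by simp
  show "x \<in> K \<Longrightarrow> (\<lambda>j. diag_coeff (rep T) (anchor x j)) \<longlonglongrightarrow> symbol T x" using lim eq by simp
qed

lemma symbol_continuous: "bop T \<Longrightarrow> E_continuous (symbol T)"
  using diag_symbol_continuous[OF symbol_limit(1)] .

lemma E_continuous_bounded:
  assumes "E_continuous f"
  shows "\<exists>c\<ge>0. \<forall>x\<in>K. \<bar>f x\<bar> \<le> c"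
proof -
  obtain p where p: "\<forall>x\<in>K. \<forall>y\<in>K. E p x y \<longrightarrow> \<bar>f x - f y\<bar> \<le> 1"
    using assms unfolding E_continuous_def by (meson zero_less_one)
  obtain F where F: "finite F" "F \<subseteq> K" "\<forall>y\<in>K. \<exists>x\<in>F. E p y x" using K_cover[of "\<lambda>_. p"] by auto
  have "\<bar>f y\<bar> \<le> (\<Sum>x\<in>F. \<bar>f x\<bar>) + 1" if y: "y \<in> K" for y
  proof -
    obtain x where x: "x \<in> F" "E p y x" using F y by blast
    then have "\<bar>f y - f x\<bar> \<le> 1" using p y F by blast
    moreover have "\<bar>f x\<bar> \<le> (\<Sum>x\<in>F. \<bar>f x\<bar>)" using F x by (intro member_le_sum) auto
    ultimately show ?thesis by linarith
  qed
  then show ?thesis by (intro exI[of _ "(\<Sum>x\<in>F. \<bar>f x\<bar>) + 1"]) (simp add: sum_nonneg)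
qed

lemma small_on_blocks:
  assumes T: "bop T" and S: "symb c e t G (symbol T) \<mu>" and \<epsilon>: "0 < \<epsilon>"
  shows "\<exists>p. \<forall>v q. supp p q v \<longrightarrow> (\<forall>n. \<bar>R v n\<bar> \<le> 1) \<longrightarrow> (\<forall>n. \<bar>rep T v n - R (\<lambda>k. \<mu> k * v k) n\<bar> \<le> \<epsilon>)"
proof -
  obtain L where "bdd_op L (rep T)" using rep_bdd_op[OF T] by blast
  from diagonal_plus_small[OF this rep_op_into[OF T] symbol_limit(1)[OF T] S \<epsilon>] show ?thesis .
qed

text \<open>The basis vectors at the anchors of \<open>x\<close> are approximate eigenvectors for
  the value of the symbol at \<open>x\<close>: on far blocks \<open>T\<close> is close to the
  multiplier, and the multiplier is diagonal. Half the basis vector appears because its norm may be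
  2.\<close>

lemma symbol_eigen:
  assumes T: "bop T" and x: "x \<in> K"
  shows "(\<lambda>j. T (vec (unit (anchor x j))) - symbol T x *\<^sub>R vec (unit (anchor x j))) \<longlonglongrightarrow> 0"
proof (rule LIMSEQ_I)
  fix e :: real assume e: "0 < e"
  note cont = symbol_continuous[OF T]
  obtain c where c: "0 \<le> c" "\<forall>x\<in>K. \<bar>symbol T x\<bar> \<le> c" using E_continuous_bounded[OF cont] by blast
  obtain t G \<mu> where S: "symb c 1 t G (symbol T) \<mu>" using symb_exists[OF cont c(2,1), of 1] by auto
  obtain p where p: "\<And>v q. supp p q v \<Longrightarrow> (\<forall>n. \<bar>R v n\<bar> \<le> 1) \<Longrightarrow> \<forall>n. \<bar>rep T v n - R (\<lambda>k. \<mu> k * v k) n\<bar> \<le> e / 8"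
    using small_on_blocks[OF T S, of "e / 8"] e by auto
  obtain N where N: "\<And>n. N \<le> n \<Longrightarrow> \<bar>\<mu> n - symbol T (\<kappa> n)\<bar> \<le> e / 8" using symb_limit[OF S, of "e / 8"] e by auto
  have "norm (T (vec (unit (anchor x j))) - symbol T x *\<^sub>R vec (unit (anchor x j)) - 0) < e" if j: "max p N \<le> j" for j
  proof -
    define n where "n = anchor x j"
    have n: "p \<le> n" "N \<le> n" "\<kappa> n = x" using j anchor_ge[OF x, of j] anchor[OF x, of j] by (auto simp: n_def)
    define v where "v = (\<lambda>k. (1/2) * unit n k)"
    have sv: "supp p (Suc n) v" unfolding v_def by (intro supp_scale supp_mono[OF unit_supp]) (use n in auto)
    have "\<forall>k. \<bar>R v k\<bar> \<le> 1" unfolding v_def R_scale using unit_bound[of n] by (simp add: abs_mult)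
    then have b: "\<bar>rep T v k - R (\<lambda>k. \<mu> k * v k) k\<bar> \<le> e / 8" for k using p[OF sv] by blast
    have c1: "rep T v k = (1/2) * rep T (unit n) k" for k
    proof -
      have "T (vec v) = (1/2) *\<^sub>R T (vec (unit n))"
        unfolding v_def vec_scale[OF fs_unit] by (rule bopD(3)[OF T vec_in_spc[OF fs_unit]])
      then show ?thesis by (simp add: rep_def scaleR_bcontfun.rep_eq)
    qed
    have "(\<lambda>k. \<mu> k * v k) = (\<lambda>k. (\<mu> n / 2) * unit n k)" by (auto simp: v_def unit_def)
    then have c2: "R (\<lambda>k. \<mu> k * v k) k = \<mu> n / 2 * R (unit n) k" for k by (simp only: R_scale)
    have b2: "\<bar>rep T (unit n) k - \<mu> n * R (unit n) k\<bar> \<le> e / 4" for k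
    proof -
      have "rep T (unit n) k - \<mu> n * R (unit n) k = 2 * (rep T v k - R (\<lambda>k. \<mu> k * v k) k)"
        using c1[of k] c2[of k] by simp
      then show ?thesis using b[of k] by (simp only: abs_mult) simp
    qed
    have sm: "\<bar>(\<mu> n - symbol T x) * R (unit n) k\<bar> \<le> e / 8 * 2" for k
      unfolding abs_mult using N[OF n(2)] n(3) unit_bound e by (intro mult_mono) auto
    then have "\<bar>rep T (unit n) k - symbol T x * R (unit n) k\<bar> \<le> e / 2" for k
    proof -
      have "\<bar>\<mu> n * R (unit n) k - symbol T x * R (unit n) k\<bar> \<le> e / 4"
        using sm[of k] by (simp add: left_diff_distrib)
      then show ?thesis using b2[of k] by linarith
    qed
    then have "norm (T (vec (unit n)) - symbol T x *\<^sub>R vec (unit n)) \<le> e / 2"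
      by (intro norm_bound) (simp add: rep_def minus_bcontfun.rep_eq scaleR_bcontfun.rep_eq fs_unit)
    then show ?thesis using e by (simp add: n_def)
  qed
  then show "\<exists>N. \<forall>j\<ge>N. norm (T (vec (unit (anchor x j))) - symbol T x *\<^sub>R vec (unit (anchor x j)) - 0) < e" by blast
qed

lemma coeff_vec_unit: "coeff (vec (unit n)) n = 1"
  by (simp add: fs_unit unit_def)

text \<open>Coefficient \<open>n\<close> of \<open>T d - c *\<^sub>R d\<close>, for the basis vector
  \<open>d\<close> at \<open>n\<close>, is the diagonal coefficient minus \<open>c\<close>. So an
  approximate eigenvalue determines the symbol, and the algebraic rules follow from limits of
  eigenvectors.\<close>

lemma symbol_eqI:
  assumes x: "x \<in> K" and lim: "(\<lambda>j. T (vec (unit (anchor x j))) - c *\<^sub>R vec (unit (anchor x j))) \<longlonglongrightarrow> 0"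
  shows "symbol T x = c"
proof -
  have "(\<lambda>j. diag_coeff (rep T) (anchor x j) - c) \<longlonglongrightarrow> 0"
  proof (rule Lim_null_comparison)
    show "\<forall>\<^sub>F j in sequentially. norm (diag_coeff (rep T) (anchor x j) - c) \<le>
        8 * norm (T (vec (unit (anchor x j))) - c *\<^sub>R vec (unit (anchor x j)))"
    proof (rule always_eventually, rule allI)
      fix j
      show "norm (diag_coeff (rep T) (anchor x j) - c) \<le> 8 * norm (T (vec (unit (anchor x j))) - c *\<^sub>R vec (unit (anchor x j)))"
        using coeff_le[of "T (vec (unit (anchor x j))) - c *\<^sub>R vec (unit (anchor x j))" "anchor x j"]
        unfolding coeff_diff coeff_scale coeff_vec_unit by (simp add: diag_coeff_def rep_def)
    qed
    show "(\<lambda>j. 8 * norm (T (vec (unit (anchor x j))) - c *\<^sub>R vec (unit (anchor x j)))) \<longlonglongrightarrow> 0"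
      using tendsto_mult_right_zero[OF tendsto_norm_zero[OF lim]] .
  qed
  then have "(\<lambda>j. diag_coeff (rep T) (anchor x j)) \<longlonglongrightarrow> c" by (simp add: LIM_zero_iff)
  then show ?thesis using x by (simp add: symbol_def limI)
qed

lemma symbol_add:
  assumes "bop S" "bop T" "x \<in> K" "\<And>y. y \<in> spc \<Longrightarrow> U y = S y + T y"
  shows "symbol U x = symbol S x + symbol T x"
proof (rule symbol_eqI[OF assms(3)])
  show "(\<lambda>j. U (vec (unit (anchor x j))) - (symbol S x + symbol T x) *\<^sub>R vec (unit (anchor x j))) \<longlonglongrightarrow> 0"
    using tendsto_add[OF symbol_eigen[OF assms(1,3)] symbol_eigen[OF assms(2,3)]]
    by (simp add: assms(4) vec_in_spc fs_unit algebra_simps)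
qed

lemma symbol_scale:
  assumes "bop T" "x \<in> K" "\<And>y. y \<in> spc \<Longrightarrow> U y = c *\<^sub>R T y"
  shows "symbol U x = c * symbol T x"
proof (rule symbol_eqI[OF assms(2)])
  show "(\<lambda>j. U (vec (unit (anchor x j))) - (c * symbol T x) *\<^sub>R vec (unit (anchor x j))) \<longlonglongrightarrow> 0"
    using tendsto_scaleR[OF tendsto_const symbol_eigen[OF assms(1,2)], of c]
    by (simp add: assms(3) vec_in_spc fs_unit algebra_simps)
qed

lemma symbol_compose:
  assumes S: "bop S" and T: "bop T" and x: "x \<in> K" and U: "\<And>y. y \<in> spc \<Longrightarrow> U y = S (T y)"
  shows "symbol U x = symbol S x * symbol T x"
proof (rule symbol_eqI[OF x])
  let ?u = "\<lambda>j. vec (unit (anchor x j))"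
  let ?d = "\<lambda>j. T (?u j) - symbol T x *\<^sub>R ?u j"
  have u: "?u j \<in> spc" for j by (rule vec_in_spc[OF fs_unit])
  have Tu: "T (?u j) \<in> spc" for j by (rule bopD(1)[OF T u])
  have su: "symbol T x *\<^sub>R ?u j \<in> spc" for j by (rule subspace_scale[OF subspace_spc u])
  have d: "?d j \<in> spc" for j by (rule subspace_diff[OF subspace_spc Tu su])
  obtain B where B: "0 < B" "\<forall>x\<in>spc. norm (S x) \<le> B * norm x" using bopD(5)[OF S] by blast
  have "(\<lambda>j. S (?d j)) \<longlonglongrightarrow> 0"
  proof (rule Lim_null_comparison)
    show "\<forall>\<^sub>F j in sequentially. norm (S (?d j)) \<le> B * norm (?d j)" using B d by (auto intro: always_eventually)
    show "(\<lambda>j. B * norm (?d j)) \<longlonglongrightarrow> 0"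
      using tendsto_mult_right_zero[OF tendsto_norm_zero[OF symbol_eigen[OF T x]]] .
  qed
  then have "(\<lambda>j. S (?d j) + symbol T x *\<^sub>R (S (?u j) - symbol S x *\<^sub>R ?u j)) \<longlonglongrightarrow> 0 + symbol T x *\<^sub>R 0"
    by (intro tendsto_add tendsto_scaleR tendsto_const symbol_eigen[OF S x])
  moreover have "S (?d j) + symbol T x *\<^sub>R (S (?u j) - symbol S x *\<^sub>R ?u j) = U (?u j) - (symbol S x * symbol T x) *\<^sub>R ?u j" for j
    using bopD(4)[OF S Tu su, of j j] bopD(3)[OF S u, of "symbol T x" j] U[OF u, of j]
    by (simp add: algebra_simps)
  ultimately show "(\<lambda>j. U (?u j) - (symbol S x * symbol T x) *\<^sub>R ?u j) \<longlonglongrightarrow> 0" by simp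
qed

lemma symbol_id: "x \<in> K \<Longrightarrow> (\<And>y. y \<in> spc \<Longrightarrow> U y = y) \<Longrightarrow> symbol U x = 1"
  by (rule symbol_eqI) (simp_all add: vec_in_spc fs_unit)

lemma symbol_norm_le:
  assumes T: "bop T" and x: "x \<in> K" and B: "\<And>y. y \<in> spc \<Longrightarrow> norm (T y) \<le> B * norm y"
  shows "\<bar>symbol T x\<bar> \<le> B"
proof -
  let ?u = "\<lambda>j. vec (unit (anchor x j))"
  have u1: "1 \<le> norm (?u j)" for j
    using coord_le[of "?u j" "anchor x j"] by (simp add: fs_unit R_unit_self)
  have "\<bar>symbol T x\<bar> \<le> B + norm (T (?u j) - symbol T x *\<^sub>R ?u j)" for j
  proof -
    have "\<bar>symbol T x\<bar> * norm (?u j) \<le> norm (T (?u j)) + norm (T (?u j) - symbol T x *\<^sub>R ?u j)"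
      using norm_triangle_ineq4[of "T (?u j)" "T (?u j) - symbol T x *\<^sub>R ?u j"] by simp
    also have "\<dots> \<le> B * norm (?u j) + norm (T (?u j) - symbol T x *\<^sub>R ?u j) * norm (?u j)"
      using B[OF vec_in_spc[OF fs_unit]] u1[of j] mult_left_mono[of 1 "norm (?u j)" "norm (T (?u j) - symbol T x *\<^sub>R ?u j)"]
      by (intro add_mono) auto
    finally have "\<bar>symbol T x\<bar> * norm (?u j) \<le> (B + norm (T (?u j) - symbol T x *\<^sub>R ?u j)) * norm (?u j)"
      by (simp add: algebra_simps)
    moreover have "0 < norm (?u j)" using u1[of j] by linarith
    ultimately show ?thesis by (rule mult_right_le_imp_le)
  qed
  moreover have "(\<lambda>j. B + norm (T (?u j) - symbol T x *\<^sub>R ?u j)) \<longlonglongrightarrow> B + 0"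
    by (intro tendsto_add tendsto_const tendsto_norm_zero symbol_eigen[OF T x])
  ultimately show ?thesis
    by (intro LIMSEQ_le_const[of "\<lambda>j. B + norm (T (?u j) - symbol T x *\<^sub>R ?u j)"]) auto
qed

text \<open>Along a subsequence the images of the basis vectors converge to some \<open>y\<close>.
  The diagonal coefficients are read at indices tending to infinity, where the coefficients of
  \<open>y\<close> tend to 0.\<close>

lemma symbol_compact:
  assumes T: "bop T" and x: "x \<in> K" and cpt: "compact (closure (T ` (spc \<inter> cball 0 1)))"
  shows "symbol T x = 0"
proof -
  let ?u = "\<lambda>j. (1/2) *\<^sub>R vec (unit (anchor x j))"
  have u: "?u j \<in> spc \<inter> cball 0 1" for j
  proof -
    have "norm (vec (unit (anchor x j))) \<le> 2" by (rule vec_norm_le[OF fs_unit unit_bound])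
    moreover have "?u j \<in> spc" by (rule subspace_scale[OF subspace_spc vec_in_spc[OF fs_unit]])
    ultimately show ?thesis by simp
  qed
  have mem: "\<forall>j. T (?u j) \<in> closure (T ` (spc \<inter> cball 0 1))"
    by (intro allI closure_subset[THEN subsetD] imageI u)
  obtain y r where yr: "strict_mono r" "((\<lambda>j. T (?u j)) \<circ> r) \<longlonglongrightarrow> y"
    by (rule seq_compactE[OF cpt[THEN compact_imp_seq_compact] mem])
  have "T (?u j) \<in> spc" for j using bopD(1)[OF T] u by blast
  then have y: "y \<in> spc" using closed_sequentially[OF closed_spc _ yr(2)] by simp
  have c1: "(\<lambda>i. coeff y (anchor x (r i))) \<longlonglongrightarrow> 0"
    by (rule filterlim_compose[OF coeff_tendsto_0[OF y] filterlim_compose[OF anchor_filterlim[OF x] filterlim_subseq[OF yr(1)]]])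
  have c2: "(\<lambda>i. coeff (T (?u (r i)) - y) (anchor x (r i))) \<longlonglongrightarrow> 0"
  proof (rule Lim_null_comparison)
    show "\<forall>\<^sub>F i in sequentially. norm (coeff (T (?u (r i)) - y) (anchor x (r i))) \<le> 8 * norm (T (?u (r i)) - y)"
      by (rule always_eventually) (simp only: real_norm_def coeff_le simp_thms)
    show "(\<lambda>i. 8 * norm (T (?u (r i)) - y)) \<longlonglongrightarrow> 0"
      using yr(2) by (intro tendsto_mult_right_zero tendsto_norm_zero LIM_zero) (simp add: o_def)
  qed
  have half: "coeff (T (?u j)) n = (1/2) * coeff (T (vec (unit (anchor x j)))) n" for j n
    unfolding bopD(3)[OF T vec_in_spc[OF fs_unit]] coeff_scale ..
  then have "diag_coeff (rep T) (anchor x (r i)) = 2 * (coeff y (anchor x (r i)) + coeff (T (?u (r i)) - y) (anchor x (r i)))" for i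
    unfolding coeff_diff diag_coeff_def rep_def half by simp
  then have "(\<lambda>i. diag_coeff (rep T) (anchor x (r i))) \<longlonglongrightarrow> 2 * (0 + 0)"
    using tendsto_mult[OF tendsto_const tendsto_add[OF c1 c2], of 2] by simp
  moreover have "(\<lambda>i. diag_coeff (rep T) (anchor x (r i))) \<longlonglongrightarrow> symbol T x"
    using LIMSEQ_subseq_LIMSEQ[OF symbol_limit(2)[OF T x] yr(1)] by (simp add: o_def)
  ultimately show ?thesis using LIMSEQ_unique by fastforce
qed

lemma tail_small:
  assumes T: "bop T" and small: "\<And>v q. supp p q v \<Longrightarrow> (\<forall>n. \<bar>R v n\<bar> \<le> 1) \<Longrightarrow> \<forall>n. \<bar>rep T v n\<bar> \<le> \<epsilon>" and \<epsilon>: "0 \<le> \<epsilon>"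
    and x: "x \<in> spc"
  shows "norm (T x - T (vec (restr 0 p (coeff x)))) \<le> 8 * norm x * \<epsilon>"
proof (cases "x = 0")
  case True
  have "norm (vec (restr 0 p (coeff x))) \<le> 0" using restr_norm[of p x] True by simp
  then show ?thesis using True by simp
next
  case False
  then have nx: "0 < norm x" by simp
  obtain B where B: "0 < B" "\<forall>x\<in>spc. norm (T x) \<le> B * norm x" using bopD(5)[OF T] by blast
  have lim: "(\<lambda>q. T (vec (restr 0 q (coeff x)))) \<longlonglongrightarrow> T x"
  proof -
    have "(\<lambda>q. T (vec (restr 0 q (coeff x)) - x)) \<longlonglongrightarrow> 0"
    proof (rule Lim_null_comparison)
      show "\<forall>\<^sub>F q in sequentially. norm (T (vec (restr 0 q (coeff x)) - x)) \<le> B * norm (vec (restr 0 q (coeff x)) - x)"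
        using B x subspace_diff[OF subspace_spc vec_in_spc[OF fs_restr]] by (intro always_eventually) blast
      show "(\<lambda>q. B * norm (vec (restr 0 q (coeff x)) - x)) \<longlonglongrightarrow> 0"
        by (intro tendsto_mult_right_zero tendsto_norm_zero LIM_zero restr_tendsto x)
    qed
    then have "(\<lambda>q. T (vec (restr 0 q (coeff x))) - T x) \<longlonglongrightarrow> 0"
      using bopD(4)[OF T vec_in_spc[OF fs_restr] x] by simp
    then show ?thesis by (rule LIM_zero_cancel)
  qed
  have "norm (T (vec (restr 0 q (coeff x))) - T (vec (restr 0 p (coeff x)))) \<le> 8 * norm x * \<epsilon>" if q: "p \<le> q" for q
  proof -
    define a where "a = mlt p q (\<lambda>_. 1) (coeff x)"
    have sa: "supp p q a" by (auto simp: a_def mlt_def supp_def)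
    have ab: "\<bar>R a n\<bar> \<le> 8 * norm x" for n
      unfolding a_def by (rule mlt_bound) (auto simp: coord_le)
    have eq: "(\<lambda>k. restr 0 q (coeff x) k - restr 0 p (coeff x) k) = a"
      using q by (auto simp: a_def mlt_def restr_def)
    have "T (vec (restr 0 q (coeff x))) - T (vec (restr 0 p (coeff x))) = T (vec a)"
      using bopD(4)[OF T vec_in_spc[OF fs_restr] vec_in_spc[OF fs_restr]] vec_diff[OF fs_restr fs_restr] eq by metis
    also have "\<dots> = (8 * norm x) *\<^sub>R T (vec (\<lambda>k. (1 / (8 * norm x)) * a k))"
      unfolding vec_scale[OF supp_fs[OF sa]] bopD(3)[OF T vec_in_spc[OF supp_fs[OF sa]]] using nx by simp
    finally have "norm (T (vec (restr 0 q (coeff x))) - T (vec (restr 0 p (coeff x)))) =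
        8 * norm x * norm (T (vec (\<lambda>k. (1 / (8 * norm x)) * a k)))" by simp
    moreover have "norm (T (vec (\<lambda>k. (1 / (8 * norm x)) * a k))) \<le> \<epsilon>"
    proof (rule norm_bound)
      fix n
      have "\<forall>n. \<bar>R (\<lambda>k. (1 / (8 * norm x)) * a k) n\<bar> \<le> 1"
        unfolding R_scale using ab nx by (simp add: abs_mult divide_le_eq)
      then show "norm (apply_bcontfun (T (vec (\<lambda>k. (1 / (8 * norm x)) * a k))) n) \<le> \<epsilon>"
        using small[OF supp_scale[OF sa], of "1 / (8 * norm x)"] unfolding rep_def by simp
    qed
    ultimately show ?thesis using nx by (simp add: mult_left_mono)
  qed
  then show ?thesis
    using LIMSEQ_le_const2[OF tendsto_norm[OF tendsto_diff[OF lim tendsto_const]]] by blast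
qed

text \<open>With zero symbol the operator itself is small on far blocks. On the unit ball it is
  therefore uniformly close to its action on the projection to the first \<open>p\<close> basis
  vectors, whose image lies in a compact set of finite dimension.\<close>

lemma symbol_zero_compact:
  assumes T: "bop T" and 0: "\<And>x. x \<in> K \<Longrightarrow> symbol T x = 0"
  shows "compact (closure (T ` (spc \<inter> cball 0 1)))"
proof (rule compact_closure_if_approximable[OF closed_bcontfun_complete[OF closed_closure]])
  fix e :: real assume e: "0 < e"
  \<comment> \<open>For the zero function the multiplier can be zero at every coefficient, so no
    diagonal part has to be subtracted.\<close>
  have S: "symb 0 1 (\<lambda>j. j) (\<lambda>j x. 0) (symbol T) (\<lambda>k. 0)" by (simp add: symb_def 0)
  obtain p where p: "\<And>v q. supp p q v \<Longrightarrow> (\<forall>n. \<bar>R v n\<bar> \<le> 1) \<Longrightarrow> \<forall>n. \<bar>rep T v n\<bar> \<le> e / 8"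
    using small_on_blocks[OF T S, of "e / 8"] e by auto
  define w where "w k = T (vec (ext p (\<lambda>i. if i = k then 1 else 0)))" for k
  let ?C = "{\<Sum>k<p. c k *\<^sub>R w k | c. \<forall>k<p. \<bar>c k\<bar> \<le> 1}"
  have "\<exists>y\<in>?C. dist (T x) y \<le> e" if x: "x \<in> spc" "norm x \<le> 1" for x
  proof (rule bexI)
    let ?y = "T (vec (restr 0 p (coeff x)))"
    have "norm (T x - ?y) \<le> 8 * norm x * (e / 8)" by (rule tail_small[OF T p _ x(1)]) (use e in auto)
    also have "\<dots> \<le> 8 * 1 * (e / 8)" using x e by (intro mult_right_mono) auto
    finally show "dist (T x) ?y \<le> e" by (simp add: dist_norm)
    have "restr 0 p (coeff x) = ext p (apply_bcontfun x)" by (simp add: ext_def)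
    also have "\<dots> = ext p (\<lambda>i. \<Sum>k<p. apply_bcontfun x k * (if i = k then 1 else 0))"
      by (rule ext_cong) (simp add: if_distrib[of "\<lambda>x. _ * x"] cong: if_cong)
    also have "\<dots> = (\<lambda>i. \<Sum>k<p. apply_bcontfun x k * ext p (\<lambda>i. if i = k then 1 else 0) i)"
      by (simp add: ext_sum ext_scale)
    finally have "rep T (restr 0 p (coeff x)) = rep T (\<lambda>i. \<Sum>k<p. apply_bcontfun x k * ext p (\<lambda>i. if i = k then 1 else 0) i)"
      by simp
    moreover obtain L where "bdd_op L (rep T)" using rep_bdd_op[OF T] by blast
    ultimately have "rep T (restr 0 p (coeff x)) =
        (\<lambda>i. \<Sum>k<p. rep T (\<lambda>i. apply_bcontfun x k * ext p (\<lambda>i. if i = k then 1 else 0) i) i)"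
      using bdd_op_sum[of L "rep T" "{..<p}" "\<lambda>k i. apply_bcontfun x k * ext p (\<lambda>i. if i = k then 1 else 0) i"]
      by (simp add: fs_scale fs_ext)
    moreover have "T (vec (\<lambda>i. c * ext p u i)) = c *\<^sub>R T (vec (ext p u))" for c u
      unfolding vec_scale[OF fs_ext] by (rule bopD(3)[OF T vec_in_spc[OF fs_ext]])
    moreover have "apply_bcontfun (\<Sum>k<n. g k) i = (\<Sum>k<n. apply_bcontfun (g k) i)" for n i and g :: "nat \<Rightarrow> nat \<Rightarrow>\<^sub>C real"
      by (induction n) (simp_all add: zero_bcontfun.rep_eq plus_bcontfun.rep_eq)
    ultimately have "?y = (\<Sum>k<p. apply_bcontfun x k *\<^sub>R w k)"
      by (intro bcontfun_eqI) (simp add: rep_def w_def fun_eq_iff scaleR_bcontfun.rep_eq)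
    then show "?y \<in> ?C" using x coord_le[of x] by (auto intro!: exI[of _ "apply_bcontfun x"] intro: order_trans)
  qed
  then show "\<exists>C. compact C \<and> (\<forall>y\<in>T ` (spc \<inter> cball 0 1). \<exists>z\<in>C. dist y z \<le> e)"
    using compact_scaled_combinations[where n = p and w = w] by (intro exI[of _ ?C]) auto
qed

text \<open>The operator acts as in \<open>multiplication_norm\<close>: on values below
  \<open>p\<close>, on coefficients from \<open>p\<close> on. Its diagonal coefficients from
  \<open>p\<close> on are those of the multiplier, which tend to \<open>f\<close>.\<close>

lemma symbol_onto:
  assumes f: "E_continuous f" "\<And>x. x \<in> K \<Longrightarrow> \<bar>f x\<bar> \<le> c" and c: "0 \<le> c" and \<delta>: "0 < \<delta>" and M: "\<And>j. 64 \<le> \<delta> * m j"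
  shows "\<exists>T. T \<in> extensional spc \<and> bop T \<and> (\<forall>x\<in>K. symbol T x = f x) \<and> (\<forall>x\<in>spc. norm (T x) \<le> (1 + \<delta>) * c * norm x)"
proof (cases "c = 0")
  case True
  have "\<exists>T. T \<in> extensional spc \<and> bop T \<and> (\<forall>a. fs a \<longrightarrow> T (vec a) = 0) \<and> (\<forall>x\<in>spc. norm (T x) \<le> 0 * norm x)"
    using subspace_0[OF subspace_spc] by (intro extension) auto
  then obtain T where T: "T \<in> extensional spc" "bop T" "\<forall>x\<in>spc. norm (T x) \<le> 0 * norm x" by blast
  have "symbol T x = f x" if "x \<in> K" for x
    using symbol_norm_le[OF T(2) that, of 0] T(3) f(2)[OF that] True by simp
  then show ?thesis using T True by auto
next
  case False
  then have c: "0 < c" using c by simp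
  \<comment> \<open>With \<open>64 / \<delta>\<close> as lower bound of the weights, both
    \<open>32 * c / M\<close> and \<open>16 * \<epsilon>\<close> equal
    \<open>c * \<delta> / 2\<close>. As \<open>\<epsilon>\<close> is proportional to
    \<open>c\<close>, the case \<open>c = 0\<close> had to be treated apart.\<close>
  define \<epsilon> where "\<epsilon> = c * \<delta> / 32"
  have \<epsilon>: "0 < \<epsilon>" using c \<delta> by (simp add: \<epsilon>_def)
  obtain t G \<mu> where S: "symb c \<epsilon> t G f \<mu>" using symb_exists[OF f(1) _ _ \<epsilon>, of c] f(2) c by auto
  define p where "p = t 0"
  define V0 where "V0 a = (\<lambda>k. ext p (\<lambda>k. f (\<kappa> k) * R a k) k + (if p \<le> k then \<mu> k * a k else 0))" for a
  have fsV: "fs (V0 a)" if a: "fs a" for a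
  proof -
    obtain q where q: "supp 0 q a" using a by (auto simp: fs_def)
    have "fs (\<lambda>k. if p \<le> k then \<mu> k * a k else 0)"
      by (rule supp_fs[of 0 q]) (use q in \<open>auto simp: supp_def\<close>)
    then show ?thesis unfolding V0_def by (rule fs_add[OF fs_ext])
  qed
  have add: "V0 (\<lambda>k. a k + a' k) = (\<lambda>k. V0 a k + V0 a' k)" for a a'
  proof -
    have "(\<lambda>k. f (\<kappa> k) * R (\<lambda>k. a k + a' k) k) = (\<lambda>k. f (\<kappa> k) * R a k + f (\<kappa> k) * R a' k)"
      by (simp add: R_add distrib_left)
    then show ?thesis by (auto simp: V0_def ext_add distrib_left fun_eq_iff)
  qed
  have scale: "V0 (\<lambda>k. d * a k) = (\<lambda>k. d * V0 a k)" for d a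
  proof -
    have "(\<lambda>k. f (\<kappa> k) * R (\<lambda>k. d * a k) k) = (\<lambda>k. d * (f (\<kappa> k) * R a k))"
      by (simp add: R_scale algebra_simps)
    then show ?thesis unfolding V0_def by (simp only: ext_scale) (auto simp: distrib_left)
  qed
  have "norm (vec (V0 a)) \<le> (1 + \<delta>) * c * norm (vec a)" if a: "fs a" for a
  proof (rule vec_norm_le[OF fsV[OF a]])
    fix n
    obtain q where q: "supp 0 q a" using a unfolding fs_def by blast
    define M0 where "M0 = 64 / \<delta>"
    have M0: "M0 \<le> m j" "0 < M0" for j using M[of j] \<delta> by (auto simp: M0_def field_simps)
    have "\<forall>x\<in>K. \<bar>f x\<bar> \<le> c" using f(2) by blast
    from multiplication_norm[OF S this M0 q vec_coord_le[OF a], of p n]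
    have "\<bar>R (V0 a) n\<bar> \<le> (c + 32 * c / M0 + 16 * \<epsilon>) * norm (vec a)" by (simp add: V0_def R_add p_def)
    also have "c + 32 * c / M0 + 16 * \<epsilon> = (1 + \<delta>) * c" using \<delta> by (simp add: M0_def \<epsilon>_def algebra_simps)
    finally show "\<bar>R (V0 a) n\<bar> \<le> (1 + \<delta>) * c * norm (vec a)" .
  qed
  then have "\<exists>T. T \<in> extensional spc \<and> bop T \<and> (\<forall>a. fs a \<longrightarrow> T (vec a) = vec (V0 a)) \<and> (\<forall>x\<in>spc. norm (T x) \<le> (1 + \<delta>) * c * norm x)"
    using c \<delta> by (intro extension) (auto simp: fsV add scale vec_add vec_scale intro: vec_in_spc)
  then obtain T where T: "T \<in> extensional spc" "bop T" "\<forall>a. fs a \<longrightarrow> T (vec a) = vec (V0 a)"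
     "\<forall>x\<in>spc. norm (T x) \<le> (1 + \<delta>) * c * norm x" by blast
  have "symbol T x = f x" if x: "x \<in> K" for x
  proof (rule LIMSEQ_unique[OF symbol_limit(2)[OF T(2) x]])
    have "diag_coeff (rep T) n = \<mu> n" if "p \<le> n" for n
    proof -
      have "diag_coeff (rep T) n = V0 (unit n) n" using T(3) fs_unit fsV[OF fs_unit] by (simp add: diag_coeff_def rep_def)
      moreover have "ext p (\<lambda>k. f (\<kappa> k) * R (unit n) k) n = 0" using that by (simp add: ext_def restr_def)
      ultimately show ?thesis using that by (simp add: V0_def unit_def)
    qed
    then have ev: "\<forall>\<^sub>F j in sequentially. \<mu> (anchor x j) = diag_coeff (rep T) (anchor x j)"
      using anchor_ge[OF x] by (intro eventually_sequentiallyI[of p]) (metis order_trans)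
    have "(\<lambda>j. \<mu> (anchor x j)) \<longlonglongrightarrow> f x"
    proof (rule LIMSEQ_I)
      fix e :: real assume e: "0 < e"
      obtain N where N: "\<And>n. N \<le> n \<Longrightarrow> \<bar>\<mu> n - f (\<kappa> n)\<bar> \<le> e / 2" using symb_limit[OF S, of "e / 2"] e by auto
      have "norm (\<mu> (anchor x j) - f x) < e" if "N \<le> j" for j
        using N[of "anchor x j"] anchor_ge[OF x, of j] anchor[OF x, of j] that e by force
      then show "\<exists>N. \<forall>j\<ge>N. norm (\<mu> (anchor x j) - f x) < e" by blast
    qed
    then show "(\<lambda>j. diag_coeff (rep T) (anchor x j)) \<longlonglongrightarrow> f x" by (rule Lim_transform_eventually[OF _ ev])
  qed
  then show ?thesis using T by blast
qed

end

section \<open>The dual space\<close>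

lemma of_subspace_sel [simp]:
  "carrier (of_subspace V) = V" "nrm (of_subspace V) = norm"
  "x \<oplus>\<^bsub>of_subspace V\<^esub> y = x + y" "c \<odot>\<^bsub>of_subspace V\<^esub> x = c *\<^sub>R x"
  by (simp_all add: of_subspace_def)

lemma op_norm_nonneg:
  assumes "\<exists>B. \<forall>x\<in>carrier M. nrm N (T x) \<le> B * nrm M x" "\<And>x. x \<in> carrier M \<Longrightarrow> 0 \<le> nrm M x"
    "\<And>x. x \<in> carrier M \<Longrightarrow> 0 \<le> nrm N (T x)" "carrier M \<noteq> {}"
  shows "0 \<le> op_norm M N T"
proof (rule ccontr)
  assume neg: "\<not> ?thesis"
  obtain x where x: "x \<in> carrier M" using assms(4) by blast
  have zero: "nrm M y = 0" if y: "y \<in> carrier M" for y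
  proof -
    have "nrm N (T y) \<le> op_norm M N T * nrm M y" by (rule op_norm_bound[OF assms(1,2) y])
    then have "0 \<le> op_norm M N T * nrm M y" using assms(3)[OF y] by linarith
    then show ?thesis using neg assms(2)[OF y] by (simp add: zero_le_mult_iff)
  qed
  have "op_norm M N T = (SUP x\<in>carrier M. (0::real))" unfolding op_norm_def by (rule SUP_cong) (auto simp: zero)
  also have "\<dots> = 0" using x by (intro cSUP_const) blast
  finally show False using neg by simp
qed

lemma bounded_linear_inverse:
  assumes S: "bounded_linear_map N M S" and bij: "bij_betw S (carrier N) (carrier M)"
    and add: "\<And>x y. x \<in> carrier N \<Longrightarrow> y \<in> carrier N \<Longrightarrow> x \<oplus>\<^bsub>N\<^esub> y \<in> carrier N"
    and scale: "\<And>c x. x \<in> carrier N \<Longrightarrow> c \<odot>\<^bsub>N\<^esub> x \<in> carrier N"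
    and lower: "\<And>x. x \<in> carrier N \<Longrightarrow> nrm N x \<le> k * nrm M (S x)"
  shows "bounded_linear_map M N (inv_into (carrier N) S)"
proof -
  let ?I = "inv_into (carrier N) S"
  have mem: "?I y \<in> carrier N" if "y \<in> carrier M" for y
    using bij that by (metis bij_betw_def inv_into_into)
  have SI: "S (?I y) = y" if "y \<in> carrier M" for y
    using bij that by (metis bij_betw_inv_into_right)
  have IS: "?I (S x) = x" if "x \<in> carrier N" for x
    using bij that by (metis bij_betw_inv_into_left)
  have Sadd: "S (x \<oplus>\<^bsub>N\<^esub> y) = S x \<oplus>\<^bsub>M\<^esub> S y" if "x \<in> carrier N" "y \<in> carrier N" for x y
    using S that by (simp add: bounded_linear_map_def)
  have Sscale: "S (c \<odot>\<^bsub>N\<^esub> x) = c \<odot>\<^bsub>M\<^esub> S x" if "x \<in> carrier N" for c x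
    using S that by (simp add: bounded_linear_map_def)
  show ?thesis
    unfolding bounded_linear_map_def
  proof (intro conjI ballI allI)
    show "?I \<in> carrier M \<rightarrow> carrier N" using mem by blast
    fix x y assume xy: "x \<in> carrier M" "y \<in> carrier M"
    have "S (?I x \<oplus>\<^bsub>N\<^esub> ?I y) = x \<oplus>\<^bsub>M\<^esub> y" using Sadd[OF mem[OF xy(1)] mem[OF xy(2)]] SI xy by simp
    then show "?I (x \<oplus>\<^bsub>M\<^esub> y) = ?I x \<oplus>\<^bsub>N\<^esub> ?I y" using IS[OF add[OF mem[OF xy(1)] mem[OF xy(2)]]] by simp
  next
    fix c x assume x: "x \<in> carrier M"
    have "S (c \<odot>\<^bsub>N\<^esub> ?I x) = c \<odot>\<^bsub>M\<^esub> x" using Sscale[OF mem[OF x]] SI[OF x] by simp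
    then show "?I (c \<odot>\<^bsub>M\<^esub> x) = c \<odot>\<^bsub>N\<^esub> ?I x" using IS[OF scale[OF mem[OF x]]] by metis
  next
    show "\<exists>B. \<forall>x\<in>carrier M. nrm N (?I x) \<le> B * nrm M x"
      using lower[OF mem] SI by (intro exI[of _ k]) auto
  qed
qed

text \<open>The explicit maps, from sequences to functionals and from finite sequences to vectors,
  run against the direction in which the isomorphism is wanted. The inverse of the inverse agrees
  with \<open>S\<close> on the carrier only, which is all that \<open>bounded_linear_map\<close>
  inspects.\<close>

lemma isomorphism_inverse:
  assumes S: "bounded_linear_map N M S" and bij: "bij_betw S (carrier N) (carrier M)"
    and add: "\<And>x y. x \<in> carrier N \<Longrightarrow> y \<in> carrier N \<Longrightarrow> x \<oplus>\<^bsub>N\<^esub> y \<in> carrier N"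
    and scale: "\<And>c x. x \<in> carrier N \<Longrightarrow> c \<odot>\<^bsub>N\<^esub> x \<in> carrier N"
    and lower: "\<And>x. x \<in> carrier N \<Longrightarrow> nrm N x \<le> k * nrm M (S x)"
  shows "isomorphism M N (inv_into (carrier N) S)"
proof -
  have eq: "inv_into (carrier M) (inv_into (carrier N) S) x = S x" if "x \<in> carrier N" for x
    using inv_into_inv_into_eq[OF bij that] .
  have "bounded_linear_map N M (inv_into (carrier M) (inv_into (carrier N) S))"
    using S unfolding bounded_linear_map_def Pi_iff by (simp add: eq add scale)
  then show ?thesis
    unfolding isomorphism_def
    using bounded_linear_inverse[OF S bij add scale lower] bij_betw_inv_into[OF bij] by blast
qed

lemma summable_superposition:
  fixes \<beta> :: "nat \<Rightarrow> nat \<Rightarrow> real"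
  assumes b: "\<And>j n. (\<Sum>k<n. \<bar>\<beta> j k\<bar>) \<le> C * (1/2) ^ j"
  shows "summable (\<lambda>j. \<beta> j k)" and "summable (\<lambda>k. \<bar>\<Sum>j. \<beta> j k\<bar>)" and "(\<Sum>k. \<bar>\<Sum>j. \<beta> j k\<bar>) \<le> 2 * C"
proof -
  have bk: "\<bar>\<beta> j k\<bar> \<le> C * (1/2) ^ j" for j k
  proof -
    have "\<bar>\<beta> j k\<bar> \<le> (\<Sum>i<Suc k. \<bar>\<beta> j i\<bar>)" by (rule member_le_sum) auto
    then show ?thesis using b[of j "Suc k"] by linarith
  qed
  have geo: "summable (\<lambda>j. C * (1/2) ^ j)" by (intro summable_mult summable_geometric) simp
  have abs_sum: "summable (\<lambda>j. \<bar>\<beta> j k\<bar>)" for k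
    by (rule summable_comparison_test[OF _ geo]) (use bk in auto)
  show "summable (\<lambda>j. \<beta> j k)" for k using abs_sum by (rule summable_rabs_cancel)
  have part: "(\<Sum>k<n. \<bar>\<Sum>j. \<beta> j k\<bar>) \<le> 2 * C" for n
  proof -
    have "(\<Sum>k<n. \<bar>\<Sum>j. \<beta> j k\<bar>) \<le> (\<Sum>k<n. \<Sum>j. \<bar>\<beta> j k\<bar>)" by (intro sum_mono summable_rabs abs_sum)
    also have "\<dots> = (\<Sum>j. \<Sum>k<n. \<bar>\<beta> j k\<bar>)" by (rule suminf_sum[symmetric]) (rule abs_sum)
    also have "\<dots> \<le> (\<Sum>j. C * (1/2) ^ j)"
      by (rule suminf_le[OF b _ geo]) (intro summable_sum abs_sum)
    also have "\<dots> = 2 * C" by (subst suminf_mult) (auto simp: suminf_geometric)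
    finally show ?thesis .
  qed
  show "summable (\<lambda>k. \<bar>\<Sum>j. \<beta> j k\<bar>)" by (rule summableI_nonneg_bounded[OF _ part]) simp
  then show "(\<Sum>k. \<bar>\<Sum>j. \<beta> j k\<bar>) \<le> 2 * C" by (rule suminf_le_const) (rule part)
qed

context bourgain_delbaen
begin

text \<open>The sequence \<open>c\<close> is paired with the coordinates of the vector, not with its
  basis coefficients: it is the coordinate functionals that span a copy of
  \<open>\<ell>\<^sub>1\<close>.\<close>

definition pairing :: "(nat \<Rightarrow> real) \<Rightarrow> (nat \<Rightarrow>\<^sub>C real) \<Rightarrow> real" where
  "pairing c = (\<lambda>x\<in>spc. \<Sum>n. c n * apply_bcontfun x n)"

lemma pairing_summable:
  assumes "summable (\<lambda>n. \<bar>c n\<bar>)"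
  shows "summable (\<lambda>n. c n * apply_bcontfun x n)" "\<bar>\<Sum>n. c n * apply_bcontfun x n\<bar> \<le> (\<Sum>n. \<bar>c n\<bar>) * norm x"
proof -
  have le: "\<bar>c n * apply_bcontfun x n\<bar> \<le> \<bar>c n\<bar> * norm x" for n
    unfolding abs_mult by (intro mult_left_mono coord_le) simp
  have s: "summable (\<lambda>n. \<bar>c n\<bar> * norm x)" using assms by (rule summable_mult2)
  have a: "summable (\<lambda>n. \<bar>c n * apply_bcontfun x n\<bar>)"
    by (rule summable_comparison_test[OF _ s]) (use le in auto)
  then show "summable (\<lambda>n. c n * apply_bcontfun x n)" by (rule summable_rabs_cancel)
  have "\<bar>\<Sum>n. c n * apply_bcontfun x n\<bar> \<le> (\<Sum>n. \<bar>c n * apply_bcontfun x n\<bar>)" by (rule summable_rabs[OF a])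
  also have "\<dots> \<le> (\<Sum>n. \<bar>c n\<bar> * norm x)" by (rule suminf_le[OF le a s])
  also have "\<dots> = (\<Sum>n. \<bar>c n\<bar>) * norm x" using assms by (rule suminf_mult2[symmetric])
  finally show "\<bar>\<Sum>n. c n * apply_bcontfun x n\<bar> \<le> (\<Sum>n. \<bar>c n\<bar>) * norm x" .
qed

abbreviation "dual \<equiv> dual_space (of_subspace spc)"

lemma carrier_dual:
  "carrier dual = {\<phi> \<in> extensional spc. (\<forall>x\<in>spc. \<forall>y\<in>spc. \<phi> (x + y) = \<phi> x + \<phi> y) \<and>
     (\<forall>c. \<forall>x\<in>spc. \<phi> (c *\<^sub>R x) = c * \<phi> x) \<and> (\<exists>B. \<forall>x\<in>spc. \<bar>\<phi> x\<bar> \<le> B * norm x)}"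
  by (auto simp: dual_space_def operator_space_def bounded_linear_map_def)

lemma nrm_dual: "nrm dual \<phi> = op_norm (of_subspace spc) (of_subspace UNIV) \<phi>"
  by (simp add: dual_space_def operator_space_def)

lemma nrm_dual_bound: "\<phi> \<in> carrier dual \<Longrightarrow> x \<in> spc \<Longrightarrow> \<bar>\<phi> x\<bar> \<le> nrm dual \<phi> * norm x"
  using op_norm_bound[of "of_subspace spc" "of_subspace UNIV" \<phi> x]
  by (auto simp: nrm_dual carrier_dual)

lemma pairing_mem: "summable (\<lambda>n. \<bar>c n\<bar>) \<Longrightarrow> pairing c \<in> carrier dual"
proof -
  assume c: "summable (\<lambda>n. \<bar>c n\<bar>)"
  have "pairing c (x + y) = pairing c x + pairing c y" if "x \<in> spc" "y \<in> spc" for x y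
    using that suminf_add[OF pairing_summable(1)[OF c] pairing_summable(1)[OF c], of x y] subspace_add[OF subspace_spc that]
    by (simp add: pairing_def plus_bcontfun.rep_eq distrib_left)
  moreover have "pairing c (d *\<^sub>R x) = d * pairing c x" if "x \<in> spc" for x d
    using that suminf_mult[OF pairing_summable(1)[OF c], of d x] subspace_scale[OF subspace_spc that]
    by (simp add: pairing_def scaleR_bcontfun.rep_eq algebra_simps)
  moreover have "\<forall>x\<in>spc. \<bar>pairing c x\<bar> \<le> (\<Sum>n. \<bar>c n\<bar>) * norm x"
    using pairing_summable(2)[OF c] by (simp add: pairing_def)
  ultimately show ?thesis unfolding carrier_dual by (auto simp: pairing_def)
qed

text \<open>Tested on the extension of finitely many signs of \<open>c\<close>, a vector of norm at
  most 2. The extension is uncontrolled beyond \<open>N\<close> except for this bound, and there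
  \<open>c\<close> has a small tail.\<close>

lemma pairing_lower:
  assumes c: "summable (\<lambda>n. \<bar>c n\<bar>)"
  shows "(\<Sum>n. \<bar>c n\<bar>) \<le> 2 * nrm dual (pairing c)"
proof (rule field_le_epsilon)
  fix e :: real assume e: "0 < e"
  obtain N where N: "\<And>n. N \<le> n \<Longrightarrow> norm (\<Sum>i. \<bar>c (i + n)\<bar>) < e / 3"
    using suminf_exist_split[OF _ c, of "e / 3"] e by auto
  define x where "x = vec (ext N (\<lambda>n. sgn (c n)))"
  have xs: "x \<in> spc" unfolding x_def by (rule vec_in_spc[OF fs_ext])
  have nx: "norm x \<le> 2"
    unfolding x_def using ext_bound[of N "\<lambda>n. sgn (c n)" 1] by (intro vec_norm_le[OF fs_ext]) (simp add: abs_sgn_eq)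
  have xn: "c n * apply_bcontfun x n = \<bar>c n\<bar>" if "n < N" for n
    using that by (simp add: x_def fs_ext abs_sgn)
  have sc: "summable (\<lambda>n. \<bar>c (n + N)\<bar>)" using c by (rule summable_ignore_initial_segment)
  have sx: "summable (\<lambda>n. c n * apply_bcontfun x n)" by (rule pairing_summable(1)[OF c])
  have sxN: "summable (\<lambda>n. c (n + N) * apply_bcontfun x (n + N))" using sx by (rule summable_ignore_initial_segment)
  have le: "\<bar>c (n + N) * apply_bcontfun x (n + N)\<bar> \<le> 2 * \<bar>c (n + N)\<bar>" for n
    unfolding abs_mult using mult_left_mono[OF order_trans[OF coord_le nx], of "\<bar>c (n + N)\<bar>" "n + N"] by (simp add: mult.commute)
  have a: "summable (\<lambda>n. \<bar>c (n + N) * apply_bcontfun x (n + N)\<bar>)"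
    by (rule summable_comparison_test[OF _ summable_mult[OF sc, of 2]]) (use le in auto)
  have "\<bar>\<Sum>n. c (n + N) * apply_bcontfun x (n + N)\<bar> \<le> (\<Sum>n. \<bar>c (n + N) * apply_bcontfun x (n + N)\<bar>)" by (rule summable_rabs[OF a])
  also have "\<dots> \<le> (\<Sum>n. 2 * \<bar>c (n + N)\<bar>)" by (rule suminf_le[OF le a summable_mult[OF sc]])
  also have "\<dots> = 2 * (\<Sum>n. \<bar>c (n + N)\<bar>)" by (rule suminf_mult[OF sc])
  finally have t: "\<bar>\<Sum>n. c (n + N) * apply_bcontfun x (n + N)\<bar> \<le> 2 * (e / 3)" using N[of N] by simp
  have "pairing c x = (\<Sum>n. c (n + N) * apply_bcontfun x (n + N)) + (\<Sum>n<N. \<bar>c n\<bar>)"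
    using xs suminf_split_initial_segment[OF sx, of N] xn by (simp add: pairing_def)
  moreover have "(\<Sum>n. \<bar>c n\<bar>) = (\<Sum>n. \<bar>c (n + N)\<bar>) + (\<Sum>n<N. \<bar>c n\<bar>)" by (rule suminf_split_initial_segment[OF c])
  moreover have "(\<Sum>n. \<bar>c (n + N)\<bar>) \<le> e / 3" using N[of N] by simp
  moreover have "\<bar>pairing c x\<bar> \<le> nrm dual (pairing c) * norm x" by (rule nrm_dual_bound[OF pairing_mem[OF c] xs])
  moreover have "nrm dual (pairing c) * norm x \<le> nrm dual (pairing c) * 2"
  proof (rule mult_left_mono[OF nx])
    show "0 \<le> nrm dual (pairing c)"
      unfolding nrm_dual using pairing_mem[OF c] xs
      by (intro op_norm_nonneg) (auto simp: carrier_dual)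
  qed
  ultimately show "(\<Sum>n. \<bar>c n\<bar>) \<le> 2 * nrm dual (pairing c) + e" using t by linarith
qed

end

context saturated
begin

text \<open>The basis is shrinking. Regarded as an operator with constant values, the functional is
  small on far rapidly increasing blocks by \<open>RIS_small\<close>, and then on all far bounded
  blocks by \<open>block_small\<close>.\<close>

lemma functional_tail:
  assumes \<phi>: "\<phi> \<in> carrier dual" and \<epsilon>: "0 < \<epsilon>"
  shows "\<exists>p. \<forall>v q. supp p q v \<longrightarrow> (\<forall>n. \<bar>R v n\<bar> \<le> 1) \<longrightarrow> \<bar>\<phi> (vec v)\<bar> \<le> \<epsilon>"
proof -
  have lin: "x \<in> spc \<Longrightarrow> y \<in> spc \<Longrightarrow> \<phi> (x + y) = \<phi> x + \<phi> y" "x \<in> spc \<Longrightarrow> \<phi> (c *\<^sub>R x) = c * \<phi> x" for x y c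
    using \<phi> by (auto simp: carrier_dual)
  obtain B where B: "\<forall>x\<in>spc. \<bar>\<phi> x\<bar> \<le> B * norm x" using \<phi> by (auto simp: carrier_dual)
  have U: "bdd_op \<bar>B\<bar> (\<lambda>a n. \<phi> (vec a))"
    unfolding bdd_op_def
  proof (intro conjI allI impI)
    fix a b n assume a: "fs a" "\<forall>n. \<bar>R a n\<bar> \<le> b"
    have "\<bar>\<phi> (vec a)\<bar> \<le> \<bar>B\<bar> * norm (vec a)" using B vec_in_spc[OF a(1)]
      by (meson abs_ge_self mult_right_mono norm_ge_zero order_trans)
    also have "\<dots> \<le> \<bar>B\<bar> * b" using vec_norm_le[OF a(1)] a(2) by (intro mult_left_mono) auto
    finally show "\<bar>\<phi> (vec a)\<bar> \<le> \<bar>B\<bar> * b" .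
  qed (auto simp: vec_add vec_scale lin vec_in_spc)
  have "\<exists>p. \<forall>v q. supp p q v \<longrightarrow> (\<forall>n. \<bar>R v n\<bar> \<le> 1) \<longrightarrow> (\<forall>n::nat. \<bar>\<phi> (vec v)\<bar> \<le> \<epsilon>)"
  proof (rule block_small[OF _ _ \<epsilon>, where W = "\<lambda>v n. \<phi> (vec v)"])
    fix C \<epsilon> :: real assume "0 \<le> C" "0 < \<epsilon>"
    from RIS_small[OF U this]
    show "\<exists>p i. \<forall>v q. supp p q v \<longrightarrow> GV C i v \<longrightarrow> (\<forall>n::nat. \<bar>\<phi> (vec v)\<bar> \<le> \<epsilon>)" by simp
  qed (simp add: vec_add lin vec_in_spc)
  then show ?thesis by simp
qed

text \<open>\<open>\<phi>\<close> is cut along intervals so far out that its restriction to the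
  \<open>j\<close>-th one is of order \<open>(1/2) ^ j\<close>. Each piece is a combination of
  finitely many coordinates with coefficients of the same order, and the coefficients of all pieces
  sum to an absolutely summable sequence.\<close>

lemma pairing_onto:
  assumes \<phi>: "\<phi> \<in> carrier dual"
  shows "\<exists>c. summable (\<lambda>n. \<bar>c n\<bar>) \<and> pairing c = \<phi>"
proof -
  have lin: "x \<in> spc \<Longrightarrow> y \<in> spc \<Longrightarrow> \<phi> (x + y) = \<phi> x + \<phi> y" "x \<in> spc \<Longrightarrow> \<phi> (c *\<^sub>R x) = c * \<phi> x" for x y c
    using \<phi> by (auto simp: carrier_dual)
  have ext: "\<phi> \<in> extensional spc" using \<phi> by (auto simp: carrier_dual)
  obtain B where B: "0 \<le> B" "\<forall>x\<in>spc. \<bar>\<phi> x\<bar> \<le> B * norm x"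
  proof -
    obtain B where "\<forall>x\<in>spc. \<bar>\<phi> x\<bar> \<le> B * norm x" using \<phi> by (auto simp: carrier_dual)
    then have "\<forall>x\<in>spc. \<bar>\<phi> x\<bar> \<le> \<bar>B\<bar> * norm x" by (meson abs_ge_self mult_right_mono norm_ge_zero order_trans)
    then show thesis using that[of "\<bar>B\<bar>"] by simp
  qed
  define A where "A = B + 1"
  have A: "0 < A" using B by (simp add: A_def)
  have "\<exists>p. \<forall>v q. supp p q v \<longrightarrow> (\<forall>n. \<bar>R v n\<bar> \<le> 1) \<longrightarrow> \<bar>\<phi> (vec v)\<bar> \<le> A * (1/2) ^ j" for j
    by (rule functional_tail[OF \<phi>]) (use A in simp)
  then obtain r where r: "\<And>j v q. supp (r j) q v \<Longrightarrow> (\<forall>n. \<bar>R v n\<bar> \<le> 1) \<Longrightarrow> \<bar>\<phi> (vec v)\<bar> \<le> A * (1/2) ^ j" by metis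
  \<comment> \<open>The summand \<open>j\<close> makes \<open>p\<close> unbounded, and
    \<open>p 0 = 0\<close> lets the pieces exhaust \<open>\<phi>\<close>.\<close>
  define p where "p j = (if j = 0 then 0 else j + (\<Sum>i\<le>j. r i))" for j
  have p_mono: "p j \<le> p (Suc j)" for j by (simp add: p_def)
  have small: "\<bar>\<phi> (vec v)\<bar> \<le> A * (1/2) ^ j" if v: "supp (p j) q v" "\<forall>n. \<bar>R v n\<bar> \<le> 1" for j v q
  proof (cases "j = 0")
    case True
    have fv: "fs v" using v(1) supp_fs by blast
    have "\<bar>\<phi> (vec v)\<bar> \<le> B * norm (vec v)" using B vec_in_spc[OF fv] by blast
    also have "\<dots> \<le> B * 1" using B v(2) by (intro mult_left_mono vec_norm_le[OF fv]) auto
    finally show ?thesis using True by (simp add: A_def)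
  next
    case False
    have "r j \<le> (\<Sum>i\<le>j. r i)" by (rule member_le_sum) auto
    then have "r j \<le> p j" using False by (simp add: p_def)
    then show ?thesis using r supp_mono[OF v(1)] v(2) by blast
  qed
  define g where "g j a = \<phi> (vec (restr (p j) (p (Suc j)) a))" for j a
  have fsr: "fs (restr i j a)" for i j a by (rule supp_fs[of i j]) (auto simp: supp_def restr_def)
  have "\<exists>\<beta>. (\<Sum>k<p (Suc j). \<bar>\<beta> k\<bar>) \<le> 8 * A * (1/2) ^ j \<and>
      (\<forall>a. supp 0 (p (Suc j)) a \<longrightarrow> g j a = (\<Sum>k<p (Suc j). \<beta> k * R a k))" for j
  proof (rule functional_repr)
    fix a a' c
    have "restr (p j) (p (Suc j)) (\<lambda>k. a k + a' k) = (\<lambda>k. restr (p j) (p (Suc j)) a k + restr (p j) (p (Suc j)) a' k)"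
      by (auto simp: restr_def)
    then show "g j (\<lambda>k. a k + a' k) = g j a + g j a'" by (simp add: g_def vec_add fsr lin vec_in_spc)
    have "restr (p j) (p (Suc j)) (\<lambda>k. c * a k) = (\<lambda>k. c * restr (p j) (p (Suc j)) a k)" by (auto simp: restr_def)
    then show "g j (\<lambda>k. c * a k) = c * g j a" by (simp add: g_def vec_scale fsr lin vec_in_spc)
  next
    fix a :: "nat \<Rightarrow> real" assume a: "supp 0 (p (Suc j)) a" "\<And>k. k < p (Suc j) \<Longrightarrow> \<bar>R a k\<bar> \<le> 1"
    let ?v = "restr (p j) (p (Suc j)) a"
    have "\<bar>R ?v n\<bar> \<le> 8 * 1" for n unfolding restr_mlt by (rule mlt_bound) (use a in auto)
    then have "\<forall>n. \<bar>R (\<lambda>k. (1/8) * ?v k) n\<bar> \<le> 1" unfolding R_scale by (simp add: abs_mult)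
    moreover have "supp (p j) (p (Suc j)) (\<lambda>k. (1/8) * ?v k)" by (auto simp: supp_def restr_def)
    ultimately have "\<bar>\<phi> (vec (\<lambda>k. (1/8) * ?v k))\<bar> \<le> A * (1/2) ^ j" by (rule small[rotated])
    then have "\<bar>(1/8) * \<phi> (vec ?v)\<bar> \<le> A * (1/2) ^ j" using lin(2)[OF vec_in_spc, OF fsr] by (simp only: vec_scale[OF fsr])
    then show "g j a \<le> 8 * A * (1/2) ^ j" by (simp add: g_def abs_mult)
  qed
  then obtain \<beta>0 where \<beta>0: "\<And>j. (\<Sum>k<p (Suc j). \<bar>\<beta>0 j k\<bar>) \<le> 8 * A * (1/2) ^ j"
      "\<And>j a. supp 0 (p (Suc j)) a \<Longrightarrow> g j a = (\<Sum>k<p (Suc j). \<beta>0 j k * R a k)" by metis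
  define \<beta> where "\<beta> j k = (if k < p (Suc j) then \<beta>0 j k else 0)" for j k
  have \<beta>b: "(\<Sum>k<n. \<bar>\<beta> j k\<bar>) \<le> 8 * A * (1/2) ^ j" for j n
  proof -
    have "(\<Sum>k<n. \<bar>\<beta> j k\<bar>) \<le> (\<Sum>k<max n (p (Suc j)). \<bar>\<beta> j k\<bar>)" by (intro sum_mono2) auto
    also have "\<dots> = (\<Sum>k<p (Suc j). \<bar>\<beta>0 j k\<bar>)" by (intro sum.mono_neutral_cong_right) (auto simp: \<beta>_def)
    finally show ?thesis using \<beta>0(1)[of j] by linarith
  qed
  define c where "c k = (\<Sum>j. \<beta> j k)" for k
  have c: "summable (\<lambda>k. \<bar>c k\<bar>)" unfolding c_def by (rule summable_superposition(2)[OF \<beta>b])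
  have fin: "(\<Sum>k. \<beta> j k * apply_bcontfun x k) = \<phi> (vec (restr (p j) (p (Suc j)) (coeff x)))"
    "summable (\<lambda>k. \<beta> j k * apply_bcontfun x k)" for j x
  proof -
    have "(\<Sum>k. \<beta> j k * apply_bcontfun x k) = (\<Sum>k<p (Suc j). \<beta> j k * apply_bcontfun x k)"
      by (rule suminf_finite) (auto simp: \<beta>_def)
    also have "\<dots> = (\<Sum>k<p (Suc j). \<beta>0 j k * R (restr 0 (p (Suc j)) (coeff x)) k)"
      by (intro sum.cong) (auto simp: \<beta>_def R_restr_low)
    also have "\<dots> = g j (restr 0 (p (Suc j)) (coeff x))"
      by (rule \<beta>0(2)[symmetric]) (auto simp: supp_def restr_def)
    also have "restr (p j) (p (Suc j)) (restr 0 (p (Suc j)) (coeff x)) = restr (p j) (p (Suc j)) (coeff x)"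
      by (auto simp: restr_def)
    then have "g j (restr 0 (p (Suc j)) (coeff x)) = \<phi> (vec (restr (p j) (p (Suc j)) (coeff x)))"
      by (simp add: g_def)
    finally show "(\<Sum>k. \<beta> j k * apply_bcontfun x k) = \<phi> (vec (restr (p j) (p (Suc j)) (coeff x)))" .
    show "summable (\<lambda>k. \<beta> j k * apply_bcontfun x k)"
      by (rule summable_finite[of "{..<p (Suc j)}"]) (auto simp: \<beta>_def)
  qed
  have tele: "(\<Sum>j<l. \<phi> (vec (restr (p j) (p (Suc j)) (coeff x)))) = \<phi> (vec (restr 0 (p l) (coeff x)))" for l x
  proof (induction l)
    case 0
    have "restr 0 (p 0) (coeff x) = (\<lambda>k. 0 * 0)" by (auto simp: restr_def p_def)
    then have "vec (restr 0 (p 0) (coeff x)) = 0 *\<^sub>R vec (\<lambda>_. 0)" by (simp only: vec_scale[OF fs_zero])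
    then show ?case using lin(2)[OF vec_in_spc, OF fs_zero, of 0] by simp
  next
    case (Suc l)
    have "restr 0 (p (Suc l)) (coeff x) = (\<lambda>k. restr 0 (p l) (coeff x) k + restr (p l) (p (Suc l)) (coeff x) k)"
      using p_mono[of l] by (auto simp: restr_def)
    then have "vec (restr 0 (p (Suc l)) (coeff x)) = vec (restr 0 (p l) (coeff x)) + vec (restr (p l) (p (Suc l)) (coeff x))"
      by (simp only: vec_add[OF fsr fsr])
    then show ?case using Suc by (simp add: lin(1) vec_in_spc fsr)
  qed
  have "pairing c x = \<phi> x" if x: "x \<in> spc" for x
  proof -
    have close: "\<bar>pairing c x - \<phi> (vec (restr 0 (p l) (coeff x)))\<bar> \<le> 16 * A * (1/2) ^ l * norm x" for l
    proof -
      define \<gamma> where "\<gamma> k = (\<Sum>j. \<beta> (j + l) k)" for k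
      have "(\<Sum>k<n. \<bar>\<beta> (j + l) k\<bar>) \<le> 8 * A * (1/2) ^ l * (1/2) ^ j" for j n
        using \<beta>b[of "j + l" n] by (simp add: power_add mult.commute mult.left_commute)
      from summable_superposition(2,3)[OF this]
      have \<gamma>: "summable (\<lambda>k. \<bar>\<gamma> k\<bar>)" "(\<Sum>k. \<bar>\<gamma> k\<bar>) \<le> 16 * A * (1/2) ^ l" unfolding \<gamma>_def by (simp_all add: algebra_simps)
      have split: "c k = \<gamma> k + (\<Sum>j<l. \<beta> j k)" for k
        unfolding c_def \<gamma>_def by (rule suminf_split_initial_segment[OF summable_superposition(1)[OF \<beta>b]])
      have "(\<Sum>k. c k * apply_bcontfun x k) = (\<Sum>k. \<gamma> k * apply_bcontfun x k + (\<Sum>j<l. \<beta> j k * apply_bcontfun x k))"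
        by (simp add: split distrib_right sum_distrib_right)
      also have "\<dots> = (\<Sum>k. \<gamma> k * apply_bcontfun x k) + (\<Sum>k. \<Sum>j<l. \<beta> j k * apply_bcontfun x k)"
        by (intro suminf_add[symmetric] pairing_summable(1)[OF \<gamma>(1)] summable_sum fin(2))
      also have "(\<Sum>k. \<Sum>j<l. \<beta> j k * apply_bcontfun x k) = (\<Sum>j<l. \<Sum>k. \<beta> j k * apply_bcontfun x k)"
        by (rule suminf_sum) (rule fin(2))
      finally have "pairing c x - \<phi> (vec (restr 0 (p l) (coeff x))) = (\<Sum>k. \<gamma> k * apply_bcontfun x k)"
        using x by (simp add: pairing_def fin(1) tele)
      also have "\<bar>\<Sum>k. \<gamma> k * apply_bcontfun x k\<bar> \<le> (\<Sum>k. \<bar>\<gamma> k\<bar>) * norm x" by (rule pairing_summable(2)[OF \<gamma>(1)])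
      then have "\<bar>\<Sum>k. \<gamma> k * apply_bcontfun x k\<bar> \<le> 16 * A * (1/2) ^ l * norm x"
        using mult_right_mono[OF \<gamma>(2), of "norm x"] by simp
      finally show ?thesis .
    qed
    have "\<phi> (vec (restr 0 q (coeff x))) - \<phi> x = \<phi> (vec (restr 0 q (coeff x)) - x)" for q
    proof -
      have "\<phi> (vec (restr 0 q (coeff x)) + (-1) *\<^sub>R x) = \<phi> (vec (restr 0 q (coeff x))) + (-1) * \<phi> x"
        using lin(1)[OF vec_in_spc[OF fsr] subspace_scale[OF subspace_spc x]] lin(2)[OF x] by metis
      then show ?thesis by simp
    qed
    then have tail: "\<bar>\<phi> (vec (restr 0 q (coeff x))) - \<phi> x\<bar> \<le> B * norm (vec (restr 0 q (coeff x)) - x)" for q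
      using B(2) subspace_diff[OF subspace_spc vec_in_spc[OF fsr] x] by metis
    have lim1: "(\<lambda>l. 16 * A * (1/2) ^ l * norm x) \<longlonglongrightarrow> 0"
      by (intro tendsto_mult_left_zero tendsto_mult_right_zero LIMSEQ_power_zero) simp
    have "(\<lambda>l. \<phi> (vec (restr 0 (p l) (coeff x)))) \<longlonglongrightarrow> pairing c x"
    proof (rule LIM_zero_cancel, rule Lim_null_comparison[OF _ lim1])
      show "\<forall>\<^sub>F l in sequentially. norm (\<phi> (vec (restr 0 (p l) (coeff x))) - pairing c x) \<le> 16 * A * (1/2) ^ l * norm x"
        using close by (intro always_eventually allI) (simp add: abs_minus_commute)
    qed
    moreover have lim: "(\<lambda>q. \<phi> (vec (restr 0 q (coeff x)))) \<longlonglongrightarrow> \<phi> x"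
    proof (rule LIM_zero_cancel, rule Lim_null_comparison)
      show "\<forall>\<^sub>F q in sequentially. norm (\<phi> (vec (restr 0 q (coeff x))) - \<phi> x) \<le> B * norm (vec (restr 0 q (coeff x)) - x)"
        using tail by (intro always_eventually) simp
      show "(\<lambda>q. B * norm (vec (restr 0 q (coeff x)) - x)) \<longlonglongrightarrow> 0"
        by (intro tendsto_mult_right_zero tendsto_norm_zero LIM_zero restr_tendsto x)
    qed
    have "j \<le> p j" for j by (simp add: p_def)
    then have "filterlim p at_top sequentially"
      by (intro filterlim_at_top_mono[OF filterlim_ident]) simp
    from filterlim_compose[OF lim this]
    have "(\<lambda>l. \<phi> (vec (restr 0 (p l) (coeff x)))) \<longlonglongrightarrow> \<phi> x" .
    ultimately show ?thesis by (rule LIMSEQ_unique)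
  qed
  then have "pairing c = \<phi>" using ext by (intro extensionalityI[of _ spc]) (auto simp: pairing_def)
  then show ?thesis using c by blast
qed

lemma dual_isomorphic: "isomorphic dual ell_1"
proof -
  have c1: "carrier ell_1 = {c. summable (\<lambda>n. \<bar>c n\<bar>)}" by (simp add: ell_1_def)
  have add: "c \<oplus>\<^bsub>ell_1\<^esub> d = (\<lambda>n. c n + d n)" and scale: "r \<odot>\<^bsub>ell_1\<^esub> c = (\<lambda>n. r * c n)"
    and nrm1: "nrm ell_1 c = (\<Sum>n. \<bar>c n\<bar>)" for c d r by (simp_all add: ell_1_def)
  have addD: "\<phi> \<oplus>\<^bsub>dual\<^esub> \<psi> = (\<lambda>x\<in>spc. \<phi> x + \<psi> x)" and scaleD: "r \<odot>\<^bsub>dual\<^esub> \<phi> = (\<lambda>x\<in>spc. r * \<phi> x)" for \<phi> \<psi> r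
    by (simp_all add: dual_space_def operator_space_def)
  have sadd: "summable (\<lambda>n. \<bar>c n + d n\<bar>)" if "summable (\<lambda>n. \<bar>c n\<bar>)" "summable (\<lambda>n. \<bar>d n\<bar>)" for c d :: "nat \<Rightarrow> real"
    by (rule summable_comparison_test[OF _ summable_add[OF that]]) auto
  have sscale: "summable (\<lambda>n. \<bar>r * c n\<bar>)" if "summable (\<lambda>n. \<bar>c n\<bar>)" for c :: "nat \<Rightarrow> real" and r
    using summable_mult[OF that, of "\<bar>r\<bar>"] by (simp add: abs_mult)
  have blm: "bounded_linear_map ell_1 dual pairing"
    unfolding bounded_linear_map_def
  proof (intro conjI ballI allI)
    show "pairing \<in> carrier ell_1 \<rightarrow> carrier dual" using pairing_mem by (auto simp: c1)
    fix c d assume "c \<in> carrier ell_1" "d \<in> carrier ell_1"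
    then show "pairing (c \<oplus>\<^bsub>ell_1\<^esub> d) = pairing c \<oplus>\<^bsub>dual\<^esub> pairing d"
      unfolding add addD
      by (auto simp: pairing_def c1 distrib_right suminf_add pairing_summable(1) fun_eq_iff)
  next
    fix r c assume "c \<in> carrier ell_1"
    then show "pairing (r \<odot>\<^bsub>ell_1\<^esub> c) = r \<odot>\<^bsub>dual\<^esub> pairing c"
      unfolding scale scaleD
      by (auto simp: pairing_def c1 mult.assoc suminf_mult pairing_summable(1) fun_eq_iff)
  next
    have "nrm dual (pairing c) \<le> 1 * nrm ell_1 c" if c: "c \<in> carrier ell_1" for c
      unfolding nrm_dual nrm1
    proof (rule op_norm_least)
      show "carrier (of_subspace spc) \<noteq> {}" using subspace_0[OF subspace_spc] by auto
      show "0 \<le> 1 * (\<Sum>n. \<bar>c n\<bar>)" using c by (simp add: c1 suminf_nonneg)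
    qed (use c pairing_summable(2) in \<open>auto simp: pairing_def c1\<close>)
    then show "\<exists>B. \<forall>c\<in>carrier ell_1. nrm dual (pairing c) \<le> B * nrm ell_1 c" by blast
  qed
  have lower: "nrm ell_1 c \<le> 2 * nrm dual (pairing c)" if "c \<in> carrier ell_1" for c
    using that pairing_lower by (simp add: nrm1 c1)
  have bij: "bij_betw pairing (carrier ell_1) (carrier dual)"
    unfolding bij_betw_def
  proof
    show "inj_on pairing (carrier ell_1)"
    proof (rule inj_onI)
      fix c d assume cd: "c \<in> carrier ell_1" "d \<in> carrier ell_1" "pairing c = pairing d"
      have s: "summable (\<lambda>n. \<bar>c n + (-1) * d n\<bar>)" using sadd[OF _ sscale[of d "-1"]] cd by (simp add: c1)
      have "pairing (\<lambda>n. c n + (-1) * d n) x = 0" if x: "x \<in> spc" for x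
      proof -
        have "pairing (\<lambda>n. c n + (-1) * d n) x = (\<Sum>n. c n * apply_bcontfun x n - d n * apply_bcontfun x n)"
          using x by (simp add: pairing_def left_diff_distrib)
        also have "\<dots> = pairing c x - pairing d x"
          using x cd(1,2) by (simp add: pairing_def suminf_diff[symmetric] pairing_summable(1) c1)
        finally show ?thesis using cd(3) by simp
      qed
      then have z: "pairing (\<lambda>n. c n + (-1) * d n) = (\<lambda>x\<in>spc. 0)"
        by (intro extensionalityI[of _ spc]) (auto simp: pairing_def)
      have "nrm dual (pairing (\<lambda>n. c n + (-1) * d n)) \<le> 0"
        unfolding nrm_dual z
        by (rule op_norm_least) (use subspace_0[OF subspace_spc] in auto)
      then have "(\<Sum>n. \<bar>c n + (-1) * d n\<bar>) \<le> 0" using pairing_lower[OF s] by linarith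
      then have "(\<Sum>n. \<bar>c n + (-1) * d n\<bar>) = 0" using suminf_nonneg[OF s] by (intro antisym) auto
      then have "\<bar>c n + (-1) * d n\<bar> = 0" for n
        using suminf_eq_zero_iff[OF s] by simp
      then show "c = d" by (auto simp: fun_eq_iff)
    qed
    show "pairing ` carrier ell_1 = carrier dual"
    proof
      show "pairing ` carrier ell_1 \<subseteq> carrier dual" using pairing_mem unfolding c1 by blast
      show "carrier dual \<subseteq> pairing ` carrier ell_1"
      proof
        fix \<phi> assume "\<phi> \<in> carrier dual"
        then obtain c where "summable (\<lambda>n. \<bar>c n\<bar>)" "pairing c = \<phi>" using pairing_onto by blast
        then show "\<phi> \<in> pairing ` carrier ell_1" unfolding c1 by blast
      qed
    qed
  qed
  have "isomorphism dual ell_1 (inv_into (carrier ell_1) pairing)"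
    by (rule isomorphism_inverse[OF blm bij _ _ lower]) (use sadd sscale in \<open>auto simp: add scale c1\<close>)
  then show ?thesis unfolding isomorphic_def by blast
qed

end

section \<open>The Calkin algebra\<close>

context bourgain_delbaen
begin

definition stage :: "nat \<Rightarrow> (nat \<Rightarrow>\<^sub>C real) set" where
  "stage n = {vec a | a. supp 0 n a}"

lemma stage_eq_span: "stage n = span ((\<lambda>k. vec (unit k)) ` {..<n})"
proof
  have expand: "vec a = (\<Sum>k<n. a k *\<^sub>R vec (unit k))" if a: "supp 0 n a" for a
  proof -
    have "a = (\<lambda>i. \<Sum>k<n. a k * unit k i)"
    proof
      fix i show "a i = (\<Sum>k<n. a k * unit k i)"
        using a by (cases "i < n") (auto simp: unit_def supp_def if_distrib[of "\<lambda>x. _ * x"] cong: if_cong)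
    qed
    then have "vec a = vec (\<lambda>i. \<Sum>k<n. a k * unit k i)" by simp
    also have "\<dots> = (\<Sum>k<n. vec (\<lambda>i. a k * unit k i))" by (rule vec_sum) (auto intro: fs_scale fs_unit)
    finally show ?thesis by (simp add: vec_scale fs_unit)
  qed
  show "stage n \<subseteq> span ((\<lambda>k. vec (unit k)) ` {..<n})"
  proof
    fix x assume "x \<in> stage n"
    then obtain a where a: "supp 0 n a" "x = vec a" by (auto simp: stage_def)
    show "x \<in> span ((\<lambda>k. vec (unit k)) ` {..<n})"
      unfolding a(2) expand[OF a(1)] by (intro span_sum span_scale span_base) simp
  qed
  show "span ((\<lambda>k. vec (unit k)) ` {..<n}) \<subseteq> stage n"
  proof (rule span_minimal)
    show "(\<lambda>k. vec (unit k)) ` {..<n} \<subseteq> stage n"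
    proof
      fix x assume "x \<in> (\<lambda>k. vec (unit k)) ` {..<n}"
      then obtain k where k: "k < n" "x = vec (unit k)" by auto
      have "supp 0 n (unit k)" using k(1) by (auto simp: supp_def unit_def)
      then show "x \<in> stage n" unfolding stage_def k(2) by blast
    qed
    show "subspace (stage n)"
      unfolding subspace_def
    proof (intro conjI ballI allI)
      have "vec (\<lambda>k. 0 * 0) = 0 *\<^sub>R vec (\<lambda>_. 0)" by (rule vec_scale[OF fs_zero])
      then show "0 \<in> stage n" by (auto simp: stage_def supp_def intro!: exI[of _ "\<lambda>_. 0"])
    next
      fix x y assume "x \<in> stage n" "y \<in> stage n"
      then obtain a b where ab: "supp 0 n a" "x = vec a" "supp 0 n b" "y = vec b" by (auto simp: stage_def)
      have "x + y = vec (\<lambda>k. a k + b k)"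
        unfolding ab by (rule vec_add[symmetric]) (use ab supp_fs in blast)+
      then show "x + y \<in> stage n" using supp_add[OF ab(1,3)] unfolding stage_def by blast
    next
      fix c x assume "x \<in> stage n"
      then obtain a where a: "supp 0 n a" "x = vec a" by (auto simp: stage_def)
      have "c *\<^sub>R x = vec (\<lambda>k. c * a k)"
        unfolding a by (rule vec_scale[symmetric, OF supp_fs[OF a(1)]])
      then show "c *\<^sub>R x \<in> stage n" using supp_scale[OF a(1)] unfolding stage_def by blast
    qed
  qed
qed

lemma subspace_stage: "subspace (stage n)"
  by (simp add: stage_eq_span)

lemma dim_stage: "dim (stage n) = n"
proof -
  let ?B = "(\<lambda>k. vec (unit k)) ` {..<n}"
  have inj: "inj_on (\<lambda>k. vec (unit k)) {..<n}"
  proof (rule inj_onI)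
    fix i j assume "vec (unit i) = vec (unit j)"
    then have "coeff (vec (unit i)) i = coeff (vec (unit j)) i" by simp
    then show "i = j" by (simp add: fs_unit unit_def split: if_splits)
  qed
  have "independent ?B"
  proof (rule independent_if_scalars_zero)
    fix f x assume z: "(\<Sum>x\<in>?B. f x *\<^sub>R x) = 0" and x: "x \<in> ?B"
    then obtain i where i: "i < n" "x = vec (unit i)" by auto
    have "(\<Sum>x\<in>?B. f x *\<^sub>R x) = (\<Sum>k<n. f (vec (unit k)) *\<^sub>R vec (unit k))"
      using inj by (simp add: sum.reindex)
    also have "\<dots> = vec (\<lambda>j. \<Sum>k<n. f (vec (unit k)) * unit k j)"
      by (subst vec_sum) (auto simp: vec_scale fs_unit intro: fs_scale)
    finally have e: "vec (\<lambda>j. \<Sum>k<n. f (vec (unit k)) * unit k j) = 0" using z by simp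
    have "fs (\<lambda>j. \<Sum>k<n. f (vec (unit k)) * unit k j)" by (intro fs_sum fs_scale fs_unit)
    then have "(\<Sum>k<n. f (vec (unit k)) * unit k i) = coeff (vec (\<lambda>j. \<Sum>k<n. f (vec (unit k)) * unit k j)) i"
      by simp
    also have "\<dots> = 0" using coeff_le[of 0 i] by (simp add: e)
    finally show "f x = 0" using i by (simp add: unit_def if_distrib[of "\<lambda>x. _ * x"] cong: if_cong)
  qed simp
  then have "dim (stage n) = card ?B"
    by (rule dim_eq_card[rotated]) (simp add: stage_eq_span span_span)
  then show ?thesis using inj by (simp add: card_image)
qed

text \<open>Taking the first \<open>n\<close> coordinates has norm at most 1, and its inverse is the
  extension operator, of norm at most 2.\<close>

lemma stage_isomorphic: "isomorphic_with 2 (of_subspace (stage n)) (ell_infinity n)"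
proof -
  let ?M = "of_subspace (stage n)" and ?N = "ell_infinity n"
  define S where "S u = vec (ext n u)" for u
  have cN: "carrier ?N = extensional {..<n}" by (simp add: ell_infinity_def)
  have addN: "u \<oplus>\<^bsub>?N\<^esub> v = (\<lambda>i\<in>{..<n}. u i + v i)" and scN: "c \<odot>\<^bsub>?N\<^esub> u = (\<lambda>i\<in>{..<n}. c * u i)" for u v c
    by (simp_all add: ell_infinity_def)
  have nN_ge: "\<bar>u i\<bar> \<le> nrm ?N u" if "i < n" for u i
    unfolding ell_infinity_def using that by (auto intro!: Max_ge)
  have nN_le: "nrm ?N u \<le> B" if "0 \<le> B" "\<And>i. i < n \<Longrightarrow> \<bar>u i\<bar> \<le> B" for u B
    unfolding ell_infinity_def using that by auto
  have nN0: "0 \<le> nrm ?N u" for u unfolding ell_infinity_def by (auto intro!: Max_ge)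
  have Sadd: "S (u \<oplus>\<^bsub>?N\<^esub> v) = S u + S v" for u v
  proof -
    have "ext n (u \<oplus>\<^bsub>?N\<^esub> v) = ext n (\<lambda>i. u i + v i)" by (rule ext_cong) (simp add: addN)
    then show ?thesis by (simp add: S_def ext_add vec_add fs_ext)
  qed
  have Ssc: "S (c \<odot>\<^bsub>?N\<^esub> u) = c *\<^sub>R S u" for u c
  proof -
    have "ext n (c \<odot>\<^bsub>?N\<^esub> u) = ext n (\<lambda>i. c * u i)" by (rule ext_cong) (simp add: scN)
    then show ?thesis by (simp add: S_def ext_scale vec_scale fs_ext)
  qed
  have Sn: "norm (S u) \<le> 2 * nrm ?N u" for u
    unfolding S_def by (intro vec_norm_le[OF fs_ext] ext_bound nN_ge nN0)
  have Sl: "nrm ?N u \<le> norm (S u)" for u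
  proof (rule nN_le)
    fix i assume "i < n"
    then show "\<bar>u i\<bar> \<le> norm (S u)"
      using vec_coord_le[OF fs_ext, of n u i] by (simp add: S_def)
  qed simp
  have Smem: "S u \<in> stage n" for u unfolding S_def stage_def using ext_supp0 by blast
  have blm: "bounded_linear_map ?N ?M S"
    unfolding bounded_linear_map_def using Smem Sadd Ssc Sn by (auto intro!: exI[of _ 2])
  have bij: "bij_betw S (carrier ?N) (carrier ?M)"
    unfolding bij_betw_def
  proof
    show "inj_on S (carrier ?N)"
    proof (rule inj_onI)
      fix u v assume uv: "u \<in> carrier ?N" "v \<in> carrier ?N" "S u = S v"
      have "u i = v i" if "i < n" for i
        using arg_cong[OF uv(3), of "\<lambda>x. apply_bcontfun x i"] that by (simp add: S_def fs_ext)
      then show "u = v" using uv(1,2) by (intro extensionalityI[of _ "{..<n}"]) (auto simp: cN)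
    qed
    have "x \<in> S ` carrier ?N" if x: "x \<in> stage n" for x
    proof -
      obtain a where a: "supp 0 n a" "x = vec a" using x by (auto simp: stage_def)
      have "ext n (restrict (R a) {..<n}) = ext n (R a)" by (rule ext_cong) simp
      then have "S (restrict (R a) {..<n}) = x" by (simp add: S_def ext_R[OF a(1)] a(2))
      then show ?thesis by (metis cN image_eqI restrict_extensional)
    qed
    then show "S ` carrier ?N = carrier ?M" using Smem by auto
  qed
  let ?T = "inv_into (carrier ?N) S"
  have iso: "isomorphism ?M ?N ?T"
    by (rule isomorphism_inverse[OF blm bij, of 1]) (auto simp: cN addN scN Sl)
  have T: "?T x \<in> carrier ?N" "S (?T x) = x" if "x \<in> stage n" for x
    using bij that by (metis bij_betw_def inv_into_into of_subspace_sel(1), metis bij_betw_inv_into_right of_subspace_sel(1))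
  have inv_eq: "inv_into (carrier ?M) ?T u = S u" if "u \<in> carrier ?N" for u
    by (rule inv_into_inv_into_eq[OF bij that])
  have st: "stage n \<noteq> {}" using subspace_0[OF subspace_stage] by blast
  have o1: "op_norm ?M ?N ?T \<le> 1"
    by (rule op_norm_least) (use T Sl st in \<open>auto, metis\<close>)
  have o1': "0 \<le> op_norm ?M ?N ?T"
    by (rule op_norm_nonneg) (use iso st nN0 in \<open>auto simp: isomorphism_def bounded_linear_map_def\<close>)
  have "op_norm ?N ?M (inv_into (carrier ?M) ?T) \<le> 2"
  proof (rule op_norm_least)
    show "carrier ?N \<noteq> {}" using restrict_extensional by (auto simp: cN)
  qed (use inv_eq Sn nN0 in auto)
  then have "op_norm ?M ?N ?T * op_norm ?N ?M (inv_into (carrier ?M) ?T) \<le> 1 * 2"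
    using o1 o1' by (meson mult_mono' order_trans mult_left_mono mult_right_mono zero_le_numeral)
  then show ?thesis unfolding isomorphic_with_def using iso by auto
qed

lemma separable_spc: "separable_banach spc"
proof -
  define C where "C = (\<lambda>l. vec (list_coeff l)) ` UNIV"
  have fsl: "fs (list_coeff l)" for l
    by (rule supp_fs[of 0 "length l"]) (auto simp: supp_def list_coeff_def)
  have sub: "C \<subseteq> spc" using vec_in_spc[OF fsl] by (auto simp: C_def)
  have dense: "spc \<subseteq> closure C"
  proof
    fix x assume x: "x \<in> spc"
    show "x \<in> closure C"
      unfolding closure_approachable
    proof (intro allI impI)
      fix e :: real assume e: "0 < e"
      obtain a where a: "fs a" "norm (x - vec a) < e / 2" using spc_approx[OF x, of "e / 2"] e by auto
      obtain q where q: "supp 0 q a" using a by (auto simp: fs_def)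
      define d where "d = e / (4 * (real q + 1))"
      have d: "0 < d" using e by (simp add: d_def)
      have "\<forall>k. \<exists>r::rat. \<bar>of_rat r - a k\<bar> \<le> d" using rat_approx[OF d] by blast
      then obtain r :: "nat \<Rightarrow> rat" where r: "\<And>k. \<bar>of_rat (r k) - a k\<bar> \<le> d" by metis
      define l where "l = map r [0..<q]"
      have lk: "list_coeff l k = (if k < q then of_rat (r k) else 0)" for k by (simp add: list_coeff_def l_def)
      define b where "b = (\<lambda>k. list_coeff l k - a k)"
      have b0: "b k = 0" if "\<not> k < q" for k using q that by (auto simp: b_def supp_def lk)
      have eq: "b = (\<lambda>i. \<Sum>k<q. b k * unit k i)"
      proof
        fix i
        have "(\<Sum>k<q. b k * unit k i) = (\<Sum>k<q. if k = i then b i else 0)"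
          by (rule sum.cong) (auto simp: unit_def)
        also have "\<dots> = b i" using b0[of i] by simp
        finally show "b i = (\<Sum>k<q. b k * unit k i)" by simp
      qed
      have Rb: "R b n = (\<Sum>k<q. b k * R (unit k) n)" for n
      proof -
        have "R b n = R (\<lambda>i. \<Sum>k<q. b k * unit k i) n" using arg_cong[OF eq, of "\<lambda>x. R x n"] .
        also have "\<dots> = (\<Sum>k<q. b k * R (unit k) n)" by (simp only: R_sum finite_lessThan R_scale)
        finally show ?thesis .
      qed
      have "\<bar>R b n\<bar> \<le> e / 2" for n
      proof -
        have "\<bar>R b n\<bar> \<le> (\<Sum>k<q. \<bar>b k * R (unit k) n\<bar>)" unfolding Rb by (rule sum_abs)
        also have "\<dots> \<le> (\<Sum>k<q. d * 2)"
        proof (rule sum_mono)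
          fix k assume "k \<in> {..<q}"
          then have "\<bar>b k\<bar> \<le> d" using r[of k] by (simp add: lk b_def)
          then show "\<bar>b k * R (unit k) n\<bar> \<le> d * 2" unfolding abs_mult using unit_bound d by (intro mult_mono) auto
        qed
        also have "\<dots> \<le> e / 2" using e by (simp add: d_def field_simps)
        finally show ?thesis .
      qed
      then have "norm (vec (list_coeff l) - vec a) \<le> e / 2"
        using vec_norm_le[OF fs_diff[OF fsl a(1)]] vec_diff[OF fsl a(1)] unfolding b_def by metis
      then have "dist (vec (list_coeff l)) x < e"
        using a(2) norm_triangle_ineq[of "vec (list_coeff l) - vec a" "vec a - x"]
        by (simp add: dist_norm norm_minus_commute)
      then show "\<exists>y\<in>C. dist y x < e" by (auto simp: C_def)
    qed
  qed
  have "separable_space (top_of_set spc)"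
    unfolding separable_space_def
  proof (intro exI[of _ C] conjI)
    show "countable C" by (simp add: C_def)
    show "C \<subseteq> topspace (top_of_set spc)" using sub by simp
    have "spc \<inter> C = C" using sub by blast
    then show "top_of_set spc closure_of C = topspace (top_of_set spc)"
      using dense by (auto simp: closure_of_subtopology)
  qed
  then show ?thesis unfolding separable_banach_def using subspace_spc complete_spc by blast
qed

lemma L_infinity_spc: "L_infinity_space spc"
proof -
  have "strict_mono stage"
    unfolding strict_mono_Suc_iff
  proof
    fix n
    have "stage n \<subseteq> stage (Suc n)" using supp_mono[of 0 n _ 0 "Suc n"] by (auto simp: stage_def)
    moreover have "stage n \<noteq> stage (Suc n)" using dim_stage by (metis n_not_Suc_n)
    ultimately show "stage n < stage (Suc n)" by blast
  qed
  moreover have "stage n \<subseteq> spc" for n using vec_in_spc supp_fs by (auto simp: stage_def)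
  moreover have "\<exists>B. finite B \<and> stage n = span B" for n
    using stage_eq_span by (intro exI[of _ "(\<lambda>k. vec (unit k)) ` {..<n}"]) simp
  moreover have "spc = closure (\<Union>n. stage n)"
  proof -
    have "(\<Union>n. stage n) = vec ` {a. fs a}" by (auto simp: stage_def fs_def)
    then show ?thesis by (simp add: spc_def)
  qed
  moreover have "isomorphic_with 2 (of_subspace (stage n)) (ell_infinity (dim (stage n)))" for n
    using stage_isomorphic by (simp add: dim_stage)
  ultimately have "L_infinity_const_space 2 spc"
    unfolding L_infinity_const_space_def using separable_spc subspace_stage by blast
  then show ?thesis unfolding L_infinity_space_def by (intro exI[of _ 2]) simp
qed

end

text \<open>The last two assumptions say that the cells form neighbourhood bases on
  \<open>K\<close>, so that \<open>E_continuous\<close> amounts to continuity on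
  \<open>K\<close>.\<close>

locale argyros_haydon_metric = argyros_haydon E \<kappa> wt age prd bc m nn K
  for E :: "nat \<Rightarrow> 'k::metric_space \<Rightarrow> 'k \<Rightarrow> bool" and \<kappa> wt age prd bc m nn K +
  assumes compact_K: "compact K"
    and cell_nbhd: "\<forall>x\<in>K. \<forall>p. \<exists>d>0. \<forall>y. dist y x < d \<longrightarrow> E p y x"
    and cell_small: "\<forall>x\<in>K. \<forall>d>0. \<exists>p. \<forall>y. E p y x \<longrightarrow> dist y x < d"
begin

lemma K_nonempty: "K \<noteq> {}"
  using \<kappa>_in by blast

section \<open>Cosets of compact operators as fibres of the symbol\<close>

abbreviation "L \<equiv> operator_algebra (of_subspace spc)"
abbreviation "Cpt \<equiv> compact_operators spc"
abbreviation "Cal \<equiv> calkin_algebra spc"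
abbreviation "CK \<equiv> continuous_functions K"

lemma carrier_L: "carrier L = {T \<in> extensional spc. bop T}"
  by (simp add: operator_algebra_def operator_space_def)

lemma add_L: "S \<oplus>\<^bsub>L\<^esub> T = (\<lambda>x\<in>spc. S x + T x)"
  by (simp add: operator_algebra_def operator_space_def)

lemma mult_L: "S \<otimes>\<^bsub>L\<^esub> T = compose spc S T"
  by (simp add: operator_algebra_def)

lemma one_L: "\<one>\<^bsub>L\<^esub> = (\<lambda>x\<in>spc. x)"
  by (simp add: operator_algebra_def restrict_def fun_eq_iff)

lemma smult_L: "c \<odot>\<^bsub>L\<^esub> T = (\<lambda>x\<in>spc. c *\<^sub>R T x)"
  by (simp add: operator_algebra_def operator_space_def)

lemma nrm_L: "nrm L T = op_norm (of_subspace spc) (of_subspace spc) T"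
  by (simp add: operator_algebra_def operator_space_def)

lemma nrm_L_bound: "bop T \<Longrightarrow> x \<in> spc \<Longrightarrow> norm (T x) \<le> nrm L T * norm x"
  unfolding nrm_L using op_norm_bound[of "of_subspace spc" "of_subspace spc" T x]
  by (auto simp: subspace_map_iff)

lemma nrm_L_least: "0 \<le> C \<Longrightarrow> (\<And>x. x \<in> spc \<Longrightarrow> norm (T x) \<le> C * norm x) \<Longrightarrow> nrm L T \<le> C"
  unfolding nrm_L by (rule op_norm_least) (use subspace_0[OF subspace_spc] in auto)

lemma nrm_L_nonneg: "bop T \<Longrightarrow> 0 \<le> nrm L T"
  unfolding nrm_L by (rule op_norm_nonneg) (use subspace_0[OF subspace_spc] in \<open>auto simp: subspace_map_iff\<close>)

lemma symbol_ext: "symbol T \<in> extensional K"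
  by (simp add: symbol_def)

lemma symbol_mem: "bop T \<Longrightarrow> symbol T \<in> carrier CK"
proof -
  assume T: "bop T"
  have "continuous_on K (symbol T)"
    unfolding continuous_on_iff
  proof (intro ballI allI impI)
    fix x and e :: real assume x: "x \<in> K" and e: "0 < e"
    obtain p where p: "\<forall>x\<in>K. \<forall>y\<in>K. E p x y \<longrightarrow> \<bar>symbol T x - symbol T y\<bar> \<le> e / 2"
      using symbol_continuous[OF T] e unfolding E_continuous_def by (meson half_gt_zero)
    obtain d where d: "0 < d" "\<forall>y. dist y x < d \<longrightarrow> E p y x" using cell_nbhd x by blast
    have "dist (symbol T y) (symbol T x) < e" if "y \<in> K" "dist y x < d" for y
    proof -
      have "\<bar>symbol T y - symbol T x\<bar> \<le> e / 2" using p d that x by blast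
      then show ?thesis using e by (simp add: dist_real_def)
    qed
    then show "\<exists>d>0. \<forall>y\<in>K. dist y x < d \<longrightarrow> dist (symbol T y) (symbol T x) < e" using d(1) by blast
  qed
  then show ?thesis by (simp add: continuous_functions_def symbol_ext)
qed

lemma CK_bdd: "f \<in> carrier CK \<Longrightarrow> bdd_above ((\<lambda>x. \<bar>f x\<bar>) ` K)"
  using compact_K by (intro bounded_imp_bdd_above compact_imp_bounded compact_continuous_image)
    (auto simp: continuous_functions_def intro: continuous_intros)

lemma CK_le: "f \<in> carrier CK \<Longrightarrow> x \<in> K \<Longrightarrow> \<bar>f x\<bar> \<le> nrm CK f"
  using cSUP_upper[OF _ CK_bdd] by (simp add: continuous_functions_def)

lemma CK_least: "(\<And>x. x \<in> K \<Longrightarrow> \<bar>f x\<bar> \<le> B) \<Longrightarrow> nrm CK f \<le> B"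
  using K_nonempty by (auto simp: continuous_functions_def intro: cSUP_least)

lemma CK_nonneg: "f \<in> carrier CK \<Longrightarrow> 0 \<le> nrm CK f"
  using K_nonempty CK_le abs_ge_zero order_trans by blast

lemma CK_E_continuous: "f \<in> carrier CK \<Longrightarrow> E_continuous f"
proof (rule E_continuousI)
  fix x and \<epsilon> :: real assume f: "f \<in> carrier CK" and x: "x \<in> K" and \<epsilon>: "0 < \<epsilon>"
  obtain d where d: "0 < d" "\<forall>y\<in>K. dist y x < d \<longrightarrow> dist (f y) (f x) < \<epsilon>"
  proof -
    have "continuous_on K f" using f by (simp add: continuous_functions_def)
    then show ?thesis using x \<epsilon> that unfolding continuous_on_iff by blast
  qed
  obtain p where p: "\<forall>y. E p y x \<longrightarrow> dist y x < d" using cell_small x d(1) by blast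
  have "\<forall>y\<in>K. E p y x \<longrightarrow> \<bar>f y - f x\<bar> \<le> \<epsilon>" using d p by (auto simp: dist_real_def intro: less_imp_le)
  then show "\<exists>p. \<forall>y\<in>K. E p y x \<longrightarrow> \<bar>f y - f x\<bar> \<le> \<epsilon>" by blast
qed

text \<open>By \<open>coset_eq\<close> these are the elements of the Calkin algebra, and its
  operations become those of functions.\<close>

definition fiber :: "('k \<Rightarrow> real) \<Rightarrow> ((nat \<Rightarrow>\<^sub>C real) \<Rightarrow> nat \<Rightarrow>\<^sub>C real) set" where
  "fiber f = {T \<in> carrier L. symbol T = f}"

lemma L_add: "S \<in> carrier L \<Longrightarrow> T \<in> carrier L \<Longrightarrow> S \<oplus>\<^bsub>L\<^esub> T \<in> carrier L"
proof -
  assume "S \<in> carrier L" "T \<in> carrier L"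
  then have S: "bop S" and T: "bop T" by (auto simp: carrier_L)
  obtain B C where BC: "\<forall>x\<in>spc. norm (S x) \<le> B * norm x" "\<forall>x\<in>spc. norm (T x) \<le> C * norm x"
    using S T by (auto simp: subspace_map_iff)
  have "norm (S x + T x) \<le> (B + C) * norm x" if "x \<in> spc" for x
    using BC that norm_triangle_ineq[of "S x" "T x"] by (fastforce simp: distrib_right)
  then have "\<exists>B. \<forall>x\<in>spc. norm (S x + T x) \<le> B * norm x" by blast
  then show ?thesis using S T subspace_spc
    by (simp add: carrier_L add_L subspace_map_iff subspace_add subspace_scale algebra_simps scaleR_add_right)
qed

lemma L_scale: "T \<in> carrier L \<Longrightarrow> c \<odot>\<^bsub>L\<^esub> T \<in> carrier L"
proof -
  assume "T \<in> carrier L"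
  then have T: "bop T" by (auto simp: carrier_L)
  obtain C where C: "\<forall>x\<in>spc. norm (T x) \<le> C * norm x" using T by (auto simp: subspace_map_iff)
  have "norm (c *\<^sub>R T x) \<le> (\<bar>c\<bar> * C) * norm x" if "x \<in> spc" for x
    using mult_left_mono[OF C[rule_format, OF that], of "\<bar>c\<bar>"] by (simp add: mult.assoc)
  then have "\<exists>B. \<forall>x\<in>spc. norm (c *\<^sub>R T x) \<le> B * norm x" by blast
  then show ?thesis using T subspace_spc
    by (auto simp: carrier_L smult_L subspace_map_iff subspace_add subspace_scale scaleR_add_right)
qed

lemma L_mult: "S \<in> carrier L \<Longrightarrow> T \<in> carrier L \<Longrightarrow> S \<otimes>\<^bsub>L\<^esub> T \<in> carrier L"
proof -
  assume "S \<in> carrier L" "T \<in> carrier L"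
  then have S: "bop S" and T: "bop T" by (auto simp: carrier_L)
  obtain B where B: "0 < B" "\<forall>x\<in>spc. norm (S x) \<le> B * norm x" using bopD(5)[OF S] by blast
  obtain C where C: "\<forall>x\<in>spc. norm (T x) \<le> C * norm x" using T by (auto simp: subspace_map_iff)
  have "norm (S (T x)) \<le> (B * C) * norm x" if x: "x \<in> spc" for x
  proof -
    have "norm (S (T x)) \<le> B * norm (T x)" using B bopD(1)[OF T x] by blast
    also have "\<dots> \<le> B * (C * norm x)" using B C x by (intro mult_left_mono) auto
    finally show ?thesis by (simp add: mult.assoc)
  qed
  then have "\<exists>D. \<forall>x\<in>spc. norm (S (T x)) \<le> D * norm x" by blast
  then show ?thesis using bopD(1-3)[OF S] bopD(1-3)[OF T] subspace_spc
    by (auto simp: carrier_L mult_L compose_def subspace_map_iff subspace_add subspace_scale)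
qed

lemma L_one: "\<one>\<^bsub>L\<^esub> \<in> carrier L"
  using subspace_spc by (auto simp: carrier_L one_L subspace_map_iff subspace_add subspace_scale intro!: exI[of _ 1])

lemma symbol_ops:
  assumes "S \<in> carrier L" "T \<in> carrier L"
  shows "symbol (S \<oplus>\<^bsub>L\<^esub> T) = symbol S \<oplus>\<^bsub>CK\<^esub> symbol T"
    and "symbol (S \<otimes>\<^bsub>L\<^esub> T) = symbol S \<otimes>\<^bsub>CK\<^esub> symbol T"
    and "symbol (c \<odot>\<^bsub>L\<^esub> T) = c \<odot>\<^bsub>CK\<^esub> symbol T"
proof -
  have S: "bop S" and T: "bop T" using assms by (auto simp: carrier_L)
  have "symbol (S \<oplus>\<^bsub>L\<^esub> T) x = symbol S x + symbol T x" if "x \<in> K" for x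
    by (rule symbol_add[OF S T that]) (simp add: add_L)
  then show "symbol (S \<oplus>\<^bsub>L\<^esub> T) = symbol S \<oplus>\<^bsub>CK\<^esub> symbol T"
    by (intro extensionalityI[OF symbol_ext]) (auto simp: continuous_functions_def)
  have "symbol (S \<otimes>\<^bsub>L\<^esub> T) x = symbol S x * symbol T x" if "x \<in> K" for x
    by (rule symbol_compose[OF S T that]) (simp add: mult_L compose_def)
  then show "symbol (S \<otimes>\<^bsub>L\<^esub> T) = symbol S \<otimes>\<^bsub>CK\<^esub> symbol T"
    by (intro extensionalityI[OF symbol_ext]) (auto simp: continuous_functions_def)
  have "symbol (c \<odot>\<^bsub>L\<^esub> T) x = c * symbol T x" if "x \<in> K" for x
    by (rule symbol_scale[OF T that]) (simp add: smult_L)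
  then show "symbol (c \<odot>\<^bsub>L\<^esub> T) = c \<odot>\<^bsub>CK\<^esub> symbol T"
    by (intro extensionalityI[OF symbol_ext]) (auto simp: continuous_functions_def)
qed

lemma symbol_one: "symbol \<one>\<^bsub>L\<^esub> = \<one>\<^bsub>CK\<^esub>"
proof -
  have "symbol \<one>\<^bsub>L\<^esub> x = 1" if "x \<in> K" for x by (rule symbol_id[OF that]) (simp add: one_L)
  then show ?thesis by (intro extensionalityI[OF symbol_ext]) (auto simp: continuous_functions_def)
qed

lemma compact_iff: "Cpt = {T \<in> carrier L. \<forall>x\<in>K. symbol T x = 0}"
proof -
  have "compact (closure (T ` (spc \<inter> cball 0 1))) \<longleftrightarrow> (\<forall>x\<in>K. symbol T x = 0)" if "T \<in> carrier L" for T
  proof -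
    have "bop T" using that by (simp add: carrier_L)
    then show ?thesis using symbol_compact symbol_zero_compact by blast
  qed
  then show ?thesis unfolding compact_operators_def by blast
qed

text \<open>Two operators with the same symbol differ by one with zero symbol, which is compact, and
  conversely.\<close>

lemma coset_eq: "T \<in> carrier L \<Longrightarrow> Cpt +>\<^bsub>L\<^esub> T = fiber (symbol T)"
proof
  assume T: "T \<in> carrier L"
  show "Cpt +>\<^bsub>L\<^esub> T \<subseteq> fiber (symbol T)"
  proof
    fix U assume "U \<in> Cpt +>\<^bsub>L\<^esub> T"
    then obtain S where S: "S \<in> Cpt" "U = S \<oplus>\<^bsub>L\<^esub> T" unfolding a_r_coset_def' by blast
    then have SL: "S \<in> carrier L" "\<forall>x\<in>K. symbol S x = 0" by (auto simp: compact_iff)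
    have "symbol U = symbol T" unfolding S(2) symbol_ops(1)[OF SL(1) T]
      by (intro extensionalityI[of _ K]) (auto simp: continuous_functions_def SL(2) symbol_ext)
    then show "U \<in> fiber (symbol T)" using L_add[OF SL(1) T] S(2) by (simp add: fiber_def)
  qed
  show "fiber (symbol T) \<subseteq> Cpt +>\<^bsub>L\<^esub> T"
  proof
    fix U assume U: "U \<in> fiber (symbol T)"
    then have UL: "U \<in> carrier L" "symbol U = symbol T" by (auto simp: fiber_def)
    define S where "S = U \<oplus>\<^bsub>L\<^esub> ((-1) \<odot>\<^bsub>L\<^esub> T)"
    have mT: "(-1) \<odot>\<^bsub>L\<^esub> T \<in> carrier L" by (rule L_scale[OF T])
    have SL: "S \<in> carrier L" unfolding S_def by (rule L_add[OF UL(1) mT])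
    have "symbol S x = 0" if "x \<in> K" for x
      unfolding S_def symbol_ops(1)[OF UL(1) mT] symbol_ops(3)[OF T T] UL(2)
      using that by (simp add: continuous_functions_def)
    then have "S \<in> Cpt" using SL by (simp add: compact_iff)
    moreover have "U = S \<oplus>\<^bsub>L\<^esub> T"
      using UL(1) by (intro extensionalityI[of _ spc]) (auto simp: S_def add_L smult_L carrier_L)
    ultimately show "U \<in> Cpt +>\<^bsub>L\<^esub> T" unfolding a_r_coset_def' by blast
  qed
qed

lemma fiber_lift:
  assumes f: "f \<in> carrier CK" and \<delta>: "0 < \<delta>" and M: "\<And>j. 64 \<le> \<delta> * m j"
  shows "\<exists>T\<in>fiber f. nrm L T \<le> (1 + \<delta>) * nrm CK f"
proof -
  obtain T where T: "T \<in> extensional spc" "bop T" "\<forall>x\<in>K. symbol T x = f x"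
    "\<forall>x\<in>spc. norm (T x) \<le> (1 + \<delta>) * nrm CK f * norm x"
    using symbol_onto[OF CK_E_continuous[OF f] CK_le[OF f] CK_nonneg[OF f] \<delta> M] by blast
  have "symbol T = f"
    using f T(3) by (intro extensionalityI[OF symbol_ext]) (auto simp: continuous_functions_def)
  moreover have "nrm L T \<le> (1 + \<delta>) * nrm CK f"
    using T(4) CK_nonneg[OF f] \<delta> by (intro nrm_L_least) auto
  ultimately show ?thesis using T by (auto simp: fiber_def carrier_L)
qed

lemma fiber_nonempty: "f \<in> carrier CK \<Longrightarrow> fiber f \<noteq> {}"
proof -
  assume f: "f \<in> carrier CK"
  have "64 \<le> 2 * m j" for j using m_ge[of j] by simp
  then show ?thesis using fiber_lift[OF f, of 2] by auto
qed

lemma carrier_Cal: "carrier Cal = fiber ` carrier CK"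
proof -
  have "carrier Cal = (\<lambda>T. Cpt +>\<^bsub>L\<^esub> T) ` carrier L"
    by (auto simp: calkin_algebra_def Let_def FactRing_def A_RCOSETS_def')
  also have "\<dots> = (\<lambda>T. fiber (symbol T)) ` carrier L" by (rule image_cong[OF refl coset_eq])
  also have "\<dots> = fiber ` carrier CK"
  proof
    show "(\<lambda>T. fiber (symbol T)) ` carrier L \<subseteq> fiber ` carrier CK"
      using symbol_mem by (auto simp: carrier_L)
    show "fiber ` carrier CK \<subseteq> (\<lambda>T. fiber (symbol T)) ` carrier L"
    proof
      fix A assume "A \<in> fiber ` carrier CK"
      then obtain f where f: "f \<in> carrier CK" "A = fiber f" by blast
      then obtain T where "T \<in> fiber f" using fiber_nonempty by blast
      then show "A \<in> (\<lambda>T. fiber (symbol T)) ` carrier L" using f(2) by (auto simp: fiber_def)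
    qed
  qed
  finally show ?thesis .
qed

lemma CK_ops:
  "f \<in> carrier CK \<Longrightarrow> g \<in> carrier CK \<Longrightarrow> f \<oplus>\<^bsub>CK\<^esub> g \<in> carrier CK"
  "f \<in> carrier CK \<Longrightarrow> g \<in> carrier CK \<Longrightarrow> f \<otimes>\<^bsub>CK\<^esub> g \<in> carrier CK"
  "f \<in> carrier CK \<Longrightarrow> c \<odot>\<^bsub>CK\<^esub> f \<in> carrier CK"
  "\<one>\<^bsub>CK\<^esub> \<in> carrier CK"
  by (auto simp: continuous_functions_def intro!: continuous_intros cong: continuous_on_cong)

lemma fiber_add:
  assumes f: "f \<in> carrier CK" and g: "g \<in> carrier CK"
  shows "fiber f \<oplus>\<^bsub>Cal\<^esub> fiber g = fiber (f \<oplus>\<^bsub>CK\<^esub> g)"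
proof -
  have "fiber f \<oplus>\<^bsub>Cal\<^esub> fiber g = (\<Union>S\<in>fiber f. \<Union>T\<in>fiber g. {S \<oplus>\<^bsub>L\<^esub> T})"
    by (simp add: calkin_algebra_def Let_def FactRing_def set_add_def')
  also have "\<dots> = fiber (f \<oplus>\<^bsub>CK\<^esub> g)"
  proof
    show "(\<Union>S\<in>fiber f. \<Union>T\<in>fiber g. {S \<oplus>\<^bsub>L\<^esub> T}) \<subseteq> fiber (f \<oplus>\<^bsub>CK\<^esub> g)"
      using L_add symbol_ops(1) by (auto simp: fiber_def)
    show "fiber (f \<oplus>\<^bsub>CK\<^esub> g) \<subseteq> (\<Union>S\<in>fiber f. \<Union>T\<in>fiber g. {S \<oplus>\<^bsub>L\<^esub> T})"
    proof
      fix U assume "U \<in> fiber (f \<oplus>\<^bsub>CK\<^esub> g)"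
      then have U: "U \<in> carrier L" "symbol U = f \<oplus>\<^bsub>CK\<^esub> g" by (auto simp: fiber_def)
      obtain T where T: "T \<in> carrier L" "symbol T = g" using fiber_nonempty[OF g] by (auto simp: fiber_def)
      have mT: "(-1) \<odot>\<^bsub>L\<^esub> T \<in> carrier L" by (rule L_scale[OF T(1)])
      let ?S = "U \<oplus>\<^bsub>L\<^esub> ((-1) \<odot>\<^bsub>L\<^esub> T)"
      have "symbol ?S = f"
        unfolding symbol_ops(1)[OF U(1) mT] symbol_ops(3)[OF T(1) T(1)] U(2) T(2)
        using f by (intro extensionalityI[of _ K]) (auto simp: continuous_functions_def)
      then have "?S \<in> fiber f" using L_add[OF U(1) mT] by (simp add: fiber_def)
      moreover have "U = ?S \<oplus>\<^bsub>L\<^esub> T"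
        using U(1) by (intro extensionalityI[of _ spc]) (auto simp: add_L smult_L carrier_L)
      ultimately show "U \<in> (\<Union>S\<in>fiber f. \<Union>T\<in>fiber g. {S \<oplus>\<^bsub>L\<^esub> T})" using T by (auto simp: fiber_def)
    qed
  qed
  finally show ?thesis .
qed

lemma fiber_mult:
  assumes f: "f \<in> carrier CK" and g: "g \<in> carrier CK"
  shows "fiber f \<otimes>\<^bsub>Cal\<^esub> fiber g = fiber (f \<otimes>\<^bsub>CK\<^esub> g)"
proof -
  have "fiber f \<otimes>\<^bsub>Cal\<^esub> fiber g = (\<Union>S\<in>fiber f. \<Union>T\<in>fiber g. Cpt +>\<^bsub>L\<^esub> (S \<otimes>\<^bsub>L\<^esub> T))"
    by (simp add: calkin_algebra_def Let_def FactRing_def rcoset_mult_def)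
  also have "\<dots> = (\<Union>S\<in>fiber f. \<Union>T\<in>fiber g. fiber (f \<otimes>\<^bsub>CK\<^esub> g))"
  proof (intro SUP_cong refl)
    fix S T assume "S \<in> fiber f" "T \<in> fiber g"
    then show "Cpt +>\<^bsub>L\<^esub> (S \<otimes>\<^bsub>L\<^esub> T) = fiber (f \<otimes>\<^bsub>CK\<^esub> g)"
      using coset_eq[OF L_mult, of S T] symbol_ops(2)[of S T] by (auto simp: fiber_def)
  qed
  also have "\<dots> = fiber (f \<otimes>\<^bsub>CK\<^esub> g)" using fiber_nonempty[OF f] fiber_nonempty[OF g] by simp
  finally show ?thesis .
qed

lemma fiber_scale:
  assumes f: "f \<in> carrier CK"
  shows "c \<odot>\<^bsub>Cal\<^esub> fiber f = fiber (c \<odot>\<^bsub>CK\<^esub> f)"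
proof -
  have "c \<odot>\<^bsub>Cal\<^esub> fiber f = (\<Union>T\<in>fiber f. Cpt +>\<^bsub>L\<^esub> (c \<odot>\<^bsub>L\<^esub> T))"
    by (simp add: calkin_algebra_def Let_def)
  also have "\<dots> = (\<Union>T\<in>fiber f. fiber (c \<odot>\<^bsub>CK\<^esub> f))"
  proof (intro SUP_cong refl)
    fix T assume "T \<in> fiber f"
    then show "Cpt +>\<^bsub>L\<^esub> (c \<odot>\<^bsub>L\<^esub> T) = fiber (c \<odot>\<^bsub>CK\<^esub> f)"
      using coset_eq[OF L_scale, of T c] symbol_ops(3)[of T T c] by (auto simp: fiber_def)
  qed
  also have "\<dots> = fiber (c \<odot>\<^bsub>CK\<^esub> f)" using fiber_nonempty[OF f] by simp
  finally show ?thesis .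
qed

lemma fiber_one: "\<one>\<^bsub>Cal\<^esub> = fiber \<one>\<^bsub>CK\<^esub>"
  using coset_eq[OF L_one] symbol_one by (simp add: calkin_algebra_def Let_def FactRing_def)

lemma nrm_Cal: "nrm Cal A = (INF T\<in>A. nrm L T)"
  by (simp add: calkin_algebra_def Let_def)

lemma nrm_fiber_ge: "f \<in> carrier CK \<Longrightarrow> nrm CK f \<le> nrm Cal (fiber f)"
  unfolding nrm_Cal
proof (rule cINF_greatest[OF fiber_nonempty])
  fix T assume "T \<in> fiber f"
  then have T: "bop T" "symbol T = f" by (auto simp: fiber_def carrier_L)
  show "nrm CK f \<le> nrm L T"
    using symbol_norm_le[OF T(1) _ nrm_L_bound[OF T(1)]] T(2) by (intro CK_least) auto
qed

lemma nrm_fiber_le: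
  assumes T: "T \<in> fiber f"
  shows "nrm Cal (fiber f) \<le> nrm L T"
  unfolding nrm_Cal
proof (rule cINF_lower[OF _ T])
  show "bdd_below (nrm L ` fiber f)"
    using nrm_L_nonneg by (intro bdd_belowI2[of _ 0]) (auto simp: fiber_def carrier_L)
qed

text \<open>The symbol is bounded by the norm of every operator in the coset, which gives norm at
  most 1 for \<open>\<Phi>\<close>. For the inverse, \<open>fiber_lift\<close> provides a
  representative of norm at most \<open>1 + \<delta>\<close> times that of the function.\<close>

theorem calkin_isomorphism:
  assumes \<delta>: "0 < \<delta>" and M: "\<And>j. 64 \<le> \<delta> * m j"
  shows "\<exists>\<Phi>. \<Phi> \<in> bounded_algebra_hom Cal CK \<and> op_norm Cal CK \<Phi> = 1 \<and>
     bij_betw \<Phi> (carrier Cal) (carrier CK) \<and>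
     bounded_linear_map CK Cal (inv_into (carrier Cal) \<Phi>) \<and>
     op_norm Cal CK \<Phi> * op_norm CK Cal (inv_into (carrier Cal) \<Phi>) \<le> 1 + \<delta>"
proof -
  \<comment> \<open>Any representative will do, as the symbol is constant on a fibre.\<close>
  define \<Phi> where "\<Phi> A = symbol (SOME T. T \<in> A)" for A
  have \<Phi>: "\<Phi> (fiber f) = f" if "f \<in> carrier CK" for f
  proof -
    have "(SOME T. T \<in> fiber f) \<in> fiber f" using fiber_nonempty[OF that] by (simp add: some_in_eq)
    then show ?thesis by (simp add: \<Phi>_def fiber_def)
  qed
  have bij: "bij_betw \<Phi> (carrier Cal) (carrier CK)"
  proof (rule bij_betwI[where g = fiber])
    show "\<Phi> \<in> carrier Cal \<rightarrow> carrier CK" using \<Phi> by (auto simp: carrier_Cal)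
    show "fiber \<in> carrier CK \<rightarrow> carrier Cal" by (auto simp: carrier_Cal)
  qed (use \<Phi> in \<open>auto simp: carrier_Cal\<close>)
  have ring: "\<Phi> \<in> ring_hom Cal CK"
    unfolding ring_hom_def
    using \<Phi> CK_ops by (auto simp: carrier_Cal fiber_add fiber_mult fiber_one)
  have nn0: "0 \<le> nrm Cal A" if "A \<in> carrier Cal" for A
    using that by (auto simp: carrier_Cal intro: order_trans[OF CK_nonneg nrm_fiber_ge])
  have \<Phi>n: "nrm CK (\<Phi> A) \<le> 1 * nrm Cal A" if "A \<in> carrier Cal" for A
    using that nrm_fiber_ge \<Phi> by (auto simp: carrier_Cal)
  have lower: "nrm Cal A \<le> (1 + \<delta>) * nrm CK (\<Phi> A)" if "A \<in> carrier Cal" for A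
  proof -
    obtain f where f: "f \<in> carrier CK" "A = fiber f" using \<open>A \<in> carrier Cal\<close> by (auto simp: carrier_Cal)
    obtain T where "T \<in> fiber f" "nrm L T \<le> (1 + \<delta>) * nrm CK f" using fiber_lift[OF f(1) \<delta> M] by blast
    then show ?thesis using nrm_fiber_le[of T f] f \<Phi>[OF f(1)] by simp
  qed
  have blm: "bounded_linear_map Cal CK \<Phi>"
    unfolding bounded_linear_map_def
  proof (intro conjI ballI allI)
    show "\<Phi> \<in> carrier Cal \<rightarrow> carrier CK" using bij by (auto simp: bij_betw_def)
    show "\<exists>B. \<forall>A\<in>carrier Cal. nrm CK (\<Phi> A) \<le> B * nrm Cal A" using \<Phi>n by blast
  qed (auto simp: carrier_Cal fiber_add fiber_scale \<Phi> CK_ops)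
  have inv: "bounded_linear_map CK Cal (inv_into (carrier Cal) \<Phi>)"
    by (rule bounded_linear_inverse[OF blm bij _ _ lower])
      (auto simp: carrier_Cal fiber_add fiber_scale CK_ops)
  have ne: "carrier Cal \<noteq> {}" "carrier CK \<noteq> {}" using CK_ops(4) by (auto simp: carrier_Cal)
  have one_nrm: "nrm CK \<one>\<^bsub>CK\<^esub> = 1" using K_nonempty by (simp add: continuous_functions_def)
  have n1: "op_norm Cal CK \<Phi> \<le> 1" by (rule op_norm_least[OF \<Phi>n nn0 ne(1)]) auto
  \<comment> \<open>The norm of \<open>\<Phi>\<close> is attained at the unit, whose coset contains
    the identity operator.\<close>
  have "nrm Cal (fiber \<one>\<^bsub>CK\<^esub>) \<le> nrm L \<one>\<^bsub>L\<^esub>"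
    by (rule nrm_fiber_le) (simp add: fiber_def L_one symbol_one)
  also have "nrm L \<one>\<^bsub>L\<^esub> \<le> 1" by (rule nrm_L_least) (auto simp: one_L)
  finally have one_le: "nrm Cal (fiber \<one>\<^bsub>CK\<^esub>) \<le> 1" .
  have "nrm CK (\<Phi> (fiber \<one>\<^bsub>CK\<^esub>)) \<le> op_norm Cal CK \<Phi> * nrm Cal (fiber \<one>\<^bsub>CK\<^esub>)"
  proof (rule op_norm_bound)
    show "\<exists>B. \<forall>A\<in>carrier Cal. nrm CK (\<Phi> A) \<le> B * nrm Cal A" using \<Phi>n by blast
  qed (use nn0 CK_ops(4) in \<open>auto simp: carrier_Cal\<close>)
  then have "1 \<le> op_norm Cal CK \<Phi> * nrm Cal (fiber \<one>\<^bsub>CK\<^esub>)" using \<Phi>[OF CK_ops(4)] one_nrm by simp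
  moreover have "1 \<le> nrm Cal (fiber \<one>\<^bsub>CK\<^esub>)" using nrm_fiber_ge[OF CK_ops(4)] one_nrm by simp
  ultimately have n2: "1 \<le> op_norm Cal CK \<Phi>" using one_le by simp
  have invf: "inv_into (carrier Cal) \<Phi> f \<in> carrier Cal" "\<Phi> (inv_into (carrier Cal) \<Phi> f) = f" if "f \<in> carrier CK" for f
    using bij that by (metis bij_betw_def inv_into_into, metis bij_betw_inv_into_right)
  have "op_norm CK Cal (inv_into (carrier Cal) \<Phi>) \<le> 1 + \<delta>"
  proof (rule op_norm_least[OF _ CK_nonneg ne(2)])
    fix f assume f: "f \<in> carrier CK"
    show "nrm Cal (inv_into (carrier Cal) \<Phi> f) \<le> (1 + \<delta>) * nrm CK f"
      using lower[OF invf(1)[OF f]] invf(2)[OF f] by simp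
  qed (use \<delta> in auto)
  then show ?thesis using ring blm bij inv n1 n2 unfolding bounded_algebra_hom_def
    by (intro exI[of _ \<Phi>]) (auto intro: antisym)
qed

end

theorem theorem5p1:
  fixes K :: "'k::metric_space set"
  assumes "compact K" and "countable K" and "K \<noteq> {}"
  shows "(\<exists>(X :: (nat \<Rightarrow>\<^sub>C real) set) \<Phi>.
            L_infinity_space X \<and>
            isomorphic (dual_space (of_subspace X)) ell_1 \<and>
            \<Phi> \<in> bounded_algebra_hom (calkin_algebra X) (continuous_functions K) \<and>
            op_norm (calkin_algebra X) (continuous_functions K) \<Phi> = 1 \<and>
            bij_betw \<Phi> (carrier (calkin_algebra X)) (carrier (continuous_functions K))) \<and>
         (\<forall>\<epsilon>>0. \<exists>(X :: (nat \<Rightarrow>\<^sub>C real) set) \<Phi>.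
            L_infinity_space X \<and>
            isomorphic (dual_space (of_subspace X)) ell_1 \<and>
            \<Phi> \<in> bounded_algebra_hom (calkin_algebra X) (continuous_functions K) \<and>
            op_norm (calkin_algebra X) (continuous_functions K) \<Phi> = 1 \<and>
            bij_betw \<Phi> (carrier (calkin_algebra X)) (carrier (continuous_functions K)) \<and>
            bounded_linear_map (continuous_functions K) (calkin_algebra X)
              (inv_into (carrier (calkin_algebra X)) \<Phi>) \<and>
            op_norm (calkin_algebra X) (continuous_functions K) \<Phi> *
            op_norm (continuous_functions K) (calkin_algebra X)
              (inv_into (carrier (calkin_algebra X)) \<Phi>) \<le> 1 + \<epsilon>)"
    (is "?A \<and> (\<forall>\<epsilon>>0. ?B \<epsilon>)")
proof -
  have B: "?B \<epsilon>" if \<epsilon>: "0 < \<epsilon>" for \<epsilon>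
  proof -
    obtain E \<kappa> wt age prd bc m nn where AH: "argyros_haydon E \<kappa> wt age prd bc m nn K" and M: "\<forall>j. 64 / \<epsilon> \<le> m j"
      and E: "\<forall>x\<in>K. \<forall>p. \<exists>d>0. \<forall>y. dist y x < d \<longrightarrow> E p y x" "\<forall>x\<in>K. \<forall>d>0. \<exists>p. \<forall>y. E p y x \<longrightarrow> dist y x < d"
      using argyros_haydon_exists[OF assms, of "64 / \<epsilon>"] by (elim exE conjE) (rule that)
    interpret argyros_haydon_metric E \<kappa> wt age prd bc m nn K
      by (intro argyros_haydon_metric.intro AH argyros_haydon_metric_axioms.intro assms(1) E)
    have "64 \<le> \<epsilon> * m j" for j using M \<epsilon> by (simp add: field_simps)
    from calkin_isomorphism[OF \<epsilon> this] show ?thesis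
      using L_infinity_spc dual_isomorphic by blast
  qed
  \<comment> \<open>The statement without a bound on the inverse is contained in the case
    \<open>\<epsilon> = 1\<close>.\<close>
  have "?A" using B[OF zero_less_one] by blast
  then show ?thesis using B by blast
qed

end
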